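(* Let $V$ be a projective variety over a field $K$ (of arbitrary characteristic), and let $f,g:V\to V$ be morphisms that are both polarized by the same ample line bundle $\mathcal{L}$. If $\mathrm{Prep}(f)\neq\mathrm{Prep}(g)$, then there is a positive integer $j$ such that $\langle f^j,g^j\rangle$ is a free semigroup on two generators.
   Context: A morphism $f:V\to V$ is polarized by the ample line bundle $\mathcal{L}$ if there is an integer $d>1$ with $f^*\mathcal{L}\cong\mathcal{L}^{\otimes d}$ (the integer $d$ may differ for $f$ and $g$). $\mathrm{Prep}(f)$ denotes the set of preperiodic points of $f$ in $V(\overline{K})$, i.e. points with finite forward orbit under $f$. $\langle f,g\rangle$ denotes the semigroup generated by $f$ and $g$ under composition; it is a free semigroup on two generators if distinct words in the two generators give distinct maps. *)

theory Defs
  imports "HOL-Algebra.Algebraic_Closure_Type" "HOL-Library.Poly_Mapping"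
begin

text \<open>
  The base field is a type \<open>'k\<close> and its algebraic closure is \<open>'k alg_closure\<close>. A projective
  variety over \<open>'k\<close> (an integral closed subscheme of projective space) is represented by its set
  of geometric points together with the Zariski topology and the regular functions defined by
  polynomials with coefficients in \<open>'k\<close>. Since the scheme is reduced, sections of its structure
  sheaf and morphisms over \<open>'k\<close> are determined by their values on geometric points, so no
  information is lost; geometric irreducibility or reducedness is not assumed.
\<close>

subsection \<open>Projective space and its Zariski topology over the base field\<close>

type_synonym 'k mpoly = "(nat \<Rightarrow>\<^sub>0 nat) \<Rightarrow>\<^sub>0 'k"

definition homogeneous :: "nat \<Rightarrow> nat \<Rightarrow> 'k::field mpoly \<Rightarrow> bool" where
  "homogeneous N d p \<longleftrightarrow>
     (\<forall>m\<in>Poly_Mapping.keys p. Poly_Mapping.keys m \<subseteq> {..N} \<and>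
        (\<Sum>i\<in>Poly_Mapping.keys m. Poly_Mapping.lookup m i) = d)"

definition mpoly_eval :: "'k::field mpoly \<Rightarrow> (nat \<Rightarrow> 'k alg_closure) \<Rightarrow> 'k alg_closure" where
  "mpoly_eval p x =
     (\<Sum>m\<in>Poly_Mapping.keys p. to_ac (Poly_Mapping.lookup p m) *
        (\<Prod>i\<in>Poly_Mapping.keys m. x i ^ Poly_Mapping.lookup m i))"

text \<open>A point of projective space is the set of all its homogeneous coordinate vectors.\<close>

type_synonym 'k proj_point = "(nat \<Rightarrow> 'k alg_closure) set"

definition proj_class :: "(nat \<Rightarrow> 'k::field alg_closure) \<Rightarrow> 'k proj_point" where
  "proj_class x = {(\<lambda>i. c * x i) | c. c \<noteq> 0}"

definition proj_space :: "nat \<Rightarrow> 'k::field proj_point set" where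
  "proj_space N = {proj_class x | x. (\<forall>i>N. x i = 0) \<and> (\<exists>i. x i \<noteq> 0)}"

definition proj_closed :: "nat \<Rightarrow> 'k::field proj_point set \<Rightarrow> bool" where
  "proj_closed N Z \<longleftrightarrow>
     (\<exists>S. (\<forall>p\<in>S. \<exists>d. homogeneous N d p) \<and>
          Z = {P \<in> proj_space N. \<forall>p\<in>S. \<forall>x\<in>P. mpoly_eval p x = 0})"

definition zariski_open :: "nat \<Rightarrow> 'k::field proj_point set \<Rightarrow> 'k proj_point set \<Rightarrow> bool" where
  "zariski_open N V U \<longleftrightarrow> (\<exists>Z. proj_closed N Z \<and> U = V - Z)"

definition projective_variety :: "nat \<Rightarrow> 'k::field proj_point set \<Rightarrow> bool" where
  "projective_variety N V \<longleftrightarrow>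
     proj_closed N V \<and> V \<noteq> {} \<and>
     (\<forall>Z1 Z2. proj_closed N Z1 \<and> proj_closed N Z2 \<and> V \<subseteq> Z1 \<union> Z2 \<longrightarrow> V \<subseteq> Z1 \<or> V \<subseteq> Z2)"

subsection \<open>Regular functions and morphisms\<close>

definition regular_on ::
    "nat \<Rightarrow> 'k::field proj_point set \<Rightarrow> 'k proj_point set \<Rightarrow> ('k proj_point \<Rightarrow> 'k alg_closure) \<Rightarrow> bool"
  where
  "regular_on N V U \<phi> \<longleftrightarrow>
     (\<forall>P\<in>U. \<exists>U' d p q. zariski_open N V U' \<and> P \<in> U' \<and> U' \<subseteq> U \<and>
        homogeneous N d p \<and> homogeneous N d q \<and>
        (\<forall>Q\<in>U'. \<forall>x\<in>Q. mpoly_eval q x \<noteq> 0 \<and> \<phi> Q = mpoly_eval p x / mpoly_eval q x))"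

definition regular_unit_on ::
    "nat \<Rightarrow> 'k::field proj_point set \<Rightarrow> 'k proj_point set \<Rightarrow> ('k proj_point \<Rightarrow> 'k alg_closure) \<Rightarrow> bool"
  where
  "regular_unit_on N V U \<phi> \<longleftrightarrow> regular_on N V U \<phi> \<and> (\<forall>P\<in>U. \<phi> P \<noteq> 0)"

text \<open>Only the values of a morphism on its source \<open>V\<close> are relevant.\<close>

definition morphism ::
    "nat \<Rightarrow> 'k::field proj_point set \<Rightarrow> nat \<Rightarrow> 'k proj_point set \<Rightarrow> ('k proj_point \<Rightarrow> 'k proj_point) \<Rightarrow> bool"
  where
  "morphism N V M W f \<longleftrightarrow>
     f ` V \<subseteq> W \<and>
     (\<forall>U. zariski_open M W U \<longrightarrow> zariski_open N V {P \<in> V. f P \<in> U}) \<and>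
     (\<forall>U \<phi>. zariski_open M W U \<and> regular_on M W U \<phi> \<longrightarrow>
        regular_on N V {P \<in> V. f P \<in> U} (\<lambda>P. \<phi> (f P)))"

definition closed_embedding ::
    "nat \<Rightarrow> 'k::field proj_point set \<Rightarrow> nat \<Rightarrow> ('k proj_point \<Rightarrow> 'k proj_point) \<Rightarrow> bool" where
  "closed_embedding N V M e \<longleftrightarrow>
     proj_closed M (e ` V) \<and> morphism N V M (e ` V) e \<and>
     (\<exists>e'. morphism M (e ` V) N V e' \<and> (\<forall>P\<in>V. e' (e P) = P))"

subsection \<open>Line bundles\<close>

text \<open>
  A line bundle is given by an open cover trivializing it and its transition functions; the
  convention is that a section with local expressions \<open>s i\<close> satisfies \<open>s i = transition i j * s j\<close>.
\<close>

record (overloaded) ('i, 'k::field) line_bundle_data =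
  index :: "'i set"
  chart :: "'i \<Rightarrow> 'k proj_point set"
  transition :: "'i \<Rightarrow> 'i \<Rightarrow> 'k proj_point \<Rightarrow> 'k alg_closure"

definition line_bundle ::
    "nat \<Rightarrow> 'k::field proj_point set \<Rightarrow> ('i, 'k) line_bundle_data \<Rightarrow> bool" where
  "line_bundle N V L \<longleftrightarrow>
     (\<forall>i\<in>index L. zariski_open N V (chart L i)) \<and>
     (\<Union>i\<in>index L. chart L i) = V \<and>
     (\<forall>i\<in>index L. \<forall>j\<in>index L. regular_unit_on N V (chart L i \<inter> chart L j) (transition L i j)) \<and>
     (\<forall>i\<in>index L. \<forall>j\<in>index L. \<forall>k\<in>index L. \<forall>P \<in> chart L i \<inter> chart L j \<inter> chart L k.
        transition L i j P * transition L j k P = transition L i k P)"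

text \<open>
  An isomorphism sends a section with local expressions \<open>s i\<close> to the one with local expressions
  \<open>h j i * s i\<close>; the condition says that this is compatible with both families of transition functions.
\<close>

definition line_bundle_iso ::
    "nat \<Rightarrow> 'k::field proj_point set \<Rightarrow> ('i, 'k) line_bundle_data \<Rightarrow> ('j, 'k) line_bundle_data \<Rightarrow> bool"
  where
  "line_bundle_iso N V L L' \<longleftrightarrow>
     (\<exists>h. (\<forall>i\<in>index L. \<forall>j\<in>index L'. regular_unit_on N V (chart L i \<inter> chart L' j) (h j i)) \<and>
          (\<forall>i\<in>index L. \<forall>i'\<in>index L. \<forall>j\<in>index L'. \<forall>j'\<in>index L'.
             \<forall>P \<in> chart L i \<inter> chart L i' \<inter> chart L' j \<inter> chart L' j'.
               h j i P * transition L i i' P = transition L' j j' P * h j' i' P))"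

definition tensor_power :: "('i, 'k::field) line_bundle_data \<Rightarrow> nat \<Rightarrow> ('i, 'k) line_bundle_data" where
  "tensor_power L d =
     \<lparr>index = index L, chart = chart L, transition = (\<lambda>i j P. transition L i j P ^ d)\<rparr>"

definition pullback ::
    "'k::field proj_point set \<Rightarrow> ('k proj_point \<Rightarrow> 'k proj_point) \<Rightarrow>
     ('i, 'k) line_bundle_data \<Rightarrow> ('i, 'k) line_bundle_data" where
  "pullback V f L =
     \<lparr>index = index L, chart = (\<lambda>i. {P \<in> V. f P \<in> chart L i}), transition = (\<lambda>i j P. transition L i j (f P))\<rparr>"

text \<open>
  The bundle \<open>O(1)\<close>: the global section given by the coordinate \<open>X\<^sub>k\<close> is \<open>X\<^sub>k / X\<^sub>i\<close> on the chart
  where \<open>X\<^sub>i\<close> does not vanish. The quotient of coordinates does not depend on the representative.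
\<close>

definition twisting_bundle :: "nat \<Rightarrow> (nat, 'k::field) line_bundle_data" where
  "twisting_bundle M =
     \<lparr>index = {..M},
      chart = (\<lambda>i. {P \<in> proj_space M. \<forall>x\<in>P. x i \<noteq> 0}),
      transition = (\<lambda>i j P. (SOME x. x \<in> P) j / (SOME x. x \<in> P) i)\<rparr>"

definition very_ample ::
    "nat \<Rightarrow> 'k::field proj_point set \<Rightarrow> ('i, 'k) line_bundle_data \<Rightarrow> bool" where
  "very_ample N V L \<longleftrightarrow>
     (\<exists>M e. closed_embedding N V M e \<and> line_bundle_iso N V L (pullback V e (twisting_bundle M)))"

definition ample ::
    "nat \<Rightarrow> 'k::field proj_point set \<Rightarrow> ('i, 'k) line_bundle_data \<Rightarrow> bool" where
  "ample N V L \<longleftrightarrow> (\<exists>m>0. very_ample N V (tensor_power L m))"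

definition polarized_by ::
    "nat \<Rightarrow> 'k::field proj_point set \<Rightarrow> ('k proj_point \<Rightarrow> 'k proj_point) \<Rightarrow>
     ('i, 'k) line_bundle_data \<Rightarrow> bool" where
  "polarized_by N V f L \<longleftrightarrow> (\<exists>d>1. line_bundle_iso N V (pullback V f L) (tensor_power L d))"

subsection \<open>Dynamics\<close>

definition Prep :: "'a set \<Rightarrow> ('a \<Rightarrow> 'a) \<Rightarrow> 'a set" where
  "Prep V f = {x \<in> V. finite {(f ^^ n) x | n. True}}"

text \<open>A word is a list of letters, \<open>True\<close> standing for \<open>a\<close> and \<open>False\<close> for \<open>b\<close>.\<close>

definition word_map :: "('a \<Rightarrow> 'a) \<Rightarrow> ('a \<Rightarrow> 'a) \<Rightarrow> bool list \<Rightarrow> 'a \<Rightarrow> 'a" where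
  "word_map a b w = foldr (\<lambda>l h. (if l then a else b) \<circ> h) w id"

definition generate_free_semigroup :: "'a set \<Rightarrow> ('a \<Rightarrow> 'a) \<Rightarrow> ('a \<Rightarrow> 'a) \<Rightarrow> bool" where
  "generate_free_semigroup V a b \<longleftrightarrow>
     (\<forall>w w'. w \<noteq> [] \<and> w' \<noteq> [] \<and> w \<noteq> w' \<longrightarrow> (\<exists>x\<in>V. word_map a b w x \<noteq> word_map a b w' x))"

end

theory Submission
  imports Defs "Jordan_Normal_Form.Char_Poly" "HOL-Library.Function_Algebras" "HOL-Library.FuncSet"
begin

text \<open>
  Embed \<open>V\<close> in \<open>P\<^sup>M\<close> by a power of \<open>L\<close> and let \<open>C\<close> be the affine cone over the image. The isomorphisms
  \<open>L\<^sup>m \<cong> O(1)\<close> and \<open>f\<^sup>*L \<cong> L\<^sup>d\<close> lift \<open>f\<close> to a map \<open>\<Phi>\<close> of \<open>C\<close> that is locally a quotient of forms and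
  homogeneous of degree \<open>d\<close>. By the projective Nullstellensatz, \<open>x\<^sub>a\<^sup>D \<Phi>\<^sub>b\<close> is a form on \<open>C\<close> and every form of
  large degree is a combination of the \<open>\<Phi>\<^sub>b\<close>. This has two consequences.

  First, \<open>f\<close> is dominant: otherwise the Hilbert function of \<open>C\<close> would grow exponentially. Hence
  \<open>f\<close> and \<open>g\<close> can be cancelled on the right of an identity between words.

  Second, a height \<open>h\<close> satisfies \<open>h (f P) = d h P + O(1)\<close>. To have a height over an arbitrary field
  without a product formula, every finite subset of the algebraic closure is placed in the fraction
  field of a subring with a norm that is at least 1 on nonzero elements, and the height of \<open>x\<close> measures, for
  large \<open>N\<close>, how small a common multiple of the monomials of degree \<open>N\<close> in \<open>x\<close> can be made. The subring is
  built one generator at a time so that the Northcott property persists.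

  Take \<open>P\<close> with finite \<open>f\<close>-orbit and infinite \<open>g\<close>-orbit. By Northcott the heights of the \<open>g\<^sup>j P\<close> are unbounded,
  so they grow like \<open>d\<^sub>2\<^sup>j\<close>, whereas those of \<open>f\<^sup>j P\<close> stay bounded. If two different words in \<open>f\<^sup>j\<close>, \<open>g\<^sup>j\<close> agree,
  cancellation reduces to \<open>u f\<^sup>j = v g\<^sup>j\<close> (or to a nonempty word equal to the identity, which is excluded by
  its degree), both sides having the same degree; evaluating at \<open>P\<close> is a contradiction for large \<open>j\<close>.
\<close>

text \<open>Forms of degree \<open>d\<close> on the cone need not give all sections of O(d), since
  the embedding need not be projectively normal. The lift \<open>\<Phi>\<close> can therefore not be
  expected to be polynomial, and both height inequalities are drawn from identities for
  \<open>x\<^sub>a\<^sup>D \<Phi>\<^sub>b\<close> and for high powers of the single coordinates.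
  Only finitely many field elements matter: the coefficients of these identities and the coordinates
  of one point. So a height on one finitely generated field is enough. The norms are only
  submultiplicative, and algebraic extensions introduce constant factors. All bounds are therefore
  kept in the shape \<open>B ^ n\<close> with \<open>n\<close> free: a constant
  \<open>C \<ge> 1\<close> is at most \<open>C ^ n\<close>, and at most \<open>exp (e * n)\<close>
  for large \<open>n\<close>, so that it disappears from the height. Passing to powers makes the
  contrast between the two orbits of \<open>P\<close> exceed all bounded errors. One exponent
  \<open>j\<close> serves for all pairs of words, because the degrees of \<open>u\<close> and
  \<open>v\<close> cancel from the comparison.\<close>

hide_const (open) module.smult

section \<open>Homogeneous polynomial functions\<close>

text \<open>
  \<open>hpoly n d p\<close>: \<open>p\<close> is given by a form of degree \<open>d\<close> in the variables \<open>x i\<close> with \<open>i < n\<close> and coefficients in the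
  base field, although it is evaluated on the algebraic closure.
\<close>

inductive hpoly :: "nat \<Rightarrow> nat \<Rightarrow> ((nat \<Rightarrow> 'k::field alg_closure) \<Rightarrow> 'k alg_closure) \<Rightarrow> bool"
  for n where
  zero: "hpoly n d (\<lambda>x. 0)"
| const: "hpoly n 0 (\<lambda>x. to_ac c)"
| var: "i < n \<Longrightarrow> hpoly n 1 (\<lambda>x. x i)"
| add: "hpoly n d p \<Longrightarrow> hpoly n d q \<Longrightarrow> hpoly n d (\<lambda>x. p x + q x)"
| mult: "hpoly n d p \<Longrightarrow> hpoly n d' q \<Longrightarrow> hpoly n (d + d') (\<lambda>x. p x * q x)"

lemma hpoly_one: "hpoly n 0 (\<lambda>x. 1)"
  using hpoly.const[of n 1] by simp

lemma hpoly_scale: "hpoly n d p \<Longrightarrow> hpoly n d (\<lambda>x. to_ac c * p x)"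
  using hpoly.mult[OF hpoly.const[of n c]] by simp

lemma hpoly_uminus: "hpoly n d p \<Longrightarrow> hpoly n d (\<lambda>x. - p x)"
  using hpoly_scale[of n d p "-1"] by simp

lemma hpoly_diff: "hpoly n d p \<Longrightarrow> hpoly n d q \<Longrightarrow> hpoly n d (\<lambda>x. p x - q x)"
  using hpoly.add[OF _ hpoly_uminus] by fastforce

lemma hpoly_sum: "(\<And>i. i \<in> S \<Longrightarrow> hpoly n d (p i)) \<Longrightarrow> hpoly n d (\<lambda>x. \<Sum>i\<in>S. p i x)"
  by (induction S rule: infinite_finite_induct) (auto intro: hpoly.zero hpoly.add)

lemma hpoly_power: "hpoly n d p \<Longrightarrow> hpoly n (k * d) (\<lambda>x. p x ^ k)"
  by (induction k) (auto intro: hpoly_one hpoly.mult)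

lemma hpoly_var_power: "i < n \<Longrightarrow> hpoly n k (\<lambda>x. x i ^ k)"
  using hpoly_power[OF hpoly.var[of i n], of k] by simp

lemma hpoly_mult': "hpoly n d p \<Longrightarrow> hpoly n d' q \<Longrightarrow> e = d + d' \<Longrightarrow> hpoly n e (\<lambda>x. p x * q x)"
  using hpoly.mult by blast

lemma hpoly_mono: "hpoly n d p \<Longrightarrow> n \<le> n' \<Longrightarrow> hpoly n' d p"
  by (induction rule: hpoly.induct) (auto intro: hpoly.intros hpoly.var[simplified])

lemma hpoly_cong: "hpoly n d p \<Longrightarrow> (\<And>i. i < n \<Longrightarrow> x i = y i) \<Longrightarrow> p x = p y"
  by (induction rule: hpoly.induct) (auto intro!: arg_cong2[where f = "(+)"] arg_cong2[where f = "(*)"])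

lemma hpoly_homogeneous: "hpoly n d p \<Longrightarrow> p (\<lambda>i. c * x i) = c ^ d * p x"
  by (induction rule: hpoly.induct) (auto simp: algebra_simps power_add)

lemma hpoly_degree_0: "hpoly n d p \<Longrightarrow> d = 0 \<Longrightarrow> \<exists>c. p = (\<lambda>x. to_ac c)"
proof (induction rule: hpoly.induct)
  case (zero d) then show ?case by (intro exI[of _ 0]) auto
next
  case (add d p q)
  then obtain a b where "p = (\<lambda>x. to_ac a)" "q = (\<lambda>x. to_ac b)" by auto
  then show ?case by (intro exI[of _ "a + b"]) simp
next
  case (mult d p d' q)
  then obtain a b where "p = (\<lambda>x. to_ac a)" "q = (\<lambda>x. to_ac b)" by auto
  then show ?case by (intro exI[of _ "a * b"]) simp
qed auto

text \<open>
  Coefficients of a form of degree \<open>d\<close> in \<open>n + 1\<close> variables, as a polynomial in the last variable.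
\<close>

definition hcoeffs :: "nat \<Rightarrow> nat \<Rightarrow> (nat \<Rightarrow> (nat \<Rightarrow> 'k::field alg_closure) \<Rightarrow> 'k alg_closure) \<Rightarrow> bool" where
  "hcoeffs n d c \<longleftrightarrow> (\<forall>j\<le>d. hpoly n (d - j) (c j)) \<and> (\<forall>j>d. c j = (\<lambda>x. 0))"

lemma hpoly_Suc_decomp:
  "hpoly (Suc n) d p \<Longrightarrow> \<exists>c. hcoeffs n d c \<and> p = (\<lambda>x. \<Sum>j\<le>d. c j x * x n ^ j)"
proof (induction rule: hpoly.induct)
  case (zero d)
  show ?case by (intro exI[of _ "\<lambda>j x. 0"]) (auto simp: hcoeffs_def intro: hpoly.zero)
next
  case (const a)
  show ?case
    by (intro exI[of _ "\<lambda>j x. if j = 0 then to_ac a else 0"]) (auto simp: hcoeffs_def intro: hpoly.const)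
next
  case (var i)
  show ?case
  proof (cases "i = n")
    case True
    then show ?thesis
      by (intro exI[of _ "\<lambda>j x. if j = 1 then 1 else 0"])
        (auto simp: hcoeffs_def le_Suc_eq intro: hpoly_one hpoly.zero)
  next
    case False
    then show ?thesis using var
      by (intro exI[of _ "\<lambda>j x. if j = 0 then x i else 0"])
        (auto simp: hcoeffs_def le_Suc_eq intro!: hpoly.zero hpoly.var[simplified])
  qed
next
  case (add d p q)
  then obtain c c' where "hcoeffs n d c" "p = (\<lambda>x. \<Sum>j\<le>d. c j x * x n ^ j)"
    "hcoeffs n d c'" "q = (\<lambda>x. \<Sum>j\<le>d. c' j x * x n ^ j)" by blast
  then show ?case
    by (intro exI[of _ "\<lambda>j x. c j x + c' j x"])
      (auto simp: hcoeffs_def sum.distrib algebra_simps intro: hpoly.add)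
next
  case (mult d p d' q)
  then obtain c c' where c: "hcoeffs n d c" "p = (\<lambda>x. \<Sum>j\<le>d. c j x * x n ^ j)"
    "hcoeffs n d' c'" "q = (\<lambda>x. \<Sum>j\<le>d'. c' j x * x n ^ j)" by blast
  \<comment> \<open>If \<open>k > d\<close> or \<open>r - k > d'\<close>, a factor is zero by the
    second half of \<open>hcoeffs\<close>; otherwise the truncated subtractions are exact.\<close>
  have 1: "hpoly n (d + d' - r) (\<lambda>x. c k x * c' (r - k) x)" if "k \<le> r" "r \<le> d + d'" for k r
  proof (cases "k \<le> d \<and> r - k \<le> d'")
    case True
    then have "hpoly n (d - k + (d' - (r - k))) (\<lambda>x. c k x * c' (r - k) x)"
      using c by (intro hpoly.mult) (auto simp: hcoeffs_def)
    moreover have "d - k + (d' - (r - k)) = d + d' - r" using True that by auto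
    ultimately show ?thesis by simp
  next
    case False
    then have "(\<lambda>x. c k x * c' (r - k) x) = (\<lambda>x. 0)" using c by (auto simp: hcoeffs_def not_le)
    then show ?thesis by (simp add: hpoly.zero)
  qed
  have 2: "c k x * c' (r - k) x = 0" if "r > d + d'" "k \<le> r" for k r x
    using c that by (cases "k \<le> d") (auto simp: hcoeffs_def)
  show ?case
  proof (intro exI[of _ "\<lambda>r x. \<Sum>k\<le>r. c k x * c' (r - k) x"] conjI ext)
    show "hcoeffs n (d + d') (\<lambda>r x. \<Sum>k\<le>r. c k x * c' (r - k) x)"
      using 1 2 by (auto simp: hcoeffs_def intro!: hpoly_sum sum.neutral)
    fix x
    show "p x * q x = (\<Sum>r\<le>d + d'. (\<Sum>k\<le>r. c k x * c' (r - k) x) * x n ^ r)"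
      unfolding c(2,4) using c(1,3)
      by (intro polynomial_product) (auto simp: hcoeffs_def)
  qed
qed

section \<open>Monomials and exponent vectors\<close>

definition expo :: "nat \<Rightarrow> nat \<Rightarrow> (nat \<Rightarrow> nat) set" where
  "expo n d = {\<alpha>. (\<forall>i\<ge>n. \<alpha> i = 0) \<and> (\<Sum>i<n. \<alpha> i) = d}"

definition monom_at :: "nat \<Rightarrow> (nat \<Rightarrow> nat) \<Rightarrow> (nat \<Rightarrow> 'a::comm_ring_1) \<Rightarrow> 'a" where
  "monom_at n \<alpha> x = (\<Prod>i<n. x i ^ \<alpha> i)"

lemma expo_le: "\<alpha> \<in> expo n d \<Longrightarrow> \<alpha> i \<le> d"
  unfolding expo_def using member_le_sum[of i "{..<n}" \<alpha>] by (cases "i < n") auto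

text \<open>A crude bound, but for fixed \<open>n\<close> it is polynomial in \<open>d\<close>,
  which is all that the contradiction in \<open>dominant\<close> requires.\<close>

lemma card_expo: "finite (expo n d) \<and> card (expo n d) \<le> (d + 1) ^ n"
proof -
  have inj: "inj_on (\<lambda>\<alpha>. restrict \<alpha> {..<n}) (expo n d)"
  proof (rule inj_onI, rule ext)
    fix \<alpha> \<beta> i assume h: "\<alpha> \<in> expo n d" "\<beta> \<in> expo n d" "restrict \<alpha> {..<n} = restrict \<beta> {..<n}"
    show "\<alpha> i = \<beta> i" using h(1,2) fun_cong[OF h(3), of i] by (cases "i < n") (auto simp: expo_def)
  qed
  have sub: "(\<lambda>\<alpha>. restrict \<alpha> {..<n}) ` expo n d \<subseteq> ({..<n} \<rightarrow>\<^sub>E {..d})"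
    by (auto intro: expo_le split: if_splits)
  have fin: "finite ({..<n} \<rightarrow>\<^sub>E {..d})" by (intro finite_PiE) auto
  have "card (expo n d) \<le> card ({..<n} \<rightarrow>\<^sub>E {..d})" by (rule card_inj_on_le[OF inj sub fin])
  also have "\<dots> = (d + 1) ^ n" by (simp add: card_PiE)
  finally show ?thesis using finite_subset[OF sub fin] finite_imageD[OF _ inj] by auto
qed

lemmas finite_expo = card_expo[THEN conjunct1]

lemma expo_add: "\<alpha> \<in> expo n d \<Longrightarrow> \<beta> \<in> expo n d' \<Longrightarrow> (\<lambda>i. \<alpha> i + \<beta> i) \<in> expo n (d + d')"
  by (auto simp: expo_def sum.distrib)

lemma monom_at_add: "monom_at n (\<lambda>i. \<alpha> i + \<beta> i) x = monom_at n \<alpha> x * monom_at n \<beta> x"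
  by (simp add: monom_at_def power_add prod.distrib)

lemma expo_single: "i < n \<Longrightarrow> (\<lambda>j. if j = i then d else 0) \<in> expo n d"
  by (auto simp: expo_def)

lemma monom_at_single: "i < n \<Longrightarrow> monom_at n (\<lambda>j. if j = i then d else 0) x = x i ^ d"
proof -
  assume i: "i < n"
  have "monom_at n (\<lambda>j. if j = i then d else 0) x = (\<Prod>j<n. if j = i then x j ^ d else 1)"
    unfolding monom_at_def by (rule prod.cong) auto
  then show ?thesis using i by simp
qed

lemma expo_split:
  assumes "\<alpha> \<in> expo n (d + d')"
  obtains \<beta> \<gamma> where "\<beta> \<in> expo n d" "\<gamma> \<in> expo n d'" "\<alpha> = (\<lambda>i. \<beta> i + \<gamma> i)"
proof -
  have "\<exists>\<beta> \<gamma>. \<beta> \<in> expo n d \<and> \<gamma> \<in> expo n d' \<and> \<alpha> = (\<lambda>i. \<beta> i + \<gamma> i)" using assms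
  proof (induction d arbitrary: \<alpha>)
    case 0
    then show ?case by (intro exI[of _ "\<lambda>i. 0"] exI[of _ \<alpha>]) (auto simp: expo_def)
  next
    case (Suc d)
    have "\<exists>i<n. \<alpha> i > 0"
    proof (rule ccontr)
      assume "\<not> (\<exists>i<n. \<alpha> i > 0)"
      then have "(\<Sum>i<n. \<alpha> i) = 0" by simp
      then show False using Suc.prems by (simp add: expo_def)
    qed
    then obtain i where i: "i < n" "\<alpha> i > 0" by blast
    define \<alpha>' where "\<alpha>' = \<alpha>(i := \<alpha> i - 1)"
    define \<epsilon> where "\<epsilon> = (\<lambda>j. if j = i then 1 else 0 :: nat)"
    have e: "\<epsilon> \<in> expo n 1" unfolding \<epsilon>_def by (rule expo_single[OF i(1)])
    have eq: "\<alpha> = (\<lambda>j. \<epsilon> j + \<alpha>' j)" using i by (auto simp: \<epsilon>_def \<alpha>'_def)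
    have "(\<Sum>j<n. \<alpha> j) = 1 + (\<Sum>j<n. \<alpha>' j)"
      unfolding eq using e by (simp add: sum.distrib expo_def)
    then have "\<alpha>' \<in> expo n (d + d')" using Suc.prems i by (auto simp: expo_def \<alpha>'_def)
    from Suc.IH[OF this] obtain \<beta> \<gamma> where bg: "\<beta> \<in> expo n d" "\<gamma> \<in> expo n d'" "\<alpha>' = (\<lambda>i. \<beta> i + \<gamma> i)" by blast
    show ?case
      using expo_add[OF e bg(1)] bg(2,3) eq
      by (intro exI[of _ "\<lambda>j. \<epsilon> j + \<beta> j"] exI[of _ \<gamma>]) (auto simp: algebra_simps)
  qed
  then show ?thesis using that by blast
qed

text \<open>Some exponent exceeds the average. The threshold \<open>n * d\<close> reappears wherever
  powers of the single variables have to control all monomials of large degree.\<close>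

lemma expo_pigeonhole:
  assumes "\<alpha> \<in> expo n k" "n * d < k"
  obtains i \<beta> where "i < n" "\<beta> \<in> expo n (k - d)" "\<And>x :: nat \<Rightarrow> 'a::comm_ring_1. monom_at n \<alpha> x = x i ^ d * monom_at n \<beta> x"
proof -
  have "\<exists>i<n. \<alpha> i > d"
  proof (rule ccontr)
    assume "\<not> ?thesis"
    then have "(\<Sum>i<n. \<alpha> i) \<le> (\<Sum>i<n. d)" by (intro sum_mono) (meson lessThan_iff not_less)
    then show False using assms by (simp add: expo_def)
  qed
  then obtain i where i: "i < n" "\<alpha> i > d" by blast
  define \<beta> where "\<beta> = \<alpha>(i := \<alpha> i - d)"
  define \<epsilon> where "\<epsilon> = (\<lambda>j. if j = i then d else 0)"
  have e: "\<epsilon> \<in> expo n d" unfolding \<epsilon>_def by (rule expo_single[OF i(1)])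
  have eq: "\<alpha> = (\<lambda>j. \<epsilon> j + \<beta> j)" using i by (auto simp: \<epsilon>_def \<beta>_def)
  have "(\<Sum>j<n. \<alpha> j) = d + (\<Sum>j<n. \<beta> j)"
    unfolding eq using e by (simp add: sum.distrib expo_def)
  then have "\<beta> \<in> expo n (k - d)" using assms i by (auto simp: expo_def \<beta>_def)
  moreover have "monom_at n \<alpha> x = x i ^ d * monom_at n \<beta> x" for x :: "nat \<Rightarrow> 'a"
    unfolding eq monom_at_add by (simp add: \<epsilon>_def monom_at_single[OF i(1)])
  ultimately show ?thesis using that i by blast
qed

lemma hpoly_monom_at: "\<alpha> \<in> expo n d \<Longrightarrow> hpoly n d (monom_at n \<alpha>)"
proof -
  have "hpoly n (\<Sum>i<m. \<alpha> i) (\<lambda>x. \<Prod>i<m. x i ^ \<alpha> i)" if "m \<le> n" for m using that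
    by (induction m) (auto intro!: hpoly_one hpoly.mult hpoly_var_power)
  from this[of n] show "\<alpha> \<in> expo n d \<Longrightarrow> hpoly n d (monom_at n \<alpha>)"
    by (simp add: expo_def monom_at_def[abs_def])
qed

lemma hpoly_monomials:
  assumes "hpoly n d p"
  shows "\<exists>c. \<forall>x. p x = (\<Sum>\<alpha>\<in>expo n d. to_ac (c \<alpha>) * monom_at n \<alpha> x)"
  using assms
proof (induction rule: hpoly.induct)
  case (zero d) show ?case by (intro exI[of _ "\<lambda>_. 0"]) auto
next
  case (const a)
  have "expo n 0 = {\<lambda>i. 0}" by (auto simp: expo_def not_less[symmetric])
  then show ?case by (intro exI[of _ "\<lambda>_. a"]) (auto simp: monom_at_def)
next
  case (var i)
  define \<epsilon> where "\<epsilon> = (\<lambda>j. if j = i then 1 else 0 :: nat)"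
  have "x i = (\<Sum>\<alpha>\<in>expo n 1. to_ac (if \<alpha> = \<epsilon> then 1 else 0) * monom_at n \<alpha> x)" for x :: "nat \<Rightarrow> 'a alg_closure"
  proof -
    have "(\<Sum>\<alpha>\<in>expo n 1. to_ac (if \<alpha> = \<epsilon> then 1 else 0) * monom_at n \<alpha> x)
      = (\<Sum>\<alpha>\<in>expo n 1. if \<alpha> = \<epsilon> then monom_at n \<alpha> x else 0)" by (rule sum.cong) auto
    also have "\<dots> = monom_at n \<epsilon> x"
      using expo_single[OF var, of 1] by (simp add: finite_expo \<epsilon>_def)
    also have "\<dots> = x i" unfolding \<epsilon>_def using monom_at_single[OF var, of 1 x] by simp
    finally show ?thesis by simp
  qed
  then show ?case by (intro exI[of _ "\<lambda>\<alpha>. if \<alpha> = \<epsilon> then 1 else 0"]) auto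
next
  case (add d p q)
  then obtain c c' where "\<forall>x. p x = (\<Sum>\<alpha>\<in>expo n d. to_ac (c \<alpha>) * monom_at n \<alpha> x)"
    "\<forall>x. q x = (\<Sum>\<alpha>\<in>expo n d. to_ac (c' \<alpha>) * monom_at n \<alpha> x)" by blast
  then show ?case
    by (intro exI[of _ "\<lambda>\<alpha>. c \<alpha> + c' \<alpha>"]) (simp add: sum.distrib algebra_simps)
next
  case (mult d p d' q)
  then obtain c c' where c: "\<forall>x. p x = (\<Sum>\<alpha>\<in>expo n d. to_ac (c \<alpha>) * monom_at n \<alpha> x)"
    "\<forall>x. q x = (\<Sum>\<alpha>\<in>expo n d'. to_ac (c' \<alpha>) * monom_at n \<alpha> x)" by blast
  define P where "P = expo n d \<times> expo n d'"
  define s where "s = (\<lambda>(\<alpha>, \<beta>) (i::nat). \<alpha> i + \<beta> i :: nat)"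
  \<comment> \<open>The pairs whose exponents add up to \<open>\<gamma>\<close> are collected into
    one coefficient of the product.\<close>
  define C where "C \<gamma> = (\<Sum>(\<alpha>,\<beta>)\<in>{z\<in>P. s z = \<gamma>}. c \<alpha> * c' \<beta>)" for \<gamma>
  have fin: "finite P" by (simp add: P_def finite_expo)
  have "p x * q x = (\<Sum>\<gamma>\<in>expo n (d + d'). to_ac (C \<gamma>) * monom_at n \<gamma> x)" for x
  proof -
    have "p x * q x = (\<Sum>(\<alpha>,\<beta>)\<in>P. (to_ac (c \<alpha>) * monom_at n \<alpha> x) * (to_ac (c' \<beta>) * monom_at n \<beta> x))"
      using c by (simp add: sum_product sum.cartesian_product P_def)
    also have "\<dots> = (\<Sum>z\<in>P. to_ac (c (fst z) * c' (snd z)) * monom_at n (s z) x)"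
      by (rule sum.cong) (auto simp: s_def monom_at_add case_prod_unfold)
    also have "\<dots> = (\<Sum>\<gamma>\<in>expo n (d + d'). \<Sum>z\<in>{z\<in>P. s z = \<gamma>}. to_ac (c (fst z) * c' (snd z)) * monom_at n (s z) x)"
      by (rule sum.group[symmetric]) (auto simp: fin finite_expo P_def s_def expo_add)
    also have "\<dots> = (\<Sum>\<gamma>\<in>expo n (d + d'). to_ac (C \<gamma>) * monom_at n \<gamma> x)"
      by (rule sum.cong) (auto simp: C_def to_ac_sum sum_distrib_right case_prod_unfold)
    finally show ?thesis .
  qed
  then show ?case by blast
qed

text \<open>The degree is an explicit index because the zero function is a form of every
  degree.\<close>

definition graded_ideal :: "nat \<Rightarrow> (nat \<Rightarrow> ((nat \<Rightarrow> 'k::field alg_closure) \<Rightarrow> 'k alg_closure) \<Rightarrow> bool) \<Rightarrow> bool" where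
  "graded_ideal n I \<longleftrightarrow>
     (\<forall>e p. I e p \<longrightarrow> hpoly n e p) \<and> (\<forall>e. I e (\<lambda>x. 0)) \<and>
     (\<forall>e p q. I e p \<longrightarrow> I e q \<longrightarrow> I e (\<lambda>x. p x + q x)) \<and>
     (\<forall>e d p q. hpoly n d q \<longrightarrow> I e p \<longrightarrow> I (d + e) (\<lambda>x. q x * p x))"

context
  fixes n :: nat and I :: "nat \<Rightarrow> ((nat \<Rightarrow> 'k::field alg_closure) \<Rightarrow> 'k alg_closure) \<Rightarrow> bool"
  assumes gi: "graded_ideal n I"
begin

lemma graded_idealD:
  shows "I e p \<Longrightarrow> hpoly n e p" and "I e (\<lambda>x. 0)"
    and "I e p \<Longrightarrow> I e q \<Longrightarrow> I e (\<lambda>x. p x + q x)"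
    and "hpoly n d q \<Longrightarrow> I e p \<Longrightarrow> I (d + e) (\<lambda>x. q x * p x)"
  using gi by (auto simp: graded_ideal_def)

lemma graded_ideal_mult: "hpoly n d q \<Longrightarrow> I e p \<Longrightarrow> e' = d + e \<Longrightarrow> I e' (\<lambda>x. q x * p x)"
  using graded_idealD(4) by blast

lemma graded_ideal_uminus: "I e p \<Longrightarrow> I e (\<lambda>x. - p x)"
  using graded_idealD(4)[OF hpoly.const[of n "-1"], of e p] by simp

lemma graded_ideal_diff: "I e p \<Longrightarrow> I e q \<Longrightarrow> I e (\<lambda>x. p x - q x)"
  using graded_idealD(3)[OF _ graded_ideal_uminus, of e p q] by simp

lemma graded_ideal_sum: "(\<And>i. i \<in> S \<Longrightarrow> I e (p i)) \<Longrightarrow> I e (\<lambda>x. \<Sum>i\<in>S. p i x)"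
  by (induction S rule: infinite_finite_induct) (auto intro: graded_idealD)

text \<open>By \<open>expo_pigeonhole\<close> every monomial of degree above \<open>m * D\<close> in
  the first \<open>m\<close> variables contains some \<open>x\<^sub>i\<^sup>D\<close>. Allowing
  \<open>m < n\<close> serves forms that do not involve the last variable.\<close>

lemma graded_ideal_var_powers:
  assumes D: "\<And>i. i < m \<Longrightarrow> I D (\<lambda>x. x i ^ D)" and "m \<le> n" and p: "hpoly m k p" and k: "m * D < k"
  shows "I k p"
proof -
  obtain c where c: "\<forall>x. p x = (\<Sum>\<alpha>\<in>expo m k. to_ac (c \<alpha>) * monom_at m \<alpha> x)"
    using hpoly_monomials[OF p] by blast
  have "I k (\<lambda>x. to_ac (c \<alpha>) * monom_at m \<alpha> x)" if a: "\<alpha> \<in> expo m k" for \<alpha>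
  proof -
    obtain i \<beta> where i: "i < m" "\<beta> \<in> expo m (k - D)" "\<And>x :: nat \<Rightarrow> 'k alg_closure. monom_at m \<alpha> x = x i ^ D * monom_at m \<beta> x"
      using expo_pigeonhole[OF a k] by blast
    have "m > 0" using i by auto
    then have "D \<le> k" using k by (cases m) auto
    have "hpoly n (k - D) (\<lambda>x. to_ac (c \<alpha>) * monom_at m \<beta> x)"
      using hpoly_mono[OF hpoly_monom_at[OF i(2)] \<open>m \<le> n\<close>] by (rule hpoly_scale)
    from graded_ideal_mult[OF this D[OF i(1)]] \<open>D \<le> k\<close>
    have "I k (\<lambda>x. to_ac (c \<alpha>) * monom_at m \<beta> x * x i ^ D)" by simp
    then show ?thesis using i(3) by (simp add: mult_ac)
  qed
  then have "I k (\<lambda>x. \<Sum>\<alpha>\<in>expo m k. to_ac (c \<alpha>) * monom_at m \<alpha> x)" by (rule graded_ideal_sum)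
  moreover have "p = (\<lambda>x. \<Sum>\<alpha>\<in>expo m k. to_ac (c \<alpha>) * monom_at m \<alpha> x)" using c by auto
  ultimately show ?thesis by simp
qed

end

section \<open>The projective Nullstellensatz\<close>

text \<open>
  \<open>hdiv n N j r\<close> replaces \<open>hpoly n (N - j) r\<close> where \<open>j > N\<close> is possible: truncated subtraction must then not
  admit the constants.
\<close>

definition hdiv :: "nat \<Rightarrow> nat \<Rightarrow> nat \<Rightarrow> ((nat \<Rightarrow> 'k::field alg_closure) \<Rightarrow> 'k alg_closure) \<Rightarrow> bool" where
  "hdiv n N j r \<longleftrightarrow> r = (\<lambda>x. 0) \<or> (j \<le> N \<and> hpoly n (N - j) r)"

lemma hdiv_add: "hdiv n N j r \<Longrightarrow> hdiv n N j s \<Longrightarrow> hdiv n N j (\<lambda>x. r x + s x)"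
  by (auto simp: hdiv_def intro: hpoly.add)

lemma hdiv_zero: "hdiv n N j (\<lambda>x. 0)"
  by (simp add: hdiv_def)

lemma hdiv_sum: "(\<And>i. i \<in> S \<Longrightarrow> hdiv n N j (r i)) \<Longrightarrow> hdiv n N j (\<lambda>x. \<Sum>i\<in>S. r i x)"
  by (induction S rule: infinite_finite_induct) (auto intro: hdiv_zero hdiv_add)

lemma hdiv_mult: "hpoly n d c \<Longrightarrow> hdiv n N j r \<Longrightarrow> N' = d + N \<Longrightarrow> hdiv n N' j (\<lambda>x. c x * r x)"
  by (auto simp: hdiv_def intro: hpoly_mult')

lemma hdiv_uminus: "hdiv n N j r \<Longrightarrow> hdiv n N j (\<lambda>x. - r x)"
  by (auto simp: hdiv_def intro: hpoly_uminus)

context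
  fixes n :: nat and I :: "nat \<Rightarrow> ((nat \<Rightarrow> 'k::field alg_closure) \<Rightarrow> 'k alg_closure) \<Rightarrow> bool"
  assumes gi: "graded_ideal (Suc n) I"
begin

lemmas giD = graded_idealD[OF gi] graded_ideal_diff[OF gi] graded_ideal_sum[OF gi]

text \<open>Division by a form that is monic in the last variable: its leading power is exchanged
  for the powers \<open>N - e + j < N\<close>, to which the induction applies.\<close>

lemma monic_reduction:
  assumes f: "I e (\<lambda>x. x n ^ e + (\<Sum>j<e. c j x * x n ^ j))" and c: "\<And>j. j < e \<Longrightarrow> hpoly n (e - j) (c j)"
  shows "\<exists>r. (\<forall>i<e. hdiv n N i (r i)) \<and> I N (\<lambda>x. x n ^ N - (\<Sum>i<e. r i x * x n ^ i))"
proof (induction N rule: less_induct)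
  case (less N)
  show ?case
  proof (cases "N < e")
    case True
    have "(\<Sum>i<e. (if i = N then 1 else 0) * x n ^ i) = x n ^ N" for x :: "nat \<Rightarrow> 'k alg_closure"
    proof -
      have "(\<Sum>i<e. (if i = N then 1 else 0) * x n ^ i) = (\<Sum>i<e. if i = N then x n ^ i else 0)"
        by (rule sum.cong) auto
      then show ?thesis using True by simp
    qed
    then show ?thesis
      by (intro exI[of _ "\<lambda>i x. if i = N then 1 else 0"]) (auto simp: hdiv_def giD hpoly_one)
  next
    case False
    have "\<forall>j. \<exists>r. j < e \<longrightarrow> (\<forall>i<e. hdiv n (N - e + j) i (r i)) \<and>
        I (N - e + j) (\<lambda>x. x n ^ (N - e + j) - (\<Sum>i<e. r i x * x n ^ i))"
      using less[of "N - e + j" for j] False by (auto simp: less_diff_conv)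
    from choice[OF this] obtain r where r: "\<And>j i. j < e \<Longrightarrow> i < e \<Longrightarrow> hdiv n (N - e + j) i (r j i)"
      "\<And>j. j < e \<Longrightarrow> I (N - e + j) (\<lambda>x. x n ^ (N - e + j) - (\<Sum>i<e. r j i x * x n ^ i))"
      by blast
    define s where "s = (\<lambda>i x. - (\<Sum>j<e. c j x * r j i x))"
    have "hdiv n N i (s i)" if "i < e" for i
    proof -
      have "hdiv n N i (\<lambda>x. c j x * r j i x)" if "j \<in> {..<e}" for j
      proof -
        have j: "j < e" using that by simp
        have "N = e - j + (N - e + j)" using j False by simp
        from hdiv_mult[OF c[OF j] r(1)[OF j \<open>i < e\<close>] this] show ?thesis .
      qed
      then have "hdiv n N i (\<lambda>x. \<Sum>j<e. c j x * r j i x)" by (rule hdiv_sum)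
      then show ?thesis unfolding s_def by (rule hdiv_uminus)
    qed
    moreover have "I N (\<lambda>x. x n ^ N - (\<Sum>i<e. s i x * x n ^ i))"
    proof -
      have 1: "I N (\<lambda>x. x n ^ (N - e) * (x n ^ e + (\<Sum>j<e. c j x * x n ^ j)))"
      proof -
        have "hpoly (Suc n) (N - e) (\<lambda>x. x n ^ (N - e) :: 'k alg_closure)" using hpoly_var_power[of n "Suc n"] by blast
        from giD(4)[OF this f] show ?thesis using False by simp
      qed
      have 2: "I N (\<lambda>x. \<Sum>j<e. c j x * (x n ^ (N - e + j) - (\<Sum>i<e. r j i x * x n ^ i)))"
      proof (rule giD(6))
        fix j assume "j \<in> {..<e}"
        then have j: "j < e" by simp
        show "I N (\<lambda>x. c j x * (x n ^ (N - e + j) - (\<Sum>i<e. r j i x * x n ^ i)))"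
        proof -
          have "hpoly (Suc n) (e - j) (c j)" using c[OF j] by (rule hpoly_mono) simp
          from giD(4)[OF this r(2)[OF j]] show ?thesis using j False by simp
        qed
      qed
      have "x n ^ (N - e) * (x n ^ e + (\<Sum>j<e. c j x * x n ^ j))
          - (\<Sum>j<e. c j x * (x n ^ (N - e + j) - (\<Sum>i<e. r j i x * x n ^ i)))
          = x n ^ N - (\<Sum>i<e. s i x * x n ^ i)" for x
      proof -
        have "(\<Sum>i<e. s i x * x n ^ i) = - (\<Sum>i<e. \<Sum>j<e. c j x * r j i x * x n ^ i)"
          by (simp add: s_def sum_distrib_right sum_negf)
        also have "(\<Sum>i<e. \<Sum>j<e. c j x * r j i x * x n ^ i) = (\<Sum>j<e. \<Sum>i<e. c j x * r j i x * x n ^ i)"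
          by (rule sum.swap)
        finally have a: "(\<Sum>i<e. s i x * x n ^ i) = - (\<Sum>j<e. c j x * (\<Sum>i<e. r j i x * x n ^ i))"
          by (simp add: sum_distrib_left mult.assoc)
        have b: "x n ^ (N - e) * x n ^ e = x n ^ N" using False by (simp flip: power_add)
        have c: "x n ^ (N - e) * (\<Sum>j<e. c j x * x n ^ j) = (\<Sum>j<e. c j x * x n ^ (N - e + j))"
          by (simp add: sum_distrib_left power_add mult_ac)
        show ?thesis unfolding a distrib_left b c by (simp add: right_diff_distrib sum_subtractf)
      qed
      then show ?thesis using giD(5)[OF 1 2] by simp
    qed
    ultimately show ?thesis by blast
  qed
qed

text \<open>Gaussian elimination in place of the determinant in Nakayama's lemma. Each relation
  equates a multiple of a power, by a form not vanishing at \<open>a\<close>, with a combination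
  whose coefficients vanish at \<open>a\<close>. The relation for the top power is solved for that
  power and substituted into the others.\<close>

lemma graded_nakayama:
  assumes "\<forall>l<Suc s. \<exists>\<delta> \<rho> m. hpoly n \<delta> \<rho> \<and> \<rho> a \<noteq> 0 \<and> (\<forall>i<Suc s. hdiv n (\<delta> + l) i (m i) \<and> m i a = 0) \<and>
     I (\<delta> + l) (\<lambda>x. \<rho> x * x n ^ l - (\<Sum>i<Suc s. m i x * x n ^ i))"
  shows "\<exists>\<delta> \<rho>. hpoly n \<delta> \<rho> \<and> \<rho> a \<noteq> 0 \<and> I \<delta> \<rho>"
  using assms
proof (induction s)
  case 0
  then obtain \<delta> \<rho> m where h: "hpoly n \<delta> \<rho>" "\<rho> a \<noteq> 0" "hdiv n \<delta> 0 (m 0)" "m 0 a = 0"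
    "I \<delta> (\<lambda>x. \<rho> x - m 0 x)" by (auto simp: lessThan_Suc)
  have "hpoly n \<delta> (m 0)" using h(3) by (auto simp: hdiv_def intro: hpoly.zero)
  then show ?case using h by (intro exI[of _ \<delta>] exI[of _ "\<lambda>x. \<rho> x - m 0 x"]) (auto intro: hpoly_diff)
next
  case (Suc s)
  obtain \<delta>' \<rho>0 m' where h: "hpoly n \<delta>' \<rho>0" "\<rho>0 a \<noteq> 0" "\<And>i. i < Suc (Suc s) \<Longrightarrow> hdiv n (\<delta>' + Suc s) i (m' i)"
    "\<And>i. i < Suc (Suc s) \<Longrightarrow> m' i a = 0"
    "I (\<delta>' + Suc s) (\<lambda>x. \<rho>0 x * x n ^ Suc s - (\<Sum>i<Suc (Suc s). m' i x * x n ^ i))"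
    using Suc.prems[rule_format, OF lessI] by blast
  \<comment> \<open>The coefficient of the top power on the right moves to the left. It vanishes at
    \<open>a\<close>, so the new factor still does not.\<close>
  define \<rho>' where "\<rho>' = (\<lambda>x. \<rho>0 x - m' (Suc s) x)"
  have "hpoly n \<delta>' (m' (Suc s))" using h(3)[of "Suc s"] by (auto simp: hdiv_def intro: hpoly.zero)
  then have r': "hpoly n \<delta>' \<rho>'" "\<rho>' a \<noteq> 0" unfolding \<rho>'_def using h by (auto intro: hpoly_diff)
  have I': "I (\<delta>' + Suc s) (\<lambda>x. \<rho>' x * x n ^ Suc s - (\<Sum>i<Suc s. m' i x * x n ^ i))"
    using h(5) by (simp add: \<rho>'_def algebra_simps)
  show ?case
  proof (rule Suc.IH, intro allI impI)
    fix l assume l: "l < Suc s"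
    obtain \<delta> \<rho> m where g: "hpoly n \<delta> \<rho>" "\<rho> a \<noteq> 0" "\<And>i. i < Suc (Suc s) \<Longrightarrow> hdiv n (\<delta> + l) i (m i)"
      "\<And>i. i < Suc (Suc s) \<Longrightarrow> m i a = 0"
      "I (\<delta> + l) (\<lambda>x. \<rho> x * x n ^ l - (\<Sum>i<Suc (Suc s). m i x * x n ^ i))"
      using Suc.prems[rule_format, OF less_SucI[OF l]] by blast
    define q where "q = m (Suc s)"
    define M where "M = (\<lambda>i x. \<rho>' x * m i x + q x * m' i x)"
    have Ia: "I (\<delta>' + (\<delta> + l)) (\<lambda>x. \<rho>' x * (\<rho> x * x n ^ l - (\<Sum>i<Suc (Suc s). m i x * x n ^ i)))"
      by (rule giD(4)[OF hpoly_mono[OF r'(1)] g(5)]) simp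
    have Ib: "I (\<delta>' + (\<delta> + l)) (\<lambda>x. q x * (\<rho>' x * x n ^ Suc s - (\<Sum>i<Suc s. m' i x * x n ^ i)))"
    proof (cases "q = (\<lambda>x. 0)")
      case True then show ?thesis by (simp add: giD(2))
    next
      case False
      then have q: "Suc s \<le> \<delta> + l" "hpoly n (\<delta> + l - Suc s) q"
        using g(3)[of "Suc s"] by (auto simp: q_def hdiv_def)
      have "hpoly (Suc n) (\<delta> + l - Suc s) q" using q(2) by (rule hpoly_mono) simp
      moreover have "\<delta>' + (\<delta> + l) = (\<delta> + l - Suc s) + (\<delta>' + Suc s)" using q(1) by simp
      ultimately show ?thesis using I' by (intro graded_ideal_mult[OF gi])
    qed
    have "\<rho>' x * (\<rho> x * x n ^ l - (\<Sum>i<Suc (Suc s). m i x * x n ^ i))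
        + q x * (\<rho>' x * x n ^ Suc s - (\<Sum>i<Suc s. m' i x * x n ^ i))
        = \<rho>' x * \<rho> x * x n ^ l - (\<Sum>i<Suc s. M i x * x n ^ i)" for x
    proof -
      have "(\<Sum>i<Suc s. M i x * x n ^ i) = \<rho>' x * (\<Sum>i<Suc s. m i x * x n ^ i) + q x * (\<Sum>i<Suc s. m' i x * x n ^ i)"
        by (simp only: M_def distrib_right sum.distrib sum_distrib_left mult.assoc)
      moreover have "(\<Sum>i<Suc (Suc s). m i x * x n ^ i) = (\<Sum>i<Suc s. m i x * x n ^ i) + q x * x n ^ Suc s"
        by (simp add: q_def)
      ultimately show ?thesis by (simp only: algebra_simps)
    qed
    then have Ic: "I (\<delta>' + \<delta> + l) (\<lambda>x. \<rho>' x * \<rho> x * x n ^ l - (\<Sum>i<Suc s. M i x * x n ^ i))"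
      using giD(3)[OF Ia Ib] by (simp add: add.assoc)
    have M: "hdiv n (\<delta>' + \<delta> + l) i (M i)" "M i a = 0" if i: "i < Suc s" for i
    proof -
      have "hdiv n (\<delta>' + \<delta> + l) i (\<lambda>x. q x * m' i x)"
      proof (cases "q = (\<lambda>x. 0)")
        case True then show ?thesis by (simp add: hdiv_zero)
      next
        case False
        then have q: "Suc s \<le> \<delta> + l" "hpoly n (\<delta> + l - Suc s) q"
          using g(3)[of "Suc s"] by (auto simp: q_def hdiv_def)
        have "\<delta>' + \<delta> + l = (\<delta> + l - Suc s) + (\<delta>' + Suc s)" using q(1) by simp
        then show ?thesis using h(3)[of i] i by (intro hdiv_mult[OF q(2)]) auto
      qed
      then show "hdiv n (\<delta>' + \<delta> + l) i (M i)"
        unfolding M_def using i by (intro hdiv_add hdiv_mult[OF r'(1) g(3)]) auto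
      show "M i a = 0" using i g(4) h(4) by (simp add: M_def)
    qed
    show "\<exists>\<delta> \<rho> m. hpoly n \<delta> \<rho> \<and> \<rho> a \<noteq> 0 \<and> (\<forall>i<Suc s. hdiv n (\<delta> + l) i (m i) \<and> m i a = 0) \<and>
        I (\<delta> + l) (\<lambda>x. \<rho> x * x n ^ l - (\<Sum>i<Suc s. m i x * x n ^ i))"
      using M Ic hpoly.mult[OF r'(1) g(1)] r'(2) g(2)
      by (intro exI[of _ "\<delta>' + \<delta>"] exI[of _ "\<lambda>x. \<rho>' x * \<rho> x"] exI[of _ M]) auto
  qed
qed

end

text \<open>\<open>c\<close> is algebraic over the base field, and after division by a power of the
  variable its equation has a nonzero constant term; this expresses the inverse as a polynomial in
  \<open>c\<close>.\<close>

lemma subring_algebraic_inverse: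
  fixes E :: "'k::field alg_closure set"
  assumes k: "range to_ac \<subseteq> E" and add: "\<And>a b. a \<in> E \<Longrightarrow> b \<in> E \<Longrightarrow> a + b \<in> E"
    and mult: "\<And>a b. a \<in> E \<Longrightarrow> b \<in> E \<Longrightarrow> a * b \<in> E" and c: "c \<in> E" "c \<noteq> 0"
  shows "inverse c \<in> E"
proof -
  have poly_E: "poly (map_poly to_ac p) c \<in> E" for p :: "'k poly"
    using k c by (induction p) (auto simp: map_poly_pCons intro!: add mult)
  have "\<exists>p :: 'k poly. coeff p 0 \<noteq> 0 \<and> poly (map_poly to_ac p) c = 0"
  proof -
    obtain p :: "'k poly" where p: "p \<noteq> 0" "poly (map_poly to_ac p) c = 0"
      using alg_closure_algebraic by blast
    have "p \<noteq> 0 \<longrightarrow> poly (map_poly to_ac p) c = 0 \<longrightarrow> ?thesis"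
    proof (induction p)
      case (pCons a p)
      show ?case
      proof (cases "a = 0")
        case True
        then show ?thesis using pCons c by (auto simp: map_poly_pCons)
      next
        case False
        then show ?thesis by (intro impI exI[of _ "pCons a p"]) auto
      qed
    qed simp
    then show ?thesis using p by blast
  qed
  then obtain p :: "'k poly" where p: "coeff p 0 \<noteq> 0" "poly (map_poly to_ac p) c = 0" by blast
  obtain a q where pq: "p = pCons a q" by (cases p)
  have "to_ac a + c * poly (map_poly to_ac q) c = 0" "a \<noteq> 0" using p by (auto simp: pq map_poly_pCons)
  then have "c * (to_ac (- inverse a) * poly (map_poly to_ac q) c) = 1"
    by (simp add: field_simps add_eq_0_iff)
  then have "inverse c = to_ac (- inverse a) * poly (map_poly to_ac q) c" by (simp add: inverse_unique)
  then show ?thesis using poly_E[of q] k mult by (metis range_subsetD)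
qed

lemma hcoeffs_sum_upto:
  assumes "hcoeffs n e c" "e \<le> e'"
  shows "(\<Sum>j\<le>e'. c j x * x n ^ j) = (\<Sum>j\<le>e. c j x * x n ^ j)"
  using assms by (intro sum.mono_neutral_right) (auto simp: hcoeffs_def)

text \<open>
  Induction on the number of variables. If \<open>(0, \<dots>, 0, 1)\<close> is not a zero of \<open>I\<close>, then \<open>I\<close> contains a form monic in the
  last variable, and the elimination ideal has a zero \<open>a'\<close> or contains powers of all variables. In the first case the
  specialisations of \<open>I\<close> at \<open>a'\<close> are an ideal of polynomials in one variable; if it had no zero it would contain 1, and by
  \<open>graded_nakayama\<close> the elimination ideal would contain a form not vanishing at \<open>a'\<close>.
\<close>

theorem projective_nullstellensatz:
  fixes I :: "nat \<Rightarrow> ((nat \<Rightarrow> 'k::field alg_closure) \<Rightarrow> 'k alg_closure) \<Rightarrow> bool"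
  assumes "graded_ideal n I"
  shows "(\<exists>a. (\<exists>i<n. a i \<noteq> 0) \<and> (\<forall>e p. I e p \<longrightarrow> p a = 0)) \<or> (\<exists>D. \<forall>i<n. I D (\<lambda>x. x i ^ D))"
  using assms
proof (induction n arbitrary: I)
  case 0
  then show ?case by auto
next
  case (Suc n)
  note gi = Suc.prems
  note giD = graded_idealD[OF gi] and gi_sum = graded_ideal_sum[OF gi] and gi_diff = graded_ideal_diff[OF gi]
    and gi_powers = graded_ideal_var_powers[OF gi] and gi_red = monic_reduction[OF gi] and gi_nak = graded_nakayama[OF gi]
  define u where "u = (\<lambda>i. if i = n then 1 else 0 :: 'k alg_closure)"
  show ?case
  proof (cases "\<forall>e p. I e p \<longrightarrow> p u = 0")
    case True
    then show ?thesis by (intro disjI1 exI[of _ u]) (auto simp: u_def)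
  next
    case False
    then obtain e p where p: "I e p" "p u \<noteq> 0" by blast
    obtain c0 where c0: "hcoeffs n e c0" "p = (\<lambda>x. \<Sum>j\<le>e. c0 j x * x n ^ j)"
      using hpoly_Suc_decomp[OF giD(1)[OF p(1)]] by blast
    have "hpoly n 0 (c0 e)" using c0(1) by (auto simp: hcoeffs_def)
    from hpoly_degree_0[OF this] obtain \<kappa> where \<kappa>: "c0 e = (\<lambda>x. to_ac \<kappa>)" by auto
    have van: "c0 j u = 0" if "j < e" for j
    proof -
      have "hpoly n (e - j) (c0 j)" using c0(1) that by (auto simp: hcoeffs_def)
      from hpoly_cong[OF this, of u "\<lambda>i. 0 * u i"] hpoly_homogeneous[OF this, of 0 u] that
      show ?thesis by (simp add: u_def power_0_left split: if_splits)
    qed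
    have un: "u n = 1" by (simp add: u_def)
    have "p u = c0 e u"
    proof -
      have "p u = (\<Sum>j\<le>e. c0 j u * u n ^ j)" by (simp add: c0(2))
      also have "\<dots> = (\<Sum>j\<le>e. if j = e then c0 e u else 0)"
        by (rule sum.cong) (use van un in auto)
      finally show ?thesis by simp
    qed
    then have k0: "\<kappa> \<noteq> 0" using p \<kappa> by auto
    define c where "c = (\<lambda>j x. to_ac (inverse \<kappa>) * c0 j x)"
    have c: "hpoly n (e - j) (c j)" if "j < e" for j
      unfolding c_def using c0(1) that by (intro hpoly_scale) (auto simp: hcoeffs_def)
    have f: "I e (\<lambda>x. x n ^ e + (\<Sum>j<e. c j x * x n ^ j))"
    proof -
      have "I (0 + e) (\<lambda>x. to_ac (inverse \<kappa>) * p x)" by (rule giD(4)[OF hpoly.const p(1)])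
      moreover have "to_ac (inverse \<kappa>) * p x = x n ^ e + (\<Sum>j<e. c j x * x n ^ j)" for x
      proof -
        have "p x = to_ac \<kappa> * x n ^ e + (\<Sum>j<e. c0 j x * x n ^ j)"
          unfolding c0(2) using \<kappa> by (simp add: lessThan_Suc_atMost[symmetric])
        then show ?thesis using k0 by (simp add: c_def distrib_left sum_distrib_left mult.assoc)
      qed
      ultimately show ?thesis by simp
    qed
    note red = gi_red[OF f c]
    define I' where "I' = (\<lambda>e p. I e p \<and> hpoly n e p)"
    have m4: "I (d + e) (\<lambda>x. q x * p x)" if "hpoly n d q" "I e p" for d e p q
      using giD(4)[OF hpoly_mono[OF that(1)] that(2)] by simp
    have gi': "graded_ideal n I'"
      unfolding graded_ideal_def I'_def
      using giD(1-3) m4 by (auto intro: hpoly.zero hpoly.add hpoly.mult)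
    from Suc.IH[OF gi'] show ?thesis
    proof
      assume "\<exists>D. \<forall>i<n. I' D (\<lambda>x. x i ^ D)"
      then obtain D where D: "\<And>i. i < n \<Longrightarrow> I D (\<lambda>x. x i ^ D)" by (auto simp: I'_def)
      define N where "N = D + n * D + e + 1"
      obtain r where r: "\<And>i. i < e \<Longrightarrow> hdiv n N i (r i)" "I N (\<lambda>x. x n ^ N - (\<Sum>i<e. r i x * x n ^ i))"
        using red[of N] by blast
      have "I N (\<lambda>x. x n ^ i * r i x)" if i: "i < e" for i
      proof (cases "r i = (\<lambda>x. 0)")
        case True then show ?thesis by (simp add: giD(2))
      next
        case False
        then have "hpoly n (N - i) (r i)" using r(1)[OF i] by (auto simp: hdiv_def)
        then have "I (N - i) (r i)"
          using i by (intro gi_powers[OF D]) (auto simp: N_def)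
        from giD(4)[OF hpoly_var_power[of n "Suc n" i] this] show ?thesis
          using i by (simp add: N_def add.assoc)
      qed
      then have "I N (\<lambda>x. \<Sum>i<e. x n ^ i * r i x)" by (intro gi_sum) auto
      from giD(3)[OF r(2) this] have T: "I N (\<lambda>x. x n ^ N)" by (simp add: mult.commute)
      have "I N (\<lambda>x. x i ^ N)" if "i < Suc n" for i
      proof (cases "i = n")
        case False
        then have "I D (\<lambda>x. x i ^ D)" using that D by simp
        note * = giD(4)[OF hpoly_var_power[OF that, of "N - D"] this]
        have "N - D + D = N" by (simp add: N_def)
        then show ?thesis using * by (simp flip: power_add)
      qed (use T in simp)
      then show ?thesis by blast
    next
      assume "\<exists>a. (\<exists>i<n. a i \<noteq> 0) \<and> (\<forall>e p. I' e p \<longrightarrow> p a = 0)"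
      then obtain a0 i0 where a0: "i0 < n" "a0 i0 \<noteq> 0" "\<And>e p. I' e p \<Longrightarrow> p a0 = 0" by blast
      \<comment> \<open>Normalised to \<open>a i0 = 1\<close>, so that multiplication by powers of
        \<open>x i0\<close> raises the degree of a form without changing its value at
        \<open>a\<close>.\<close>
      define a where "a = (\<lambda>i. inverse (a0 i0) * a0 i)"
      have ai0: "a i0 = 1" using a0 by (simp add: a_def)
      have van: "p a = 0" if "I e p" "hpoly n e p" for e p
        using hpoly_homogeneous[OF that(2), of "inverse (a0 i0)" a0] a0(3)[of e p] that
        by (simp add: a_def I'_def)
      \<comment> \<open>The values of forms at \<open>a\<close>. By algebraicity this ring is a
        field, the residue field of the point.\<close>
      define E where "E = {p a | p d. hpoly n d p}"
      have lift: "\<exists>p'. hpoly n (d + k) p' \<and> p' a = p a" if "hpoly n d p" for p d k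
        using hpoly.mult[OF that hpoly_var_power[OF a0(1), of k]] ai0
        by (intro exI[of _ "\<lambda>x. p x * x i0 ^ k"]) auto
      have E_add: "y + z \<in> E" if "y \<in> E" "z \<in> E" for y z
      proof -
        obtain p d q d' where pq: "hpoly n d p" "y = p a" "hpoly n d' q" "z = q a" using \<open>y \<in> E\<close> \<open>z \<in> E\<close> by (auto simp: E_def)
        obtain p' where p': "hpoly n (d + d') p'" "p' a = p a" using lift[OF pq(1), of d'] by blast
        obtain q' where q': "hpoly n (d' + d) q'" "q' a = q a" using lift[OF pq(3), of d] by blast
        have "hpoly n (d + d') (\<lambda>x. p' x + q' x)" using p' q' by (intro hpoly.add) (auto simp: add.commute)
        then show ?thesis unfolding E_def pq using p' q'
          by (intro CollectI exI[of _ "\<lambda>x. p' x + q' x"] exI[of _ "d + d'"]) auto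
      qed
      have E_mult: "y * z \<in> E" if yz: "y \<in> E" "z \<in> E" for y z
      proof -
        obtain p d q d' where pq: "hpoly n d p" "y = p a" "hpoly n d' q" "z = q a" using yz by (auto simp: E_def)
        show ?thesis unfolding E_def pq using hpoly.mult[OF pq(1,3)]
          by (intro CollectI exI[of _ "\<lambda>x. p x * q x"] exI[of _ "d + d'"]) auto
      qed
      have E_const: "range to_ac \<subseteq> E"
      proof clarify
        fix c :: 'k
        show "to_ac c \<in> E" unfolding E_def using hpoly.const[of n c]
          by (intro CollectI exI[of _ "\<lambda>x. to_ac c"] exI[of _ 0]) auto
      qed
      have E_inv: "inverse y \<in> E" if "y \<in> E" "y \<noteq> 0" for y
        by (rule subring_algebraic_inverse[OF E_const E_add E_mult that])
      \<comment> \<open>The last variable stays free. Forms of different degrees meet in one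
        polynomial ring over \<open>E\<close>; this is why the degree is existentially quantified
        and why sums require \<open>J_raise\<close>.\<close>
      define J where "J = {f :: 'k alg_closure poly. \<exists>e c. hcoeffs n e c \<and> I e (\<lambda>x. \<Sum>j\<le>e. c j x * x n ^ j) \<and> (\<forall>j. coeff f j = c j a)}"
      have J_smult: "smult y f \<in> J" if y: "y \<in> E" and f: "f \<in> J" for y f
      proof -
        obtain q d where q: "hpoly n d q" "y = q a" using y by (auto simp: E_def)
        obtain e c where c: "hcoeffs n e c" "I e (\<lambda>x. \<Sum>j\<le>e. c j x * x n ^ j)" "\<And>j. coeff f j = c j a"
          using f by (auto simp: J_def)
        define c' where "c' = (\<lambda>j x. q x * c j x)"
        have hc: "hcoeffs n (d + e) c'"
        proof -
          have "hpoly n (d + e - j) (c' j)" for j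
          proof (cases "j \<le> e")
            case True
            then have "hpoly n (d + (e - j)) (c' j)" unfolding c'_def using c(1) q(1) by (intro hpoly.mult) (auto simp: hcoeffs_def)
            then show ?thesis using True by simp
          next
            case False
            then have "c' j = (\<lambda>x. 0)" using c(1) by (auto simp: c'_def hcoeffs_def)
            then show ?thesis by (simp add: hpoly.zero)
          qed
          then show ?thesis using c(1) by (auto simp: hcoeffs_def c'_def)
        qed
        have "(\<Sum>j\<le>d + e. c' j x * x n ^ j) = q x * (\<Sum>j\<le>e. c j x * x n ^ j)" for x
          using hcoeffs_sum_upto[OF c(1), of "d + e" x]
          by (simp add: c'_def mult.assoc flip: sum_distrib_left)
        moreover have "I (d + e) (\<lambda>x. q x * (\<Sum>j\<le>e. c j x * x n ^ j))"
          using giD(4)[OF hpoly_mono[OF q(1)] c(2)] by simp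
        ultimately have "I (d + e) (\<lambda>x. \<Sum>j\<le>d + e. c' j x * x n ^ j)" by simp
        then show ?thesis unfolding J_def using hc c(3) q(2)
          by (intro CollectI exI[of _ "d + e"] exI[of _ c']) (auto simp: c'_def)
      qed
      have J_raise: "\<exists>c. hcoeffs n (d + e) c \<and> I (d + e) (\<lambda>x. \<Sum>j\<le>d + e. c j x * x n ^ j) \<and> (\<forall>j. coeff f j = c j a)"
        if c: "hcoeffs n e c" "I e (\<lambda>x. \<Sum>j\<le>e. c j x * x n ^ j)" "\<forall>j. coeff f j = c j a" for f c d e
      proof -
        define c' where "c' = (\<lambda>j x. x i0 ^ d * c j x)"
        have hc: "hcoeffs n (d + e) c'"
        proof -
          have "hpoly n (d + e - j) (c' j)" for j
          proof (cases "j \<le> e")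
            case True
            then have "hpoly n (d + (e - j)) (c' j)" unfolding c'_def using c(1) hpoly_var_power[OF a0(1)] by (intro hpoly.mult) (auto simp: hcoeffs_def)
            then show ?thesis using True by simp
          next
            case False
            then have "c' j = (\<lambda>x. 0)" using c(1) by (auto simp: c'_def hcoeffs_def)
            then show ?thesis by (simp add: hpoly.zero)
          qed
          then show ?thesis using c(1) by (auto simp: hcoeffs_def c'_def)
        qed
        have "(\<Sum>j\<le>d + e. c' j x * x n ^ j) = x i0 ^ d * (\<Sum>j\<le>e. c j x * x n ^ j)" for x
          using hcoeffs_sum_upto[OF c(1), of "d + e" x]
          by (simp add: c'_def mult.assoc flip: sum_distrib_left)
        moreover have "I (d + e) (\<lambda>x. x i0 ^ d * (\<Sum>j\<le>e. c j x * x n ^ j))"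
          using giD(4)[OF hpoly_var_power[of i0 "Suc n" d] c(2)] a0(1) by simp
        ultimately have "I (d + e) (\<lambda>x. \<Sum>j\<le>d + e. c' j x * x n ^ j)" by simp
        then show ?thesis using hc c(3) ai0
          by (intro exI[of _ c']) (auto simp: c'_def)
      qed
      have J_add: "f + g \<in> J" if "f \<in> J" "g \<in> J" for f g
      proof -
        obtain e c where c: "hcoeffs n e c" "I e (\<lambda>x. \<Sum>j\<le>e. c j x * x n ^ j)" "\<forall>j. coeff f j = c j a"
          using \<open>f \<in> J\<close> by (auto simp: J_def)
        obtain d b where b: "hcoeffs n d b" "I d (\<lambda>x. \<Sum>j\<le>d. b j x * x n ^ j)" "\<forall>j. coeff g j = b j a"
          using \<open>g \<in> J\<close> by (auto simp: J_def)
        obtain c' where c': "hcoeffs n (d + e) c'" "I (d + e) (\<lambda>x. \<Sum>j\<le>d + e. c' j x * x n ^ j)" "\<forall>j. coeff f j = c' j a"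
          using J_raise[OF c, of d] by blast
        obtain b' where b': "hcoeffs n (d + e) b'" "I (d + e) (\<lambda>x. \<Sum>j\<le>d + e. b' j x * x n ^ j)" "\<forall>j. coeff g j = b' j a"
          using J_raise[OF b, of e] by (auto simp: add.commute)
        have "hcoeffs n (d + e) (\<lambda>j x. c' j x + b' j x)"
          using c'(1) b'(1) by (auto simp: hcoeffs_def intro: hpoly.add)
        moreover have "I (d + e) (\<lambda>x. \<Sum>j\<le>d + e. (c' j x + b' j x) * x n ^ j)"
          using giD(3)[OF c'(2) b'(2)] by (simp add: distrib_right sum.distrib)
        ultimately show ?thesis unfolding J_def using c'(3) b'(3)
          by (intro CollectI exI[of _ "d + e"] exI[of _ "\<lambda>j x. c' j x + b' j x"]) auto
      qed
      have J_shift: "pCons 0 f \<in> J" if "f \<in> J" for f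
      proof -
        obtain e c where c: "hcoeffs n e c" "I e (\<lambda>x. \<Sum>j\<le>e. c j x * x n ^ j)" "\<forall>j. coeff f j = c j a"
          using \<open>f \<in> J\<close> by (auto simp: J_def)
        define c' where "c' = (\<lambda>j. case j of 0 \<Rightarrow> (\<lambda>x. 0) | Suc i \<Rightarrow> c i)"
        have "hcoeffs n (Suc e) c'"
          using c(1) by (auto simp: hcoeffs_def c'_def split: nat.split intro: hpoly.zero)
        moreover have "(\<Sum>j\<le>Suc e. c' j x * x n ^ j) = x n ^ 1 * (\<Sum>j\<le>e. c j x * x n ^ j)" for x
          by (simp add: sum.atMost_Suc_shift c'_def sum_distrib_left mult_ac del: sum.atMost_Suc)
        then have "I (1 + e) (\<lambda>x. \<Sum>j\<le>Suc e. c' j x * x n ^ j)"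
          using giD(4)[OF hpoly_var_power[of n "Suc n" 1] c(2)] by simp
        ultimately show ?thesis unfolding J_def using c(3)
          by (intro CollectI exI[of _ "Suc e"] exI[of _ c']) (auto simp: c'_def coeff_pCons split: nat.split)
      qed
      have J_monom: "monom 1 k * f \<in> J" if "f \<in> J" for f k
        using that by (induction k) (auto simp: monom_Suc J_shift)
      have J_coeff: "coeff f j \<in> E" if "f \<in> J" for f j
      proof -
        obtain e c where c: "hcoeffs n e c" "coeff f j = c j a"
          using \<open>f \<in> J\<close> by (auto simp: J_def)
        have "hpoly n (e - j) (c j)" using c(1) by (cases "j \<le> e") (auto simp: hcoeffs_def intro: hpoly.zero)
        then show ?thesis unfolding E_def c(2) by blast
      qed
      define h0 where "h0 = monom 1 e + (\<Sum>j<e. monom (c j a) j)"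
      have h0c: "coeff h0 j = (if j < e then c j a else if j = e then 1 else 0)" for j
      proof -
        have "(\<Sum>i<e. coeff (monom (c i a) i) j) = (\<Sum>i<e. if i = j then c i a else 0)"
          by (rule sum.cong) auto
        then show ?thesis by (auto simp: h0_def coeff_sum)
      qed
      have h0J: "h0 \<in> J"
      proof -
        define c' where "c' = (\<lambda>j x. if j < e then c j x else if j = e then 1 else 0)"
        have "hcoeffs n e c'"
          using c by (auto simp: hcoeffs_def c'_def le_less intro: hpoly_one)
        moreover have "(\<Sum>j\<le>e. c' j x * x n ^ j) = x n ^ e + (\<Sum>j<e. c j x * x n ^ j)" for x
          by (simp add: c'_def lessThan_Suc_atMost[symmetric])
        then have "I e (\<lambda>x. \<Sum>j\<le>e. c' j x * x n ^ j)" using f by simp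
        ultimately show ?thesis unfolding J_def
          by (intro CollectI exI[of _ e] exI[of _ c']) (auto simp: c'_def h0c)
      qed
      have h0n: "h0 \<noteq> 0" using h0c[of e] by auto
      \<comment> \<open>An element of least degree, made monic by inverting its leading coefficient
        in \<open>E\<close>, generates \<open>J\<close>.\<close>
      obtain h1 where h1: "h1 \<in> J" "h1 \<noteq> 0" "\<And>g. g \<in> J \<Longrightarrow> g \<noteq> 0 \<Longrightarrow> degree h1 \<le> degree g"
        using ex_has_least_nat[of "\<lambda>f. f \<in> J \<and> f \<noteq> 0" h0 degree] h0J h0n by blast
      define h where "h = smult (inverse (lead_coeff h1)) h1"
      have hJ: "h \<in> J" unfolding h_def using h1 by (intro J_smult E_inv J_coeff) auto
      have hlead: "lead_coeff h = 1" "degree h = degree h1" using h1 by (auto simp: h_def)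
      have dvd: "h dvd g" if "g \<in> J" for g using that
      proof (induction "degree g" arbitrary: g rule: less_induct)
        case less
        show ?case
        proof (cases "g = 0")
          case False
          then have dg: "degree h \<le> degree g" using h1 less hlead by simp
          define k where "k = degree g - degree h"
          define q where "q = smult (- lead_coeff g) (monom 1 k * h)"
          have neg: "- lead_coeff g \<in> E" using E_mult[OF subsetD[OF E_const rangeI[of _ "-1"]] J_coeff[OF less.prems]] by simp
          then have qJ: "q \<in> J" unfolding q_def by (intro J_smult J_monom hJ)
          have hne: "h \<noteq> 0" using hlead by auto
          have dq1: "degree q = degree g"
            using False hne dg by (simp add: q_def k_def degree_mult_eq degree_monom_eq)
          have dq2: "lead_coeff q = - lead_coeff g"
            unfolding q_def lead_coeff_smult lead_coeff_mult hlead(1) by (simp add: degree_monom_eq)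
          note dq = dq1 dq2
          have "g + q \<in> J" using less.prems qJ by (rule J_add)
          have dd: "g + q = 0 \<or> degree (g + q) < degree g"
          proof (cases "degree g = 0")
            case True
            then have "degree (g + q) = 0" using dq degree_add_le[of g 0 q] by simp
            moreover have "coeff (g + q) 0 = 0" using dq True by simp
            ultimately have "g + q = 0" by (metis leading_coeff_0_iff)
            then show ?thesis by simp
          next
            case False
            have "degree (g + q) \<le> degree g" using dq by (intro degree_add_le) auto
            moreover have "coeff (g + q) (degree g) = 0" using dq by simp
            ultimately show ?thesis using False by (metis le_neq_implies_less leading_coeff_0_iff)
          qed
          have "h dvd g + q" using dd less.hyps[OF _ \<open>g + q \<in> J\<close>] by auto
          moreover have "h dvd q" by (simp add: q_def dvd_smult)
          ultimately show ?thesis by (metis dvd_add_left_iff)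
        qed simp
      qed
      show ?thesis
      proof (cases "degree h = 0")
        case False
        obtain b where b: "poly h b = 0" using alg_closed_imp_poly_has_root[of h] False by auto
        have "p (a(n := b)) = 0" if p: "I d p" for d p
        proof -
          obtain c' where c': "hcoeffs n d c'" "p = (\<lambda>x. \<Sum>j\<le>d. c' j x * x n ^ j)"
            using hpoly_Suc_decomp[OF giD(1)[OF p]] by blast
          define g where "g = (\<Sum>j\<le>d. monom (c' j a) j)"
          have gc: "coeff g j = c' j a" for j
          proof -
            have "coeff g j = (\<Sum>i\<le>d. if i = j then c' i a else 0)"
              unfolding g_def coeff_sum by (rule sum.cong) auto
            then show ?thesis using c'(1) by (auto simp: hcoeffs_def)
          qed
          have "g \<in> J" unfolding J_def using c' p gc by blast
          then have "poly g b = 0" using dvd b by (metis dvd_trans poly_eq_0_iff_dvd)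
          moreover have "c' j (a(n := b)) = c' j a" if "j \<le> d" for j
          proof -
            have "hpoly n (d - j) (c' j)" using c'(1) that by (auto simp: hcoeffs_def)
            from hpoly_cong[OF this, of "a(n := b)" a] show ?thesis by simp
          qed
          ultimately show ?thesis by (simp add: c'(2) g_def poly_sum poly_monom)
        qed
        moreover have "(a(n := b)) i0 \<noteq> 0" "i0 < Suc n" using a0(1) ai0 by auto
        ultimately show ?thesis by blast
      next
        case True
        \<comment> \<open>A constant generator is 1, so \<open>I\<close> contains a form that
          specialises to 1 at \<open>a\<close>. It supplies the relations for
          \<open>graded_nakayama\<close>.\<close>
        then obtain b where b: "h = [:b:]" using degree_eq_zeroE[of h] by blast
        then have "b = 1" using hlead(1) by simp
        then have "h = 1" unfolding b by (simp add: one_pCons)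
        then have "1 \<in> J" using hJ by simp
        then obtain d b where b: "hcoeffs n d b" "I d (\<lambda>x. \<Sum>j\<le>d. b j x * x n ^ j)" "\<And>j. coeff 1 j = b j a"
          unfolding J_def by blast
        have b0: "b 0 a = 1" using b(3)[of 0] by simp
        have bj: "b j a = 0" if "j > 0" for j using b(3)[of j] that by simp
        show ?thesis
        proof (cases e)
          case 0
          then have "I 0 (\<lambda>x. 1)" using f by simp
          then have False using van[of 0 "\<lambda>x. 1"] hpoly_one by auto
          then show ?thesis ..
        next
          case (Suc s)
          have "\<forall>N. \<exists>r. (\<forall>i<Suc s. hdiv n N i (r i)) \<and> I N (\<lambda>x. x n ^ N - (\<Sum>i<Suc s. r i x * x n ^ i))"
            using red unfolding Suc by blast
          from choice[OF this] obtain r where r: "\<And>N i. i < Suc s \<Longrightarrow> hdiv n N i (r N i)"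
            "\<And>N. I N (\<lambda>x. x n ^ N - (\<Sum>i<Suc s. r N i x * x n ^ i))" by blast
          have "\<exists>\<delta> \<rho>. hpoly n \<delta> \<rho> \<and> \<rho> a \<noteq> 0 \<and> I \<delta> \<rho>"
          proof (rule gi_nak[of s], intro allI impI)
            fix l assume "l < Suc s"
            \<comment> \<open>That form is multiplied by the \<open>l\<close>-th power of the last
              variable, and each term with \<open>j \<ge> 1\<close> is reduced below the power
              \<open>e\<close>. Only the term \<open>j = 0\<close> has a coefficient that does not
              vanish at \<open>a\<close>.\<close>
            define m where "m = (\<lambda>i x. - (\<Sum>j=1..d. b j x * r (j + l) i x))"
            have b0h: "hpoly n d (b 0)" using b(1) by (auto simp: hcoeffs_def)
            have m: "hdiv n (d + l) i (m i) \<and> m i a = 0" if i: "i < Suc s" for i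
            proof
              have "hdiv n (d + l) i (\<lambda>x. b j x * r (j + l) i x)" if j: "j \<in> {1..d}" for j
              proof -
                have "hpoly n (d - j) (b j)" using b(1) j by (auto simp: hcoeffs_def)
                moreover have "d + l = d - j + (j + l)" using j by simp
                ultimately show ?thesis using hdiv_mult[OF _ r(1)[OF i]] by blast
              qed
              from hdiv_uminus[OF hdiv_sum[OF this]] show "hdiv n (d + l) i (m i)" unfolding m_def .
              show "m i a = 0" by (simp add: m_def bj)
            qed
            have I1: "I (l + d) (\<lambda>x. x n ^ l * (\<Sum>j\<le>d. b j x * x n ^ j))"
              using giD(4)[OF hpoly_var_power[of n "Suc n" l] b(2)] by simp
            have I2: "I (l + d) (\<lambda>x. \<Sum>j=1..d. b j x * (x n ^ (j + l) - (\<Sum>i<Suc s. r (j + l) i x * x n ^ i)))"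
            proof (rule gi_sum)
              fix j assume j: "j \<in> {1..d}"
              have "hpoly n (d - j) (b j)" using b(1) j by (auto simp: hcoeffs_def)
              then have "hpoly (Suc n) (d - j) (b j)" by (rule hpoly_mono) simp
              from giD(4)[OF this r(2)[of "j + l"]] j
              show "I (l + d) (\<lambda>x. b j x * (x n ^ (j + l) - (\<Sum>i<Suc s. r (j + l) i x * x n ^ i)))" by (simp add: add.commute)
            qed
            have eq: "x n ^ l * (\<Sum>j\<le>d. b j x * x n ^ j) - (\<Sum>j=1..d. b j x * (x n ^ (j + l) - (\<Sum>i<Suc s. r (j + l) i x * x n ^ i)))
              = b 0 x * x n ^ l - (\<Sum>i<Suc s. m i x * x n ^ i)" for x
            proof -
              have "(\<Sum>i<Suc s. m i x * x n ^ i) = - (\<Sum>i<Suc s. \<Sum>j=1..d. b j x * r (j + l) i x * x n ^ i)"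
                by (simp only: m_def sum_distrib_right sum_negf mult_minus_left)
              also have "(\<Sum>i<Suc s. \<Sum>j=1..d. b j x * r (j + l) i x * x n ^ i) = (\<Sum>j=1..d. \<Sum>i<Suc s. b j x * r (j + l) i x * x n ^ i)"
                by (rule sum.swap)
              finally have A: "(\<Sum>i<Suc s. m i x * x n ^ i) = - (\<Sum>j=1..d. b j x * (\<Sum>i<Suc s. r (j + l) i x * x n ^ i))"
                by (simp only: sum_distrib_left mult.assoc)
              have "{..d} = insert 0 {1..d}" by auto
              then have "(\<Sum>j\<le>d. b j x * x n ^ j) = b 0 x + (\<Sum>j=1..d. b j x * x n ^ j)" by simp
              then have B: "x n ^ l * (\<Sum>j\<le>d. b j x * x n ^ j) = b 0 x * x n ^ l + (\<Sum>j=1..d. b j x * x n ^ (j + l))"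
                by (simp add: distrib_left sum_distrib_left power_add mult_ac)
              show ?thesis unfolding A B by (simp add: right_diff_distrib sum_subtractf)
            qed
            have "I (d + l) (\<lambda>x. b 0 x * x n ^ l - (\<Sum>i<Suc s. m i x * x n ^ i))"
              using gi_diff[OF I1 I2] unfolding eq by (simp add: add.commute)
            then show "\<exists>\<delta> \<rho> m. hpoly n \<delta> \<rho> \<and> \<rho> a \<noteq> 0 \<and> (\<forall>i<Suc s. hdiv n (\<delta> + l) i (m i) \<and> m i a = 0) \<and>
                I (\<delta> + l) (\<lambda>x. \<rho> x * x n ^ l - (\<Sum>i<Suc s. m i x * x n ^ i))"
              using b0h b0 m by (intro exI[of _ d] exI[of _ "b 0"] exI[of _ m]) auto
          qed
          then show ?thesis using van by blast
        qed
      qed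
    qed
  qed
qed

section \<open>Normed subrings with the Northcott property\<close>

text \<open>Only submultiplicativity is asked, and \<open>nm 1\<close> may exceed 1: in an integral
  extension the coordinate norm is submultiplicative only up to a constant, which is cured by
  scaling.\<close>

locale normed_subring =
  fixes A :: "'a::field set" and nm :: "'a \<Rightarrow> real"
  assumes zero_closed: "0 \<in> A" and one_closed: "1 \<in> A"
    and add_closed: "a \<in> A \<Longrightarrow> b \<in> A \<Longrightarrow> a + b \<in> A"
    and mult_closed: "a \<in> A \<Longrightarrow> b \<in> A \<Longrightarrow> a * b \<in> A"
    and uminus_closed: "a \<in> A \<Longrightarrow> - a \<in> A"
    and nm_zero: "nm 0 = 0"
    and nm_ge_1: "a \<in> A \<Longrightarrow> a \<noteq> 0 \<Longrightarrow> 1 \<le> nm a"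
    and nm_add: "a \<in> A \<Longrightarrow> b \<in> A \<Longrightarrow> nm (a + b) \<le> nm a + nm b"
    and nm_mult: "a \<in> A \<Longrightarrow> b \<in> A \<Longrightarrow> nm (a * b) \<le> nm a * nm b"
    and nm_uminus: "a \<in> A \<Longrightarrow> nm (- a) = nm a"

definition fracs :: "'a::field set \<Rightarrow> 'a set" where
  "fracs A = {a / b | a b. a \<in> A \<and> b \<in> A \<and> b \<noteq> 0}"

definition polys_over :: "'a::zero set \<Rightarrow> 'a poly set" where
  "polys_over A = {p. \<forall>i. coeff p i \<in> A}"

text \<open>
  The points \<open>z\<close> of bounded height, with the height regularised over the powers of \<open>z\<close>: a fixed denominator \<open>\<mu>\<close> for
  \<open>1, z, \<dots>, z\<^sup>n\<close> may be as large as \<open>B\<^sup>n\<close>. Passing to large \<open>n\<close> makes the multiplicative constants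
  in the norm irrelevant.
\<close>

definition northcott :: "'a::field set \<Rightarrow> ('a \<Rightarrow> real) \<Rightarrow> bool" where
  "northcott A nm \<longleftrightarrow> (\<forall>B\<ge>1. finite {z. \<exists>n \<mu>. n > 0 \<and> \<mu> \<noteq> 0 \<and> (\<forall>k\<le>n. \<mu> * z ^ k \<in> A \<and> nm (\<mu> * z ^ k) \<le> B ^ n)})"

section \<open>The prime ring\<close>

lemma northcott_finite:
  assumes "finite A" shows "northcott A nm"
  unfolding northcott_def
proof (intro allI impI)
  fix B :: real
  have "{z. \<exists>n \<mu>. n > 0 \<and> \<mu> \<noteq> 0 \<and> (\<forall>k\<le>n. \<mu> * z ^ k \<in> A \<and> nm (\<mu> * z ^ k) \<le> B ^ n)} \<subseteq> (\<lambda>(a, b). a / b) ` (A \<times> A)"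
  proof clarify
    fix z n \<mu> assume h: "n > (0::nat)" "\<mu> \<noteq> 0" "\<forall>k\<le>n. \<mu> * z ^ k \<in> A \<and> nm (\<mu> * z ^ k) \<le> B ^ n"
    have "\<mu> * z \<in> A" "\<mu> \<in> A" using h(3)[rule_format, of 1] h(3)[rule_format, of 0] h(1) by auto
    moreover have "z = \<mu> * z / \<mu>" using h by simp
    ultimately show "z \<in> (\<lambda>(a, b). a / b) ` (A \<times> A)" by (intro image_eqI[of _ _ "(\<mu> * z, \<mu>)"]) auto
  qed
  then show "finite {z. \<exists>n \<mu>. n > 0 \<and> \<mu> \<noteq> 0 \<and> (\<forall>k\<le>n. \<mu> * z ^ k \<in> A \<and> nm (\<mu> * z ^ k) \<le> B ^ n)}"
    using assms finite_subset by blast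
qed

text \<open>In characteristic 0 take the integers with the absolute value. If
  \<open>z = p / q\<close> in lowest terms, then \<open>q ^ n\<close> divides \<open>\<mu>\<close>
  and \<open>p ^ n\<close> divides \<open>\<mu> * z ^ n\<close>, so \<open>p\<close> and
  \<open>q\<close> are bounded by \<open>B\<close>. In positive characteristic the prime ring is
  finite and carries the trivial norm.\<close>

lemma exists_northcott_prime_ring:
  "\<exists>(A :: 'a::field set) nm. normed_subring A nm \<and> northcott A nm"
proof (cases "CHAR('a) = 0")
  case True
  have inj: "of_int m = (of_int m' :: 'a) \<longleftrightarrow> m = m'" for m m'
    using of_int_eq_0_iff_char_dvd[of "m - m'", where 'a = 'a] True by simp
  define \<iota> where "\<iota> = (\<lambda>x :: 'a. THE m. of_int m = x)"
  have \<iota>: "\<iota> (of_int m) = m" for m by (simp add: \<iota>_def inj)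
  define nm where "nm = (\<lambda>x. real_of_int \<bar>\<iota> x\<bar>)"
  have nm: "nm (of_int m) = \<bar>m\<bar>" for m by (simp add: nm_def \<iota>)
  define A where "A = (range of_int :: 'a set)"
  have "normed_subring A nm"
  proof
    show "0 \<in> A" unfolding A_def by (intro range_eqI[of _ _ 0]) simp
    show "1 \<in> A" unfolding A_def by (intro range_eqI[of _ _ 1]) simp
    show "nm 0 = 0" using nm[of 0] by simp
    fix a b assume "a \<in> A" "b \<in> A"
    then obtain m m' where m: "a = of_int m" "b = of_int m'" by (auto simp: A_def)
    have e: "a + b = of_int (m + m')" "a * b = of_int (m * m')" "- a = of_int (- m)" by (auto simp: m)
    show "a + b \<in> A" "a * b \<in> A" "- a \<in> A" unfolding e A_def by (rule rangeI)+
    show "nm (a + b) \<le> nm a + nm b" "nm (a * b) \<le> nm a * nm b" "nm (- a) = nm a"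
      unfolding e nm unfolding m nm by (auto simp: abs_mult)
    assume "a \<noteq> 0"
    then have "m \<noteq> 0" by (auto simp: m)
    then show "1 \<le> nm a" unfolding m nm by simp
  qed
  moreover have "northcott A nm"
    unfolding northcott_def
  proof (intro allI impI)
    fix B :: real assume B: "B \<ge> 1"
    define b where "b = \<lfloor>B\<rfloor>"
    have "{z. \<exists>n \<mu>. n > 0 \<and> \<mu> \<noteq> 0 \<and> (\<forall>k\<le>n. \<mu> * z ^ k \<in> A \<and> nm (\<mu> * z ^ k) \<le> B ^ n)} \<subseteq>
      (\<lambda>(p, q). of_int p / of_int q) ` ({-b..b} \<times> {-b..b})"
    proof clarify
      fix z n \<mu> assume h: "n > (0::nat)" "\<mu> \<noteq> 0" "\<forall>k\<le>n. \<mu> * z ^ k \<in> A \<and> nm (\<mu> * z ^ k) \<le> B ^ n"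
      obtain m0 where m0: "\<mu> = of_int m0" using h(3)[rule_format, of 0] by (auto simp: A_def)
      obtain m1 where m1: "\<mu> * z = of_int m1" using h(3)[rule_format, of 1] h(1) by (auto simp: A_def)
      obtain mn where mn: "\<mu> * z ^ n = of_int mn" using h(3)[rule_format, of n] by (auto simp: A_def)
      have m0n: "m0 \<noteq> 0" using h(2) m0 by auto
      define g where "g = gcd m1 m0"
      define p where "p = m1 div g"
      define q where "q = m0 div g"
      have g: "g \<noteq> 0" "g dvd m1" "g dvd m0" using m0n by (auto simp: g_def)
      have pq: "m1 = p * g" "m0 = q * g" using g by (auto simp: p_def q_def)
      have cop: "coprime p q" unfolding p_def q_def g_def using m0n by (intro div_gcd_coprime) auto
      have qn: "q \<noteq> 0" using m0n pq by auto
      have gn: "(of_int g :: 'a) \<noteq> 0" using g inj[of g 0] by simp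
      have qn': "(of_int q :: 'a) \<noteq> 0" using qn inj[of q 0] by simp
      have "of_int q * of_int g * z = (of_int p * of_int g :: 'a)" using m1 unfolding m0 pq by simp
      then have qz: "of_int q * z = (of_int p :: 'a)" using gn by simp
      have "(of_int (q ^ n * mn) :: 'a) = of_int (p ^ n * m0)"
        using mn[symmetric] by (simp add: qz[symmetric] power_mult_distrib m0)
      then have e: "q ^ n * mn = p ^ n * m0" by (simp only: inj)
      have "q ^ n dvd p ^ n * m0" unfolding e[symmetric] by simp
      moreover have "coprime (q ^ n) (p ^ n)" using cop by (simp add: coprime_commute)
      ultimately have "q ^ n dvd m0" by (simp add: coprime_dvd_mult_right_iff)
      then have "\<bar>q ^ n\<bar> \<le> \<bar>m0\<bar>" using m0n by (rule dvd_imp_le_int[rotated])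
      moreover have "\<bar>m0\<bar> \<le> B ^ n" using h(3)[rule_format, of 0] by (simp add: m0 nm)
      ultimately have "real_of_int (\<bar>q ^ n\<bar>) \<le> B ^ n" by linarith
      then have "real_of_int \<bar>q\<bar> ^ n \<le> B ^ n" by (simp add: power_abs)
      then have q: "\<bar>q\<bar> \<le> b" using h(1) B by (simp add: b_def le_floor_iff)
      have p: "\<bar>p\<bar> \<le> b"
      proof (cases "p = 0")
        case False
        then have mnn: "mn \<noteq> 0" using e m0n by auto
        have "p ^ n dvd q ^ n * mn" unfolding e by simp
        moreover have "coprime (p ^ n) (q ^ n)" using cop by simp
        ultimately have "p ^ n dvd mn" by (simp add: coprime_dvd_mult_right_iff)
        then have "\<bar>p ^ n\<bar> \<le> \<bar>mn\<bar>" using mnn by (rule dvd_imp_le_int[rotated])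
        moreover have "\<bar>mn\<bar> \<le> B ^ n" using h(3)[rule_format, of n] by (simp add: mn nm)
        ultimately have "real_of_int (\<bar>p ^ n\<bar>) \<le> B ^ n" by linarith
        then have "real_of_int \<bar>p\<bar> ^ n \<le> B ^ n" by (simp add: power_abs)
        then show ?thesis using h(1) B by (simp add: b_def le_floor_iff)
      qed (use B in \<open>simp add: b_def\<close>)
      have "z = of_int p / of_int q" using qz qn' by (simp add: field_simps)
      then show "z \<in> (\<lambda>(p, q). of_int p / of_int q) ` ({-b..b} \<times> {-b..b})"
        using p q by (intro image_eqI[of _ _ "(p, q)"]) auto
    qed
    then show "finite {z. \<exists>n \<mu>. n > 0 \<and> \<mu> \<noteq> 0 \<and> (\<forall>k\<le>n. \<mu> * z ^ k \<in> A \<and> nm (\<mu> * z ^ k) \<le> B ^ n)}"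
      by (rule finite_subset) simp
  qed
  ultimately show ?thesis by blast
next
  case False
  define A where "A = (range of_int :: 'a set)"
  define nm where "nm = (\<lambda>x :: 'a. if x = 0 then 0 else 1 :: real)"
  define c where "c = int CHAR('a)"
  have "A \<subseteq> of_int ` {0..<c}"
  proof
    fix x assume "x \<in> A"
    then obtain m where m: "x = of_int m" by (auto simp: A_def)
    have "(of_int (m - m mod c) :: 'a) = 0" unfolding of_int_eq_0_iff_char_dvd c_def by (simp add: minus_mod_eq_mult_div)
    then have "x = of_int (m mod c)" by (simp add: m)
    then show "x \<in> of_int ` {0..<c}" using False by (auto simp: c_def)
  qed
  then have "finite A" by (rule finite_subset) simp
  moreover have "normed_subring A nm"
  proof
    show "0 \<in> A" unfolding A_def by (intro range_eqI[of _ _ 0]) simp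
    show "1 \<in> A" unfolding A_def by (intro range_eqI[of _ _ 1]) simp
    show "nm 0 = 0" by (simp add: nm_def)
    fix a b assume "a \<in> A" "b \<in> A"
    then obtain m m' where m: "a = of_int m" "b = of_int m'" by (auto simp: A_def)
    have e: "a + b = of_int (m + m')" "a * b = of_int (m * m')" "- a = of_int (- m)" by (auto simp: m)
    show "a + b \<in> A" "a * b \<in> A" "- a \<in> A" unfolding e A_def by (rule rangeI)+
    show "nm (a + b) \<le> nm a + nm b" "nm (a * b) \<le> nm a * nm b" "nm (- a) = nm a"
      by (auto simp: nm_def)
    assume "a \<noteq> 0"
    then show "1 \<le> nm a" by (simp add: nm_def)
  qed
  ultimately show ?thesis using northcott_finite by blast
qed

section \<open>Adjoining a transcendental element\<close>

lemma polys_over_division: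
  fixes K :: "'a::field set"
  assumes K: "\<And>a b. a \<in> K \<Longrightarrow> b \<in> K \<Longrightarrow> a + b \<in> K" "\<And>a b. a \<in> K \<Longrightarrow> b \<in> K \<Longrightarrow> a * b \<in> K"
    "\<And>a. a \<in> K \<Longrightarrow> - a \<in> K" "\<And>a. a \<in> K \<Longrightarrow> inverse a \<in> K" "0 \<in> K"
    and f: "f \<in> polys_over K" and g: "g \<in> polys_over K" "g \<noteq> 0"
  shows "\<exists>s\<in>polys_over K. \<exists>r\<in>polys_over K. f = g * s + r \<and> (r = 0 \<or> degree r < degree g)"
  using f
proof (induction "degree f" arbitrary: f rule: less_induct)
  case less
  show ?case
  proof (cases "f = 0 \<or> degree f < degree g")
    case True
    then show ?thesis using less.prems K(5) by (intro bexI[of _ 0] bexI[of _ f]) (auto simp: polys_over_def)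
  next
    case False
    define c where "c = lead_coeff f * inverse (lead_coeff g)"
    have cK: "c \<in> K" unfolding c_def using less.prems g by (intro K) (auto simp: polys_over_def)
    define k where "k = degree f - degree g"
    define q where "q = g * monom c k"
    have cn: "c \<noteq> 0" using False g by (simp add: c_def)
    have lq: "lead_coeff q = lead_coeff g * c" using cn by (simp add: q_def lead_coeff_mult degree_monom_eq)
    have "lead_coeff g \<noteq> 0" using g by simp
    then have dq2: "lead_coeff q = lead_coeff f" unfolding lq c_def by simp
    have dq1: "degree q = degree f"
      using False g cn by (simp add: q_def k_def degree_mult_eq degree_monom_eq monom_eq_0_iff)
    note dq = dq1 dq2
    have qK: "q \<in> polys_over K"
      unfolding q_def polys_over_def using g(1) cK K(2,5) by (auto simp: mult.commute[of g] coeff_monom_mult polys_over_def)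
    have mK: "monom c k \<in> polys_over K" using cK K(5) by (auto simp: polys_over_def)
    have "coeff f i + - coeff q i \<in> K" for i using less.prems qK by (intro K) (auto simp: polys_over_def)
    then have fq: "f - q \<in> polys_over K" by (simp add: polys_over_def)
    have "f - q = 0 \<or> degree (f - q) < degree f"
    proof (cases "degree f = 0")
      case True
      then have "degree (f - q) = 0" using dq degree_diff_le[of f 0 q] by simp
      moreover have "coeff (f - q) 0 = 0" using dq True by simp
      ultimately have "f - q = 0" by (metis leading_coeff_0_iff)
      then show ?thesis by simp
    next
      case False
      have "degree (f - q) \<le> degree f" using dq by (intro degree_diff_le) auto
      moreover have "coeff (f - q) (degree f) = 0" using dq by simp
      ultimately show ?thesis using False by (metis le_neq_implies_less leading_coeff_0_iff)
    qed
    then have "\<exists>s\<in>polys_over K. \<exists>r\<in>polys_over K. f - q = g * s + r \<and> (r = 0 \<or> degree r < degree g)"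
    proof
      assume "f - q = 0"
      then show ?thesis using K(5) by (intro bexI[of _ 0]) (auto simp: polys_over_def)
    qed (rule less.hyps[OF _ fq])
    then obtain s r where sr: "s \<in> polys_over K" "r \<in> polys_over K" "f - q = g * s + r" "r = 0 \<or> degree r < degree g" by blast
    have "s + monom c k \<in> polys_over K" using sr(1) mK K(1) by (auto simp: polys_over_def simp del: coeff_monom)
    moreover have "f = g * (s + monom c k) + r" using sr(3) by (simp add: q_def algebra_simps)
    ultimately show ?thesis using sr by blast
  qed
qed

text \<open>A replacement for unique factorisation. By \<open>div\<close>, \<open>q\<close> divides
  every denominator of the fraction; hence all \<open>S j\<close> except the last are multiples of
  \<open>q\<close>, and the quotients form a progression with the same ratio and one term
  less.\<close>

lemma geometric_polys:
  fixes S :: "nat \<Rightarrow> 'a::field poly"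
  assumes q: "q \<noteq> 0" and div: "\<And>s s'. s \<in> K \<Longrightarrow> s' \<in> K \<Longrightarrow> P1 * s = P0 * s' \<Longrightarrow> \<exists>u\<in>K. s = q * u"
    and pq: "P1 * q = P0 * p" and S: "\<And>j. j \<le> N \<Longrightarrow> S j \<in> K" "\<And>j. j < N \<Longrightarrow> S (Suc j) * q = S j * p"
  shows "\<exists>w. \<forall>j\<le>N. S j = q ^ (N - j) * p ^ j * w"
  using S
proof (induction N arbitrary: S)
  case 0
  then show ?case by (intro exI[of _ "S 0"]) auto
next
  case (Suc N)
  have "\<exists>u\<in>K. S j = q * u" if "j \<le> N" for j
  proof (rule div)
    have "P1 * S j * q = P0 * (S j * p)" using pq by (simp add: mult_ac)
    also have "\<dots> = P0 * S (Suc j) * q" using Suc.prems(2)[of j] that by (simp add: mult_ac)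
    finally show "P1 * S j = P0 * S (Suc j)" using q by simp
  qed (use Suc.prems that in auto)
  then obtain s where s: "\<And>j. j \<le> N \<Longrightarrow> s j \<in> K" "\<And>j. j \<le> N \<Longrightarrow> S j = q * s j" by metis
  have S': "S (Suc j) = p * s j" if "j \<le> N" for j
    using Suc.prems(2)[of j] that s(2)[OF that] q by (simp add: mult_ac)
  have "s (Suc j) * q = s j * p" if "j < N" for j
    using S'[of j] s(2)[of "Suc j"] that by (simp add: mult_ac)
  with Suc.IH[of s] s(1) obtain w where w: "\<And>j. j \<le> N \<Longrightarrow> s j = q ^ (N - j) * p ^ j * w" by blast
  have "S j = q ^ (Suc N - j) * p ^ j * w" if "j \<le> Suc N" for j
  proof (cases "j \<le> N")
    case True
    then show ?thesis using s(2) w by (simp add: Suc_diff_le mult_ac)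
  next
    case False
    then have "j = Suc N" using that by simp
    then show ?thesis using S'[of N] w[of N] by (simp add: mult_ac)
  qed
  then show ?case by blast
qed

context normed_subring
begin

lemma sum_closed: "(\<And>i. i \<in> S \<Longrightarrow> f i \<in> A) \<Longrightarrow> sum f S \<in> A"
  by (induction S rule: infinite_finite_induct) (auto simp: zero_closed add_closed)

lemma prod_closed: "(\<And>i. i \<in> S \<Longrightarrow> f i \<in> A) \<Longrightarrow> prod f S \<in> A"
  by (induction S rule: infinite_finite_induct) (auto simp: one_closed mult_closed)

lemma power_closed: "a \<in> A \<Longrightarrow> a ^ n \<in> A"
  by (induction n) (auto simp: one_closed mult_closed)

lemma nm_nonneg: "a \<in> A \<Longrightarrow> 0 \<le> nm a"
  using nm_ge_1[of a] nm_zero by (cases "a = 0") auto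

lemma nm_sum: "(\<And>i. i \<in> S \<Longrightarrow> f i \<in> A) \<Longrightarrow> nm (sum f S) \<le> (\<Sum>i\<in>S. nm (f i))"
proof (induction S rule: infinite_finite_induct)
  case (insert x F)
  then have "nm (sum f (insert x F)) \<le> nm (f x) + nm (sum f F)" by (auto intro!: nm_add sum_closed)
  then show ?case using insert by auto
qed (auto simp: nm_zero)

text \<open>The factor \<open>nm 1\<close> is the norm of the empty product. In
  \<open>nm_power_mult\<close> the trailing factor \<open>b\<close> avoids it.\<close>

lemma nm_prod: "(\<And>i. i \<in> S \<Longrightarrow> f i \<in> A) \<Longrightarrow> nm (prod f S) \<le> nm 1 * (\<Prod>i\<in>S. nm (f i))"
proof (induction S rule: infinite_finite_induct)
  case (insert x F)
  then have "nm (prod f (insert x F)) \<le> nm (f x) * nm (prod f F)" by (auto intro!: nm_mult prod_closed)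
  also have "\<dots> \<le> nm (f x) * (nm 1 * (\<Prod>i\<in>F. nm (f i)))" using insert by (intro mult_left_mono) (auto intro: nm_nonneg)
  finally show ?case using insert by (simp add: mult_ac)
qed auto

lemma nm_of_nat_mult: "a \<in> A \<Longrightarrow> of_nat c * a \<in> A \<and> nm (of_nat c * a) \<le> of_nat c * nm a"
proof (induction c)
  case (Suc c)
  have "nm (of_nat (Suc c) * a) \<le> nm a + nm (of_nat c * a)" using Suc by (auto simp: distrib_right intro!: nm_add)
  then show ?case using Suc by (auto simp: distrib_right add_closed)
qed (auto simp: zero_closed nm_zero)

lemma nm_power_mult: "a \<in> A \<Longrightarrow> b \<in> A \<Longrightarrow> nm (a ^ k * b) \<le> nm a ^ k * nm b"
proof (induction k)
  case (Suc k)
  have "nm (a ^ Suc k * b) = nm (a * (a ^ k * b))" by (simp add: mult_ac)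
  also have "\<dots> \<le> nm a * nm (a ^ k * b)" using Suc by (intro nm_mult) (auto intro: mult_closed power_closed)
  also have "\<dots> \<le> nm a * (nm a ^ k * nm b)" using Suc by (intro mult_left_mono) (auto intro: nm_nonneg)
  finally show ?case by (simp add: mult_ac)
qed auto

lemma subset_fracs: "A \<subseteq> fracs A"
  unfolding fracs_def using one_closed by force

lemma fracs_closed:
  "a \<in> fracs A \<Longrightarrow> b \<in> fracs A \<Longrightarrow> a + b \<in> fracs A"
  "a \<in> fracs A \<Longrightarrow> b \<in> fracs A \<Longrightarrow> a * b \<in> fracs A"
  "a \<in> fracs A \<Longrightarrow> - a \<in> fracs A"
  "a \<in> fracs A \<Longrightarrow> inverse a \<in> fracs A"
  "0 \<in> fracs A" "1 \<in> fracs A"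
proof -
  show "0 \<in> fracs A" "1 \<in> fracs A" using subset_fracs zero_closed one_closed by auto
  assume "a \<in> fracs A"
  then obtain x y where a: "a = x / y" "x \<in> A" "y \<in> A" "y \<noteq> 0" by (auto simp: fracs_def)
  show "- a \<in> fracs A" unfolding fracs_def using a uminus_closed
    by (intro CollectI exI[of _ "- x"] exI[of _ y]) auto
  show "inverse a \<in> fracs A"
    using a zero_closed one_closed by (cases "x = 0") (force simp: fracs_def)+
  assume "b \<in> fracs A"
  then obtain u v where b: "b = u / v" "u \<in> A" "v \<in> A" "v \<noteq> 0" by (auto simp: fracs_def)
  show "a + b \<in> fracs A" unfolding fracs_def using a b
    by (intro CollectI exI[of _ "x * v + u * y"] exI[of _ "y * v"]) (auto simp: add_frac_eq add_closed mult_closed)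
  show "a * b \<in> fracs A" unfolding fracs_def using a b
    by (intro CollectI exI[of _ "x * u"] exI[of _ "y * v"]) (auto simp: mult_closed)
qed

lemma polys_over_closed:
  "p \<in> polys_over A \<Longrightarrow> q \<in> polys_over A \<Longrightarrow> p + q \<in> polys_over A"
  "p \<in> polys_over A \<Longrightarrow> q \<in> polys_over A \<Longrightarrow> p * q \<in> polys_over A"
  "p \<in> polys_over A \<Longrightarrow> - p \<in> polys_over A"
  "0 \<in> polys_over A" "1 \<in> polys_over A"
  "pCons a p \<in> polys_over A \<longleftrightarrow> a \<in> A \<and> p \<in> polys_over A"
  by (auto simp: polys_over_def coeff_mult add_closed uminus_closed zero_closed one_closed mult_closed coeff_pCons
      intro!: sum_closed split: nat.split)

text \<open>A weighted l1 norm. Weight 2 makes it control the degree, because a leading coefficient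
  has norm at least 1; weight 1 makes it control the single coefficients.\<close>

definition pnorm :: "real \<Rightarrow> 'a poly \<Rightarrow> real" where
  "pnorm w p = (\<Sum>i\<le>degree p. nm (coeff p i) * w ^ i)"

lemma pnorm_upto: "degree p \<le> N \<Longrightarrow> pnorm w p = (\<Sum>i\<le>N. nm (coeff p i) * w ^ i)"
  unfolding pnorm_def by (intro sum.mono_neutral_left) (auto simp: coeff_eq_0 nm_zero)

lemma polys_over_coeff: "p \<in> polys_over A \<Longrightarrow> coeff p i \<in> A"
  by (simp add: polys_over_def)

lemma pnorm_zero: "pnorm w 0 = 0"
  by (simp add: pnorm_def nm_zero)

lemma pnorm_uminus: "p \<in> polys_over A \<Longrightarrow> pnorm w (- p) = pnorm w p"
  by (simp add: pnorm_def nm_uminus polys_over_coeff)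

lemma pnorm_add:
  assumes "p \<in> polys_over A" "q \<in> polys_over A" "w \<ge> 0"
  shows "pnorm w (p + q) \<le> pnorm w p + pnorm w q"
proof -
  define N where "N = max (degree p) (degree q)"
  have "degree (p + q) \<le> N" unfolding N_def by (rule degree_add_le_max)
  then have "pnorm w (p + q) = (\<Sum>i\<le>N. nm (coeff p i + coeff q i) * w ^ i)" by (simp add: pnorm_upto)
  also have "\<dots> \<le> (\<Sum>i\<le>N. (nm (coeff p i) + nm (coeff q i)) * w ^ i)"
    using assms by (intro sum_mono mult_right_mono nm_add) (auto simp: polys_over_coeff)
  also have "\<dots> = pnorm w p + pnorm w q"
    by (simp add: pnorm_upto[of p N] pnorm_upto[of q N] N_def distrib_right sum.distrib)
  finally show ?thesis .
qed

lemma pnorm_mult: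
  assumes "p \<in> polys_over A" "q \<in> polys_over A" "w \<ge> 0"
  shows "pnorm w (p * q) \<le> pnorm w p * pnorm w q"
proof -
  have "pnorm w (p * q) = (\<Sum>k\<le>degree p + degree q. nm (\<Sum>i\<le>k. coeff p i * coeff q (k - i)) * w ^ k)"
    using degree_mult_le[of p q] by (simp add: pnorm_upto coeff_mult)
  also have "\<dots> \<le> (\<Sum>k\<le>degree p + degree q. (\<Sum>i\<le>k. nm (coeff p i) * nm (coeff q (k - i))) * w ^ k)"
    using assms
    by (intro sum_mono mult_right_mono order.trans[OF nm_sum] nm_mult) (auto simp: polys_over_coeff mult_closed)
  also have "\<dots> = pnorm w p * pnorm w q"
    unfolding pnorm_def by (intro polynomial_product[symmetric]) (auto simp: coeff_eq_0 nm_zero)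
  finally show ?thesis .
qed

lemma pnorm_pCons: "pnorm w (pCons a p) = nm a + w * pnorm w p"
proof (cases "p = 0")
  case False
  have "pnorm w (pCons a p) = (\<Sum>i\<le>Suc (degree p). nm (coeff (pCons a p) i) * w ^ i)" using False by (simp add: pnorm_def)
  also have "\<dots> = nm a + w * pnorm w p"
    unfolding sum.atMost_Suc_shift by (simp add: pnorm_def sum_distrib_left mult_ac)
  finally show ?thesis .
qed (simp add: pnorm_def nm_zero)

lemma pnorm_coeff_le:
  assumes "p \<in> polys_over A" "w \<ge> 0" shows "nm (coeff p i) * w ^ i \<le> pnorm w p"
proof -
  have "nm (coeff p i) * w ^ i \<le> (\<Sum>i\<le>max i (degree p). nm (coeff p i) * w ^ i)"
    using assms by (intro member_le_sum) (auto intro!: mult_nonneg_nonneg nm_nonneg polys_over_coeff)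
  then show ?thesis by (simp add: pnorm_upto[of p "max i (degree p)"])
qed

lemma pnorm_nonneg: "p \<in> polys_over A \<Longrightarrow> w \<ge> 0 \<Longrightarrow> 0 \<le> pnorm w p"
  unfolding pnorm_def by (intro sum_nonneg mult_nonneg_nonneg nm_nonneg) (auto intro: polys_over_coeff)

lemma pnorm_ge_power_degree:
  assumes "p \<in> polys_over A" "p \<noteq> 0" shows "2 ^ degree p \<le> pnorm 2 p"
proof -
  have "1 * 2 ^ degree p \<le> nm (lead_coeff p) * 2 ^ degree p"
    using assms by (intro mult_right_mono nm_ge_1 polys_over_coeff) auto
  also have "\<dots> \<le> pnorm 2 p" using pnorm_coeff_le[OF assms(1), of 2 "degree p"] by simp
  finally show ?thesis by simp
qed

text \<open>Horner's scheme for the Taylor expansion at \<open>\<tau>\<close>: each step multiplies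
  by \<open>[:\<tau>, 1:]\<close>, whose norm of weight 1 is \<open>nm \<tau> + nm 1\<close>, and
  this number becomes the weight.\<close>

lemma pnorm_shift:
  assumes "p \<in> polys_over A" "\<tau> \<in> A"
  shows "pcompose p [:\<tau>, 1:] \<in> polys_over A \<and> pnorm 1 (pcompose p [:\<tau>, 1:]) \<le> pnorm (nm \<tau> + nm 1) p"
  using assms(1)
proof (induction p)
  case (pCons a p)
  have a: "a \<in> A" "p \<in> polys_over A" using pCons.prems by (auto simp: polys_over_closed)
  define q where "q = pcompose p [:\<tau>, 1:]"
  have q: "q \<in> polys_over A" "pnorm 1 q \<le> pnorm (nm \<tau> + nm 1) p" using pCons.IH a by (auto simp: q_def)
  have l: "[:\<tau>, 1:] \<in> polys_over A" "[:a:] \<in> polys_over A" "pnorm 1 [:\<tau>, 1:] = nm \<tau> + nm 1" "pnorm 1 [:a:] = nm a"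
    using assms a by (auto simp: polys_over_closed one_closed zero_closed pnorm_pCons pnorm_zero)
  have nn: "0 \<le> nm \<tau> + nm 1" using nm_nonneg[of \<tau>] nm_nonneg[of 1] assms one_closed by simp
  have e: "pcompose (pCons a p) [:\<tau>, 1:] = [:a:] + [:\<tau>, 1:] * q" by (simp only: pcompose_pCons q_def)
  have "pnorm 1 ([:a:] + [:\<tau>, 1:] * q) \<le> pnorm 1 [:a:] + pnorm 1 ([:\<tau>, 1:] * q)"
    using l q by (intro pnorm_add polys_over_closed) auto
  also have "\<dots> \<le> nm a + (nm \<tau> + nm 1) * pnorm 1 q"
    using pnorm_mult[OF l(1) q(1), of 1] l by simp
  also have "\<dots> \<le> nm a + (nm \<tau> + nm 1) * pnorm (nm \<tau> + nm 1) p"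
    using q nn by (intro add_left_mono mult_left_mono) auto
  finally have 1: "pnorm 1 ([:a:] + [:\<tau>, 1:] * q) \<le> pnorm (nm \<tau> + nm 1) (pCons a p)" by (simp only: pnorm_pCons)
  have "[:a:] + [:\<tau>, 1:] * q \<in> polys_over A" using l q by (intro polys_over_closed)
  with 1 show ?case unfolding e by blast
qed (auto simp: polys_over_closed pnorm_zero)

lemma polys_over_fracs_clear:
  assumes "p \<in> polys_over (fracs A)"
  shows "\<exists>a\<in>A. a \<noteq> 0 \<and> smult a p \<in> polys_over A"
  using assms
proof (induction p)
  case 0 then show ?case using one_closed by (intro bexI[of _ 1]) (auto simp: polys_over_closed)
next
  case (pCons c p)
  have co: "coeff (pCons c p) i \<in> fracs A" for i using pCons.prems by (simp add: polys_over_def)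
  have "c \<in> fracs A" using co[of 0] by simp
  moreover have "p \<in> polys_over (fracs A)" using co[of "Suc i" for i] by (simp add: polys_over_def)
  ultimately obtain a x y where h: "a \<in> A" "a \<noteq> 0" "smult a p \<in> polys_over A" "c = x / y" "x \<in> A" "y \<in> A" "y \<noteq> 0"
    using pCons.IH by (auto simp: fracs_def)
  have "coeff (smult (a * y) (pCons c p)) i \<in> A" for i
  proof (cases i)
    case 0
    then show ?thesis using h by (simp add: mult_closed)
  next
    case (Suc j)
    have "y * coeff (smult a p) j \<in> A" using h by (intro mult_closed polys_over_coeff)
    then show ?thesis using Suc by (simp add: mult_ac)
  qed
  then have "smult (a * y) (pCons c p) \<in> polys_over A" by (simp only: polys_over_def) blast
  then show ?case using h by (intro bexI[of _ "a * y"]) (auto intro: mult_closed)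
qed

end

lemma finite_bounded_polys: "finite K \<Longrightarrow> finite {p \<in> polys_over K. degree p < N}"
proof -
  assume K: "finite K"
  have "{p \<in> polys_over K. degree p < N} \<subseteq> Poly ` {xs. set xs \<subseteq> K \<and> length xs \<le> N}"
  proof
    fix p assume p: "p \<in> {p \<in> polys_over K. degree p < N}"
    have "set (coeffs p) \<subseteq> K" using p by (auto simp: polys_over_def coeffs_def)
    moreover have "length (coeffs p) \<le> N" using p by (cases "p = 0") (auto simp: length_coeffs_degree)
    ultimately show "p \<in> Poly ` {xs. set xs \<subseteq> K \<and> length xs \<le> N}" by (intro image_eqI[of _ _ "coeffs p"]) auto
  qed
  then show ?thesis using finite_lists_length_le[OF K] finite_subset by blast
qed

text \<open>Evaluation at \<open>\<tau>\<close> may lose everything because \<open>w\<close> can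
  vanish there. The order of vanishing of \<open>w\<close> gives an index \<open>s\<close> that
  serves for all \<open>j\<close>; at this index only the values of \<open>p\<close> and
  \<open>q\<close> and a nonzero constant remain.\<close>

lemma northcott_shift_coeffs:
  fixes P :: "nat \<Rightarrow> 'a::field poly"
  assumes w: "w \<noteq> 0" and P: "\<And>j. j \<le> n \<Longrightarrow> P j = q ^ (n - j) * p ^ j * w" and pq: "poly q \<tau> \<noteq> 0"
  shows "\<exists>s \<mu>. \<mu> \<noteq> 0 \<and> (\<forall>j\<le>n. coeff (pcompose (P j) [:\<tau>, 1:]) s = \<mu> * (poly p \<tau> / poly q \<tau>) ^ j)"
proof -
  define w' where "w' = pcompose w [:\<tau>, 1:]"
  have "w' \<noteq> 0" using w by (auto simp: w'_def pcompose_eq_0_iff)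
  then obtain v where v: "w' = [:-0, 1:] ^ order 0 w' * v" "\<not> [:-0, 1:] dvd v"
    using order_decomp by blast
  define s where "s = order 0 w'"
  have X: "[:-0, 1:] ^ s = monom (1::'a) s" by (simp add: monom_altdef)
  have v0: "coeff v 0 \<noteq> 0" using v(2) by (simp only: poly_0_coeff_0[symmetric] poly_eq_0_iff_dvd not_False_eq_True)
  have "coeff (pcompose (P j) [:\<tau>, 1:]) s = (coeff v 0 * poly q \<tau> ^ n) * (poly p \<tau> / poly q \<tau>) ^ j" if j: "j \<le> n" for j
  proof -
    define u where "u = pcompose (q ^ (n - j) * p ^ j) [:\<tau>, 1:]"
    have "pcompose (P j) [:\<tau>, 1:] = monom 1 s * (u * v)"
      using v(1) X by (simp add: P[OF j] pcompose_mult u_def w'_def[symmetric] s_def[symmetric] mult_ac)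
    then have "coeff (pcompose (P j) [:\<tau>, 1:]) s = coeff (u * v) 0" by (simp add: coeff_monom_mult)
    also have "\<dots> = poly u 0 * coeff v 0" by (simp add: coeff_mult poly_0_coeff_0)
    also have "poly u 0 = poly q \<tau> ^ (n - j) * poly p \<tau> ^ j" by (simp add: u_def poly_pcompose)
    also have "poly q \<tau> ^ (n - j) = poly q \<tau> ^ n / poly q \<tau> ^ j" using pq j by (simp add: power_diff)
    finally show ?thesis by (simp add: power_divide)
  qed
  then show ?thesis using v0 pq by (intro exI[of _ s] exI[of _ "coeff v 0 * poly q \<tau> ^ n"]) auto
qed

text \<open>
  If \<open>P\<^sub>k = \<mu> z\<^sup>k\<close> are polynomials in \<open>t\<close>, then \<open>z = p / q\<close> in lowest terms with \<open>q\<^sup>n w = P\<^sub>0\<close> and \<open>p\<^sup>n w = P\<^sub>n\<close>, so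
  the norm bounds the degrees of \<open>p\<close> and \<open>q\<close>. The lowest Taylor coefficients at a point \<open>\<tau>\<close> of \<open>A\<close> show that the values
  of \<open>z\<close> at \<open>\<tau>\<close> lie in a finite set given by the Northcott property of \<open>A\<close>. If \<open>A\<close> is infinite, enough values determine
  \<open>z\<close>; if it is finite, the degree bound suffices.
\<close>

lemma (in normed_subring) adjoin_transcendental:
  assumes trans: "\<And>p. p \<in> polys_over A \<Longrightarrow> poly p t = 0 \<Longrightarrow> p = 0" and nc: "northcott A nm"
  shows "\<exists>A' nm'. normed_subring A' nm' \<and> northcott A' nm' \<and> A \<subseteq> A' \<and> t \<in> A'"
proof -
  define A' where "A' = (\<lambda>p. poly p t) ` polys_over A"
  define rep where "rep = (\<lambda>a. THE p. p \<in> polys_over A \<and> poly p t = a)"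
  have uniq: "p = q" if "p \<in> polys_over A" "q \<in> polys_over A" "poly p t = poly q t" for p q
  proof -
    have "p + - q \<in> polys_over A" using that by (intro polys_over_closed)
    moreover have "poly (p + - q) t = 0" using that by simp
    ultimately have "p + - q = 0" by (rule trans)
    then show ?thesis by simp
  qed
  have rep: "rep (poly p t) = p" if "p \<in> polys_over A" for p
    unfolding rep_def using that uniq by (intro the_equality) auto
  define nm' where "nm' = (\<lambda>a. pnorm 2 (rep a))"
  have nm': "nm' (poly p t) = pnorm 2 p" if "p \<in> polys_over A" for p
    using rep[OF that] by (simp add: nm'_def)
  have const: "[:a:] \<in> polys_over A" if "a \<in> A" for a using that by (simp add: polys_over_closed)
  have ns: "normed_subring A' nm'"
  proof
    show "0 \<in> A'" unfolding A'_def by (intro image_eqI[of _ _ 0]) (auto simp: polys_over_closed)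
    show "1 \<in> A'" unfolding A'_def by (intro image_eqI[of _ _ 1]) (auto simp: polys_over_closed)
    show "nm' 0 = 0" using nm'[of 0] by (simp add: polys_over_closed pnorm_zero)
    fix a b assume "a \<in> A'" "b \<in> A'"
    then obtain p q where pq: "p \<in> polys_over A" "a = poly p t" "q \<in> polys_over A" "b = poly q t" by (auto simp: A'_def)
    have e: "a + b = poly (p + q) t" "a * b = poly (p * q) t" "- a = poly (- p) t" using pq by auto
    have c: "p + q \<in> polys_over A" "p * q \<in> polys_over A" "- p \<in> polys_over A" using pq by (auto intro: polys_over_closed)
    show "a + b \<in> A'" "a * b \<in> A'" "- a \<in> A'" unfolding e A'_def using c by (auto simp del: poly_add poly_mult poly_minus)
    show "nm' (a + b) \<le> nm' a + nm' b" "nm' (a * b) \<le> nm' a * nm' b" "nm' (- a) = nm' a"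
      unfolding e using pq c by (simp_all add: nm' pnorm_add pnorm_mult pnorm_uminus del: poly_add poly_mult poly_minus)
    assume "a \<noteq> 0"
    then have "p \<noteq> 0" using pq by auto
    then have "2 ^ degree p \<le> pnorm 2 p" using pq pnorm_ge_power_degree by blast
    moreover have "(1::real) \<le> 2 ^ degree p" by simp
    ultimately have "1 \<le> pnorm 2 p" by linarith
    then show "1 \<le> nm' a" using pq nm' by simp
  qed
  have sub: "A \<subseteq> A'"
  proof
    fix a assume "a \<in> A"
    then show "a \<in> A'" unfolding A'_def using const by (intro image_eqI[of _ _ "[:a:]"]) auto
  qed
  have tA: "t \<in> A'" unfolding A'_def
    by (intro image_eqI[of _ _ "[:0, 1:]"]) (auto simp: polys_over_closed one_closed zero_closed)
  \<comment> \<open>Lowest terms require division with remainder, hence coefficients in the fraction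
    field; the \<open>P j\<close> keep coefficients in \<open>A\<close>.\<close>
  define K where "K = fracs A"
  note Kc = fracs_closed[folded K_def]
  have AK: "A \<subseteq> K" using subset_fracs by (simp add: K_def)
  have transK: "p = 0" if p: "p \<in> polys_over K" "poly p t = 0" for p
  proof -
    obtain a where a: "a \<noteq> 0" "smult a p \<in> polys_over A"
      using polys_over_fracs_clear p by (auto simp: K_def)
    then have "smult a p = 0" using p by (intro trans) auto
    then show ?thesis using a by simp
  qed
  have Kmult: "p * q \<in> polys_over K" if "p \<in> polys_over K" "q \<in> polys_over K" for p q
  proof -
    have "sum f S \<in> K" if "\<And>i. i \<in> S \<Longrightarrow> f i \<in> K" for f and S :: "nat set"
      using that by (induction S rule: infinite_finite_induct) (auto simp: Kc)
    moreover have "coeff p j * coeff q (i - j) \<in> K" for i j using that by (intro Kc) (auto simp: polys_over_def)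
    ultimately show ?thesis by (simp add: polys_over_def coeff_mult)
  qed
  have Kdiff: "p - q \<in> polys_over K" if "p \<in> polys_over K" "q \<in> polys_over K" for p q
  proof -
    have "coeff p i + - coeff q i \<in> K" for i using that by (intro Kc) (auto simp: polys_over_def)
    then show ?thesis by (simp add: polys_over_def)
  qed
  have uniqK: "p = q" if "p \<in> polys_over K" "q \<in> polys_over K" "poly p t = poly q t" for p q
    using transK[OF Kdiff[OF that(1,2)]] that(3) by simp
  have main: "\<exists>p q w P. p \<in> polys_over K \<and> q \<in> polys_over K \<and> q \<noteq> 0 \<and> w \<noteq> 0 \<and> poly q t * z = poly p t \<and>
      (\<forall>j\<le>n. P j \<in> polys_over A \<and> P j = q ^ (n - j) * p ^ j * w \<and> pnorm 2 (P j) \<le> B ^ n)"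
    if h: "n > 0" "\<mu> \<noteq> 0" "\<forall>k\<le>n. \<mu> * z ^ k \<in> A' \<and> nm' (\<mu> * z ^ k) \<le> B ^ n" for n \<mu> z B
  proof -
    have "\<forall>k. \<exists>p. k \<le> n \<longrightarrow> p \<in> polys_over A \<and> \<mu> * z ^ k = poly p t" using h(3) by (auto simp: A'_def)
    from choice[OF this] obtain P where P: "\<And>k. k \<le> n \<Longrightarrow> P k \<in> polys_over A" "\<And>k. k \<le> n \<Longrightarrow> \<mu> * z ^ k = poly (P k) t"
      by blast
    have Pn: "pnorm 2 (P k) \<le> B ^ n" if "k \<le> n" for k
      using h(3)[rule_format, OF that] nm'[OF P(1)[OF that]] unfolding P(2)[OF that] by simp
    have PK: "P k \<in> polys_over K" if "k \<le> n" for k using P(1)[OF that] AK by (auto simp: polys_over_def)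
    have e0: "poly (P 0) t = \<mu>" and e1: "poly (P 1) t = \<mu> * z" using P(2)[of 0] P(2)[of 1] h(1) by simp_all
    have P00: "P 0 \<noteq> 0" using P(2)[of 0] h(2) by auto
    \<comment> \<open>The pairs with \<open>z = p / q\<close>. By division with remainder, a
      denominator of least degree divides all others.\<close>
    define R where "R = (\<lambda>(p, q). p \<in> polys_over K \<and> q \<in> polys_over K \<and> q \<noteq> 0 \<and> P 1 * q = P 0 * p)"
    have "R (P 1, P 0)" using PK[of 0] PK[of 1] P00 h(1) by (simp add: R_def)
    from ex_has_least_nat[of R, OF this, of "\<lambda>x. degree (snd x)"]
    obtain p q where pq: "R (p, q)" "\<And>p' q'. R (p', q') \<Longrightarrow> degree q \<le> degree q'" by (metis snd_conv surj_pair)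
    have pq': "p \<in> polys_over K" "q \<in> polys_over K" "q \<noteq> 0" "P 1 * q = P 0 * p" using pq(1) by (auto simp: R_def)
    have div: "\<exists>u\<in>polys_over K. s = q * u" if s: "s \<in> polys_over K" "s' \<in> polys_over K" "P 1 * s = P 0 * s'" for s s'
    proof -
      obtain u r where ur: "u \<in> polys_over K" "r \<in> polys_over K" "s = q * u + r" "r = 0 \<or> degree r < degree q"
        using polys_over_division[OF Kc(1-5) s(1) pq'(2,3)] by blast
      have "r = 0"
      proof (rule ccontr)
        assume r: "r \<noteq> 0"
        have "P 1 * r = P 1 * s - (P 1 * q) * u" using ur(3) by (simp add: algebra_simps)
        also have "\<dots> = P 0 * (s' - p * u)" using s(3) pq'(4) by (simp add: algebra_simps)
        finally have "R (s' - p * u, r)" using r ur pq' s by (auto simp: R_def intro!: Kdiff Kmult)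
        then show False using pq(2) ur(4) r by fastforce
      qed
      then show ?thesis using ur by auto
    qed
    have step: "P (Suc j) * q = P j * p" if j: "j < n" for j
    proof (rule uniqK)
      show "P (Suc j) * q \<in> polys_over K" "P j * p \<in> polys_over K" using j pq' by (auto intro!: Kmult PK)
      have "poly (P 1) t * poly q t = poly (P 0) t * poly p t" using arg_cong[OF pq'(4), of "\<lambda>p. poly p t"] by simp
      then have "\<mu> * (z * poly q t) = \<mu> * poly p t" unfolding e0 e1 by (simp add: mult_ac)
      then have "poly q t * z = poly p t" using h(2) by (simp add: mult.commute)
      then show "poly (P (Suc j) * q) t = poly (P j * p) t"
        using P(2)[of j] P(2)[of "Suc j"] j by (simp add: mult_ac flip: P(2))
    qed
    have qz: "poly q t * z = poly p t"
    proof -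
      have "poly (P 1) t * poly q t = poly (P 0) t * poly p t" using arg_cong[OF pq'(4), of "\<lambda>p. poly p t"] by simp
      then have "\<mu> * (z * poly q t) = \<mu> * poly p t" unfolding e0 e1 by (simp add: mult_ac)
      then show ?thesis using h(2) by (simp add: mult.commute)
    qed
    obtain w where w: "\<And>j. j \<le> n \<Longrightarrow> P j = q ^ (n - j) * p ^ j * w"
    proof -
      have "\<exists>w. \<forall>j\<le>n. P j = q ^ (n - j) * p ^ j * w"
      proof (rule geometric_polys[where K = "polys_over K" and ?P0.0 = "P 0" and ?P1.0 = "P 1"])
        show "q \<noteq> 0" "P 1 * q = P 0 * p" using pq' by blast+
        show "\<exists>u\<in>polys_over K. s = q * u" if "s \<in> polys_over K" "s' \<in> polys_over K" "P 1 * s = P 0 * s'" for s s'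
          using div that by blast
      qed (fact PK step)+
      then show ?thesis using that by blast
    qed
    have "w \<noteq> 0" using w[OF le0] P00 by (metis mult_zero_right)
    moreover have "\<forall>j\<le>n. P j \<in> polys_over A \<and> P j = q ^ (n - j) * p ^ j * w \<and> pnorm 2 (P j) \<le> B ^ n"
      using w P(1) Pn by simp
    ultimately show ?thesis using pq'(1-3) qz by blast
  qed
  \<comment> \<open>The exponent \<open>n\<close> cancels: \<open>2 ^ (n * degree q)\<close> is at
    most the norm, hence at most \<open>B ^ n\<close>.\<close>
  have deg: "degree q < \<beta>" if "q ^ n * w \<in> polys_over A" "q ^ n * w \<noteq> 0" "pnorm 2 (q ^ n * w) \<le> B ^ n" "n > 0" "B < 2 ^ \<beta>" "B \<ge> 1"
    for q w n B \<beta>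
  proof -
    have qn: "q \<noteq> 0" using that(2,4) by (auto simp: power_0_left)
    have "(2 ^ degree q) ^ n = (2::real) ^ (degree (q ^ n))" using qn by (simp add: degree_power_eq mult.commute flip: power_mult)
    also have "\<dots> \<le> 2 ^ degree (q ^ n * w)" using that(2) by (intro power_increasing) (auto simp: degree_mult_eq)
    also have "\<dots> \<le> B ^ n" using pnorm_ge_power_degree[OF that(1,2)] that(3) by simp
    finally have "2 ^ degree q \<le> B" using that by (simp add: power_mono_iff)
    then have "(2::real) ^ degree q < 2 ^ \<beta>" using that(5) by linarith
    then show ?thesis by simp
  qed
  have "northcott A' nm'"
    unfolding northcott_def
  proof (intro allI impI)
    fix B :: real assume B: "B \<ge> 1"
    obtain \<beta> where \<beta>: "B < 2 ^ \<beta>" using real_arch_pow[of 2 B] by auto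
    define Z where "Z = {z. \<exists>n \<mu>. n > 0 \<and> \<mu> \<noteq> 0 \<and> (\<forall>k\<le>n. \<mu> * z ^ k \<in> A' \<and> nm' (\<mu> * z ^ k) \<le> B ^ n)}"
    have dz: "\<exists>n p q w P. n > 0 \<and> p \<in> polys_over K \<and> q \<in> polys_over K \<and> q \<noteq> 0 \<and> p \<noteq> 0 \<and> w \<noteq> 0 \<and> poly q t * z = poly p t \<and>
      degree p < \<beta> \<and> degree q < \<beta> \<and>
      (\<forall>j\<le>n. P j \<in> polys_over A \<and> P j = q ^ (n - j) * p ^ j * w \<and> pnorm 2 (P j) \<le> B ^ n)" if "z \<in> Z" "z \<noteq> 0" for z
    proof -
      obtain n \<mu> where h: "n > 0" "\<mu> \<noteq> 0" "\<forall>k\<le>n. \<mu> * z ^ k \<in> A' \<and> nm' (\<mu> * z ^ k) \<le> B ^ n"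
        using \<open>z \<in> Z\<close> by (auto simp: Z_def)
      obtain p q w P where m: "p \<in> polys_over K" "q \<in> polys_over K" "q \<noteq> 0" "w \<noteq> 0" "poly q t * z = poly p t"
        "\<forall>j\<le>n. P j \<in> polys_over A \<and> P j = q ^ (n - j) * p ^ j * w \<and> pnorm 2 (P j) \<le> B ^ n"
        using main[OF h] by blast
      have "poly q t \<noteq> 0" using transK m(2,3) by blast
      then have pn: "p \<noteq> 0" using m(5) that(2) by auto
      have "degree q < \<beta>" using m(6)[rule_format, of 0] m(3,4) h(1) \<beta> B by (intro deg[of q n w B]) auto
      moreover have "degree p < \<beta>" using m(6)[rule_format, of n] pn m(4) h(1) \<beta> B by (intro deg[of p n w B]) auto
      ultimately show ?thesis using h(1) m pn by blast
    qed
    have "finite (Z - {0})"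
    proof (cases "finite A")
      case True
      have fK: "finite K"
      proof -
        have "K \<subseteq> (\<lambda>(a, b). a / b) ` (A \<times> A)" by (auto simp: K_def fracs_def)
        then show ?thesis using True finite_subset by blast
      qed
      have "Z - {0} \<subseteq> (\<lambda>(p, q). poly p t / poly q t) ` ({p \<in> polys_over K. degree p < \<beta>} \<times> {p \<in> polys_over K. degree p < \<beta>})"
      proof
        fix z assume "z \<in> Z - {0}"
        then obtain p q where m: "p \<in> polys_over K" "q \<in> polys_over K" "q \<noteq> 0" "poly q t * z = poly p t"
          "degree p < \<beta>" "degree q < \<beta>" using dz[of z] by blast
        have "poly q t \<noteq> 0" using transK m(2,3) by blast
        then have "z = poly p t / poly q t" using m(4) by (simp add: field_simps)
        then show "z \<in> (\<lambda>(p, q). poly p t / poly q t) ` ({p \<in> polys_over K. degree p < \<beta>} \<times> {p \<in> polys_over K. degree p < \<beta>})"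
          using m by (intro image_eqI[of _ _ "(p, q)"]) auto
      qed
      then show ?thesis using finite_bounded_polys[OF fK] finite_subset by blast
    next
      case False
      \<comment> \<open>If two fractions have the same recorded values, every point of
        \<open>T\<close> is a root of \<open>p * q' - p' * q\<close> or of \<open>p * q\<close>, and
        each of these has degree at most \<open>2 * \<beta>\<close>.\<close>
      obtain T where T: "finite T" "card T = 4 * \<beta> + 1" "T \<subseteq> A"
        using infinite_arbitrarily_large[OF False] by blast
      \<comment> \<open>Raising the weight from 2 to at most \<open>2 ^ g\<close> multiplies the
        norm of \<open>P j\<close> by at most \<open>2 ^ (g * degree (P j))\<close>, hence by at
        most \<open>B ^ (g * n)\<close>. The bound is again an \<open>n\<close>-th power, of
        \<open>B ^ (g + 1)\<close>.\<close>
      have "\<forall>\<tau>. \<exists>g. nm \<tau> + nm 1 \<le> 2 ^ g" by (meson less_imp_le one_less_numeral_iff real_arch_pow semiring_norm(76))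
      from choice[OF this] obtain g where g: "\<And>\<tau>. nm \<tau> + nm 1 \<le> 2 ^ g \<tau>" by blast
      define Y where "Y = (\<lambda>\<tau>. {z. \<exists>n \<mu>. n > 0 \<and> \<mu> \<noteq> 0 \<and> (\<forall>k\<le>n. \<mu> * z ^ k \<in> A \<and> nm (\<mu> * z ^ k) \<le> (B ^ (g \<tau> + 1)) ^ n)})"
      have fY: "finite (Y \<tau>)" for \<tau>
        using nc B unfolding northcott_def Y_def by (meson one_le_power)
      \<comment> \<open>The value 0 marks the points where \<open>p\<close> or \<open>q\<close>
        vanishes; a quotient recorded elsewhere is never 0.\<close>
      define \<Phi> where "\<Phi> = T \<rightarrow>\<^sub>E ({0} \<union> (\<Union>\<tau>\<in>T. Y \<tau>))"
      have f\<Phi>: "finite \<Phi>" unfolding \<Phi>_def using T fY by (intro finite_PiE) auto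
      define Q where "Q = (\<lambda>\<phi> z. \<exists>p q. p \<noteq> 0 \<and> q \<noteq> 0 \<and> degree p < \<beta> \<and> degree q < \<beta> \<and> poly q t \<noteq> 0 \<and> poly q t * z = poly p t \<and>
         (\<forall>\<tau>\<in>T. \<phi> \<tau> = (if poly p \<tau> \<noteq> 0 \<and> poly q \<tau> \<noteq> 0 then poly p \<tau> / poly q \<tau> else 0)))"
      have Quniq: "z = z'" if Q1: "Q \<phi> z" and Q2: "Q \<phi> z'" for \<phi> z z'
      proof -
        obtain p q where m: "p \<noteq> 0" "q \<noteq> 0" "degree p < \<beta>" "degree q < \<beta>" "poly q t \<noteq> 0" "poly q t * z = poly p t"
           "\<forall>\<tau>\<in>T. \<phi> \<tau> = (if poly p \<tau> \<noteq> 0 \<and> poly q \<tau> \<noteq> 0 then poly p \<tau> / poly q \<tau> else 0)" using Q1 unfolding Q_def by blast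
        obtain p' q' where m': "p' \<noteq> 0" "q' \<noteq> 0" "degree p' < \<beta>" "degree q' < \<beta>" "poly q' t \<noteq> 0" "poly q' t * z' = poly p' t"
           "\<forall>\<tau>\<in>T. \<phi> \<tau> = (if poly p' \<tau> \<noteq> 0 \<and> poly q' \<tau> \<noteq> 0 then poly p' \<tau> / poly q' \<tau> else 0)" using Q2 unfolding Q_def by blast
        define r where "r = p * q' - p' * q"
        have "r = 0"
        proof (rule ccontr)
          assume r: "r \<noteq> 0"
          have dr: "degree r \<le> 2 * \<beta>" unfolding r_def
            using m m' by (intro degree_diff_le order.trans[OF degree_mult_le]) auto
          have "T \<subseteq> {x. poly r x = 0} \<union> {x. poly (p * q) x = 0}"
          proof
            fix \<tau> assume tau: "\<tau> \<in> T"
            show "\<tau> \<in> {x. poly r x = 0} \<union> {x. poly (p * q) x = 0}"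
            proof (cases "poly p \<tau> \<noteq> 0 \<and> poly q \<tau> \<noteq> 0")
              case True
              then have "\<phi> \<tau> = poly p \<tau> / poly q \<tau>" "\<phi> \<tau> \<noteq> 0" using m(7) tau by auto
              moreover then have "\<phi> \<tau> = poly p' \<tau> / poly q' \<tau>" "poly q' \<tau> \<noteq> 0" using m'(7) tau by (metis (full_types))+
              ultimately have "poly p \<tau> * poly q' \<tau> = poly p' \<tau> * poly q \<tau>" using True by (simp add: frac_eq_eq)
              then show ?thesis by (simp add: r_def)
            qed auto
          qed
          then have "card T \<le> card ({x. poly r x = 0} \<union> {x. poly (p * q) x = 0})"
            using r m by (intro card_mono finite_UnI poly_roots_finite) auto
          also have "\<dots> \<le> card {x. poly r x = 0} + card {x. poly (p * q) x = 0}" by (rule card_Un_le)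
          also have "\<dots> \<le> degree r + degree (p * q)" using r m by (intro add_mono card_poly_roots_bound) auto
          also have "\<dots> \<le> 2 * \<beta> + 2 * \<beta>" using dr m by (intro add_mono order.trans[OF degree_mult_le]) auto
          finally show False using T by simp
        qed
        then have "poly p t * poly q' t = poly p' t * poly q t" by (simp add: r_def) (metis poly_mult)
        then have "poly q t * poly q' t * z = poly q t * poly q' t * z'" using m(6) m'(6) by (metis mult.assoc mult.commute)
        then show ?thesis using m(5) m'(5) by simp
      qed
      have "Z - {0} \<subseteq> (\<Union>\<phi>\<in>\<Phi>. {z. Q \<phi> z})"
      proof
        fix z assume "z \<in> Z - {0}"
        then obtain n p q w P where m: "n > 0" "p \<in> polys_over K" "q \<in> polys_over K" "q \<noteq> 0" "p \<noteq> 0" "w \<noteq> 0" "poly q t * z = poly p t"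
          "degree p < \<beta>" "degree q < \<beta>"
          and P': "\<forall>j\<le>n. P j \<in> polys_over A \<and> P j = q ^ (n - j) * p ^ j * w \<and> pnorm 2 (P j) \<le> B ^ n"
          using dz[of z] by blast
        have P: "\<And>j. j \<le> n \<Longrightarrow> P j \<in> polys_over A" "\<And>j. j \<le> n \<Longrightarrow> P j = q ^ (n - j) * p ^ j * w"
          "\<And>j. j \<le> n \<Longrightarrow> pnorm 2 (P j) \<le> B ^ n" using P' by blast+
        define \<phi> where "\<phi> = (\<lambda>\<tau>\<in>T. if poly p \<tau> \<noteq> 0 \<and> poly q \<tau> \<noteq> 0 then poly p \<tau> / poly q \<tau> else 0)"
        have "poly p \<tau> / poly q \<tau> \<in> Y \<tau>" if tau: "\<tau> \<in> T" "poly p \<tau> \<noteq> 0" "poly q \<tau> \<noteq> 0" for \<tau>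
        proof -
          have tA: "\<tau> \<in> A" using T tau by auto
          obtain s \<mu> where s: "\<mu> \<noteq> 0" "\<And>j. j \<le> n \<Longrightarrow> coeff (pcompose (P j) [:\<tau>, 1:]) s = \<mu> * (poly p \<tau> / poly q \<tau>) ^ j"
            using northcott_shift_coeffs[OF m(6) P(2) tau(3)] by blast
          have "\<mu> * (poly p \<tau> / poly q \<tau>) ^ j \<in> A \<and> nm (\<mu> * (poly p \<tau> / poly q \<tau>) ^ j) \<le> (B ^ (g \<tau> + 1)) ^ n" if j: "j \<le> n" for j
          proof -
            define c where "c = coeff (pcompose (P j) [:\<tau>, 1:]) s"
            have sh: "pcompose (P j) [:\<tau>, 1:] \<in> polys_over A" "pnorm 1 (pcompose (P j) [:\<tau>, 1:]) \<le> pnorm (nm \<tau> + nm 1) (P j)"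
              using pnorm_shift[OF P(1)[OF j] tA] by auto
            have Pj0: "P j \<noteq> 0" using P(2)[OF j] m by simp
            have "nm c \<le> pnorm 1 (pcompose (P j) [:\<tau>, 1:])" unfolding c_def using pnorm_coeff_le[OF sh(1), of 1 s] by simp
            also have "\<dots> \<le> pnorm (nm \<tau> + nm 1) (P j)" by (rule sh)
            also have "\<dots> \<le> (2 ^ degree (P j)) ^ g \<tau> * pnorm 2 (P j)"
              unfolding pnorm_def sum_distrib_left
            proof (rule sum_mono)
              fix i assume i: "i \<in> {..degree (P j)}"
              have "0 \<le> nm \<tau> + nm 1" using nm_nonneg[OF tA] nm_nonneg[OF one_closed] by simp
              then have "(nm \<tau> + nm 1) ^ i \<le> (2 ^ g \<tau>) ^ i" by (intro power_mono g)
              also have "\<dots> = (2 ^ i) ^ g \<tau>" by (simp add: mult.commute flip: power_mult)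
              also have "\<dots> \<le> (2 ^ degree (P j)) ^ g \<tau>" using i by (intro power_mono power_increasing) auto
              also have "\<dots> \<le> (2 ^ degree (P j)) ^ g \<tau> * 2 ^ i" by simp
              finally have "nm (coeff (P j) i) * (nm \<tau> + nm 1) ^ i \<le> nm (coeff (P j) i) * ((2 ^ degree (P j)) ^ g \<tau> * 2 ^ i)"
                by (intro mult_left_mono nm_nonneg polys_over_coeff P j)
              then show "nm (coeff (P j) i) * (nm \<tau> + nm 1) ^ i \<le> (2 ^ degree (P j)) ^ g \<tau> * (nm (coeff (P j) i) * 2 ^ i)"
                by (simp add: mult_ac)
            qed
            also have "\<dots> \<le> (B ^ n) ^ g \<tau> * B ^ n"
            proof (rule mult_mono)
              have "2 ^ degree (P j) \<le> B ^ n" using pnorm_ge_power_degree[OF P(1)[OF j] Pj0] P(3)[OF j] by simp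
              then show "(2 ^ degree (P j)) ^ g \<tau> \<le> (B ^ n) ^ g \<tau>" by (intro power_mono) auto
            qed (use P(1,3) j B pnorm_nonneg in auto)
            also have "\<dots> = (B ^ (g \<tau> + 1)) ^ n" by (simp add: power_mult_distrib mult_ac flip: power_mult)
            finally have "nm c \<le> (B ^ (g \<tau> + 1)) ^ n" .
            moreover have "c \<in> A" unfolding c_def using sh(1) by (rule polys_over_coeff)
            ultimately show ?thesis unfolding s(2)[OF j, symmetric] c_def[symmetric] by blast
          qed
          then show ?thesis unfolding Y_def using m(1) s(1) by blast
        qed
        then have "\<phi> \<in> \<Phi>" unfolding \<phi>_def \<Phi>_def by (intro restrict_PiE_iff[THEN iffD2] ballI) auto
        moreover have "Q \<phi> z"
        proof -
          have "poly q t \<noteq> 0" using transK[OF m(3)] m(4) by blast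
          moreover have "\<forall>\<tau>\<in>T. \<phi> \<tau> = (if poly p \<tau> \<noteq> 0 \<and> poly q \<tau> \<noteq> 0 then poly p \<tau> / poly q \<tau> else 0)"
            by (simp add: \<phi>_def)
          ultimately show ?thesis unfolding Q_def using m by blast
        qed
        ultimately show "z \<in> (\<Union>\<phi>\<in>\<Phi>. {z. Q \<phi> z})" by blast
      qed
      moreover have "finite {z. Q \<phi> z}" for \<phi>
      proof (cases "\<exists>z. Q \<phi> z")
        case True
        then obtain z where "Q \<phi> z" by blast
        then have "{z. Q \<phi> z} \<subseteq> {z}" using Quniq by blast
        then show ?thesis using finite_subset by blast
      qed auto
      ultimately show ?thesis using f\<Phi> by (meson finite_UN_I finite_subset)
    qed
    then show "finite {z. \<exists>n \<mu>. n > 0 \<and> \<mu> \<noteq> 0 \<and> (\<forall>k\<le>n. \<mu> * z ^ k \<in> A' \<and> nm' (\<mu> * z ^ k) \<le> B ^ n)}"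
      unfolding Z_def[symmetric] by simp
  qed
  then show ?thesis using ns sub tA by blast
qed

section \<open>Adjoining an integral element\<close>

lemma det_closed:
  fixes S :: "'b::comm_ring_1 set"
  assumes S: "0 \<in> S" "1 \<in> S" "\<And>a b. a \<in> S \<Longrightarrow> b \<in> S \<Longrightarrow> a + b \<in> S" "\<And>a b. a \<in> S \<Longrightarrow> b \<in> S \<Longrightarrow> a * b \<in> S"
    "\<And>a. a \<in> S \<Longrightarrow> - a \<in> S"
    and M: "M \<in> carrier_mat m m" "\<And>i j. i < m \<Longrightarrow> j < m \<Longrightarrow> M $$ (i, j) \<in> S"
  shows "det M \<in> S"
proof -
  have sum: "sum f Y \<in> S" if "\<And>i. i \<in> Y \<Longrightarrow> f i \<in> S" for f :: "'c \<Rightarrow> 'b" and Y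
    using that by (induction Y rule: infinite_finite_induct) (auto simp: S)
  have prod: "prod f Y \<in> S" if "\<And>i. i \<in> Y \<Longrightarrow> f i \<in> S" for f :: "nat \<Rightarrow> 'b" and Y
    using that by (induction Y rule: infinite_finite_induct) (auto simp: S)
  have sg: "signof p \<in> S" for p :: "nat \<Rightarrow> nat" using S(2) S(5)[OF S(2)] by (simp add: sign_def)
  show ?thesis unfolding det_def'[OF M(1)]
  proof (rule sum)
    fix p assume "p \<in> {p. p permutes {0..<m}}"
    then have "p i < m" if "i < m" for i using that permutes_in_image[of p "{0..<m}" i] by auto
    then show "signof p * (\<Prod>i = 0..<m. M $$ (i, p i)) \<in> S" by (intro S(4) sg prod M) auto
  qed
qed

text \<open>Applied with \<open>M1\<close> and \<open>M0\<close> the multiplications by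
  \<open>\<mu> * z\<close> and \<open>\<mu>\<close>, it makes the norm of
  \<open>\<mu> * (z + c)\<close> a polynomial in \<open>c\<close>.\<close>

lemma linear_det_poly:
  fixes M0 M1 :: "'a::field mat"
  assumes M: "M0 \<in> carrier_mat m m" "M1 \<in> carrier_mat m m"
  shows "\<exists>D. degree D \<le> m \<and> (\<forall>c. poly D c = det (M1 + c \<cdot>\<^sub>m M0))"
proof -
  define N where "N = mat m m (\<lambda>(i, j). [:M1 $$ (i, j), M0 $$ (i, j):])"
  have N: "N \<in> carrier_mat m m" by (simp add: N_def)
  have "degree (det N) \<le> m"
    unfolding det_def'[OF N]
  proof (rule degree_sum_le)
    show "finite {p. p permutes {0..<m}}" by (simp add: finite_permutations)
    fix p assume "p \<in> {p. p permutes {0..<m}}"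
    then have p: "p i < m" if "i < m" for i using that permutes_in_image[of p "{0..<m}" i] by auto
    have "degree (\<Prod>i = 0..<m. N $$ (i, p i)) \<le> (\<Sum>i = 0..<m. degree (N $$ (i, p i)))"
      by (rule degree_prod_sum_le[unfolded o_def]) simp
    also have "\<dots> \<le> (\<Sum>i = 0..<m. 1)" using p by (intro sum_mono) (auto simp: N_def)
    finally have "degree (\<Prod>i = 0..<m. N $$ (i, p i)) \<le> m" by simp
    then show "degree (signof p * (\<Prod>i = 0..<m. N $$ (i, p i))) \<le> m" by (auto simp: sign_def)
  qed
  moreover have "poly (det N) c = det (M1 + c \<cdot>\<^sub>m M0)" for c
  proof -
    have C: "M1 + c \<cdot>\<^sub>m M0 \<in> carrier_mat m m" using M by simp
    show ?thesis unfolding det_def'[OF N] det_def'[OF C] poly_sum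
    proof (rule sum.cong)
      fix p assume "p \<in> {p. p permutes {0..<m}}"
      then have p: "p i < m" if "i < m" for i using that permutes_in_image[of p "{0..<m}" i] by auto
      have "poly (\<Prod>i = 0..<m. N $$ (i, p i)) c = (\<Prod>i = 0..<m. (M1 + c \<cdot>\<^sub>m M0) $$ (i, p i))"
        unfolding poly_prod using p M by (intro prod.cong) (auto simp: N_def)
      then show "poly (signof p * (\<Prod>i = 0..<m. N $$ (i, p i))) c = signof p * (\<Prod>i = 0..<m. (M1 + c \<cdot>\<^sub>m M0) $$ (i, p i))"
        by (auto simp: sign_def)
    qed simp
  qed
  ultimately show ?thesis by blast
qed

context normed_subring
begin

lemma pnorm_smult:
  assumes "c \<in> A" "p \<in> polys_over A" "w \<ge> 0" shows "pnorm w (smult c p) \<le> nm c * pnorm w p"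
proof -
  have "[:c:] \<in> polys_over A" using assms by (simp add: polys_over_closed)
  from pnorm_mult[OF this assms(2,3)] show ?thesis by (simp add: pnorm_pCons pnorm_zero)
qed

lemma smult_polys_over: "c \<in> A \<Longrightarrow> p \<in> polys_over A \<Longrightarrow> smult c p \<in> polys_over A"
  by (simp add: polys_over_def mult_closed)

lemma nm_det:
  assumes M: "M \<in> carrier_mat m m" "\<And>i j. i < m \<Longrightarrow> j < m \<Longrightarrow> M $$ (i, j) \<in> A" "\<And>i j. i < m \<Longrightarrow> j < m \<Longrightarrow> nm (M $$ (i, j)) \<le> b"
  shows "nm (det M) \<le> fact m * nm 1 * b ^ m"
proof -
  have "nm (det M) \<le> (\<Sum>p\<in>{p. p permutes {0..<m}}. nm (signof p * (\<Prod>i = 0..<m. M $$ (i, p i))))"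
    unfolding det_def'[OF M(1)]
  proof (rule nm_sum)
    fix p assume "p \<in> {p. p permutes {0..<m}}"
    then have "p i < m" if "i < m" for i using that permutes_in_image[of p "{0..<m}" i] by auto
    then have "(\<Prod>i = 0..<m. M $$ (i, p i)) \<in> A" by (intro prod_closed M) auto
    then show "signof p * (\<Prod>i = 0..<m. M $$ (i, p i)) \<in> A" by (auto simp: sign_def uminus_closed)
  qed
  also have "\<dots> \<le> (\<Sum>p\<in>{p. p permutes {0..<m}}. nm 1 * b ^ m)"
  proof (rule sum_mono)
    fix p assume "p \<in> {p. p permutes {0..<m}}"
    then have p: "p i < m" if "i < m" for i using that permutes_in_image[of p "{0..<m}" i] by auto
    then have P: "(\<Prod>i = 0..<m. M $$ (i, p i)) \<in> A" by (intro prod_closed M) auto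
    have "nm (\<Prod>i = 0..<m. M $$ (i, p i)) \<le> nm 1 * (\<Prod>i = 0..<m. nm (M $$ (i, p i)))"
      using p by (intro nm_prod M) auto
    also have "\<dots> \<le> nm 1 * (\<Prod>i = 0..<m. b)"
      using p by (intro mult_left_mono prod_mono) (auto intro: nm_nonneg one_closed M)
    finally show "nm (signof p * (\<Prod>i = 0..<m. M $$ (i, p i))) \<le> nm 1 * b ^ m"
      using P by (auto simp: sign_def nm_uminus)
  qed
  also have "\<dots> = fact m * nm 1 * b ^ m" by (simp add: card_permutations)
  finally show ?thesis .
qed

text \<open>Translation by \<open>\<tau>\<close> costs the factor
  \<open>(1 + nm \<tau>) ^ n\<close>, which fits the shape \<open>B ^ n\<close> of the Northcott
  condition. Binomial coefficients count as repeated sums, through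
  \<open>nm_of_nat_mult\<close>.\<close>

lemma nm_binomial:
  assumes "\<tau> \<in> A" "\<And>k. k \<le> n \<Longrightarrow> \<mu> * z ^ k \<in> A \<and> nm (\<mu> * z ^ k) \<le> B ^ n" "k \<le> n" "B \<ge> 0"
  shows "\<mu> * (z + \<tau>) ^ k \<in> A \<and> nm (\<mu> * (z + \<tau>) ^ k) \<le> ((1 + nm \<tau>) * B) ^ n"
proof -
  have t: "0 \<le> nm \<tau>" using assms(1) by (rule nm_nonneg)
  have e: "\<mu> * (z + \<tau>) ^ k = (\<Sum>i\<le>k. of_nat (k choose i) * (\<tau> ^ (k - i) * (\<mu> * z ^ i)))"
    by (simp add: binomial_ring sum_distrib_left mult_ac)
  have cl: "\<tau> ^ (k - i) * (\<mu> * z ^ i) \<in> A" if "i \<le> k" for i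
    using assms(2)[of i] that assms(1,3) by (intro mult_closed[OF power_closed]) auto
  have in_A: "\<mu> * (z + \<tau>) ^ k \<in> A" unfolding e using cl nm_of_nat_mult by (intro sum_closed) auto
  have "nm (\<mu> * (z + \<tau>) ^ k) \<le> (\<Sum>i\<le>k. nm (of_nat (k choose i) * (\<tau> ^ (k - i) * (\<mu> * z ^ i))))"
    unfolding e using cl nm_of_nat_mult by (intro nm_sum) auto
  also have "\<dots> \<le> (\<Sum>i\<le>k. of_nat (k choose i) * (nm \<tau> ^ (k - i) * B ^ n))"
  proof (rule sum_mono)
    fix i assume i: "i \<in> {..k}"
    have "nm (of_nat (k choose i) * (\<tau> ^ (k - i) * (\<mu> * z ^ i))) \<le> of_nat (k choose i) * nm (\<tau> ^ (k - i) * (\<mu> * z ^ i))"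
      using nm_of_nat_mult cl i by auto
    also have "\<dots> \<le> of_nat (k choose i) * (nm \<tau> ^ (k - i) * nm (\<mu> * z ^ i))"
      using i assms by (intro mult_left_mono nm_power_mult) auto
    also have "\<dots> \<le> of_nat (k choose i) * (nm \<tau> ^ (k - i) * B ^ n)"
      using i assms t by (intro mult_left_mono) auto
    finally show "nm (of_nat (k choose i) * (\<tau> ^ (k - i) * (\<mu> * z ^ i))) \<le> of_nat (k choose i) * (nm \<tau> ^ (k - i) * B ^ n)" .
  qed
  also have "\<dots> = (1 + nm \<tau>) ^ k * B ^ n"
    by (simp add: binomial_ring sum_distrib_left mult_ac)
  also have "\<dots> \<le> (1 + nm \<tau>) ^ n * B ^ n" using assms t by (intro mult_right_mono power_increasing) auto
  finally show ?thesis using in_A by (simp add: power_mult_distrib)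
qed

text \<open>
  The norm \<open>\<N>\<close> from \<open>A[\<theta>]\<close> to \<open>A\<close> is the determinant of multiplication on the basis \<open>\<theta>\<^sup>i\<close>. Applied to \<open>\<mu> (z + \<tau>)\<^sup>k\<close>, it
  shows that \<open>\<N> (\<mu> (z + \<tau>)) / \<N> \<mu>\<close> lies in a finite set for each \<open>\<tau>\<close> in \<open>A\<close>. This is a polynomial in \<open>\<tau>\<close> of bounded
  degree with root \<open>- z\<close>, so finitely many \<open>\<tau>\<close> leave finitely many \<open>z\<close>.
\<close>

lemma adjoin_integral:
  assumes R: "R \<in> polys_over A" "lead_coeff R = 1" "degree R = m" "m > 0" "poly R \<theta> = 0"
    and indep: "\<And>p. p \<in> polys_over A \<Longrightarrow> degree p < m \<Longrightarrow> poly p \<theta> = 0 \<Longrightarrow> p = 0"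
    and nc: "northcott A nm"
  shows "\<exists>A' nm'. normed_subring A' nm' \<and> northcott A' nm' \<and> A \<subseteq> A' \<and> \<theta> \<in> A'"
proof -
  define A' where "A' = (\<lambda>p. poly p \<theta>) ` polys_over A"
  \<comment> \<open>Representatives of degree below \<open>m\<close> exist by reduction with the
    monic \<open>R\<close>, one Horner step at a time, and are unique by
    \<open>indep\<close>.\<close>
  define isrep where "isrep = (\<lambda>p a. p \<in> polys_over A \<and> degree p < m \<and> poly p \<theta> = a)"
  have red: "\<exists>r. isrep r (poly p \<theta>)" if "p \<in> polys_over A" for p
    using that
  proof (induction p)
    case 0 then show ?case using R(4) by (intro exI[of _ 0]) (auto simp: isrep_def)
  next
    case (pCons a p)
    then obtain r where r: "isrep r (poly p \<theta>)" "a \<in> A" by (auto simp: polys_over_closed)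
    define c where "c = coeff (pCons a r) m"
    define s where "s = pCons a r + - smult c R"
    have pr: "pCons a r \<in> polys_over A" using r by (simp add: polys_over_closed isrep_def)
    have cA: "c \<in> A" unfolding c_def using pr by (rule polys_over_coeff)
    have sA: "s \<in> polys_over A" unfolding s_def using pr cA R(1) by (intro polys_over_closed smult_polys_over)
    have "degree (pCons a r) \<le> m" using r by (auto simp: isrep_def)
    then have "degree s \<le> m" unfolding s_def using R(3) degree_smult_le[of c R] by (intro degree_add_le) auto
    moreover have "coeff s m = 0" using R(2,3) by (simp add: s_def c_def)
    ultimately have "degree s < m" using R(4) by (metis degree_0 le_neq_implies_less leading_coeff_0_iff)
    moreover have "poly s \<theta> = poly (pCons a p) \<theta>" using r R(5) by (simp add: s_def isrep_def)
    ultimately show ?case using sA by (auto simp: isrep_def)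
  qed
  have repu: "p = q" if "isrep p a" "isrep q a" for p q a
  proof -
    have "p + - q \<in> polys_over A" using that by (intro polys_over_closed) (auto simp: isrep_def)
    moreover have "degree (p + - q) < m" using that by (intro degree_add_less) (auto simp: isrep_def)
    moreover have "poly (p + - q) \<theta> = 0" using that by (simp add: isrep_def)
    ultimately have "p + - q = 0" by (rule indep)
    then show ?thesis by simp
  qed
  define rep where "rep = (\<lambda>a. THE p. isrep p a)"
  have repI: "rep a = p" if "isrep p a" for p a
    unfolding rep_def by (rule the_equality) (use that repu in auto)
  have rep: "isrep (rep a) a" if "a \<in> A'" for a
    using that red repI by (auto simp: A'_def)
  have inA': "poly p \<theta> \<in> A'" if "p \<in> polys_over A" for p using that by (simp add: A'_def)
  have A'c: "a + b \<in> A'" "a * b \<in> A'" "- a \<in> A'" if ab: "a \<in> A'" "b \<in> A'" for a b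
  proof -
    obtain p q where pq: "p \<in> polys_over A" "a = poly p \<theta>" "q \<in> polys_over A" "b = poly q \<theta>" using ab by (auto simp: A'_def)
    have e: "a + b = poly (p + q) \<theta>" "a * b = poly (p * q) \<theta>" "- a = poly (- p) \<theta>" using pq by auto
    show "a + b \<in> A'" "a * b \<in> A'" "- a \<in> A'" unfolding e using pq by (intro inA' polys_over_closed; simp)+
  qed
  have sub: "A \<subseteq> A'"
  proof
    fix a assume "a \<in> A"
    then have "[:a:] \<in> polys_over A" by (simp add: polys_over_closed)
    from inA'[OF this] show "a \<in> A'" by simp
  qed
  have thA: "\<theta> \<in> A'" using inA'[of "[:0, 1:]"] by (simp add: polys_over_closed zero_closed one_closed)
  have powA: "\<theta> ^ i \<in> A'" for i
    by (induction i) (use A'c(2)[OF thA] sub one_closed in auto)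
  have A'0: "0 \<in> A'" "1 \<in> A'" using sub zero_closed one_closed by auto
  have rep_add: "rep (a + b) = rep a + rep b" if "a \<in> A'" "b \<in> A'" for a b
    using rep[OF that(1)] rep[OF that(2)]
    by (intro repI) (auto simp: isrep_def intro: polys_over_closed degree_add_less)
  have rep_smult: "rep (c * a) = smult c (rep a)" if "c \<in> A" "a \<in> A'" for a c
    using rep[OF that(2)] that(1) degree_smult_le[of c "rep a"]
    by (intro repI) (auto simp: isrep_def intro: smult_polys_over)
  have rep_0: "rep 0 = 0" by (rule repI) (use R(4) in \<open>auto simp: isrep_def polys_over_closed\<close>)
  have rep_sum: "rep (\<Sum>i\<in>S. c i * a i) = (\<Sum>i\<in>S. smult (c i) (rep (a i))) \<and> (\<Sum>i\<in>S. c i * a i) \<in> A'"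
    if "\<And>i. i \<in> S \<Longrightarrow> c i \<in> A" "\<And>i. i \<in> S \<Longrightarrow> a i \<in> A'" for S :: "nat set" and c a
    using that
  proof (induction S rule: infinite_finite_induct)
    case (insert x F)
    have "c x * a x \<in> A'" using insert.prems sub by (intro A'c(2)) auto
    then show ?case using insert by (auto simp: rep_add rep_smult A'c(1))
  qed (auto simp: rep_0 A'0)
  define N1 where "N1 = (\<lambda>a. pnorm 1 (rep a))"
  have N1_nonneg: "0 \<le> N1 a" if "a \<in> A'" for a using rep[OF that] by (simp add: N1_def isrep_def pnorm_nonneg)
  have N1_add: "N1 (a + b) \<le> N1 a + N1 b" if "a \<in> A'" "b \<in> A'" for a b
    using rep that by (simp add: N1_def rep_add isrep_def pnorm_add)
  have N1_smult: "N1 (c * a) \<le> nm c * N1 a" if "c \<in> A" "a \<in> A'" for a c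
    using rep[OF that(2)] that by (simp add: N1_def rep_smult isrep_def pnorm_smult)
  have N1_sum: "N1 (\<Sum>i\<in>S. c i * a i) \<le> (\<Sum>i\<in>S. nm (c i) * N1 (a i))"
    if "\<And>i. i \<in> S \<Longrightarrow> c i \<in> A" "\<And>i. i \<in> S \<Longrightarrow> a i \<in> A'" for S :: "nat set" and c a
    using that
  proof (induction S rule: infinite_finite_induct)
    case (insert x F)
    have "c x * a x \<in> A'" using insert.prems sub by (intro A'c(2)) auto
    moreover have "(\<Sum>i\<in>F. c i * a i) \<in> A'" using rep_sum[of F c a] insert.prems by auto
    ultimately have "N1 (\<Sum>i\<in>insert x F. c i * a i) \<le> N1 (c x * a x) + N1 (\<Sum>i\<in>F. c i * a i)"
      using insert by (simp add: N1_add)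
    also have "\<dots> \<le> nm (c x) * N1 (a x) + (\<Sum>i\<in>F. nm (c i) * N1 (a i))"
      using insert by (intro add_mono N1_smult) auto
    finally show ?case using insert by simp
  qed (auto simp: N1_def rep_0 pnorm_zero)
  \<comment> \<open>The product of two representatives has degree below \<open>2 * m\<close>, so the
    norms of these powers of \<open>\<theta>\<close> bound the failure of \<open>N1\<close> to be
    submultiplicative.\<close>
  define \<kappa> where "\<kappa> = 1 + (\<Sum>i\<le>2 * m. N1 (\<theta> ^ i))"
  have \<kappa>1: "\<kappa> \<ge> 1" unfolding \<kappa>_def using N1_nonneg[OF powA] by (simp add: sum_nonneg)
  have \<kappa>: "N1 (\<theta> ^ i) \<le> \<kappa>" if "i \<le> 2 * m" for i
  proof -
    have "N1 (\<theta> ^ i) \<le> (\<Sum>i\<le>2 * m. N1 (\<theta> ^ i))" using that N1_nonneg[OF powA] by (intro member_le_sum) auto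
    then show ?thesis by (simp add: \<kappa>_def)
  qed
  have N1_poly: "N1 (poly p \<theta>) \<le> \<kappa> * pnorm 1 p" if p: "p \<in> polys_over A" "degree p \<le> 2 * m" for p
  proof -
    have "N1 (poly p \<theta>) \<le> (\<Sum>i\<le>degree p. nm (coeff p i) * N1 (\<theta> ^ i))"
      unfolding poly_altdef using p powA by (intro N1_sum) (auto intro: polys_over_coeff)
    also have "\<dots> \<le> (\<Sum>i\<le>degree p. nm (coeff p i) * \<kappa>)"
      using p by (intro sum_mono mult_left_mono \<kappa> nm_nonneg polys_over_coeff) auto
    finally show ?thesis by (simp add: pnorm_def sum_distrib_left mult.commute)
  qed
  have N1_mult: "N1 (a * b) \<le> \<kappa> * (N1 a * N1 b)" if "a \<in> A'" "b \<in> A'" for a b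
  proof -
    have r: "isrep (rep a) a" "isrep (rep b) b" using rep that by auto
    have "N1 (a * b) = N1 (poly (rep a * rep b) \<theta>)" using r by (simp add: isrep_def)
    also have "\<dots> \<le> \<kappa> * pnorm 1 (rep a * rep b)"
      using r degree_mult_le[of "rep a" "rep b"] by (intro N1_poly polys_over_closed) (auto simp: isrep_def)
    also have "\<dots> \<le> \<kappa> * (N1 a * N1 b)"
      unfolding N1_def using r \<kappa>1 by (intro mult_left_mono pnorm_mult) (auto simp: isrep_def)
    finally show ?thesis .
  qed
  have N1_ge_1: "1 \<le> N1 a" if "a \<in> A'" "a \<noteq> 0" for a
  proof -
    have r: "isrep (rep a) a" using rep that by auto
    then have "rep a \<noteq> 0" using that by (auto simp: isrep_def)
    then have "1 \<le> nm (lead_coeff (rep a))" using r by (intro nm_ge_1 polys_over_coeff) (auto simp: isrep_def)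
    also have "\<dots> \<le> pnorm 1 (rep a)" using pnorm_coeff_le[of "rep a" 1 "degree (rep a)"] r by (simp add: isrep_def)
    finally show ?thesis by (simp add: N1_def)
  qed
  define nm' where "nm' = (\<lambda>a. \<kappa> * N1 a)"
  have ns: "normed_subring A' nm'"
  proof
    show "0 \<in> A'" "1 \<in> A'" by (fact A'0)+
    show "nm' 0 = 0" by (simp add: nm'_def N1_def rep_0 pnorm_zero)
    fix a b assume ab: "a \<in> A'" "b \<in> A'"
    show "a + b \<in> A'" "a * b \<in> A'" "- a \<in> A'" using ab by (auto intro: A'c)
    show "nm' (a + b) \<le> nm' a + nm' b"
      using mult_left_mono[OF N1_add[OF ab], of \<kappa>] \<kappa>1 by (simp add: nm'_def distrib_left)
    show "nm' (a * b) \<le> nm' a * nm' b"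
      using mult_left_mono[OF N1_mult[OF ab], of \<kappa>] \<kappa>1 by (simp add: nm'_def mult_ac)
    have "rep (- a) = - rep a" using rep_smult[of "-1" a] ab uminus_closed[OF one_closed] by simp
    then show "nm' (- a) = nm' a" using rep[OF ab(1)] by (simp add: nm'_def N1_def pnorm_uminus isrep_def)
    assume "a \<noteq> 0"
    then have "1 * 1 \<le> \<kappa> * N1 a" using \<kappa>1 N1_ge_1[OF ab(1)] by (intro mult_mono) auto
    then show "1 \<le> nm' a" by (simp add: nm'_def)
  qed
  interpret A': normed_subring A' nm' by (rule ns)
  define M where "M = (\<lambda>a. mat m m (\<lambda>(i, j). coeff (rep (a * \<theta> ^ i)) j))"
  have Mc: "M a \<in> carrier_mat m m" for a by (simp add: M_def)
  have Me: "M a $$ (i, j) \<in> A" "nm (M a $$ (i, j)) \<le> \<kappa> * nm' a" if "a \<in> A'" "i < m" "j < m" for a i j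
  proof -
    have p: "a * \<theta> ^ i \<in> A'" using that by (intro A'c powA)
    have r: "isrep (rep (a * \<theta> ^ i)) (a * \<theta> ^ i)" by (rule rep[OF p])
    then show "M a $$ (i, j) \<in> A" using that by (simp add: M_def isrep_def polys_over_coeff)
    have "nm (M a $$ (i, j)) \<le> N1 (a * \<theta> ^ i)"
      using that r pnorm_coeff_le[of "rep (a * \<theta> ^ i)" 1 j] by (simp add: M_def N1_def isrep_def)
    also have "\<dots> \<le> \<kappa> * (N1 a * N1 (\<theta> ^ i))" using that by (intro N1_mult powA)
    also have "\<dots> \<le> \<kappa> * (N1 a * \<kappa>)" using that \<kappa>1 by (intro mult_left_mono \<kappa> N1_nonneg) auto
    finally show "nm (M a $$ (i, j)) \<le> \<kappa> * nm' a" by (simp add: nm'_def mult_ac)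
  qed
  have Msum: "a * \<theta> ^ i = (\<Sum>j<m. M a $$ (i, j) * \<theta> ^ j)" if "a \<in> A'" "i < m" for a i
  proof -
    have p: "a * \<theta> ^ i \<in> A'" using that by (intro A'c powA)
    have r: "isrep (rep (a * \<theta> ^ i)) (a * \<theta> ^ i)" by (rule rep[OF p])
    define q where "q = rep (a * \<theta> ^ i)"
    have q: "degree q < m" "poly q \<theta> = a * \<theta> ^ i" using r by (auto simp: isrep_def q_def)
    have "a * \<theta> ^ i = (\<Sum>j\<le>degree q. coeff q j * \<theta> ^ j)" unfolding q(2)[symmetric] poly_altdef ..
    also have "\<dots> = (\<Sum>j<m. coeff q j * \<theta> ^ j)" using q(1) by (intro sum.mono_neutral_left) (auto simp: coeff_eq_0)
    finally show ?thesis using that by (simp add: M_def q_def)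
  qed
  have Mmult: "M (a * b) = M a * M b" if "a \<in> A'" "b \<in> A'" for a b
  proof (rule eq_matI)
    fix i l assume "i < dim_row (M a * M b)" "l < dim_col (M a * M b)"
    then have il: "i < m" "l < m" by (auto simp: M_def)
    have "a * b * \<theta> ^ i = b * (a * \<theta> ^ i)" by (simp add: mult_ac)
    also have "\<dots> = (\<Sum>j<m. M a $$ (i, j) * (b * \<theta> ^ j))"
      unfolding Msum[OF that(1) il(1)] by (simp add: sum_distrib_left mult_ac)
    finally have "rep (a * b * \<theta> ^ i) = (\<Sum>j<m. smult (M a $$ (i, j)) (rep (b * \<theta> ^ j)))"
      using rep_sum[of "{..<m}" "\<lambda>j. M a $$ (i, j)" "\<lambda>j. b * \<theta> ^ j"] Me(1)[OF that(1) il(1)] A'c(2)[OF that(2) powA] by simp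
    then have "M (a * b) $$ (i, l) = (\<Sum>j<m. M a $$ (i, j) * M b $$ (j, l))"
      using il by (simp add: M_def coeff_sum)
    also have "\<dots> = (M a * M b) $$ (i, l)"
      using il by (simp add: M_def scalar_prod_def atLeast0LessThan)
    finally show "M (a * b) $$ (i, l) = (M a * M b) $$ (i, l)" .
  qed (auto simp: M_def)
  have Mlin: "M (a + c * b) = M a + c \<cdot>\<^sub>m M b" if "a \<in> A'" "b \<in> A'" "c \<in> A" for a b c
  proof (rule eq_matI)
    fix i j assume "i < dim_row (M a + c \<cdot>\<^sub>m M b)" "j < dim_col (M a + c \<cdot>\<^sub>m M b)"
    then have ij: "i < m" "j < m" by (auto simp: M_def)
    have "(a + c * b) * \<theta> ^ i = a * \<theta> ^ i + c * (b * \<theta> ^ i)" by (simp add: algebra_simps)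
    moreover have "rep (a * \<theta> ^ i + c * (b * \<theta> ^ i)) = rep (a * \<theta> ^ i) + smult c (rep (b * \<theta> ^ i))"
      using that sub powA A'c(2) by (simp add: rep_add rep_smult subset_iff)
    ultimately show "M (a + c * b) $$ (i, j) = (M a + c \<cdot>\<^sub>m M b) $$ (i, j)"
      using ij by (simp add: M_def)
  qed (auto simp: M_def)
  have Mconst: "M c = c \<cdot>\<^sub>m 1\<^sub>m m" if "c \<in> A" for c
  proof (rule eq_matI)
    fix i j assume "i < dim_row (c \<cdot>\<^sub>m 1\<^sub>m m)" "j < dim_col (c \<cdot>\<^sub>m (1\<^sub>m m :: 'a mat))"
    then have ij: "i < m" "j < m" by auto
    have "isrep (monom c i) (c * \<theta> ^ i)"
      using that ij degree_monom_le[of c i] zero_closed by (auto simp: isrep_def polys_over_def poly_monom intro: le_less_trans)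
    then have "rep (c * \<theta> ^ i) = monom c i" by (rule repI)
    then show "M c $$ (i, j) = (c \<cdot>\<^sub>m 1\<^sub>m m) $$ (i, j)" using ij by (simp add: M_def)
  qed (auto simp: M_def)
  define \<N> where "\<N> = (\<lambda>a. det (M a))"
  have N_mult: "\<N> (a * b) = \<N> a * \<N> b" if "a \<in> A'" "b \<in> A'" for a b
    using det_mult[OF Mc Mc] Mmult[OF that] by (simp add: \<N>_def)
  have N_const: "\<N> c = c ^ m" if "c \<in> A" for c by (simp add: \<N>_def Mconst[OF that])
  have N_A: "\<N> a \<in> A" if "a \<in> A'" for a
    unfolding \<N>_def
    by (rule det_closed[OF zero_closed one_closed add_closed mult_closed uminus_closed Mc Me(1)[OF that]])
  \<comment> \<open>The powers of \<open>\<theta>\<close> form an eigenvector, so \<open>a\<close>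
    is a root of the characteristic polynomial of \<open>M a\<close>.\<close>
  have ev: "M a *\<^sub>v vec m (\<lambda>i. \<theta> ^ i) = a \<cdot>\<^sub>v vec m (\<lambda>i. \<theta> ^ i)" if "a \<in> A'" for a
    using Msum[OF that] Mc[of a] by (intro eq_vecI) (auto simp: scalar_prod_def atLeast0LessThan M_def)
  have vn: "vec m (\<lambda>i. \<theta> ^ i) \<noteq> 0\<^sub>v m"
  proof
    assume "vec m (\<lambda>i. \<theta> ^ i) = 0\<^sub>v m"
    then have "vec m (\<lambda>i. \<theta> ^ i) $ 0 = 0" using R(4) by simp
    then show False using R(4) by simp
  qed
  \<comment> \<open>The monic characteristic polynomial vanishes at \<open>a\<close>. Divided by a
    power of the variable it gives \<open>c + a * poly s a = 0\<close> with
    \<open>c \<noteq> 0\<close> in \<open>A\<close>, and multiplicativity turns this into a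
    factorisation of \<open>(- c) ^ m\<close>.\<close>
  have N_nz: "\<N> a \<noteq> 0" if a: "a \<in> A'" "a \<noteq> 0" for a
  proof -
    have "eigenvector (M a) (vec m (\<lambda>i. \<theta> ^ i)) a"
      unfolding eigenvector_def using ev[OF a(1)] vn by (auto simp: M_def)
    then have root: "poly (char_poly (M a)) a = 0"
      using eigenvalue_root_char_poly[OF Mc] by (auto simp: eigenvalue_def)
    have nz: "char_poly (M a) \<noteq> 0" using degree_monic_char_poly[OF Mc, of a] by auto
    have over: "char_poly (M a) \<in> polys_over A"
      unfolding char_poly_def
    proof (rule det_closed[OF polys_over_closed(4,5,1,2,3) char_poly_matrix_closed[OF Mc]])
      fix i j assume ij: "i < m" "j < m"
      have "[:- (M a $$ (i, j)):] \<in> polys_over A" using Me(1)[OF a(1) ij] by (simp add: polys_over_closed uminus_closed)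
      moreover have "(if i = j then [:0, 1:] else 0) \<in> polys_over A"
        by (simp add: polys_over_closed zero_closed one_closed)
      moreover have "char_poly_matrix (M a) $$ (i, j) = (if i = j then [:0, 1:] else 0) + [:- (M a $$ (i, j)):]"
        using ij by (auto simp: char_poly_matrix_def M_def)
      ultimately show "char_poly_matrix (M a) $$ (i, j) \<in> polys_over A" by (simp only: polys_over_closed(1))
    qed
    have "r \<noteq> 0 \<longrightarrow> r \<in> polys_over A \<longrightarrow> poly r a = 0 \<longrightarrow> (\<exists>c s. c \<in> A \<and> c \<noteq> 0 \<and> s \<in> polys_over A \<and> c + a * poly s a = 0)" for r
    proof (induction r)
      case (pCons c r)
      show ?case
      proof (cases "c = 0")
        case True
        then show ?thesis using pCons a by (auto simp: polys_over_closed)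
      next
        case False
        then show ?thesis by (auto simp: polys_over_closed)
      qed
    qed simp
    then obtain c s where cs: "c \<in> A" "c \<noteq> 0" "s \<in> polys_over A" "c + a * poly s a = 0"
      using nz over root by blast
    have sA: "poly s a \<in> A'" unfolding poly_altdef
      using cs(3) a sub by (intro A'.sum_closed A'.mult_closed A'.power_closed) (auto intro: polys_over_coeff)
    have "a * poly s a = - c" using cs(4) by (simp add: eq_neg_iff_add_eq_0 add.commute)
    then have "\<N> a * \<N> (poly s a) = (- c) ^ m" using N_mult[OF a(1) sA] N_const[OF uminus_closed[OF cs(1)]] by simp
    then show ?thesis using cs(2) by auto
  qed
  define C where "C = fact m * nm 1 * \<kappa> ^ m"
  have C1: "1 \<le> C"
  proof -
    have "1 * 1 * 1 \<le> fact m * nm 1 * \<kappa> ^ m"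
      using \<kappa>1 nm_ge_1[OF one_closed] by (intro mult_mono one_le_power) auto
    then show ?thesis by (simp add: C_def)
  qed
  have N_nm: "nm (\<N> a) \<le> C * nm' a ^ m" if "a \<in> A'" for a
    using nm_det[OF Mc Me(1)[OF that] Me(2)[OF that]] by (simp add: \<N>_def C_def power_mult_distrib mult_ac)
  have "northcott A' nm'"
  proof (cases "finite A")
    case True
    have "A' \<subseteq> (\<lambda>p. poly p \<theta>) ` {p \<in> polys_over A. degree p < m}"
    proof
      fix a assume "a \<in> A'"
      from rep[OF this] show "a \<in> (\<lambda>p. poly p \<theta>) ` {p \<in> polys_over A. degree p < m}"
        by (intro image_eqI[of _ _ "rep a"]) (auto simp: isrep_def)
    qed
    then have "finite A'" using finite_bounded_polys[OF True, of m] finite_subset by blast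
    then show ?thesis by (rule northcott_finite)
  next
    case False
    \<comment> \<open>More than \<open>m\<close> values determine a polynomial of degree at most
      \<open>m\<close>, and some point of \<open>T\<close> differs from \<open>- z\<close>, which
      shows that the polynomial is not zero.\<close>
    obtain T where T: "finite T" "card T = m + 2" "T \<subseteq> A" using infinite_arbitrarily_large[OF False] by blast
    show ?thesis unfolding northcott_def
    proof (intro allI impI)
      fix B :: real assume B: "B \<ge> 1"
      \<comment> \<open>Translation by \<open>\<tau>\<close> followed by the norm turns
        \<open>B\<close> into this bound; the constant is absorbed through
        \<open>C \<le> C ^ n\<close>.\<close>
      define b where "b = (\<lambda>\<tau>. C * ((1 + nm' \<tau>) * B) ^ m)"
      define Y where "Y = (\<lambda>\<tau>. {z. \<exists>n \<mu>. n > 0 \<and> \<mu> \<noteq> 0 \<and> (\<forall>k\<le>n. \<mu> * z ^ k \<in> A \<and> nm (\<mu> * z ^ k) \<le> b \<tau> ^ n)})"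
      have fY: "finite (Y \<tau>)" if "\<tau> \<in> T" for \<tau>
      proof -
        have "0 \<le> nm' \<tau>" using that T sub by (intro A'.nm_nonneg) auto
        then have "1 * 1 \<le> (1 + nm' \<tau>) * B" using B by (intro mult_mono) auto
        then have "1 * 1 \<le> b \<tau>" unfolding b_def using C1 by (intro mult_mono one_le_power) auto
        then show ?thesis using nc unfolding northcott_def Y_def by auto
      qed
      define \<Phi> where "\<Phi> = T \<rightarrow>\<^sub>E (\<Union>\<tau>\<in>T. Y \<tau>)"
      have f\<Phi>: "finite \<Phi>" unfolding \<Phi>_def using T fY by (intro finite_PiE) auto
      define Q where "Q = (\<lambda>\<phi> q. q \<noteq> 0 \<and> degree q \<le> m \<and> (\<forall>\<tau>\<in>T. poly q \<tau> = \<phi> \<tau>))"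
      have Quniq: "q = q'" if "Q \<phi> q" "Q \<phi> q'" for \<phi> q q'
      proof (rule ccontr)
        assume "q \<noteq> q'"
        then have n: "q - q' \<noteq> 0" by simp
        have "T \<subseteq> {x. poly (q - q') x = 0}" using that by (auto simp: Q_def)
        then have "card T \<le> card {x. poly (q - q') x = 0}" using n by (intro card_mono poly_roots_finite)
        also have "\<dots> \<le> degree (q - q')" using n by (rule card_poly_roots_bound)
        also have "\<dots> \<le> m" using that by (intro degree_diff_le) (auto simp: Q_def)
        finally show False using T by simp
      qed
      have "{z. \<exists>n \<mu>. n > 0 \<and> \<mu> \<noteq> 0 \<and> (\<forall>k\<le>n. \<mu> * z ^ k \<in> A' \<and> nm' (\<mu> * z ^ k) \<le> B ^ n)} \<subseteq>
         (\<Union>\<phi>\<in>\<Phi>. {z. \<exists>q. Q \<phi> q \<and> poly q (- z) = 0})"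
      proof clarify
        fix z n \<mu> assume h: "n > (0::nat)" "\<mu> \<noteq> 0" "\<forall>k\<le>n. \<mu> * z ^ k \<in> A' \<and> nm' (\<mu> * z ^ k) \<le> B ^ n"
        have mu: "\<mu> \<in> A'" "\<mu> * z \<in> A'" using h(3)[rule_format, of 0] h(3)[rule_format, of 1] h(1) by auto
        obtain D where D: "degree D \<le> m" "\<And>c. poly D c = det (M (\<mu> * z) + c \<cdot>\<^sub>m M \<mu>)"
          using linear_det_poly[OF Mc Mc] by blast
        define q where "q = smult (inverse (\<N> \<mu>)) D"
        have N\<mu>: "\<N> \<mu> \<noteq> 0" using N_nz mu(1) h(2) by blast
        have S1: "\<mu> * (z + \<tau>) \<in> A'" if "\<tau> \<in> A" for \<tau>
          using that sub mu A'c by (auto simp: distrib_left)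
        have q\<tau>: "poly q \<tau> = \<N> (\<mu> * (z + \<tau>)) / \<N> \<mu>" if "\<tau> \<in> A" for \<tau>
        proof -
          have "\<mu> * (z + \<tau>) = \<mu> * z + \<tau> * \<mu>" by (simp add: algebra_simps)
          then have "M (\<mu> * (z + \<tau>)) = M (\<mu> * z) + \<tau> \<cdot>\<^sub>m M \<mu>" using Mlin[OF mu(2,1) that] by simp
          then show ?thesis by (simp add: q_def D(2) \<N>_def field_simps)
        qed
        have "poly q \<tau> \<in> Y \<tau>" if tau: "\<tau> \<in> T" for \<tau>
        proof -
          have tA: "\<tau> \<in> A" using tau T by auto
          define S where "S = (\<lambda>k. \<mu> * (z + \<tau>) ^ k)"
          have S: "S k \<in> A'" "nm' (S k) \<le> ((1 + nm' \<tau>) * B) ^ n" if "k \<le> n" for k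
            using A'.nm_binomial[of \<tau> n \<mu> z B k] tA sub h(3) that B by (auto simp: S_def)
          \<comment> \<open>Multiplicativity applied to
            \<open>S k * \<mu> ^ k = \<mu> * (\<mu> * (z + \<tau>)) ^ k\<close>. So
            \<open>\<N> \<mu>\<close> is a common denominator for the powers of the value at
            \<open>\<tau>\<close>.\<close>
          have "\<N> \<mu> * poly q \<tau> ^ k = \<N> (S k)" if k: "k \<le> n" for k
          proof -
            have p: "\<N> (a ^ j) = \<N> a ^ j \<and> a ^ j \<in> A'" if "a \<in> A'" for a j
            proof (induction j)
              case 0 show ?case using N_const[OF one_closed] A'0 by simp
            next
              case (Suc j) then show ?case using that by (simp add: N_mult A'c)
            qed
            have "S k * \<mu> ^ k = \<mu> * (\<mu> * (z + \<tau>)) ^ k" by (simp add: S_def power_mult_distrib mult_ac)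
            then have "\<N> (S k) * \<N> \<mu> ^ k = \<N> \<mu> * \<N> (\<mu> * (z + \<tau>)) ^ k"
              using N_mult[OF S(1)[OF k] p[OF mu(1), THEN conjunct2], of k] N_mult[OF mu(1) p[OF S1[OF tA], THEN conjunct2], of k] p mu S1[OF tA] by simp
            then have "\<N> \<mu> * poly q \<tau> ^ k = \<N> (S k) * \<N> \<mu> ^ k / \<N> \<mu> ^ k"
              unfolding q\<tau>[OF tA] power_divide by simp
            then show ?thesis using N\<mu> by simp
          qed
          moreover have "nm (\<N> (S k)) \<le> b \<tau> ^ n" if k: "k \<le> n" for k
          proof -
            have "nm (\<N> (S k)) \<le> C * nm' (S k) ^ m" using S(1)[OF k] by (rule N_nm)
            also have "\<dots> \<le> C * (((1 + nm' \<tau>) * B) ^ n) ^ m"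
              using S[OF k] C1 by (intro mult_left_mono power_mono) (auto intro: A'.nm_nonneg)
            also have "\<dots> \<le> C ^ n * (((1 + nm' \<tau>) * B) ^ n) ^ m"
              using C1 h(1) B A'.nm_nonneg[of \<tau>] tA sub by (intro mult_right_mono self_le_power) auto
            also have "\<dots> = b \<tau> ^ n" by (simp add: b_def power_mult_distrib mult.commute flip: power_mult)
            finally show ?thesis .
          qed
          ultimately show ?thesis unfolding Y_def using h(1) N\<mu> S(1) N_A
            by (intro CollectI exI[of _ n] exI[of _ "\<N> \<mu>"]) auto
        qed
        then have phi: "(\<lambda>\<tau>\<in>T. poly q \<tau>) \<in> \<Phi>" by (auto simp: \<Phi>_def)
        have "q \<noteq> 0"
        proof -
          have "\<not> T \<subseteq> {- z}" using T(2) card_mono[of "{- z}" T] by auto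
          then obtain \<tau> where tau: "\<tau> \<in> T" "\<tau> \<noteq> - z" by blast
          then have "\<mu> * (z + \<tau>) \<noteq> 0" using h(2) by (auto simp: add_eq_0_iff)
          then have "poly q \<tau> \<noteq> 0" using N_nz[OF S1] q\<tau> N\<mu> tau T by auto
          then show ?thesis by auto
        qed
        moreover have "degree q \<le> m" using D(1) degree_smult_le[of _ D] by (auto simp: q_def)
        \<comment> \<open>Here \<open>- z\<close> need not lie in \<open>A\<close>, so
          \<open>Mlin\<close> does not apply; instead the vector of powers of
          \<open>\<theta>\<close> lies in the kernel.\<close>
        moreover have "poly q (- z) = 0"
        proof -
          define v where "v = vec m (\<lambda>i. \<theta> ^ i)"
          have vc: "v \<in> carrier_vec m" by (simp add: v_def)
          have "(M (\<mu> * z) + (- z) \<cdot>\<^sub>m M \<mu>) *\<^sub>v v = M (\<mu> * z) *\<^sub>v v + ((- z) \<cdot>\<^sub>m M \<mu>) *\<^sub>v v"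
            by (rule add_mult_distrib_mat_vec[OF Mc _ vc]) (simp add: Mc)
          also have "((- z) \<cdot>\<^sub>m M \<mu>) *\<^sub>v v = (- z) \<cdot>\<^sub>v (M \<mu> *\<^sub>v v)"
            using Mc[of \<mu>] vc by (intro eq_vecI) (auto simp: M_def scalar_prod_def sum_distrib_left mult_ac sum_negf)
          also have "M (\<mu> * z) *\<^sub>v v + (- z) \<cdot>\<^sub>v (M \<mu> *\<^sub>v v) = 0\<^sub>v m"
            unfolding v_def ev[OF mu(1)] ev[OF mu(2)] by (intro eq_vecI) auto
          finally have "det (M (\<mu> * z) + (- z) \<cdot>\<^sub>m M \<mu>) = 0"
            using det_0_iff_vec_prod_zero[of "M (\<mu> * z) + (- z) \<cdot>\<^sub>m M \<mu>" m] vn vc Mc by (auto simp: v_def[symmetric])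
          then show ?thesis by (simp add: q_def D(2))
        qed
        ultimately show "z \<in> (\<Union>\<phi>\<in>\<Phi>. {z. \<exists>q. Q \<phi> q \<and> poly q (- z) = 0})"
          using phi by (intro UN_I[OF phi]) (auto simp: Q_def)
      qed
      moreover have "finite {z. \<exists>q. Q \<phi> q \<and> poly q (- z) = 0}" for \<phi>
      proof (cases "\<exists>q. Q \<phi> q")
        case True
        then obtain q where q: "Q \<phi> q" by blast
        have "{z. \<exists>q. Q \<phi> q \<and> poly q (- z) = 0} \<subseteq> uminus ` {x. poly q x = 0}"
        proof clarify
          fix z q' assume "Q \<phi> q'" "poly q' (- z) = 0"
          then have "poly q (- z) = 0" using Quniq q by blast
          then show "z \<in> uminus ` {x. poly q x = 0}" by (intro image_eqI[of _ _ "- z"]) auto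
        qed
        moreover have "finite {x. poly q x = 0}" using q by (intro poly_roots_finite) (auto simp: Q_def)
        ultimately show ?thesis using finite_subset by blast
      qed auto
      ultimately show "finite {z. \<exists>n \<mu>. n > 0 \<and> \<mu> \<noteq> 0 \<and> (\<forall>k\<le>n. \<mu> * z ^ k \<in> A' \<and> nm' (\<mu> * z ^ k) \<le> B ^ n)}"
        using f\<Phi> by (meson finite_UN_I finite_subset)
    qed
  qed
  then show ?thesis using ns sub thA by blast
qed

end

section \<open>Finitely generated fields\<close>

lemma fracs_mono: "A \<subseteq> A' \<Longrightarrow> fracs A \<subseteq> fracs A'"
  by (auto simp: fracs_def)

text \<open>If \<open>s\<close> is algebraic and \<open>a\<close> is the leading coefficient of a
  polynomial of least degree with root \<open>s\<close>, then \<open>a * s\<close> is integral and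
  \<open>s\<close> is a quotient in the ring it generates. Least degree makes the lower powers of
  \<open>a * s\<close> independent.\<close>

lemma exists_northcott_ring:
  fixes S :: "'a::field set"
  assumes "finite S"
  shows "\<exists>A nm. normed_subring A nm \<and> northcott A nm \<and> S \<subseteq> fracs A"
  using assms
proof (induction S)
  case empty
  then show ?case using exists_northcott_prime_ring by blast
next
  case (insert s S)
  then obtain A nm where A: "normed_subring A nm" "northcott A nm" "S \<subseteq> fracs A" by blast
  interpret normed_subring A nm by (rule A)
  show ?case
  proof (cases "\<exists>p\<in>polys_over A. poly p s = 0 \<and> p \<noteq> 0")
    case False
    then obtain A' nm' where A': "normed_subring A' nm'" "northcott A' nm'" "A \<subseteq> A'" "s \<in> A'"
      using adjoin_transcendental[of s] A(2) by blast
    then show ?thesis using A(3) fracs_mono[OF A'(3)] normed_subring.subset_fracs[OF A'(1)] by blast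
  next
    case True
    define P where "P = (\<lambda>p. p \<in> polys_over A \<and> poly p s = 0 \<and> p \<noteq> 0)"
    obtain p0 where "P p0" using True by (auto simp: P_def)
    from ex_has_least_nat[of P, OF this, of degree]
    obtain r where r: "P r" "\<And>p. P p \<Longrightarrow> degree r \<le> degree p" by blast
    have r': "r \<in> polys_over A" "poly r s = 0" "r \<noteq> 0" using r(1) by (auto simp: P_def)
    define m where "m = degree r"
    define a where "a = lead_coeff r"
    define \<theta> where "\<theta> = a * s"
    have a: "a \<in> A" "a \<noteq> 0" using r' by (auto simp: a_def polys_over_coeff)
    have m: "m > 0"
    proof (rule ccontr)
      assume "\<not> m > 0"
      then have "degree r = 0" by (simp add: m_def)
      then obtain c where "r = [:c:]" using degree_eq_zeroE[of r] by blast
      then show False using r' by auto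
    qed
    \<comment> \<open>The monic equation of \<open>a * s\<close>: its coefficients for
      \<open>i < m\<close> are \<open>a ^ (m - 1 - i) * coeff r i\<close>.\<close>
    define R where "R = smult (a ^ (m - 1)) (pcompose r [:0, inverse a:])"
    have Rc: "coeff R i = a ^ (m - 1) * (inverse a ^ i * coeff r i)" for i
      by (simp add: R_def coeff_pcompose_linear)
    have Rd: "degree R = m" using a by (simp add: R_def m_def degree_pcompose)
    have am: "a ^ m = a ^ (m - 1) * a" using m by (metis Suc_diff_1 power_Suc2)
    have Rl: "lead_coeff R = 1"
      unfolding Rd Rc using a am by (simp add: m_def[symmetric] a_def[symmetric, folded m_def] power_inverse field_simps)
    have Ri: "coeff R i \<in> A" for i
    proof -
      consider "i < m" | "i = m" | "i > m" by linarith
      then show ?thesis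
      proof cases
        case 1
        then have "m - 1 = (m - 1 - i) + i" by simp
        then have "a ^ (m - 1) = a ^ (m - 1 - i) * a ^ i" by (metis power_add)
        then have "coeff R i = a ^ (m - 1 - i) * coeff r i" using a unfolding Rc by (simp add: power_inverse field_simps)
        then show ?thesis using a r' by (simp add: mult_closed power_closed polys_over_coeff)
      next
        case 2
        then show ?thesis using Rl Rd one_closed by simp
      next
        case 3
        then show ?thesis using Rd by (simp add: coeff_eq_0 zero_closed)
      qed
    qed
    then have RA: "R \<in> polys_over A" by (simp add: polys_over_def)
    have "poly [:0, inverse a:] \<theta> = s" using a by (simp add: \<theta>_def)
    then have R0: "poly R \<theta> = 0" using r' by (simp only: R_def poly_smult poly_pcompose mult_zero_right)
    have ind: "p = 0" if p: "p \<in> polys_over A" "degree p < m" "poly p \<theta> = 0" for p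
    proof (rule ccontr)
      assume "p \<noteq> 0"
      define p' where "p' = pcompose p [:0, a:]"
      have "coeff p' i \<in> A" for i
        unfolding p'_def coeff_pcompose_linear using p(1) a by (intro mult_closed power_closed polys_over_coeff)
      then have "p' \<in> polys_over A" by (simp add: polys_over_def)
      moreover have "poly p' s = 0" using p(3) by (simp add: p'_def poly_pcompose \<theta>_def mult.commute)
      moreover have "p' \<noteq> 0" using \<open>p \<noteq> 0\<close> a by (auto simp: p'_def pcompose_eq_0_iff)
      ultimately have "m \<le> degree p'" using r(2)[of p'] by (simp add: P_def m_def)
      then show False using p(2) a by (simp add: p'_def degree_pcompose)
    qed
    obtain A' nm' where A': "normed_subring A' nm'" "northcott A' nm'" "A \<subseteq> A'" "\<theta> \<in> A'"
      using adjoin_integral[OF RA Rl Rd m R0 ind A(2)] by blast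
    have "s = \<theta> / a" using a by (simp add: \<theta>_def)
    then have "s \<in> fracs A'" unfolding fracs_def using A'(3,4) a by blast
    then show ?thesis using A' A(3) fracs_mono[OF A'(3)] by blast
  qed
qed

lemma (in normed_subring) common_denominator:
  assumes "finite S" "S \<subseteq> fracs A"
  shows "\<exists>\<delta>\<in>A. \<delta> \<noteq> 0 \<and> (\<forall>s\<in>S. \<delta> * s \<in> A)"
  using assms
proof (induction S)
  case empty
  then show ?case using one_closed by (intro bexI[of _ 1]) auto
next
  case (insert s S)
  then obtain \<delta> a b where h: "\<delta> \<in> A" "\<delta> \<noteq> 0" "\<forall>s\<in>S. \<delta> * s \<in> A" "s = a / b" "a \<in> A" "b \<in> A" "b \<noteq> 0"
    by (auto simp: fracs_def)
  have "\<delta> * b * s = \<delta> * a" using h by simp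
  then have 1: "\<delta> * b * s \<in> A" using mult_closed[OF h(1,5)] by (simp only:)
  have "\<delta> * b * t \<in> A" if "t \<in> S" for t
    using mult_closed[OF h(6), of "\<delta> * t"] h(3) that by (simp add: mult_ac)
  with 1 have "\<forall>t\<in>insert s S. \<delta> * b * t \<in> A" by blast
  then show ?case using h mult_closed[OF h(1,6)] by (intro bexI[of _ "\<delta> * b"] conjI) auto
qed

section \<open>Heights\<close>

text \<open>
  \<open>combo A nm G E u\<close>: \<open>u\<close> is an \<open>A\<close>-linear combination of elements of \<open>G\<close> whose coefficients have total norm at most \<open>E\<close>.
\<close>

inductive combo :: "'a::field set \<Rightarrow> ('a \<Rightarrow> real) \<Rightarrow> 'a set \<Rightarrow> real \<Rightarrow> 'a \<Rightarrow> bool" for A nm G where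
  zero: "combo A nm G 0 0"
| add: "combo A nm G E u \<Longrightarrow> c \<in> A \<Longrightarrow> g \<in> G \<Longrightarrow> combo A nm G (E + nm c) (u + c * g)"
| le: "combo A nm G E u \<Longrightarrow> E \<le> E' \<Longrightarrow> combo A nm G E' u"

lemma combo_mult:
  assumes "combo A nm G E u" "\<And>g. g \<in> G \<Longrightarrow> g * h \<in> G'"
  shows "combo A nm G' E (u * h)"
  using assms(1)
proof (induction rule: combo.induct)
  case zero then show ?case by (simp add: combo.zero)
next
  case (add E u c g)
  then show ?case using combo.add[OF add.IH add.hyps(2) assms(2)[OF add.hyps(3)]] by (simp add: algebra_simps)
next
  case (le E u E') then show ?case using combo.le by blast
qed

lemma combo_plus: "combo A nm G E u \<Longrightarrow> combo A nm G E' v \<Longrightarrow> combo A nm G (E + E') (u + v)"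
proof -
  assume u: "combo A nm G E u"
  assume "combo A nm G E' v"
  then show ?thesis
  proof (induction rule: combo.induct)
    case zero
    then show ?case using u by simp
  next
    case (add E' v c g)
    from combo.add[OF add.IH add.hyps(2,3)] show ?case by (simp add: add.assoc)
  next
    case (le E1 v E2)
    then show ?case by (intro combo.le[OF le.IH]) simp
  qed
qed

context normed_subring
begin

lemma combo_nonneg: "combo A nm G E u \<Longrightarrow> E \<ge> 0"
  by (induction rule: combo.induct) (auto intro: nm_nonneg add_nonneg_nonneg)

lemma combo_smult:
  assumes "combo A nm G E u" "a \<in> A" shows "combo A nm G (nm a * E) (a * u)"
  using assms(1)
proof (induction rule: combo.induct)
  case zero then show ?case by (simp add: combo.zero)
next
  case (add E u c g)
  have "combo A nm G (nm a * E + nm (a * c)) (a * u + a * c * g)"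
    using add assms(2) by (intro combo.add mult_closed) auto
  then have "combo A nm G (nm a * (E + nm c)) (a * u + a * c * g)"
    by (rule combo.le) (use nm_mult[OF assms(2) add.hyps(2)] in \<open>simp add: distrib_left\<close>)
  then show ?case by (simp add: algebra_simps)
next
  case (le E u E')
  then show ?case using nm_nonneg[OF assms(2)] by (meson combo.le mult_left_mono)
qed

lemma combo_norm:
  assumes "combo A nm G E u" "\<And>g. g \<in> G \<Longrightarrow> l * g \<in> A \<and> nm (l * g) \<le> Y" "Y \<ge> 0"
  shows "l * u \<in> A \<and> nm (l * u) \<le> E * Y"
  using assms(1)
proof (induction rule: combo.induct)
  case zero then show ?case by (simp add: zero_closed nm_zero)
next
  case (add E u c g)
  have lg: "l * g \<in> A" "nm (l * g) \<le> Y" using assms(2) add by auto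
  have e: "l * (u + c * g) = l * u + c * (l * g)" by (simp add: algebra_simps)
  have "nm (c * (l * g)) \<le> nm c * nm (l * g)" using add lg by (intro nm_mult)
  also have "\<dots> \<le> nm c * Y" using lg add by (intro mult_left_mono nm_nonneg)
  finally have 1: "nm (c * (l * g)) \<le> nm c * Y" .
  have c: "c * (l * g) \<in> A" by (rule mult_closed[OF add.hyps(2) lg(1)])
  have "nm (l * u + c * (l * g)) \<le> nm (l * u) + nm (c * (l * g))" using add c by (intro nm_add) auto
  then show ?case unfolding e using add c 1 by (auto simp: add_closed distrib_right)
next
  case (le E u E')
  then show ?case using mult_right_mono[OF le.hyps(2) assms(3)] by auto
qed

lemma combo_subst:
  assumes "combo A nm G E u" "\<And>g. g \<in> G \<Longrightarrow> combo A nm G' E0 (d * g)" "E0 \<ge> 0"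
  shows "combo A nm G' (E * E0) (d * u)"
  using assms(1)
proof (induction rule: combo.induct)
  case zero then show ?case by (simp add: combo.zero)
next
  case (add E u c g)
  have "combo A nm G' (nm c * E0) (c * (d * g))" by (rule combo_smult[OF assms(2)[OF add.hyps(3)] add.hyps(2)])
  from combo_plus[OF add.IH this] show ?case by (simp add: algebra_simps)
next
  case (le E u E')
  then show ?case using mult_right_mono[OF le.hyps(2) assms(3)] by (meson combo.le)
qed

end

section \<open>Height of a coordinate vector\<close>

definition hbound :: "'a::field set \<Rightarrow> ('a \<Rightarrow> real) \<Rightarrow> nat \<Rightarrow> (nat \<Rightarrow> 'a) \<Rightarrow> nat \<Rightarrow> real \<Rightarrow> bool" where
  "hbound A nm n x N B \<longleftrightarrow>
     N > 0 \<and> (\<exists>l. l \<noteq> 0 \<and> (\<forall>\<alpha>\<in>expo n N. l * monom_at n \<alpha> x \<in> A \<and> nm (l * monom_at n \<alpha> x) \<le> B ^ N))"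

text \<open>For the integers with the absolute value and coprime integral coordinates this is the
  logarithm of the largest absolute value, the usual Weil height. The infimum over all
  \<open>N\<close> removes constant factors in the norm.\<close>

definition height :: "'a::field set \<Rightarrow> ('a \<Rightarrow> real) \<Rightarrow> nat \<Rightarrow> (nat \<Rightarrow> 'a) \<Rightarrow> real" where
  "height A nm n x = Inf {ln B | B. B \<ge> 1 \<and> (\<exists>N. hbound A nm n x N B)}"

lemma monom_at_scale: "\<alpha> \<in> expo n N \<Longrightarrow> monom_at n \<alpha> (\<lambda>i. c * x i) = c ^ N * monom_at n \<alpha> x"
  by (simp add: monom_at_def power_mult_distrib prod.distrib expo_def flip: power_sum)

lemma hbound_scale: "c \<noteq> 0 \<Longrightarrow> hbound A nm n x N B \<Longrightarrow> hbound A nm n (\<lambda>i. c * x i) N B"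
proof -
  assume c: "c \<noteq> 0" and "hbound A nm n x N B"
  then obtain l where l: "N > 0" "l \<noteq> 0" "\<forall>\<alpha>\<in>expo n N. l * monom_at n \<alpha> x \<in> A \<and> nm (l * monom_at n \<alpha> x) \<le> B ^ N"
    by (auto simp: hbound_def)
  have "l / c ^ N * monom_at n \<alpha> (\<lambda>i. c * x i) = l * monom_at n \<alpha> x" if "\<alpha> \<in> expo n N" for \<alpha>
    using c by (simp add: monom_at_scale[OF that])
  then show ?thesis unfolding hbound_def using l c by (intro conjI exI[of _ "l / c ^ N"]) auto
qed

lemma height_scale: "c \<noteq> 0 \<Longrightarrow> height A nm n (\<lambda>i. c * x i) = height A nm n x"
proof -
  assume c: "c \<noteq> 0"
  have "hbound A nm n (\<lambda>i. c * x i) N B \<longleftrightarrow> hbound A nm n x N B" for N B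
    using hbound_scale[OF c, of A nm n x N B] hbound_scale[of "inverse c" A nm n "\<lambda>i. c * x i" N B] c
    by (auto simp flip: mult.assoc)
  then show ?thesis by (simp add: height_def)
qed

lemma height_le: "B \<ge> 1 \<Longrightarrow> hbound A nm n x N B \<Longrightarrow> height A nm n x \<le> ln B"
  unfolding height_def by (rule cInf_lower) (auto intro!: bdd_belowI[of _ 0])

lemma height_approx:
  assumes "hbound A nm n x N0 B0" "B0 \<ge> 1" "e > 0"
  shows "\<exists>B N. B \<ge> 1 \<and> hbound A nm n x N B \<and> ln B < height A nm n x + e"
proof -
  have "{ln B | B. B \<ge> 1 \<and> (\<exists>N. hbound A nm n x N B)} \<noteq> {}" using assms by blast
  from cInf_lessD[OF this, of "height A nm n x + e"] show ?thesis
    using assms(3) unfolding height_def by auto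
qed

definition bimon :: "nat \<Rightarrow> (nat \<Rightarrow> 'a::field) \<Rightarrow> (nat \<Rightarrow> 'a) \<Rightarrow> nat \<Rightarrow> nat \<Rightarrow> 'a set" where
  "bimon n x y m q = {monom_at n \<alpha> x * monom_at n \<kappa> y | \<alpha> \<kappa>. \<alpha> \<in> expo n m \<and> \<kappa> \<in> expo n q}"

lemma bimonI: "\<alpha> \<in> expo n m \<Longrightarrow> \<kappa> \<in> expo n q \<Longrightarrow> monom_at n \<alpha> x * monom_at n \<kappa> y \<in> bimon n x y m q"
  unfolding bimon_def by blast

lemma bimon_mult: "g \<in> bimon n x y m q \<Longrightarrow> h \<in> bimon n x y m' q' \<Longrightarrow> g * h \<in> bimon n x y (m + m') (q + q')"
proof -
  assume "g \<in> bimon n x y m q" "h \<in> bimon n x y m' q'"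
  then obtain \<alpha> \<kappa> \<alpha>' \<kappa>' where h: "g = monom_at n \<alpha> x * monom_at n \<kappa> y" "\<alpha> \<in> expo n m" "\<kappa> \<in> expo n q"
    "h = monom_at n \<alpha>' x * monom_at n \<kappa>' y" "\<alpha>' \<in> expo n m'" "\<kappa>' \<in> expo n q'" unfolding bimon_def by blast
  have "g * h = monom_at n (\<lambda>i. \<alpha> i + \<alpha>' i) x * monom_at n (\<lambda>i. \<kappa> i + \<kappa>' i) y"
    by (simp add: h monom_at_add mult_ac)
  then show ?thesis unfolding bimon_def using expo_add[OF h(2,5)] expo_add[OF h(3,6)] by blast
qed

context normed_subring
begin

text \<open>The same \<open>B\<close> serves at degree \<open>k * N\<close>, with
  \<open>l ^ k\<close> in place of \<open>l\<close>; this gives the freedom to take degrees large.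
  For \<open>k = 0\<close> the claim would ask for \<open>nm 1 \<le> 1\<close>.\<close>

lemma hbound_multiple:
  assumes "\<forall>\<alpha>\<in>expo n N. l * monom_at n \<alpha> x \<in> A \<and> nm (l * monom_at n \<alpha> x) \<le> B ^ N" "B \<ge> 0" "\<alpha> \<in> expo n (k * N)" "k > 0"
  shows "l ^ k * monom_at n \<alpha> x \<in> A \<and> nm (l ^ k * monom_at n \<alpha> x) \<le> B ^ (k * N)"
  using assms(4,3)
proof (induction k arbitrary: \<alpha>)
  case (Suc k)
  show ?case
  proof (cases "k = 0")
    case True
    then show ?thesis using Suc.prems assms(1) by simp
  next
    case False
    have "\<alpha> \<in> expo n (N + k * N)" using Suc.prems by simp
    then obtain \<beta> \<gamma> where bg: "\<beta> \<in> expo n N" "\<gamma> \<in> expo n (k * N)" "\<alpha> = (\<lambda>i. \<beta> i + \<gamma> i)" by (rule expo_split)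
    have 1: "l * monom_at n \<beta> x \<in> A" "nm (l * monom_at n \<beta> x) \<le> B ^ N" using assms(1) bg by auto
    have 2: "l ^ k * monom_at n \<gamma> x \<in> A" "nm (l ^ k * monom_at n \<gamma> x) \<le> B ^ (k * N)" using Suc.IH[of \<gamma>] bg False by auto
    have e: "l ^ Suc k * monom_at n \<alpha> x = (l * monom_at n \<beta> x) * (l ^ k * monom_at n \<gamma> x)"
      unfolding bg(3) monom_at_add by (simp add: mult_ac)
    have "nm ((l * monom_at n \<beta> x) * (l ^ k * monom_at n \<gamma> x)) \<le> nm (l * monom_at n \<beta> x) * nm (l ^ k * monom_at n \<gamma> x)"
      by (rule nm_mult[OF 1(1) 2(1)])
    also have "\<dots> \<le> B ^ N * B ^ (k * N)" using 1 2 assms(2) by (intro mult_mono) (auto intro: nm_nonneg)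
    finally show ?thesis unfolding e using mult_closed[OF 1(1) 2(1)] by (simp add: power_add)
  qed
qed simp

lemma monom_at_closed: "(\<And>i. i < n \<Longrightarrow> x i \<in> A) \<Longrightarrow> monom_at n \<alpha> x \<in> A"
  unfolding monom_at_def by (intro prod_closed power_closed) auto

lemma integral_multiple:
  fixes n :: nat
  assumes "\<And>i. i < n \<Longrightarrow> x i \<in> fracs A"
  shows "\<exists>c. c \<noteq> 0 \<and> (\<forall>i<n. c * x i \<in> A)"
proof -
  have "x ` {..<n} \<subseteq> fracs A" using assms by auto
  from common_denominator[OF finite_imageI[OF finite_lessThan] this]
  obtain \<delta> where "\<delta> \<noteq> 0" "\<forall>s\<in>x ` {..<n}. \<delta> * s \<in> A" by blast
  then show ?thesis by auto
qed

lemma hbound_rational: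
  assumes "\<And>i. i < n \<Longrightarrow> x i \<in> fracs A"
  shows "\<exists>B\<ge>1. hbound A nm n x 1 B"
proof -
  have "\<exists>c. c \<noteq> 0 \<and> (\<forall>i<n. c * x i \<in> A)" by (rule integral_multiple) (fact assms)
  then obtain c where c: "c \<noteq> 0" "\<And>i. i < n \<Longrightarrow> c * x i \<in> A" by auto
  define B where "B = 1 + (\<Sum>\<alpha>\<in>expo n 1. nm (monom_at n \<alpha> (\<lambda>i. c * x i)))"
  have cl: "monom_at n \<alpha> (\<lambda>i. c * x i) \<in> A" for \<alpha> by (rule monom_at_closed, rule c(2))
  have B: "nm (monom_at n \<alpha> (\<lambda>i. c * x i)) \<le> B" if "\<alpha> \<in> expo n 1" for \<alpha>
    unfolding B_def using member_le_sum[OF that, of "\<lambda>\<alpha>. nm (monom_at n \<alpha> (\<lambda>i. c * x i))"] cl nm_nonneg finite_expo by force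
  have "B \<ge> 1" unfolding B_def using nm_nonneg[OF cl] by (simp add: sum_nonneg)
  moreover have "hbound A nm n (\<lambda>i. c * x i) 1 B" unfolding hbound_def using cl B by (intro conjI exI[of _ 1]) auto
  then have "hbound A nm n (\<lambda>i. inverse c * (c * x i)) 1 B"
    using hbound_scale[of "inverse c" A nm n "\<lambda>i. c * x i" 1 B] c by simp
  then have "hbound A nm n x 1 B" using c by (simp flip: mult.assoc)
  ultimately show ?thesis by blast
qed

lemma monom_at_bound:
  assumes "\<And>i. i < n \<Longrightarrow> x i \<in> A"
  shows "\<exists>C\<ge>1. \<forall>\<alpha>\<in>expo n R. nm (monom_at n \<alpha> x) \<le> C"
proof (intro exI conjI ballI)
  define C where "C = 1 + (\<Sum>\<alpha>\<in>expo n R. nm (monom_at n \<alpha> x))"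
  have cl: "monom_at n \<alpha> x \<in> A" for \<alpha> by (rule monom_at_closed, rule assms)
  show "1 \<le> C" unfolding C_def using nm_nonneg[OF cl] by (simp add: sum_nonneg)
  fix \<alpha> assume "\<alpha> \<in> expo n R"
  then show "nm (monom_at n \<alpha> x) \<le> C"
    unfolding C_def using member_le_sum[of \<alpha> "expo n R" "\<lambda>\<alpha>. nm (monom_at n \<alpha> x)"] cl nm_nonneg finite_expo by force
qed

text \<open>One factor of \<open>y\<close> at a time is traded for degree \<open>d\<close> in
  \<open>x\<close>. As long as the degree in \<open>x\<close> exceeds \<open>n * D\<close>, some
  \<open>x\<^sub>a\<^sup>D\<close> is available to be combined with \<open>y\<^sub>b\<close>; that
  degree only grows, so the step can be repeated.\<close>

lemma combo_upper:
  assumes H: "\<And>a b. a < n \<Longrightarrow> b < n \<Longrightarrow> combo A nm (bimon n x y (D + d) 0) E (\<delta> * (x a ^ D * y b))"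
    and "E \<ge> 0" "g \<in> bimon n x y m q" "n * D < m"
  shows "combo A nm (bimon n x y (m + d * q) 0) (nm 1 * E ^ q) (\<delta> ^ q * g)"
  using assms(3,4)
proof (induction q arbitrary: m g)
  case 0
  have "combo A nm (bimon n x y m 0) (0 + nm 1) (0 + 1 * g)" using 0 by (intro combo.add combo.zero one_closed)
  then show ?case by simp
next
  case (Suc q)
  obtain \<alpha> \<kappa> where g: "g = monom_at n \<alpha> x * monom_at n \<kappa> y" "\<alpha> \<in> expo n m" "\<kappa> \<in> expo n (1 + q)"
    using Suc.prems by (auto simp: bimon_def)
  obtain a \<beta> where a: "a < n" "\<beta> \<in> expo n (m - D)" "\<And>x :: nat \<Rightarrow> 'a. monom_at n \<alpha> x = x a ^ D * monom_at n \<beta> x"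
    using expo_pigeonhole[OF g(2) Suc.prems(2)] by blast
  have "D \<le> n * D" using a(1) by (cases n) auto
  then have Dm: "D \<le> m" using Suc.prems(2) by linarith
  obtain \<epsilon> \<kappa>' where k: "\<epsilon> \<in> expo n 1" "\<kappa>' \<in> expo n q" "\<kappa> = (\<lambda>i. \<epsilon> i + \<kappa>' i)" using g(3) by (rule expo_split)
  obtain b \<beta>' where b: "b < n" "\<beta>' \<in> expo n 0" "\<And>x :: nat \<Rightarrow> 'a. monom_at n \<epsilon> x = x b ^ 1 * monom_at n \<beta>' x"
  proof -
    have "\<exists>b<n. \<epsilon> b > 0"
    proof (rule ccontr)
      assume "\<not> (\<exists>b<n. \<epsilon> b > 0)"
      then have "(\<Sum>i<n. \<epsilon> i) = 0" by simp
      then show False using k(1) by (simp add: expo_def)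
    qed
    then obtain b where b: "b < n" "\<epsilon> b > 0" by blast
    have "\<epsilon> = (\<lambda>j. if j = b then 1 else 0)"
    proof
      fix j
      have "\<epsilon> b \<le> 1" using expo_le[OF k(1)] .
      have "(\<Sum>i<n. \<epsilon> i) = \<epsilon> b + (\<Sum>i\<in>{..<n} - {b}. \<epsilon> i)" using b by (simp add: sum.remove)
      moreover have "(\<Sum>i<n. \<epsilon> i) = 1" using k(1) by (simp add: expo_def)
      ultimately have "(\<Sum>i\<in>{..<n} - {b}. \<epsilon> i) = 0" using b(2) by linarith
      then show "\<epsilon> j = (if j = b then 1 else 0)" using k(1) b \<open>\<epsilon> b \<le> 1\<close>
        by (cases "j < n") (auto simp: expo_def)
    qed
    then have "monom_at n \<epsilon> z = z b ^ 1 * monom_at n (\<lambda>i. 0) z" for z :: "nat \<Rightarrow> 'a"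
      using monom_at_single[OF b(1), of 1 z] by (simp add: monom_at_def)
    moreover have "(\<lambda>i. 0) \<in> expo n 0" by (simp add: expo_def)
    ultimately show ?thesis using that b(1) by blast
  qed
  have b0: "monom_at n \<beta>' z = 1" for z :: "nat \<Rightarrow> 'a" using b(2) by (simp add: monom_at_def expo_def)
  define h where "h = monom_at n \<beta> x * monom_at n \<kappa>' y"
  have h: "h \<in> bimon n x y (m - D) q" unfolding h_def bimon_def using a k by blast
  have ge: "\<delta> * g = \<delta> * (x a ^ D * y b) * h"
    using a(3)[of x] b(3)[of y] b0 by (simp add: g(1) k(3) monom_at_add h_def mult_ac)
  have "combo A nm (bimon n x y (m + d) q) E (\<delta> * g)"
    unfolding ge
  proof (rule combo_mult[OF H[OF a(1) b(1)]])
    fix g' assume "g' \<in> bimon n x y (D + d) 0"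
    from bimon_mult[OF this h] show "g' * h \<in> bimon n x y (m + d) q" using Dm by (simp add: algebra_simps)
  qed
  note c1 = this
  have c2: "combo A nm (bimon n x y (m + d + d * q) 0) (nm 1 * E ^ q) (\<delta> ^ q * g')" if "g' \<in> bimon n x y (m + d) q" for g'
    using Suc.IH[OF that] Suc.prems(2) by simp
  have "combo A nm (bimon n x y (m + d + d * q) 0) (E * (nm 1 * E ^ q)) (\<delta> ^ q * (\<delta> * g))"
    by (rule combo_subst[OF c1 c2]) (use \<open>E \<ge> 0\<close> nm_nonneg[OF one_closed] in auto)
  then show ?case by (simp add: algebra_simps)
qed

text \<open>The opposite trade: \<open>x\<^sub>c\<^sup>D\<close> becomes degree \<open>D - d\<close>
  in \<open>x\<close> and one factor of \<open>y\<close>. The reserve \<open>R\<close> keeps the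
  degree in \<open>x\<close> above \<open>n * D\<close> in all \<open>q\<close> steps.\<close>

lemma combo_lower:
  assumes H: "\<And>c. c < n \<Longrightarrow> combo A nm (bimon n x y (D - d) 1) E (\<delta> * x c ^ D)" and dD: "d \<le> D"
    and "E \<ge> 0" "g \<in> bimon n x y (R + d * q) r" "n * D < R"
  shows "combo A nm (bimon n x y R (r + q)) (nm 1 * E ^ q) (\<delta> ^ q * g)"
  using assms(4)
proof (induction q arbitrary: r g)
  case 0
  have "combo A nm (bimon n x y R r) (0 + nm 1) (0 + 1 * g)" using 0 by (intro combo.add combo.zero one_closed) auto
  then show ?case by simp
next
  case (Suc q)
  define m where "m = R + d * Suc q"
  obtain \<alpha> \<kappa> where g: "g = monom_at n \<alpha> x * monom_at n \<kappa> y" "\<alpha> \<in> expo n m" "\<kappa> \<in> expo n r"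
    using Suc.prems by (auto simp: bimon_def m_def)
  have nm: "n * D < m" using assms(5) by (simp add: m_def)
  obtain a \<beta> where a: "a < n" "\<beta> \<in> expo n (m - D)" "\<And>x :: nat \<Rightarrow> 'a. monom_at n \<alpha> x = x a ^ D * monom_at n \<beta> x"
    using expo_pigeonhole[OF g(2) nm] by blast
  have "D \<le> n * D" using a(1) by (cases n) auto
  then have Dm: "D \<le> R" using assms(5) by linarith
  define h where "h = monom_at n \<beta> x * monom_at n \<kappa> y"
  have h: "h \<in> bimon n x y (m - D) r" unfolding h_def bimon_def using a g by blast
  have ge: "\<delta> * g = \<delta> * x a ^ D * h" using a(3)[of x] by (simp add: g(1) h_def mult_ac)
  have "combo A nm (bimon n x y (R + d * q) (r + 1)) E (\<delta> * g)"
    unfolding ge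
  proof (rule combo_mult[OF H[OF a(1)]])
    fix g' assume "g' \<in> bimon n x y (D - d) 1"
    from bimon_mult[OF this h] show "g' * h \<in> bimon n x y (R + d * q) (r + 1)"
      using Dm dD by (simp add: m_def algebra_simps)
  qed
  note c1 = this
  have c2: "combo A nm (bimon n x y R (r + 1 + q)) (nm 1 * E ^ q) (\<delta> ^ q * g')" if "g' \<in> bimon n x y (R + d * q) (r + 1)" for g'
    using Suc.IH[OF that] .
  have "combo A nm (bimon n x y R (r + 1 + q)) (E * (nm 1 * E ^ q)) (\<delta> ^ q * (\<delta> * g))"
    by (rule combo_subst[OF c1 c2]) (use \<open>E \<ge> 0\<close> nm_nonneg[OF one_closed] in auto)
  then show ?case by (simp add: algebra_simps)
qed

lemma exists_power_ge:
  fixes C e :: real assumes "e > 0" "N > 0"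
  shows "\<exists>k>0. C \<le> exp (e * real (k * N))"
proof -
  obtain k where k: "C < real k * e" using reals_Archimedean3[OF assms(1)] by blast
  have "C \<le> 1 + e * real (Suc k * N)"
  proof -
    have "k \<le> Suc k * N" using assms(2) by (cases N) auto
    then have "real k * e \<le> real (Suc k * N) * e" using assms(1) by (intro mult_right_mono of_nat_mono) auto
    then show ?thesis using k by (simp add: mult.commute)
  qed
  also have "\<dots> \<le> exp (e * real (Suc k * N))" by (rule exp_ge_add_one_self)
  finally show ?thesis by blast
qed

text \<open>A multiplier for degree \<open>N\<close> in \<open>x\<close> yields one for degree
  \<open>q = k * N\<close> in \<open>y\<close>. The monomials in \<open>y\<close> are first
  multiplied by \<open>x a0 ^ R\<close>, so that \<open>combo_upper\<close> applies; the constants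
  that arise are at most \<open>exp (e / 2 * q)\<close> once \<open>k\<close> is large.\<close>

lemma height_upper:
  assumes H: "\<And>a b. a < n \<Longrightarrow> b < n \<Longrightarrow> combo A nm (bimon n x y (D + d) 0) E (\<delta> * (x a ^ D * y b))"
    and E: "E \<ge> 1" and \<delta>: "\<delta> \<noteq> 0" and d: "d > 0" and x: "\<And>i. i < n \<Longrightarrow> x i \<in> A" and a0: "a0 < n" "x a0 \<noteq> 0"
  shows "height A nm n y \<le> d * height A nm n x + ln E"
proof (rule field_le_epsilon)
  fix e :: real assume e: "e > 0"
  have xf: "x i \<in> fracs A" if "i < n" for i using x[OF that] subset_fracs by blast
  obtain B0 where B0: "B0 \<ge> 1" "hbound A nm n x 1 B0" using hbound_rational[of n x] xf by blast
  obtain B N where B: "B \<ge> 1" "hbound A nm n x N B" "ln B < height A nm n x + e / (2 * d)"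
    using height_approx[OF B0(2,1), of "e / (2 * d)"] e d by auto
  obtain l where l: "N > 0" "l \<noteq> 0" "\<forall>\<alpha>\<in>expo n N. l * monom_at n \<alpha> x \<in> A \<and> nm (l * monom_at n \<alpha> x) \<le> B ^ N"
    using B(2) by (auto simp: hbound_def)
  define R where "R = n * D + 1"
  obtain C where C: "C \<ge> 1" "\<forall>\<alpha>\<in>expo n R. nm (monom_at n \<alpha> x) \<le> C" using monom_at_bound[of n x R] x by blast
  obtain k where k: "k > 0" "nm 1 * C \<le> exp (e / 2 * real (k * N))" using exists_power_ge[of "e / 2" N "nm 1 * C"] e l(1) by auto
  define q where "q = k * N"
  have q0: "q > 0" using k l by (simp add: q_def)
  \<comment> \<open>\<open>l ^ (d * k)\<close> clears the degree \<open>d * q\<close> in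
    \<open>x\<close>, \<open>\<delta> ^ q\<close> pays for the \<open>q\<close> exchanges, and
    \<open>x a0 ^ R\<close> provides the starting degree.\<close>
  define l' where "l' = l ^ (d * k) * (\<delta> ^ q * x a0 ^ R)"
  define B' where "B' = E * B ^ d * exp (e / 2)"
  have B'1: "B' \<ge> 1"
  proof -
    have "1 * 1 * 1 \<le> E * B ^ d * exp (e / 2)" using E B(1) e by (intro mult_mono one_le_power) auto
    then show ?thesis by (simp add: B'_def)
  qed
  have bound: "l' * monom_at n \<kappa> y \<in> A \<and> nm (l' * monom_at n \<kappa> y) \<le> B' ^ q" if \<kappa>: "\<kappa> \<in> expo n q" for \<kappa>
  proof -
    define g where "g = x a0 ^ R * monom_at n \<kappa> y"
    have g: "g \<in> bimon n x y R q"
      using bimonI[OF expo_single[OF a0(1), of R] \<kappa>, of x y] monom_at_single[OF a0(1), of R x] by (simp add: g_def)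
    have co: "combo A nm (bimon n x y (R + d * q) 0) (nm 1 * E ^ q) (\<delta> ^ q * g)"
      by (rule combo_upper[OF H _ g]) (use E in \<open>auto simp: R_def\<close>)
    have "l ^ (d * k) * (\<delta> ^ q * g) \<in> A \<and> nm (l ^ (d * k) * (\<delta> ^ q * g)) \<le> (nm 1 * E ^ q) * (C * B ^ (d * q))"
    proof (rule combo_norm[OF co])
      show "0 \<le> C * B ^ (d * q)" using C B by simp
      fix h assume "h \<in> bimon n x y (R + d * q) 0"
      then obtain \<alpha> \<kappa>0 where h: "h = monom_at n \<alpha> x * monom_at n \<kappa>0 y" "\<alpha> \<in> expo n (R + d * q)" "\<kappa>0 \<in> expo n 0"
        by (auto simp: bimon_def)
      have "monom_at n \<kappa>0 y = 1" using h(3) by (simp add: monom_at_def expo_def)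
      obtain \<beta> \<gamma> where bg: "\<beta> \<in> expo n R" "\<gamma> \<in> expo n (d * q)" "\<alpha> = (\<lambda>i. \<beta> i + \<gamma> i)" using h(2) by (rule expo_split)
      have e1: "l ^ (d * k) * h = monom_at n \<beta> x * (l ^ (d * k) * monom_at n \<gamma> x)"
        using \<open>monom_at n \<kappa>0 y = 1\<close> by (simp add: h(1) bg(3) monom_at_add mult_ac)
      have "\<gamma> \<in> expo n (d * k * N)" using bg(2) by (simp add: q_def mult.assoc)
      from hbound_multiple[OF l(3) _ this] B(1) d k
      have m: "l ^ (d * k) * monom_at n \<gamma> x \<in> A" "nm (l ^ (d * k) * monom_at n \<gamma> x) \<le> B ^ (d * q)"
        by (auto simp: q_def mult.assoc)
      have cl: "monom_at n \<beta> x \<in> A" by (rule monom_at_closed, rule x)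
      have "nm (monom_at n \<beta> x * (l ^ (d * k) * monom_at n \<gamma> x)) \<le> nm (monom_at n \<beta> x) * nm (l ^ (d * k) * monom_at n \<gamma> x)"
        by (rule nm_mult[OF cl m(1)])
      also have "\<dots> \<le> C * B ^ (d * q)" using C bg(1) m C(1) by (intro mult_mono) (auto intro: nm_nonneg)
      finally show "l ^ (d * k) * h \<in> A \<and> nm (l ^ (d * k) * h) \<le> C * B ^ (d * q)"
        unfolding e1 using mult_closed[OF cl m(1)] by simp
    qed
    moreover have "l ^ (d * k) * (\<delta> ^ q * g) = l' * monom_at n \<kappa> y" by (simp add: l'_def g_def mult_ac)
    moreover have "(nm 1 * E ^ q) * (C * B ^ (d * q)) \<le> B' ^ q"
    proof -
      have "(nm 1 * E ^ q) * (C * B ^ (d * q)) = (nm 1 * C) * (E * B ^ d) ^ q"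
        by (simp add: power_mult_distrib power_mult mult_ac)
      also have "\<dots> \<le> exp (e / 2 * real q) * (E * B ^ d) ^ q"
        using k(2) E B(1) by (intro mult_right_mono) (auto simp: q_def)
      also have "\<dots> = B' ^ q" by (simp add: B'_def power_mult_distrib exp_of_nat_mult[symmetric] mult_ac)
      finally show ?thesis .
    qed
    ultimately show ?thesis by auto
  qed
  have "hbound A nm n y q B'"
    unfolding hbound_def using q0 bound l(2) \<delta> a0(2) by (intro conjI exI[of _ l']) (auto simp: l'_def)
  then have "height A nm n y \<le> ln B'" using B'1 by (intro height_le)
  also have "ln B' = ln E + d * ln B + e / 2"
    using E B(1) by (simp add: B'_def ln_mult ln_realpow)
  also have "\<dots> \<le> ln E + d * (height A nm n x + e / (2 * d)) + e / 2"
    using B(3) d by (intro add_mono mult_left_mono) auto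
  also have "\<dots> = d * height A nm n x + ln E + e" using d by (simp add: field_simps)
  finally show "height A nm n y \<le> d * height A nm n x + ln E + e" .
qed

text \<open>By \<open>combo_lower\<close> monomials of degree \<open>R + d * q\<close> in
  \<open>x\<close> are reduced to fixed degree \<open>R\<close> in \<open>x\<close> and degree
  \<open>q\<close> in \<open>y\<close>, so a multiplier for \<open>y\<close> serves for
  \<open>x\<close>.\<close>

lemma height_lower:
  assumes H: "\<And>c. c < n \<Longrightarrow> combo A nm (bimon n x y (D - d) 1) E (\<delta> * x c ^ D)"
    and dD: "d \<le> D" and E: "E \<ge> 1" and \<delta>: "\<delta> \<noteq> 0" and d: "d > 0" and x: "\<And>i. i < n \<Longrightarrow> x i \<in> A"
    and y: "\<And>i. i < n \<Longrightarrow> y i \<in> fracs A"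
  shows "d * height A nm n x \<le> height A nm n y + ln E"
proof (rule field_le_epsilon)
  fix e :: real assume e: "e > 0"
  obtain B0 where B0: "B0 \<ge> 1" "hbound A nm n y 1 B0" using hbound_rational[of n y] y by blast
  obtain B N where B: "B \<ge> 1" "hbound A nm n y N B" "ln B < height A nm n y + e / 2"
    using height_approx[OF B0(2,1), of "e / 2"] e by auto
  obtain l where l: "N > 0" "l \<noteq> 0" "\<forall>\<alpha>\<in>expo n N. l * monom_at n \<alpha> y \<in> A \<and> nm (l * monom_at n \<alpha> y) \<le> B ^ N"
    using B(2) by (auto simp: hbound_def)
  define R where "R = n * D + 1"
  obtain C where C: "C \<ge> 1" "\<forall>\<alpha>\<in>expo n R. nm (monom_at n \<alpha> x) \<le> C" using monom_at_bound[of n x R] x by blast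
  obtain k where k: "k > 0" "nm 1 * C \<le> exp (e / 2 * real (k * N))" using exists_power_ge[of "e / 2" N "nm 1 * C"] e l(1) by auto
  define q where "q = k * N"
  have q0: "q > 0" using k l by (simp add: q_def)
  define l' where "l' = l ^ k * \<delta> ^ q"
  define B1 where "B1 = E * B * exp (e / 2)"
  \<comment> \<open>Degree \<open>q\<close> in \<open>y\<close> corresponds to degree
    \<open>d * q\<close> in \<open>x\<close>, whence the \<open>d\<close>-th root; the extra degree
    \<open>R\<close> is harmless because \<open>B' \<ge> 1\<close>.\<close>
  define B' where "B' = root d B1"
  have B11: "B1 \<ge> 1"
  proof -
    have "1 * 1 * 1 \<le> E * B * exp (e / 2)" using E B(1) e by (intro mult_mono) auto
    then show ?thesis by (simp add: B1_def)
  qed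
  have B'1: "B' \<ge> 1" "B' ^ d = B1" using B11 d by (auto simp: B'_def real_root_pow_pos2)
  have bound: "l' * monom_at n \<gamma> x \<in> A \<and> nm (l' * monom_at n \<gamma> x) \<le> B' ^ (R + d * q)" if \<gamma>: "\<gamma> \<in> expo n (R + d * q)" for \<gamma>
  proof -
    define g where "g = monom_at n \<gamma> x"
    have "(\<lambda>i. 0) \<in> expo n 0" "monom_at n (\<lambda>i. 0) y = 1" by (auto simp: expo_def monom_at_def)
    then have g: "g \<in> bimon n x y (R + d * q) 0" using bimonI[OF \<gamma>, of "\<lambda>i. 0" 0 x y] by (simp add: g_def)
    have co: "combo A nm (bimon n x y R (0 + q)) (nm 1 * E ^ q) (\<delta> ^ q * g)"
      by (rule combo_lower[OF H dD _ g]) (use E in \<open>auto simp: R_def\<close>)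
    have "l ^ k * (\<delta> ^ q * g) \<in> A \<and> nm (l ^ k * (\<delta> ^ q * g)) \<le> (nm 1 * E ^ q) * (C * B ^ q)"
    proof (rule combo_norm[OF co])
      show "0 \<le> C * B ^ q" using C B by simp
      fix h assume "h \<in> bimon n x y R (0 + q)"
      then obtain \<alpha> \<kappa> where h: "h = monom_at n \<alpha> x * monom_at n \<kappa> y" "\<alpha> \<in> expo n R" "\<kappa> \<in> expo n (k * N)"
        by (auto simp: bimon_def q_def)
      have e1: "l ^ k * h = monom_at n \<alpha> x * (l ^ k * monom_at n \<kappa> y)" by (simp add: h(1) mult_ac)
      from hbound_multiple[OF l(3) _ h(3)] B(1) k
      have m: "l ^ k * monom_at n \<kappa> y \<in> A" "nm (l ^ k * monom_at n \<kappa> y) \<le> B ^ q" by (auto simp: q_def)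
      have cl: "monom_at n \<alpha> x \<in> A" by (rule monom_at_closed, rule x)
      have "nm (monom_at n \<alpha> x * (l ^ k * monom_at n \<kappa> y)) \<le> nm (monom_at n \<alpha> x) * nm (l ^ k * monom_at n \<kappa> y)"
        by (rule nm_mult[OF cl m(1)])
      also have "\<dots> \<le> C * B ^ q" using C h(2) m C(1) by (intro mult_mono) (auto intro: nm_nonneg)
      finally show "l ^ k * h \<in> A \<and> nm (l ^ k * h) \<le> C * B ^ q"
        unfolding e1 using mult_closed[OF cl m(1)] by simp
    qed
    moreover have "l ^ k * (\<delta> ^ q * g) = l' * monom_at n \<gamma> x" by (simp add: l'_def g_def mult_ac)
    moreover have "(nm 1 * E ^ q) * (C * B ^ q) \<le> B' ^ (R + d * q)"
    proof -
      have "(nm 1 * E ^ q) * (C * B ^ q) = (nm 1 * C) * (E * B) ^ q"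
        by (simp add: power_mult_distrib mult_ac)
      also have "\<dots> \<le> exp (e / 2 * real q) * (E * B) ^ q"
        using k(2) E B(1) by (intro mult_right_mono) (auto simp: q_def)
      also have "\<dots> = B1 ^ q" by (simp add: B1_def power_mult_distrib exp_of_nat_mult[symmetric] mult_ac)
      also have "\<dots> = B' ^ (d * q)" by (simp add: power_mult B'1)
      also have "\<dots> \<le> B' ^ (R + d * q)" using B'1 by (intro power_increasing) auto
      finally show ?thesis .
    qed
    ultimately show ?thesis by auto
  qed
  have "hbound A nm n x (R + d * q) B'"
    unfolding hbound_def using q0 bound l(2) \<delta> by (intro conjI exI[of _ l']) (auto simp: l'_def R_def)
  then have "height A nm n x \<le> ln B'" using B'1 by (intro height_le)
  then have "d * height A nm n x \<le> d * ln B'" using d by (intro mult_left_mono) auto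
  also have "\<dots> = ln B1" using B'1 by (simp flip: ln_realpow B'1(2))
  also have "\<dots> = ln E + ln B + e / 2" using E B(1) by (simp add: B1_def ln_mult)
  also have "\<dots> \<le> height A nm n y + ln E + e" using B(3) by simp
  finally show "d * height A nm n x \<le> height A nm n y + ln E + e" .
qed

text \<open>The bound for the monomials \<open>x a ^ (N - k) * x i ^ k\<close> is the Northcott
  condition for \<open>x i / x a\<close>, with \<open>l * x a ^ N\<close> in the role of
  \<open>\<mu>\<close>.\<close>

lemma height_northcott:
  assumes nc: "northcott A nm" and "b \<ge> 0"
  shows "\<exists>Z. finite Z \<and> (\<forall>x a. (\<forall>i<n. x i \<in> fracs A) \<longrightarrow> a < n \<longrightarrow> x a \<noteq> 0 \<longrightarrow> height A nm n x < b \<longrightarrow> (\<forall>i<n. x i / x a \<in> Z))"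
proof -
  define Z where "Z = {z. \<exists>N \<mu>. N > 0 \<and> \<mu> \<noteq> 0 \<and> (\<forall>k\<le>N. \<mu> * z ^ k \<in> A \<and> nm (\<mu> * z ^ k) \<le> exp b ^ N)}"
  have "finite Z" using nc \<open>b \<ge> 0\<close> unfolding northcott_def Z_def by auto
  moreover have "x i / x a \<in> Z" if h: "\<forall>i<n. x i \<in> fracs A" "a < n" "x a \<noteq> 0" "height A nm n x < b" "i < n" for x a i
  proof -
    obtain B0 where B0: "B0 \<ge> 1" "hbound A nm n x 1 B0" using hbound_rational[of n x] h(1) by blast
    obtain B N where B: "B \<ge> 1" "hbound A nm n x N B" "ln B < b"
      using height_approx[OF B0(2,1), of "b - height A nm n x"] h(4) by auto
    obtain l where l: "N > 0" "l \<noteq> 0" "\<forall>\<alpha>\<in>expo n N. l * monom_at n \<alpha> x \<in> A \<and> nm (l * monom_at n \<alpha> x) \<le> B ^ N"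
      using B(2) by (auto simp: hbound_def)
    have "exp (ln B) \<le> exp b" using B(3) by simp
    then have Bb: "B \<le> exp b" using B(1) by simp
    have "l * x a ^ N * (x i / x a) ^ k \<in> A \<and> nm (l * x a ^ N * (x i / x a) ^ k) \<le> exp b ^ N" if k: "k \<le> N" for k
    proof -
      define \<alpha> where "\<alpha> = (\<lambda>j. (if j = a then N - k else 0) + (if j = i then k else 0))"
      have \<alpha>: "\<alpha> \<in> expo n N" unfolding \<alpha>_def using expo_add[OF expo_single[OF h(2), of "N - k"] expo_single[OF h(5), of k]] k by simp
      have "monom_at n \<alpha> x = x a ^ (N - k) * x i ^ k"
        unfolding \<alpha>_def monom_at_add by (simp add: monom_at_single h)
      also have "\<dots> = x a ^ N * (x i / x a) ^ k" using k h(3) by (simp add: power_diff power_divide)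
      finally have "l * x a ^ N * (x i / x a) ^ k = l * monom_at n \<alpha> x" by simp
      moreover have "B ^ N \<le> exp b ^ N" using B(1) Bb by (intro power_mono) auto
      ultimately show ?thesis using l(3)[rule_format, OF \<alpha>] by (metis order.trans)
    qed
    then show ?thesis unfolding Z_def using l h(3) by (intro CollectI exI[of _ N] exI[of _ "l * x a ^ N"]) auto
  qed
  ultimately show ?thesis by blast
qed

end

section \<open>Dominance by counting forms\<close>

text \<open>Bernoulli's inequality for \<open>a ^ j\<close>, raised to the power
  \<open>n + 1\<close>, grows with one power of \<open>j\<close> more than the polynomial at
  \<open>k = j * (n + 1)\<close>.\<close>

lemma exponential_beats_polynomial:
  fixes a :: real assumes "a > 1"
  shows "\<exists>k. (real (k * e) + 1) ^ n < a ^ k"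
proof (rule ccontr)
  assume "\<not> ?thesis"
  then have le: "a ^ k \<le> (real (k * e) + 1) ^ n" for k by (meson not_less)
  define K where "K = real ((n + 1) * e) + 1"
  define b where "b = a - 1"
  have b: "b > 0" using assms by (simp add: b_def)
  have "real j * b ^ (n + 1) \<le> K ^ n" if j: "j > 0" for j
  proof -
    have "1 + real j * b \<le> a ^ j" using Bernoulli_inequality[of b j] b by (simp add: b_def)
    then have "real j * b \<le> a ^ j" by simp
    then have "(real j * b) ^ (n + 1) \<le> (a ^ j) ^ (n + 1)" using b by (intro power_mono) auto
    also have "\<dots> = a ^ (j * (n + 1))" by (rule power_mult[symmetric])
    also have "\<dots> \<le> (real (j * (n + 1) * e) + 1) ^ n" by (rule le)
    also have "\<dots> \<le> (real j * K) ^ n"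
    proof (rule power_mono)
      have "real (j * (n + 1) * e) = real j * real ((n + 1) * e)" by (simp only: of_nat_mult mult.assoc)
      moreover have "1 \<le> real j" using j by simp
      ultimately have "real (j * (n + 1) * e) + 1 \<le> real j * real ((n + 1) * e) + real j" by linarith
      then show "real (j * (n + 1) * e) + 1 \<le> real j * K" by (simp add: K_def algebra_simps)
    qed simp
    finally have "real j ^ n * (real j * b ^ (n + 1)) \<le> real j ^ n * K ^ n"
      by (simp add: power_mult_distrib mult_ac)
    then show ?thesis using j by (simp add: mult_le_cancel_left_pos)
  qed
  moreover obtain j where "K ^ n < real j * b ^ (n + 1)" using reals_Archimedean3[of "b ^ (n + 1)"] b by auto
  ultimately show False by (metis less_eq_real_def mult_zero_left not_gr_zero not_less of_nat_0 K_def zero_le_power add_nonneg_nonneg of_nat_0_le_iff zero_le_one)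
qed

text \<open>Dimensions are taken over the base field, where the forms have their coefficients,
  although the functions take values in its algebraic closure.\<close>

definition fscale :: "'k::field \<Rightarrow> ((nat \<Rightarrow> 'k alg_closure) \<Rightarrow> 'k alg_closure) \<Rightarrow> ((nat \<Rightarrow> 'k alg_closure) \<Rightarrow> 'k alg_closure)" where
  "fscale c f = (\<lambda>x. to_ac c * f x)"

interpretation fvs: vector_space "fscale :: 'k::field \<Rightarrow> _"
  by unfold_locales (auto simp: fscale_def algebra_simps fun_eq_iff)

interpretation fvs2: vector_space_pair "fscale :: 'k::field \<Rightarrow> _" "fscale :: 'k \<Rightarrow> _"
  by unfold_locales

text \<open>
  \<open>\<Phi>_finite\<close> is the statement that the lift \<open>\<Phi>\<close> has no common zeros on the cone.
\<close>

locale cone_map =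
  fixes n d M0 :: nat and C :: "(nat \<Rightarrow> 'k::field alg_closure) set"
    and \<Phi> :: "(nat \<Rightarrow> 'k alg_closure) \<Rightarrow> (nat \<Rightarrow> 'k alg_closure)"
  assumes d: "d > 0" and M0: "d \<le> M0" and C_nonempty: "C \<noteq> {}"
    and C_nonzero: "x \<in> C \<Longrightarrow> \<exists>i<n. x i \<noteq> 0"
    and C_prime: "hpoly n e p \<Longrightarrow> hpoly n e' q \<Longrightarrow> (\<And>x. x \<in> C \<Longrightarrow> p x * q x = 0) \<Longrightarrow>
       (\<forall>x\<in>C. p x = 0) \<or> (\<forall>x\<in>C. q x = 0)"
    and \<Phi>_C: "x \<in> C \<Longrightarrow> \<Phi> x \<in> C"
    and \<Phi>_finite: "hpoly n m p \<Longrightarrow> M0 < m \<Longrightarrow>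
       \<exists>Q. (\<forall>b<n. hpoly n (m - d) (Q b)) \<and> (\<forall>x\<in>C. p x = (\<Sum>b<n. Q b x * \<Phi> x b))"
begin

text \<open>Extension by zero turns equality on the cone into equality of functions, so that
  \<open>forms m\<close> is the part of degree \<open>m\<close> of the homogeneous coordinate
  ring.\<close>

definition res :: "((nat \<Rightarrow> 'k alg_closure) \<Rightarrow> 'k alg_closure) \<Rightarrow> ((nat \<Rightarrow> 'k alg_closure) \<Rightarrow> 'k alg_closure)" where
  "res f = (\<lambda>x. if x \<in> C then f x else 0)"

definition forms :: "nat \<Rightarrow> ((nat \<Rightarrow> 'k alg_closure) \<Rightarrow> 'k alg_closure) set" where
  "forms m = {res p | p. hpoly n m p}"

definition hilb :: "nat \<Rightarrow> nat" where
  "hilb m = fvs.dim (forms m)"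

lemma subspace_forms: "fvs.subspace (forms m)"
proof (rule fvs.subspaceI)
  show "0 \<in> forms m" unfolding forms_def
    by (intro CollectI exI[of _ "\<lambda>x. 0"]) (auto simp: res_def hpoly.zero fun_eq_iff)
  fix f g assume "f \<in> forms m" "g \<in> forms m"
  then obtain p q where pq: "f = res p" "hpoly n m p" "g = res q" "hpoly n m q" by (auto simp: forms_def)
  then show "f + g \<in> forms m" unfolding forms_def
    by (intro CollectI exI[of _ "\<lambda>x. p x + q x"]) (auto simp: res_def fun_eq_iff intro: hpoly.add)
next
  fix c f assume "f \<in> forms m"
  then obtain p where p: "f = res p" "hpoly n m p" by (auto simp: forms_def)
  then show "fscale c f \<in> forms m" unfolding forms_def
    by (intro CollectI exI[of _ "\<lambda>x. to_ac c * p x"]) (auto simp: res_def fscale_def fun_eq_iff intro: hpoly_scale)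
qed

lemma forms_span_monomials: "forms m \<subseteq> fvs.span ((\<lambda>\<alpha>. res (monom_at n \<alpha>)) ` expo n m)"
proof
  fix f assume "f \<in> forms m"
  then obtain p where p: "f = res p" "hpoly n m p" by (auto simp: forms_def)
  obtain c where c: "\<forall>x. p x = (\<Sum>\<alpha>\<in>expo n m. to_ac (c \<alpha>) * monom_at n \<alpha> x)" using hpoly_monomials[OF p(2)] by blast
  have eq: "f = (\<Sum>\<alpha>\<in>expo n m. fscale (c \<alpha>) (res (monom_at n \<alpha>)))"
  proof
    fix x
    have "(\<Sum>\<alpha>\<in>S. fscale (c \<alpha>) (res (monom_at n \<alpha>))) x = (\<Sum>\<alpha>\<in>S. fscale (c \<alpha>) (res (monom_at n \<alpha>)) x)" for S
      by (induction S rule: infinite_finite_induct) auto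
    then show "f x = (\<Sum>\<alpha>\<in>expo n m. fscale (c \<alpha>) (res (monom_at n \<alpha>))) x"
      using c by (simp add: p(1) res_def fscale_def)
  qed
  show "f \<in> fvs.span ((\<lambda>\<alpha>. res (monom_at n \<alpha>)) ` expo n m)"
    unfolding eq by (intro fvs.span_sum fvs.span_scale fvs.span_base imageI)
qed

lemma independent_forms:
  assumes "fvs.independent B" "B \<subseteq> forms m" shows "finite B \<and> card B \<le> hilb m"
proof -
  obtain B' where B': "B \<subseteq> B'" "B' \<subseteq> forms m" "fvs.independent B'" "forms m \<subseteq> fvs.span B'"
    using fvs.maximal_independent_subset_extend[OF assms(2,1)] by blast
  have "finite B'"
    using fvs.independent_span_bound[OF _ B'(3), of "(\<lambda>\<alpha>. res (monom_at n \<alpha>)) ` expo n m"] B'(2) forms_span_monomials[of m] finite_expo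
    by blast
  moreover have "card B' = hilb m" unfolding hilb_def using fvs.basis_card_eq_dim[OF B'(2,4,3)] .
  ultimately show ?thesis using B'(1) card_mono finite_subset by metis
qed

lemma hilb_le: "hilb m \<le> (m + 1) ^ n"
proof -
  have "hilb m \<le> card ((\<lambda>\<alpha>. res (monom_at n \<alpha>)) ` expo n m)"
    unfolding hilb_def using forms_span_monomials finite_expo by (intro fvs.dim_le_card) auto
  also have "\<dots> \<le> card (expo n m)" by (rule card_image_le[OF finite_expo])
  also have "\<dots> \<le> (m + 1) ^ n" using card_expo by blast
  finally show ?thesis .
qed

lemma forms_basis:
  obtains B where "B \<subseteq> forms m" "fvs.independent B" "fvs.span B = forms m" "finite B" "card B = hilb m"
proof -
  obtain B where B: "B \<subseteq> forms m" "fvs.independent B" "forms m \<subseteq> fvs.span B" "card B = fvs.dim (forms m)"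
    using fvs.basis_exists by blast
  moreover have "fvs.span B \<subseteq> forms m" using B(1) subspace_forms by (rule fvs.span_minimal)
  moreover have "finite B" using independent_forms[OF B(2,1)] by simp
  ultimately show ?thesis using that by (auto simp: hilb_def)
qed

text \<open>Multiplication by \<open>s\<close> is injective on forms, because the coordinate ring is
  a domain by \<open>C_prime\<close>.\<close>

lemma mult_form_independent:
  assumes s: "hpoly n e s" "x0 \<in> C" "s x0 \<noteq> 0" and B: "B \<subseteq> forms m" "fvs.independent B"
  shows "fvs.independent ((\<lambda>f x. s x * f x) ` B)" "inj_on (\<lambda>f x. s x * f x) B" "(\<lambda>f x. s x * f x) ` B \<subseteq> forms (m + e)"
proof -
  define \<mu> where "\<mu> = (\<lambda>f x. s x * f x)"
  have lin: "Vector_Spaces.linear fscale fscale \<mu>"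
    by unfold_locales (auto simp: \<mu>_def fscale_def fun_eq_iff algebra_simps)
  have sp: "fvs.span B \<subseteq> forms m" using B(1) subspace_forms by (rule fvs.span_minimal)
  have inj: "inj_on \<mu> (fvs.span B)"
  proof (rule inj_onI)
    fix f g assume fg: "f \<in> fvs.span B" "g \<in> fvs.span B" "\<mu> f = \<mu> g"
    then have "f \<in> forms m" "g \<in> forms m" using sp by auto
    then obtain p q where pq: "f = res p" "hpoly n m p" "g = res q" "hpoly n m q" by (auto simp: forms_def)
    have "hpoly n m (\<lambda>x. p x - q x)" using pq by (intro hpoly_diff)
    moreover have "s x * (p x - q x) = 0" if "x \<in> C" for x
      using fun_cong[OF fg(3), of x] that pq by (simp add: \<mu>_def res_def algebra_simps)
    ultimately have "(\<forall>x\<in>C. s x = 0) \<or> (\<forall>x\<in>C. p x - q x = 0)" using C_prime[OF s(1)] by blast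
    then have "\<forall>x\<in>C. p x = q x" using s by auto
    then show "f = g" by (auto simp: pq res_def)
  qed
  show "fvs.independent ((\<lambda>f x. s x * f x) ` B)"
    using fvs2.linear_independent_injective_image[OF lin B(2) inj] by (simp add: \<mu>_def)
  show "inj_on (\<lambda>f x. s x * f x) B" using inj_on_subset[OF inj fvs.span_superset] by (simp add: \<mu>_def)
  show "(\<lambda>f x. s x * f x) ` B \<subseteq> forms (m + e)"
  proof
    fix g assume "g \<in> (\<lambda>f x. s x * f x) ` B"
    then obtain p where p: "g = (\<lambda>x. s x * res p x)" "hpoly n m p" using B(1) by (auto simp: forms_def)
    then show "g \<in> forms (m + e)" unfolding forms_def using hpoly.mult[OF p(2) s(1)]
      by (intro CollectI exI[of _ "\<lambda>x. p x * s x"]) (auto simp: res_def mult.commute)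
  qed
qed

lemma hilb_mono: "hilb m \<le> hilb (m + k)"
proof -
  obtain x0 i where x: "x0 \<in> C" "i < n" "x0 i \<noteq> 0" using C_nonempty C_nonzero by blast
  obtain B where B: "B \<subseteq> forms m" "fvs.independent B" "card B = hilb m" using forms_basis by metis
  note m = mult_form_independent[OF hpoly_var_power[OF x(2), of k] x(1) _ B(1,2)]
  have "card ((\<lambda>f x. x i ^ k * f x) ` B) \<le> hilb (m + k)" using independent_forms[OF m(1,3)] x by simp
  then show ?thesis using card_image[OF m(2)] x B by simp
qed

lemma hilb_0: "hilb 0 \<ge> 1"
proof -
  have "fvs.independent {res (\<lambda>x. 1)}" using C_nonempty by (auto simp: res_def fun_eq_iff)
  moreover have "{res (\<lambda>x. 1)} \<subseteq> forms 0" unfolding forms_def using hpoly_one by blast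
  ultimately show ?thesis using independent_forms by fastforce
qed

text \<open>Each use of \<open>\<Phi>_finite\<close> lowers the degree of the factor
  \<open>p\<close> by \<open>d\<close> and moves one coordinate of \<open>\<Phi>\<close> into
  \<open>r\<close>, until degree \<open>M0 + 1\<close> remains.\<close>

lemma forms_iterate:
  assumes "hpoly n (M0 + 1 + d * q) p" "hpoly n j r"
  shows "res (\<lambda>x. p x * r (\<Phi> x)) \<in> fvs.span {res (\<lambda>x. p x * r (\<Phi> x)) | p r. hpoly n (M0 + 1) p \<and> hpoly n (j + q) r}"
  using assms
proof (induction q arbitrary: j p r)
  case 0
  then show ?case by (intro fvs.span_base) auto
next
  case (Suc q)
  obtain Q where Q: "\<And>b. b < n \<Longrightarrow> hpoly n (M0 + 1 + d * Suc q - d) (Q b)" "\<And>x. x \<in> C \<Longrightarrow> p x = (\<Sum>b<n. Q b x * \<Phi> x b)"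
    using \<Phi>_finite[OF Suc.prems(1)] by auto
  define g where "g = (\<lambda>b. res (\<lambda>x. Q b x * (\<Phi> x b * r (\<Phi> x))))"
  have "g b \<in> fvs.span {res (\<lambda>x. p x * r (\<Phi> x)) | p r. hpoly n (M0 + 1) p \<and> hpoly n (j + Suc q) r}" if b: "b < n" for b
  proof -
    have 1: "hpoly n (M0 + 1 + d * q) (Q b)" using Q(1)[OF b] by simp
    have 2: "hpoly n (1 + j) (\<lambda>x. x b * r x)" using hpoly.mult[OF hpoly.var[OF b] Suc.prems(2)] .
    from Suc.IH[OF 1 2] show ?thesis by (simp add: g_def)
  qed
  then have "(\<Sum>b<n. g b) \<in> fvs.span {res (\<lambda>x. p x * r (\<Phi> x)) | p r. hpoly n (M0 + 1) p \<and> hpoly n (j + Suc q) r}"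
    by (intro fvs.span_sum) auto
  moreover have "(\<Sum>b<n. g b) = res (\<lambda>x. p x * r (\<Phi> x))"
  proof
    fix x
    have "(\<Sum>b\<in>S. g b) x = (\<Sum>b\<in>S. g b x)" for S by (induction S rule: infinite_finite_induct) auto
    then show "(\<Sum>b<n. g b) x = res (\<lambda>x. p x * r (\<Phi> x)) x"
      using Q(2)[of x] by (simp add: g_def res_def sum_distrib_right mult.assoc)
  qed
  ultimately show ?case by simp
qed

text \<open>Forms of degree \<open>M0 + 1 + d * (m + e)\<close> are spanned by products of a
  monomial of degree \<open>M0 + 1\<close> with \<open>r \<circ> \<Phi>\<close>, where
  \<open>r\<close> has degree \<open>m + e\<close>. Multiples of \<open>s\<close> contribute
  nothing, so only \<open>hilb (m + e) - hilb m\<close> dimensions of \<open>r\<close>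
  count.\<close>

lemma hilb_iterate:
  assumes s: "hpoly n e s" "x0 \<in> C" "s x0 \<noteq> 0" "\<And>x. x \<in> C \<Longrightarrow> s (\<Phi> x) = 0"
  shows "hilb (M0 + 1 + d * (m + e)) + card (expo n (M0 + 1)) * hilb m \<le> card (expo n (M0 + 1)) * hilb (m + e)"
proof -
  define c where "c = card (expo n (M0 + 1))"
  obtain B where B: "B \<subseteq> forms m" "fvs.independent B" "card B = hilb m" using forms_basis by metis
  define \<mu>B where "\<mu>B = (\<lambda>f x. s x * f x) ` B"
  note mi = mult_form_independent[OF s(1-3) B(1,2), folded \<mu>B_def]
  obtain B' where B': "\<mu>B \<subseteq> B'" "B' \<subseteq> forms (m + e)" "fvs.independent B'" "forms (m + e) \<subseteq> fvs.span B'"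
    using fvs.maximal_independent_subset_extend[OF mi(3,1)] by blast
  have fB': "finite B'" using independent_forms[OF B'(3,2)] by simp
  have cB': "card B' = hilb (m + e)" unfolding hilb_def by (rule fvs.basis_card_eq_dim[OF B'(2,4,3)])
  have c\<mu>: "card \<mu>B = hilb m" unfolding \<mu>B_def using card_image[OF mi(2)] B(3) by simp
  \<comment> \<open>A basis of a complement to the multiples of \<open>s\<close>.\<close>
  define E where "E = B' - \<mu>B"
  have cE: "card E + hilb m = hilb (m + e)"
    unfolding E_def using card_Diff_subset[of \<mu>B B'] B'(1) fB' finite_subset[OF B'(1)] card_mono[OF fB' B'(1)] c\<mu> cB' by simp
  define \<Psi> where "\<Psi> = (\<lambda>\<alpha> f. res (\<lambda>x. monom_at n \<alpha> x * f (\<Phi> x)))"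
  have lin: "Vector_Spaces.linear fscale fscale (\<Psi> \<alpha>)" for \<alpha>
    by unfold_locales (auto simp: \<Psi>_def res_def fscale_def fun_eq_iff algebra_simps)
  define W where "W = (\<lambda>(\<alpha>, f). \<Psi> \<alpha> f) ` (expo n (M0 + 1) \<times> E)"
  have fW: "finite W" using finite_expo fB' by (auto simp: W_def E_def)
  have cW: "card W \<le> c * card E"
    unfolding W_def c_def using card_image_le[of "expo n (M0 + 1) \<times> E" "\<lambda>(\<alpha>, f). \<Psi> \<alpha> f"] finite_expo[of n "M0 + 1"] fB'
    by (simp add: E_def card_cartesian_product)
  have gen: "res (\<lambda>x. p x * r (\<Phi> x)) \<in> fvs.span W" if p: "hpoly n (M0 + 1) p" and r: "hpoly n (m + e) r" for p r
  proof -
    have \<Psi>W: "\<Psi> \<alpha> (res r) \<in> fvs.span W" if \<alpha>: "\<alpha> \<in> expo n (M0 + 1)" for \<alpha>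
    proof -
      have "res r \<in> fvs.span B'" using B'(4) r by (auto simp: forms_def)
      then have "\<Psi> \<alpha> (res r) \<in> fvs.span (\<Psi> \<alpha> ` B')" using fvs2.linear_span_image[OF lin] by blast
      moreover have "\<Psi> \<alpha> ` B' \<subseteq> fvs.span W"
      proof
        fix g assume "g \<in> \<Psi> \<alpha> ` B'"
        then obtain f where f: "f \<in> B'" "g = \<Psi> \<alpha> f" by blast
        show "g \<in> fvs.span W"
        proof (cases "f \<in> \<mu>B")
          case True
          then obtain f' where "f = (\<lambda>x. s x * f' x)" by (auto simp: \<mu>B_def)
          then have "g = 0" using f(2) s(4) by (auto simp: \<Psi>_def res_def fun_eq_iff)
          then show ?thesis by (simp add: fvs.span_zero)
        next
          case False
          then have "g \<in> W" unfolding W_def using f \<alpha> by (intro image_eqI[of _ _ "(\<alpha>, f)"]) (auto simp: E_def)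
          then show ?thesis by (rule fvs.span_base)
        qed
      qed
      ultimately show ?thesis using fvs.span_minimal[OF _ fvs.subspace_span] by blast
    qed
    obtain k where k: "\<forall>x. p x = (\<Sum>\<alpha>\<in>expo n (M0 + 1). to_ac (k \<alpha>) * monom_at n \<alpha> x)" using hpoly_monomials[OF p] by blast
    have "(\<Sum>\<alpha>\<in>expo n (M0 + 1). fscale (k \<alpha>) (\<Psi> \<alpha> (res r))) \<in> fvs.span W"
      by (intro fvs.span_sum fvs.span_scale \<Psi>W)
    moreover have "(\<Sum>\<alpha>\<in>expo n (M0 + 1). fscale (k \<alpha>) (\<Psi> \<alpha> (res r))) = res (\<lambda>x. p x * r (\<Phi> x))"
    proof
      fix x
      have "(\<Sum>\<alpha>\<in>S. fscale (k \<alpha>) (\<Psi> \<alpha> (res r))) x = (\<Sum>\<alpha>\<in>S. fscale (k \<alpha>) (\<Psi> \<alpha> (res r)) x)" for S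
        by (induction S rule: infinite_finite_induct) auto
      then show "(\<Sum>\<alpha>\<in>expo n (M0 + 1). fscale (k \<alpha>) (\<Psi> \<alpha> (res r))) x = res (\<lambda>x. p x * r (\<Phi> x)) x"
        using k \<Phi>_C by (simp add: \<Psi>_def res_def fscale_def sum_distrib_right mult.assoc)
    qed
    ultimately show ?thesis by simp
  qed
  have "forms (M0 + 1 + d * (m + e)) \<subseteq> fvs.span W"
  proof
    fix f assume "f \<in> forms (M0 + 1 + d * (m + e))"
    then obtain p where p: "f = res p" "hpoly n (M0 + 1 + d * (m + e)) p" by (auto simp: forms_def)
    have "res (\<lambda>x. p x * 1) \<in> fvs.span {res (\<lambda>x. p x * r (\<Phi> x)) | p r. hpoly n (M0 + 1) p \<and> hpoly n (0 + (m + e)) r}"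
      using forms_iterate[OF p(2) hpoly_one] by simp
    moreover have sub: "{res (\<lambda>x. p x * r (\<Phi> x)) | p r. hpoly n (M0 + 1) p \<and> hpoly n (0 + (m + e)) r} \<subseteq> fvs.span W"
      using gen by auto
    ultimately have "res (\<lambda>x. p x * 1) \<in> fvs.span W" using subsetD[OF fvs.span_minimal[OF sub fvs.subspace_span]] by blast
    then show "f \<in> fvs.span W" using p(1) by simp
  qed
  then have "hilb (M0 + 1 + d * (m + e)) \<le> card W" unfolding hilb_def using fW by (intro fvs.dim_le_card)
  also have "\<dots> \<le> c * card E" by (rule cW)
  finally have "hilb (M0 + 1 + d * (m + e)) + c * hilb m \<le> c * (card E + hilb m)" by (simp add: distrib_left)
  then show ?thesis by (simp add: cE c_def)
qed

text \<open>If \<open>s\<close> is not zero on the cone, monotonicity bounds the first term in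
  \<open>hilb_iterate\<close> below by \<open>hilb (m + e)\<close>. So \<open>hilb\<close> grows by
  the factor \<open>c / (c - 1)\<close> in each step of length \<open>e\<close>, against
  \<open>hilb_le\<close>.\<close>

theorem dominant:
  assumes s: "hpoly n e s" "\<And>x. x \<in> C \<Longrightarrow> s (\<Phi> x) = 0" and x0: "x0 \<in> C"
  shows "s x0 = 0"
proof (rule ccontr)
  assume nz: "s x0 \<noteq> 0"
  define c where "c = card (expo n (M0 + 1))"
  have step: "c * hilb m + hilb (m + e) \<le> c * hilb (m + e)" for m
  proof -
    have "hilb (m + e) \<le> hilb ((m + e) + (M0 + 1 + (d - 1) * (m + e)))" by (rule hilb_mono)
    also have "(m + e) + (M0 + 1 + (d - 1) * (m + e)) = M0 + 1 + d * (m + e)" using d by (cases d) auto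
    finally show ?thesis using hilb_iterate[OF s(1) x0 nz s(2), of m] by (simp add: c_def)
  qed
  have pos: "hilb m \<ge> 1" for m using hilb_0 hilb_mono[of 0 m] by simp
  have c1: "c > 1"
  proof (rule ccontr)
    assume "\<not> c > 1"
    then have "c * hilb (0 + e) \<le> 1 * hilb (0 + e)" by (intro mult_le_mono1) simp
    then have "c * hilb 0 = 0" using step[of 0] by linarith
    then have "c = 0" using pos[of 0] by simp
    then show False using step[of 0] pos[of "0 + e"] by simp
  qed
  define a where "a = real c / real (c - 1)"
  have a: "a > 1" using c1 by (simp add: a_def)
  have grow: "a ^ k \<le> real (hilb (k * e))" for k
  proof (induction k)
    case 0 then show ?case using hilb_0 by simp
  next
    case (Suc k)
    have "real c * real (hilb (k * e)) + real (hilb (k * e + e)) \<le> real c * real (hilb (k * e + e))"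
      using step[of "k * e"] by (metis of_nat_add of_nat_le_iff of_nat_mult)
    then have "real c * real (hilb (k * e)) \<le> real (c - 1) * real (hilb (k * e + e))" using c1 by (simp add: algebra_simps)
    then have "a * real (hilb (k * e)) \<le> real (hilb (k * e + e))" using c1 by (simp add: a_def field_simps)
    moreover have "a ^ Suc k \<le> a * real (hilb (k * e))" using Suc a by simp
    ultimately show ?case by (simp add: add.commute)
  qed
  obtain k where "(real (k * e) + 1) ^ n < a ^ k" using exponential_beats_polynomial[OF a] by blast
  also have "\<dots> \<le> real (hilb (k * e))" by (rule grow)
  also have "\<dots> \<le> real ((k * e + 1) ^ n)" using hilb_le of_nat_mono by blast
  finally show False by (simp add: add.commute)
qed

end

section \<open>Embedded varieties\<close>

lemma homogeneous_hpoly: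
  fixes p :: "'k::field mpoly"
  assumes "homogeneous M D p" shows "hpoly (Suc M) D (mpoly_eval p)"
proof -
  have mono: "hpoly (Suc M) (\<Sum>i\<in>K. a i) (\<lambda>x :: nat \<Rightarrow> 'k alg_closure. \<Prod>i\<in>K. x i ^ a i)" if "finite K" "K \<subseteq> {..M}" for K and a :: "nat \<Rightarrow> nat"
    using that
  proof (induction K)
    case empty then show ?case by (simp add: hpoly_one)
  next
    case (insert i K)
    then have "hpoly (Suc M) (a i + (\<Sum>i\<in>K. a i)) (\<lambda>x :: nat \<Rightarrow> 'k alg_closure. x i ^ a i * (\<Prod>i\<in>K. x i ^ a i))"
      by (intro hpoly.mult hpoly_var_power) auto
    then show ?case using insert by simp
  qed
  have "hpoly (Suc M) D (\<lambda>x. to_ac (Poly_Mapping.lookup p m) * (\<Prod>i\<in>Poly_Mapping.keys m. x i ^ Poly_Mapping.lookup m i))"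
    if "m \<in> Poly_Mapping.keys p" for m
    using mono[of "Poly_Mapping.keys m" "Poly_Mapping.lookup m"] assms that
    by (intro hpoly_scale) (auto simp: homogeneous_def)
  then have "hpoly (Suc M) D (\<lambda>x. \<Sum>m\<in>Poly_Mapping.keys p. to_ac (Poly_Mapping.lookup p m) * (\<Prod>i\<in>Poly_Mapping.keys m. x i ^ Poly_Mapping.lookup m i))"
    by (rule hpoly_sum)
  then show ?thesis by (simp add: mpoly_eval_def[abs_def])
qed

lemma hpoly_homogeneous_mpoly:
  fixes q :: "(nat \<Rightarrow> 'k::field alg_closure) \<Rightarrow> 'k alg_closure"
  assumes "hpoly (Suc M) D q" shows "\<exists>p. homogeneous M D p \<and> (\<forall>x. mpoly_eval p x = q x)"
proof -
  define n where "n = Suc M"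
  obtain c where c: "\<And>x. q x = (\<Sum>\<alpha>\<in>expo n D. to_ac (c \<alpha>) * monom_at n \<alpha> x)"
    using hpoly_monomials[OF assms] by (auto simp: n_def)
  define g where "g = (\<lambda>\<alpha>. Abs_poly_mapping \<alpha> :: nat \<Rightarrow>\<^sub>0 nat)"
  have fin: "finite {i. \<alpha> i \<noteq> 0}" if "\<alpha> \<in> expo n D" for \<alpha>
    by (rule finite_subset[of _ "{..<n}"]) (use that in \<open>auto simp: expo_def not_less[symmetric]\<close>)
  have lg: "Poly_Mapping.lookup (g \<alpha>) = \<alpha>" if "\<alpha> \<in> expo n D" for \<alpha>
    unfolding g_def using fin[OF that] by (simp add: Abs_poly_mapping_inverse)
  define h where "h = (\<lambda>m. if Poly_Mapping.lookup m \<in> expo n D then c (Poly_Mapping.lookup m) else 0)"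
  have gl: "g (Poly_Mapping.lookup m) = m" for m by (simp add: g_def Poly_Mapping.lookup_inverse)
  have sub: "{m. h m \<noteq> 0} \<subseteq> g ` expo n D"
  proof
    fix m assume "m \<in> {m. h m \<noteq> 0}"
    then have "Poly_Mapping.lookup m \<in> expo n D" by (auto simp: h_def split: if_splits)
    then show "m \<in> g ` expo n D" using gl by (metis image_eqI)
  qed
  have fh: "finite {m. h m \<noteq> 0}" using sub finite_expo finite_subset by blast
  define p where "p = Abs_poly_mapping h"
  have lp: "Poly_Mapping.lookup p = h" unfolding p_def using fh by (simp add: Abs_poly_mapping_inverse)
  have kp: "Poly_Mapping.keys p = {m. h m \<noteq> 0}" by (simp add: Poly_Mapping.keys.rep_eq lp)
  have keys_g: "Poly_Mapping.keys (g \<alpha>) = {i. \<alpha> i \<noteq> 0}" if "\<alpha> \<in> expo n D" for \<alpha>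
    by (simp add: Poly_Mapping.keys.rep_eq lg[OF that])
  have "homogeneous M D p"
    unfolding homogeneous_def
  proof
    fix m assume "m \<in> Poly_Mapping.keys p"
    then obtain \<alpha> where a: "\<alpha> \<in> expo n D" "m = g \<alpha>" using sub kp by auto
    have "{i. \<alpha> i \<noteq> 0} \<subseteq> {..<n}" using a(1) by (auto simp: expo_def not_less[symmetric])
    moreover from this have "(\<Sum>i\<in>{i. \<alpha> i \<noteq> 0}. \<alpha> i) = (\<Sum>i<n. \<alpha> i)" by (intro sum.mono_neutral_left) auto
    ultimately show "Poly_Mapping.keys m \<subseteq> {..M} \<and> (\<Sum>i\<in>Poly_Mapping.keys m. Poly_Mapping.lookup m i) = D"
      using a by (auto simp: keys_g lg n_def expo_def)
  qed
  moreover have "mpoly_eval p x = q x" for x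
  proof -
    have "mpoly_eval p x = (\<Sum>m\<in>g ` expo n D. to_ac (h m) * (\<Prod>i\<in>Poly_Mapping.keys m. x i ^ Poly_Mapping.lookup m i))"
      unfolding mpoly_eval_def lp kp using sub finite_expo by (intro sum.mono_neutral_left) auto
    also have "\<dots> = (\<Sum>\<alpha>\<in>expo n D. to_ac (h (g \<alpha>)) * (\<Prod>i\<in>Poly_Mapping.keys (g \<alpha>). x i ^ Poly_Mapping.lookup (g \<alpha>) i))"
    proof (rule sum.reindex[unfolded o_def])
      show "inj_on g (expo n D)" by (rule inj_onI) (metis lg)
    qed
    also have "\<dots> = (\<Sum>\<alpha>\<in>expo n D. to_ac (c \<alpha>) * monom_at n \<alpha> x)"
    proof (rule sum.cong)
      fix \<alpha> assume a: "\<alpha> \<in> expo n D"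
      have "{i. \<alpha> i \<noteq> 0} \<subseteq> {..<n}" using a by (auto simp: expo_def not_less[symmetric])
      then have "(\<Prod>i\<in>{i. \<alpha> i \<noteq> 0}. x i ^ \<alpha> i) = (\<Prod>i<n. x i ^ \<alpha> i)" by (intro prod.mono_neutral_left) auto
      then show "to_ac (h (g \<alpha>)) * (\<Prod>i\<in>Poly_Mapping.keys (g \<alpha>). x i ^ Poly_Mapping.lookup (g \<alpha>) i) = to_ac (c \<alpha>) * monom_at n \<alpha> x"
        using a by (simp add: keys_g lg h_def monom_at_def)
    qed simp
    finally show ?thesis by (simp add: c)
  qed
  ultimately show ?thesis by blast
qed

lemma proj_space_point:
  assumes "Q \<in> proj_space M" "x \<in> Q"
  shows "Q = proj_class x" "\<And>i. M < i \<Longrightarrow> x i = 0" "\<exists>i<Suc M. x i \<noteq> 0"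
    and "y \<in> Q \<Longrightarrow> \<exists>c. c \<noteq> 0 \<and> y = (\<lambda>i. c * x i)" and "c \<noteq> 0 \<Longrightarrow> (\<lambda>i. c * x i) \<in> Q"
proof -
  obtain z where z: "Q = proj_class z" "\<forall>i>M. z i = 0" "\<exists>i. z i \<noteq> 0" using assms(1) by (auto simp: proj_space_def)
  obtain k where k: "k \<noteq> 0" "x = (\<lambda>i. k * z i)" using assms(2) z(1) by (auto simp: proj_class_def)
  show 1: "Q = proj_class x"
  proof -
    have "y \<in> proj_class x" if yz: "y \<in> proj_class z" for y
    proof -
      obtain c where "c \<noteq> 0" "y = (\<lambda>i. c * z i)" using yz unfolding proj_class_def by blast
      then have "c / k \<noteq> 0" "y = (\<lambda>i. c / k * x i)" using k by auto
      then show ?thesis unfolding proj_class_def by blast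
    qed
    moreover have "y \<in> proj_class z" if yx: "y \<in> proj_class x" for y
    proof -
      obtain c where "c \<noteq> 0" "y = (\<lambda>i. c * x i)" using yx unfolding proj_class_def by blast
      then have "c * k \<noteq> 0" "y = (\<lambda>i. c * k * z i)" using k by (auto simp: mult.assoc)
      then show ?thesis unfolding proj_class_def by blast
    qed
    ultimately show ?thesis unfolding z(1) by blast
  qed
  show "\<And>i. M < i \<Longrightarrow> x i = 0" using z k by simp
  show "\<exists>i<Suc M. x i \<noteq> 0" using z(2,3) k by (metis mult_eq_0_iff not_less_eq)
  show "y \<in> Q \<Longrightarrow> \<exists>c. c \<noteq> 0 \<and> y = (\<lambda>i. c * x i)" unfolding 1 proj_class_def by blast
  show "c \<noteq> 0 \<Longrightarrow> (\<lambda>i. c * x i) \<in> Q" unfolding 1 proj_class_def by blast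
qed

lemma proj_space_ex: "Q \<in> proj_space M \<Longrightarrow> \<exists>x. x \<in> Q"
proof -
  assume "Q \<in> proj_space M"
  then obtain z where "Q = proj_class z" by (auto simp: proj_space_def)
  then show ?thesis unfolding proj_class_def by (intro exI[of _ "\<lambda>i. 1 * z i"]) force
qed

lemma hpoly_nonzero_class:
  assumes "Q \<in> proj_space M" "hpoly (Suc M) D p" "x \<in> Q" "y \<in> Q" "p x \<noteq> 0" shows "p y \<noteq> 0"
proof -
  obtain c where "c \<noteq> 0" "y = (\<lambda>i. c * x i)" using proj_space_point(4)[OF assms(1,3,4)] by blast
  then show ?thesis using hpoly_homogeneous[OF assms(2), of c x] assms(5) by simp
qed

lemma proj_closed_hpoly:
  "proj_closed M Z \<longleftrightarrow> (\<exists>S. (\<forall>p\<in>S. \<exists>D. hpoly (Suc M) D p) \<and> Z = {P \<in> proj_space M. \<forall>p\<in>S. \<forall>x\<in>P. p x = 0})"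
proof
  assume "proj_closed M Z"
  then obtain S where S: "\<forall>p\<in>S. \<exists>d. homogeneous M d p" "Z = {P \<in> proj_space M. \<forall>p\<in>S. \<forall>x\<in>P. mpoly_eval p x = 0}"
    by (auto simp: proj_closed_def)
  have "\<forall>p\<in>mpoly_eval ` S. \<exists>D. hpoly (Suc M) D p" using S(1) homogeneous_hpoly by blast
  moreover have "Z = {P \<in> proj_space M. \<forall>p\<in>mpoly_eval ` S. \<forall>x\<in>P. p x = 0}" unfolding S(2) by auto
  ultimately show "\<exists>S. (\<forall>p\<in>S. \<exists>D. hpoly (Suc M) D p) \<and> Z = {P \<in> proj_space M. \<forall>p\<in>S. \<forall>x\<in>P. p x = 0}" by blast
next
  assume "\<exists>S. (\<forall>p\<in>S. \<exists>D. hpoly (Suc M) D p) \<and> Z = {P \<in> proj_space M. \<forall>p\<in>S. \<forall>x\<in>P. p x = 0}"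
  then obtain S where S: "\<forall>p\<in>S. \<exists>D. hpoly (Suc M) D p" "Z = {P \<in> proj_space M. \<forall>p\<in>S. \<forall>x\<in>P. p x = 0}" by blast
  have "\<forall>p\<in>S. \<exists>p'. (\<exists>D. homogeneous M D p') \<and> (\<forall>x. mpoly_eval p' x = p x)" using S(1) hpoly_homogeneous_mpoly by blast
  from bchoice[OF this] obtain g where g: "\<And>p. p \<in> S \<Longrightarrow> \<exists>D. homogeneous M D (g p)" "\<And>p x. p \<in> S \<Longrightarrow> mpoly_eval (g p) x = p x"
    by blast
  have "\<forall>p\<in>g ` S. \<exists>D. homogeneous M D p" using g(1) by blast
  moreover have "Z = {P \<in> proj_space M. \<forall>p\<in>g ` S. \<forall>x\<in>P. mpoly_eval p x = 0}" unfolding S(2) by (auto simp: g(2))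
  ultimately show "proj_closed M Z" unfolding proj_closed_def by blast
qed

lemma proj_closed_zeros: "hpoly (Suc M) D p \<Longrightarrow> proj_closed M {P \<in> proj_space M. \<forall>x\<in>P. p x = 0}"
  unfolding proj_closed_hpoly by (intro exI[of _ "{p}"]) auto

lemma proj_closed_Un:
  assumes "proj_closed M Z" "proj_closed M Z'" shows "proj_closed M (Z \<union> Z')"
proof -
  obtain S where S: "\<forall>p\<in>S. \<exists>D. hpoly (Suc M) D p" "Z = {P \<in> proj_space M. \<forall>p\<in>S. \<forall>x\<in>P. p x = 0}"
    using assms(1) unfolding proj_closed_hpoly by blast
  obtain S' where S': "\<forall>p\<in>S'. \<exists>D. hpoly (Suc M) D p" "Z' = {P \<in> proj_space M. \<forall>p\<in>S'. \<forall>x\<in>P. p x = 0}"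
    using assms(2) unfolding proj_closed_hpoly by blast
  define R where "R = {(\<lambda>x. p x * q x) | p q. p \<in> S \<and> q \<in> S'}"
  have "\<forall>r\<in>R. \<exists>D. hpoly (Suc M) D r"
  proof
    fix r assume "r \<in> R"
    then obtain p q where "r = (\<lambda>x. p x * q x)" "p \<in> S" "q \<in> S'" by (auto simp: R_def)
    then show "\<exists>D. hpoly (Suc M) D r" using S(1) S'(1) hpoly.mult by metis
  qed
  moreover have "Z \<union> Z' = {P \<in> proj_space M. \<forall>p\<in>R. \<forall>x\<in>P. p x = 0}"
  proof (intro subset_antisym subsetI)
    fix P assume "P \<in> Z \<union> Z'"
    then show "P \<in> {P \<in> proj_space M. \<forall>p\<in>R. \<forall>x\<in>P. p x = 0}" by (auto simp: S S' R_def)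
  next
    fix P assume P: "P \<in> {P \<in> proj_space M. \<forall>p\<in>R. \<forall>x\<in>P. p x = 0}"
    show "P \<in> Z \<union> Z'"
    proof (rule ccontr)
      assume "P \<notin> Z \<union> Z'"
      then obtain p q x y where h: "p \<in> S" "x \<in> P" "p x \<noteq> 0" "q \<in> S'" "y \<in> P" "q y \<noteq> 0" using P unfolding S S' by auto
      obtain D where "hpoly (Suc M) D q" using S' h by blast
      then have qx: "q x \<noteq> 0" using hpoly_nonzero_class[of P M D q y x] P h by auto
      have "(\<lambda>x. p x * q x) \<in> R" using h by (auto simp: R_def)
      moreover have "\<forall>r\<in>R. \<forall>x\<in>P. r x = 0" using P by simp
      ultimately have "p x * q x = 0" using h(2) by fast
      with qx show False using h by simp
    qed
  qed
  ultimately show ?thesis unfolding proj_closed_hpoly by blast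
qed

lemma zariski_open_Int: "zariski_open N V U \<Longrightarrow> zariski_open N V U' \<Longrightarrow> zariski_open N V (U \<inter> U')"
proof -
  assume "zariski_open N V U" "zariski_open N V U'"
  then obtain Z Z' where "proj_closed N Z" "U = V - Z" "proj_closed N Z'" "U' = V - Z'" by (auto simp: zariski_open_def)
  then have "proj_closed N (Z \<union> Z')" "U \<inter> U' = V - (Z \<union> Z')" using proj_closed_Un by auto
  then show ?thesis unfolding zariski_open_def by blast
qed

section \<open>Morphisms and coordinate quotients\<close>

lemma morphismD:
  assumes "morphism N V M W f"
  shows "P \<in> V \<Longrightarrow> f P \<in> W" "zariski_open M W U \<Longrightarrow> zariski_open N V {P \<in> V. f P \<in> U}"
    "zariski_open M W U \<Longrightarrow> regular_on M W U \<phi> \<Longrightarrow> regular_on N V {P \<in> V. f P \<in> U} (\<lambda>P. \<phi> (f P))"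
  using assms unfolding morphism_def by blast+

lemma morphism_comp:
  assumes f: "morphism N V M W f" and g: "morphism M W K Y g" shows "morphism N V K Y (\<lambda>P. g (f P))"
  unfolding morphism_def
proof (intro conjI allI impI)
  show "(\<lambda>P. g (f P)) ` V \<subseteq> Y" using morphismD(1)[OF f] morphismD(1)[OF g] by blast
  have e: "{P \<in> V. g (f P) \<in> U} = {P \<in> V. f P \<in> {Q \<in> W. g Q \<in> U}}" for U using morphismD(1)[OF f] by blast
  {
    fix U assume "zariski_open K Y U"
    from morphismD(2)[OF f morphismD(2)[OF g this]]
    show "zariski_open N V {P \<in> V. g (f P) \<in> U}" unfolding e .
  next
    fix U \<phi> assume U: "zariski_open K Y U \<and> regular_on K Y U \<phi>"
    from morphismD(3)[OF f morphismD(2)[OF g] morphismD(3)[OF g]] U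
    show "regular_on N V {P \<in> V. g (f P) \<in> U} (\<lambda>P. \<phi> (g (f P)))" unfolding e by blast
  }
qed

lemma morphism_id: "morphism N V N V (\<lambda>P. P)"
proof -
  have e: "{P \<in> V. P \<in> U} = U" if "zariski_open N V U" for U using that by (auto simp: zariski_open_def)
  show ?thesis unfolding morphism_def using e by auto
qed

lemma morphism_funpow: "morphism N V N V f \<Longrightarrow> morphism N V N V (f ^^ j)"
proof (induction j)
  case 0 show ?case unfolding funpow.simps id_def by (rule morphism_id)
next
  case (Suc j)
  then show ?case using morphism_comp[OF Suc.IH[OF Suc.prems] Suc.prems] by (simp add: o_def)
qed

lemma morphism_word_map:
  assumes "morphism N V N V a" "morphism N V N V b" shows "morphism N V N V (word_map a b w)"
proof (induction w)
  case Nil show ?case unfolding word_map_def foldr.simps id_def by (rule morphism_id)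
next
  case (Cons l w)
  have "morphism N V N V (if l then a else b)" using assms by simp
  from morphism_comp[OF Cons.IH this] show ?case by (simp add: word_map_def o_def)
qed

text \<open>It uses the same choice of representative as \<open>twisting_bundle\<close>, so that the
  transition functions of O(1) are literally values of \<open>coord\<close>.\<close>

definition coord :: "nat \<Rightarrow> nat \<Rightarrow> 'k::field proj_point \<Rightarrow> 'k alg_closure" where
  "coord b c Q = (SOME x. x \<in> Q) b / (SOME x. x \<in> Q) c"

lemma coord_eq:
  assumes "Q \<in> proj_space M" "x \<in> Q" shows "coord b c Q = x b / x c"
proof -
  have "(SOME x. x \<in> Q) \<in> Q" using assms(2) some_in_eq[of Q] by blast
  then obtain k where "k \<noteq> 0" "(SOME x. x \<in> Q) = (\<lambda>i. k * x i)" using proj_space_point(4)[OF assms] by blast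
  then show ?thesis by (simp add: coord_def)
qed

section \<open>Rational functions on the embedded variety\<close>

locale embedded_variety =
  fixes N M :: nat and V :: "'k::field proj_point set" and e e' :: "'k proj_point \<Rightarrow> 'k proj_point"
  assumes var: "projective_variety N V" and closed: "proj_closed M (e ` V)"
    and e: "morphism N V M (e ` V) e" and e': "morphism M (e ` V) N V e'" and e'e: "P \<in> V \<Longrightarrow> e' (e P) = P"
begin

abbreviation "W \<equiv> e ` V"
abbreviation "n \<equiv> Suc M"

definition cone :: "(nat \<Rightarrow> 'k alg_closure) set" where "cone = \<Union>W"

lemma W_proj: "Q \<in> W \<Longrightarrow> Q \<in> proj_space M"
  using closed by (auto simp: proj_closed_def)

lemma cone_class: "x \<in> cone \<Longrightarrow> proj_class x \<in> W \<and> x \<in> proj_class x"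
  unfolding cone_def using proj_space_point(1)[OF W_proj] by (metis UnionE)

lemma class_eq: "Q \<in> W \<Longrightarrow> x \<in> Q \<Longrightarrow> proj_class x = Q \<and> x \<in> cone"
  unfolding cone_def using proj_space_point(1)[OF W_proj] by (metis UnionI)

lemma ee': "Q \<in> W \<Longrightarrow> e (e' Q) = Q \<and> e' Q \<in> V"
  using e'e by auto

text \<open>
  Germs at \<open>Q\<close> of regular functions on \<open>U\<close>, including that \<open>U\<close> contains a neighbourhood of \<open>Q\<close>.
\<close>

definition rat :: "'k proj_point set \<Rightarrow> 'k proj_point \<Rightarrow> ('k proj_point \<Rightarrow> 'k alg_closure) \<Rightarrow> bool" where
  "rat U Q \<phi> \<longleftrightarrow> (\<exists>D p q. hpoly n D p \<and> hpoly n D q \<and> (\<forall>x\<in>Q. q x \<noteq> 0) \<and>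
     (\<forall>Q'\<in>W. \<forall>x\<in>Q'. q x \<noteq> 0 \<longrightarrow> Q' \<in> U \<and> \<phi> Q' = p x / q x))"

lemma ratI:
  "hpoly n D p \<Longrightarrow> hpoly n D q \<Longrightarrow> \<forall>x\<in>Q. q x \<noteq> 0 \<Longrightarrow>
     \<forall>Q'\<in>W. \<forall>x\<in>Q'. q x \<noteq> 0 \<longrightarrow> Q' \<in> U \<and> \<phi> Q' = p x / q x \<Longrightarrow> rat U Q \<phi>"
  unfolding rat_def by blast

text \<open>A form \<open>r\<close> that vanishes off the neighbourhood but not at \<open>Q\<close>
  is multiplied into numerator and denominator. Nonvanishing of the denominator alone then ensures
  that the quotient is valid.\<close>

lemma regular_rat:
  assumes "regular_on M W U \<phi>" "Q \<in> U" "Q \<in> W" shows "rat U Q \<phi>"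
proof -
  obtain U' d p q where h: "zariski_open M W U'" "Q \<in> U'" "U' \<subseteq> U" "homogeneous M d p" "homogeneous M d q"
    "\<forall>Q\<in>U'. \<forall>x\<in>Q. mpoly_eval q x \<noteq> 0 \<and> \<phi> Q = mpoly_eval p x / mpoly_eval q x"
    using assms(1,2) unfolding regular_on_def by blast
  obtain Z where Z: "proj_closed M Z" "U' = W - Z" using h(1) by (auto simp: zariski_open_def)
  obtain S where S: "\<forall>p\<in>S. \<exists>D. hpoly n D p" "Z = {P \<in> proj_space M. \<forall>p\<in>S. \<forall>x\<in>P. p x = 0}"
    using Z(1) unfolding proj_closed_hpoly by blast
  have "Q \<notin> Z" "Q \<in> proj_space M" using h(2) Z(2) W_proj assms(3) by auto
  then obtain r x where r: "r \<in> S" "x \<in> Q" "r x \<noteq> 0" unfolding S(2) by blast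
  obtain D where D: "hpoly n D r" using S(1) r by blast
  note hp = homogeneous_hpoly[OF h(4)] and hq = homogeneous_hpoly[OF h(5)]
  have rn: "r y \<noteq> 0" if "y \<in> Q" for y using hpoly_nonzero_class[OF W_proj[OF assms(3)] D r(2) that r(3)] .
  have "Q' \<in> U'" if "Q' \<in> W" "x \<in> Q'" "r x \<noteq> 0" for Q' x using that Z(2) S(2) r(1) by auto
  then have dm: "\<forall>Q'\<in>W. \<forall>x\<in>Q'. mpoly_eval q x * r x \<noteq> 0 \<longrightarrow> Q' \<in> U \<and> \<phi> Q' = (mpoly_eval p x * r x) / (mpoly_eval q x * r x)"
    using h(3,6) by auto
  have nz: "\<forall>x\<in>Q. mpoly_eval q x * r x \<noteq> 0" using rn h(2,6) by auto
  from ratI[OF hpoly.mult[OF hp D] hpoly.mult[OF hq D] nz dm] show ?thesis .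
qed

lemma rat_mult:
  assumes "rat U Q \<phi>" "rat U' Q \<psi>" shows "rat (U \<inter> U') Q (\<lambda>Q. \<phi> Q * \<psi> Q)"
proof -
  obtain D p q where p: "hpoly n D p" "hpoly n D q" "\<forall>x\<in>Q. q x \<noteq> 0"
    "\<forall>Q'\<in>W. \<forall>x\<in>Q'. q x \<noteq> 0 \<longrightarrow> Q' \<in> U \<and> \<phi> Q' = p x / q x" using assms(1) unfolding rat_def by blast
  obtain D' p' q' where p': "hpoly n D' p'" "hpoly n D' q'" "\<forall>x\<in>Q. q' x \<noteq> 0"
    "\<forall>Q'\<in>W. \<forall>x\<in>Q'. q' x \<noteq> 0 \<longrightarrow> Q' \<in> U' \<and> \<psi> Q' = p' x / q' x" using assms(2) unfolding rat_def by blast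
  have dm: "\<forall>Q'\<in>W. \<forall>x\<in>Q'. q x * q' x \<noteq> 0 \<longrightarrow> Q' \<in> U \<inter> U' \<and> \<phi> Q' * \<psi> Q' = (p x * p' x) / (q x * q' x)"
    using p(4) p'(4) by simp
  have nz: "\<forall>x\<in>Q. q x * q' x \<noteq> 0" using p(3) p'(3) by simp
  from ratI[OF hpoly.mult[OF p(1) p'(1)] hpoly.mult[OF p(2) p'(2)] nz dm] show ?thesis .
qed

lemma rat_diff:
  assumes "rat U Q \<phi>" "rat U' Q \<psi>" shows "rat (U \<inter> U') Q (\<lambda>Q. \<phi> Q - \<psi> Q)"
proof -
  obtain D p q where p: "hpoly n D p" "hpoly n D q" "\<forall>x\<in>Q. q x \<noteq> 0"
    "\<forall>Q'\<in>W. \<forall>x\<in>Q'. q x \<noteq> 0 \<longrightarrow> Q' \<in> U \<and> \<phi> Q' = p x / q x" using assms(1) unfolding rat_def by blast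
  obtain D' p' q' where p': "hpoly n D' p'" "hpoly n D' q'" "\<forall>x\<in>Q. q' x \<noteq> 0"
    "\<forall>Q'\<in>W. \<forall>x\<in>Q'. q' x \<noteq> 0 \<longrightarrow> Q' \<in> U' \<and> \<psi> Q' = p' x / q' x" using assms(2) unfolding rat_def by blast
  have dm: "\<forall>Q'\<in>W. \<forall>x\<in>Q'. q x * q' x \<noteq> 0 \<longrightarrow> Q' \<in> U \<inter> U' \<and> \<phi> Q' - \<psi> Q' = (p x * q' x - q x * p' x) / (q x * q' x)"
    using p(4) p'(4) by (auto simp: diff_frac_eq mult_ac)
  have nz: "\<forall>x\<in>Q. q x * q' x \<noteq> 0" using p(3) p'(3) by simp
  have hd: "hpoly n (D + D') (\<lambda>x. p x * q' x - q x * p' x)"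
    by (rule hpoly_diff[OF hpoly.mult[OF p(1) p'(2)] hpoly.mult[OF p(2) p'(1)]])
  from ratI[OF hd hpoly.mult[OF p(2) p'(2)] nz dm] show ?thesis .
qed

text \<open>With the denominator \<open>p * q\<close> instead of \<open>p\<close>, nonvanishing
  still implies membership in \<open>U\<close>.\<close>

lemma rat_inverse:
  assumes "rat U Q \<phi>" "Q \<in> W" "\<phi> Q \<noteq> 0" shows "rat U Q (\<lambda>Q. inverse (\<phi> Q))"
proof -
  obtain D p q where p: "hpoly n D p" "hpoly n D q" "\<forall>x\<in>Q. q x \<noteq> 0"
    "\<forall>Q'\<in>W. \<forall>x\<in>Q'. q x \<noteq> 0 \<longrightarrow> Q' \<in> U \<and> \<phi> Q' = p x / q x" using assms(1) unfolding rat_def by blast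
  have nz: "\<forall>x\<in>Q. p x * q x \<noteq> 0" using p(3,4) assms(2,3) by auto
  have dm: "\<forall>Q'\<in>W. \<forall>x\<in>Q'. p x * q x \<noteq> 0 \<longrightarrow> Q' \<in> U \<and> inverse (\<phi> Q') = (q x * q x) / (p x * q x)"
    using p(4) by simp
  from ratI[OF hpoly.mult[OF p(2) p(2)] hpoly.mult[OF p(1,2)] nz dm] show ?thesis .
qed

lemma rat_power:
  assumes "rat U Q \<phi>" shows "rat U Q (\<lambda>Q. \<phi> Q ^ Suc k)"
proof (induction k)
  case 0 then show ?case using assms by simp
next
  case (Suc k) then show ?case using rat_mult[OF assms Suc.IH] by simp
qed

lemma rat_pull:
  assumes g: "morphism N V N V g" and U: "zariski_open N V U" "regular_on N V U \<phi>" and Q: "Q \<in> W" "g (e' Q) \<in> U"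
  shows "rat {Q \<in> W. g (e' Q) \<in> U} Q (\<lambda>Q. \<phi> (g (e' Q)))"
proof -
  have "morphism M W N V (\<lambda>Q. g (e' Q))" by (rule morphism_comp[OF e' g])
  then have "regular_on M W {Q \<in> W. g (e' Q) \<in> U} (\<lambda>Q. \<phi> (g (e' Q)))" using morphismD(3) U by blast
  then show ?thesis using Q by (intro regular_rat) auto
qed

lemma coordinate_open: "c < n \<Longrightarrow> zariski_open M W {Q \<in> W. \<forall>x\<in>Q. x c \<noteq> 0}"
proof -
  assume c: "c < n"
  have "{Q \<in> W. \<forall>x\<in>Q. x c \<noteq> 0} = W - {P \<in> proj_space M. \<forall>x\<in>P. x c = 0}"
  proof (intro subset_antisym subsetI)
    fix Q assume Q: "Q \<in> {Q \<in> W. \<forall>x\<in>Q. x c \<noteq> 0}"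
    then obtain x where "x \<in> Q" using proj_space_ex[OF W_proj, of Q] by auto
    then show "Q \<in> W - {P \<in> proj_space M. \<forall>x\<in>P. x c = 0}" using Q by auto
  next
    fix Q assume Q: "Q \<in> W - {P \<in> proj_space M. \<forall>x\<in>P. x c = 0}"
    then obtain x where "x \<in> Q" "x c \<noteq> 0" using W_proj by blast
    then show "Q \<in> {Q \<in> W. \<forall>x\<in>Q. x c \<noteq> 0}"
      using hpoly_nonzero_class[OF W_proj hpoly.var[OF c], of Q x] Q by auto
  qed
  then show ?thesis unfolding zariski_open_def using proj_closed_zeros[OF hpoly.var[OF c]] by blast
qed

lemma coord_regular:
  assumes "b < n" "c < n" shows "regular_on M W {Q \<in> W. \<forall>x\<in>Q. x c \<noteq> 0} (coord b c)"
  unfolding regular_on_def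
proof
  fix P assume P: "P \<in> {Q \<in> W. \<forall>x\<in>Q. x c \<noteq> 0}"
  obtain p :: "'k mpoly" where p: "homogeneous M 1 p" "\<And>x. mpoly_eval p x = x b" using hpoly_homogeneous_mpoly[OF hpoly.var[OF assms(1)]] by blast
  obtain q :: "'k mpoly" where q: "homogeneous M 1 q" "\<And>x. mpoly_eval q x = x c" using hpoly_homogeneous_mpoly[OF hpoly.var[OF assms(2)]] by blast
  show "\<exists>U' d p q. zariski_open M W U' \<and> P \<in> U' \<and> U' \<subseteq> {Q \<in> W. \<forall>x\<in>Q. x c \<noteq> 0} \<and> homogeneous M d p \<and> homogeneous M d q \<and>
      (\<forall>Q\<in>U'. \<forall>x\<in>Q. mpoly_eval q x \<noteq> 0 \<and> coord b c Q = mpoly_eval p x / mpoly_eval q x)"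
  proof -
    have "\<forall>Q\<in>{Q \<in> W. \<forall>x\<in>Q. x c \<noteq> 0}. \<forall>x\<in>Q. mpoly_eval q x \<noteq> 0 \<and> coord b c Q = mpoly_eval p x / mpoly_eval q x"
      using coord_eq[OF W_proj] by (auto simp: p(2) q(2))
    then show ?thesis using coordinate_open[OF assms(2)] P p(1) q(1) by blast
  qed
qed

lemma coord_rat:
  assumes g: "morphism N V N V g" and "b < n" "c < n" and Q: "Q \<in> W" "\<forall>y\<in>e (g (e' Q)). y c \<noteq> 0"
  shows "rat {Q \<in> W. \<forall>y\<in>e (g (e' Q)). y c \<noteq> 0} Q (\<lambda>Q. coord b c (e (g (e' Q))))"
proof -
  define U where "U = {Q \<in> W. \<forall>x\<in>Q. x c \<noteq> 0}"
  have m: "morphism M W M W (\<lambda>Q. e (g (e' Q)))" by (rule morphism_comp[OF morphism_comp[OF e' g] e])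
  have "regular_on M W {Q \<in> W. e (g (e' Q)) \<in> U} (\<lambda>Q. coord b c (e (g (e' Q))))"
    using morphismD(3)[OF m coordinate_open[OF assms(3)] coord_regular[OF assms(2,3)]] by (simp add: U_def)
  moreover have gW: "e (g (e' Q)) \<in> W" if "Q \<in> W" for Q by (rule morphismD(1)[OF m that])
  then have "{Q \<in> W. e (g (e' Q)) \<in> U} = {Q \<in> W. \<forall>y\<in>e (g (e' Q)). y c \<noteq> 0}" by (auto simp: U_def)
  ultimately show ?thesis using Q by (intro regular_rat) auto
qed

text \<open>If \<open>g1\<close> and \<open>g2\<close> differ at \<open>P\<close>, some 2 by 2 minor
  of the coordinates of the two images is nonzero. Near \<open>e P\<close> this minor is a quotient
  of forms that vanishes on the image of \<open>f\<close>, so \<open>dom\<close> makes it vanish at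
  \<open>P\<close> as well.\<close>

lemma right_cancel:
  assumes g1: "morphism N V N V g1" and g2: "morphism N V N V g2" and f: "morphism N V N V f"
    and dom: "\<And>D s. hpoly n D s \<Longrightarrow> (\<And>P x. P \<in> V \<Longrightarrow> x \<in> e (f P) \<Longrightarrow> s x = 0) \<Longrightarrow> (\<forall>x\<in>cone. s x = 0)"
    and eq: "\<And>P. P \<in> V \<Longrightarrow> g1 (f P) = g2 (f P)" and P: "P \<in> V"
  shows "g1 P = g2 P"
proof (rule ccontr)
  assume ne: "g1 P \<noteq> g2 P"
  have gV: "g1 R \<in> V" "g2 R \<in> V" if "R \<in> V" for R using morphismD(1)[OF g1] morphismD(1)[OF g2] that by blast+
  define Q where "Q = e P"
  have Q: "Q \<in> W" "e' Q = P" using P e'e by (auto simp: Q_def)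
  have W1: "e (g1 P) \<in> W" "e (g2 P) \<in> W" using gV[OF P] by auto
  obtain y where y: "y \<in> e (g1 P)" using proj_space_ex[OF W_proj[OF W1(1)]] by blast
  obtain z where z: "z \<in> e (g2 P)" using proj_space_ex[OF W_proj[OF W1(2)]] by blast
  obtain c where c: "c < n" "y c \<noteq> 0" using proj_space_point(3)[OF W_proj[OF W1(1)] y] by blast
  obtain c' where c': "c' < n" "z c' \<noteq> 0" using proj_space_point(3)[OF W_proj[OF W1(2)] z] by blast
  have "\<exists>b<n. \<exists>b'<n. y b * z b' \<noteq> y b' * z b"
  proof (rule ccontr)
    assume "\<not> ?thesis"
    then have all: "y b * z b' = y b' * z b" if "b < n" "b' < n" for b b' using that by blast
    have "z = (\<lambda>i. (z c' / y c') * y i)"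
    proof
      fix i
      have yc': "y c' \<noteq> 0"
      proof
        assume "y c' = 0"
        then have "y c * z c' = 0" using all[of c c'] c c' by simp
        then show False using c c' by simp
      qed
      show "z i = (z c' / y c') * y i"
      proof (cases "i < n")
        case True
        then show ?thesis using all[of i c'] c' yc' by (simp add: field_simps)
      next
        case False
        then have "z i = 0" "y i = 0" using proj_space_point(2)[OF W_proj[OF W1(1)] y] proj_space_point(2)[OF W_proj[OF W1(2)] z] by auto
        then show ?thesis by simp
      qed
    qed
    moreover have "z c' / y c' \<noteq> 0"
    proof
      assume "z c' / y c' = 0"
      then have "z c' = 0" using \<open>z = (\<lambda>i. (z c' / y c') * y i)\<close> by (metis mult_zero_left)
      then show False using c' by simp
    qed
    ultimately have "z \<in> e (g1 P)" using proj_space_point(5)[OF W_proj[OF W1(1)] y] by metis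
    then have "e (g1 P) = e (g2 P)" using class_eq[OF W1(1)] class_eq[OF W1(2) z] by metis
    then show False using ne e'e gV[OF P] by metis
  qed
  then obtain b b' where b: "b < n" "b' < n" "y b * z b' \<noteq> y b' * z b" by blast
  define \<alpha> where "\<alpha> = (\<lambda>k Q. coord k c (e (g1 (e' Q))))"
  define \<beta> where "\<beta> = (\<lambda>k Q. coord k c' (e (g2 (e' Q))))"
  have nz1: "\<forall>y\<in>e (g1 (e' Q)). y c \<noteq> 0"
    using hpoly_nonzero_class[OF W_proj[OF W1(1)] hpoly.var[OF c(1)] y _ c(2)] by (simp add: Q)
  have nz2: "\<forall>y\<in>e (g2 (e' Q)). y c' \<noteq> 0"
    using hpoly_nonzero_class[OF W_proj[OF W1(2)] hpoly.var[OF c'(1)] z _ c'(2)] by (simp add: Q)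
  note ra = coord_rat[OF g1 _ c(1) Q(1) nz1] and rb = coord_rat[OF g2 _ c'(1) Q(1) nz2]
  define \<phi> where "\<phi> = (\<lambda>Q. \<alpha> b Q * \<beta> b' Q - \<alpha> b' Q * \<beta> b Q)"
  obtain U where "rat U Q \<phi>"
    unfolding \<phi>_def \<alpha>_def \<beta>_def using rat_diff[OF rat_mult[OF ra[OF b(1)] rb[OF b(2)]] rat_mult[OF ra[OF b(2)] rb[OF b(1)]]] by blast
  then obtain D p q where p: "hpoly n D p" "hpoly n D q" "\<forall>x\<in>Q. q x \<noteq> 0"
    "\<forall>Q'\<in>W. \<forall>x\<in>Q'. q x \<noteq> 0 \<longrightarrow> Q' \<in> U \<and> \<phi> Q' = p x / q x" unfolding rat_def by blast
  have "\<phi> Q = (y b * z b' - y b' * z b) / (y c * z c')"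
    unfolding \<phi>_def \<alpha>_def \<beta>_def Q(2) using coord_eq[OF W_proj[OF W1(1)] y] coord_eq[OF W_proj[OF W1(2)] z] c c'
    by (simp add: diff_divide_distrib)
  then have "\<phi> Q \<noteq> 0" using b c c' by simp
  obtain x where x: "x \<in> Q" using proj_space_ex[OF W_proj[OF Q(1)]] by blast
  have pq0: "p x * q x \<noteq> 0" using p(3,4) x Q(1) \<open>\<phi> Q \<noteq> 0\<close> by auto
  \<comment> \<open>At zeros of \<open>q\<close> nothing is known about \<open>p\<close>; the
    product makes the identity hold on the whole image of \<open>f\<close>.\<close>
  have "\<forall>x\<in>cone. p x * q x = 0"
  proof (rule dom)
    show "hpoly n (D + D) (\<lambda>x. p x * q x)" by (rule hpoly.mult[OF p(1,2)])
    fix R x' assume R: "R \<in> V" "x' \<in> e (f R)"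
    have fR: "f R \<in> V" by (rule morphismD(1)[OF f R(1)])
    have "\<phi> (e (f R)) = 0"
    proof -
      have e1: "e (g1 (f R)) = e (g2 (f R))" using eq[OF R(1)] by simp
      have v2: "e (g1 (f R)) \<in> proj_space M" using W_proj gV(1)[OF fR] by blast
      obtain v where v: "v \<in> e (g1 (f R))" using proj_space_ex[OF v2] by blast
      show ?thesis unfolding \<phi>_def \<alpha>_def \<beta>_def e'e[OF fR] e1[symmetric] coord_eq[OF v2 v] by simp
    qed
    then have "q x' \<noteq> 0 \<longrightarrow> p x' / q x' = 0" using p(4) R fR by (metis image_eqI)
    then show "p x' * q x' = 0" by auto
  qed
  then show False using pq0 class_eq[OF Q(1) x] by blast
qed

text \<open>The zero loci of \<open>p\<close> and \<open>q\<close> pull back along \<open>e\<close>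
  to closed sets that cover the irreducible \<open>V\<close>.\<close>

lemma cone_prime:
  assumes p: "hpoly n D p" and q: "hpoly n D' q" and pq: "\<And>x. x \<in> cone \<Longrightarrow> p x * q x = 0"
  shows "(\<forall>x\<in>cone. p x = 0) \<or> (\<forall>x\<in>cone. q x = 0)"
proof -
  have op: "\<exists>Z. proj_closed N Z \<and> (\<forall>P\<in>V. P \<in> Z \<longleftrightarrow> (\<forall>x\<in>e P. r x = 0))" if r: "hpoly n E r" for E r
  proof -
    have "zariski_open M W (W - {P \<in> proj_space M. \<forall>x\<in>P. r x = 0})"
      unfolding zariski_open_def using proj_closed_zeros[OF r] by blast
    then have "zariski_open N V {P \<in> V. e P \<in> W - {P \<in> proj_space M. \<forall>x\<in>P. r x = 0}}"
      by (rule morphismD(2)[OF e])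
    then obtain Z where Z: "proj_closed N Z" "{P \<in> V. e P \<in> W - {P \<in> proj_space M. \<forall>x\<in>P. r x = 0}} = V - Z"
      unfolding zariski_open_def by blast
    have "P \<in> Z \<longleftrightarrow> (\<forall>x\<in>e P. r x = 0)" if "P \<in> V" for P using Z(2) that W_proj by blast
    then show ?thesis using Z(1) by blast
  qed
  obtain Z where Z: "proj_closed N Z" "\<And>P. P \<in> V \<Longrightarrow> P \<in> Z \<longleftrightarrow> (\<forall>x\<in>e P. p x = 0)" using op[OF p] by blast
  obtain Z' where Z': "proj_closed N Z'" "\<And>P. P \<in> V \<Longrightarrow> P \<in> Z' \<longleftrightarrow> (\<forall>x\<in>e P. q x = 0)" using op[OF q] by blast
  have "V \<subseteq> Z \<union> Z'"
  proof
    fix P assume P: "P \<in> V"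
    then have eP: "e P \<in> W" by simp
    obtain x where x: "x \<in> e P" using proj_space_ex[OF W_proj[OF eP]] by blast
    have "p x = 0 \<or> q x = 0" using pq class_eq[OF eP x] by auto
    then show "P \<in> Z \<union> Z'"
      using Z(2)[OF P] Z'(2)[OF P] hpoly_nonzero_class[OF W_proj[OF eP] p _ x] hpoly_nonzero_class[OF W_proj[OF eP] q _ x] by auto
  qed
  then have "V \<subseteq> Z \<or> V \<subseteq> Z'" using var Z(1) Z'(1) unfolding projective_variety_def by blast
  then show ?thesis using Z(2) Z'(2) unfolding cone_def by blast
qed

end

section \<open>Free semigroups from heights\<close>

lemma word_map_append: "word_map a b (u @ v) x = word_map a b u (word_map a b v x)"
  by (induction u) (auto simp: word_map_def)

lemma word_map_Cons: "word_map a b (l # w) x = (if l then a else b) (word_map a b w x)"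
  by (simp add: word_map_def)

lemma word_map_Nil: "word_map a b [] x = x"
  by (simp add: word_map_def)

lemma word_map_swap: "word_map b a w = word_map a b (map Not w)"
  by (induction w) (auto simp: word_map_def)

lemma generate_free_semigroup_swap:
  assumes "generate_free_semigroup V a b" shows "generate_free_semigroup V b a"
proof -
  have "map Not w = map Not w' \<longleftrightarrow> w = w'" for w w' by (rule inj_map_eq_map) (auto simp: inj_def)
  then show ?thesis using assms unfolding generate_free_semigroup_def word_map_swap[of b a] by (metis map_is_Nil_conv)
qed

text \<open>The part of the argument that only uses heights. \<open>U\<close> stands for the points
  with coordinates in the fraction field of the chosen ring, where \<open>H\<close> behaves well;
  identities between words are cancelled on \<open>V\<close> and evaluated on
  \<open>U\<close>.\<close>

locale height_dynamics =
  fixes U V :: "'a set" and f g :: "'a \<Rightarrow> 'a" and H :: "'a \<Rightarrow> real" and d1 d2 :: nat and K :: real and P0 :: 'a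
  assumes d1: "d1 > 1" and d2: "d2 > 1" and UV: "U \<subseteq> V"
    and f: "P \<in> U \<Longrightarrow> f P \<in> U" "P \<in> U \<Longrightarrow> \<bar>H (f P) - real d1 * H P\<bar> \<le> K"
    and g: "P \<in> U \<Longrightarrow> g P \<in> U" "P \<in> U \<Longrightarrow> \<bar>H (g P) - real d2 * H P\<bar> \<le> K"
    and P0: "P0 \<in> U" and bounded: "\<exists>b. \<forall>k. H ((f ^^ k) P0) \<le> b" and unbounded: "\<exists>k. H ((g ^^ k) P0) > b"
    and cancel: "(\<And>P. P \<in> V \<Longrightarrow> word_map (f ^^ j) (g ^^ j) (w @ [l]) P = word_map (f ^^ j) (g ^^ j) (w' @ [l]) P) \<Longrightarrow>
       P \<in> V \<Longrightarrow> word_map (f ^^ j) (g ^^ j) w P = word_map (f ^^ j) (g ^^ j) w' P"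
begin

text \<open>
  The error \<open>K (D - 1)\<close> is what makes this property stable under composition.
\<close>

definition ctrl :: "('a \<Rightarrow> 'a) \<Rightarrow> real \<Rightarrow> bool" where
  "ctrl u D \<longleftrightarrow> D \<ge> 1 \<and> (\<forall>P\<in>U. u P \<in> U \<and> \<bar>H (u P) - D * H P\<bar> \<le> K * (D - 1))"

lemma K_nonneg: "K \<ge> 0"
  using f(2)[OF P0] by linarith

lemma ctrl_comp:
  assumes "ctrl u D" "ctrl v D'" shows "ctrl (\<lambda>P. v (u P)) (D' * D)"
  unfolding ctrl_def
proof (intro conjI ballI)
  have D: "D \<ge> 1" "D' \<ge> 1" using assms by (auto simp: ctrl_def)
  have "1 * 1 \<le> D' * D" using D by (intro mult_mono) auto
  then show "1 \<le> D' * D" by simp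
  fix P assume P: "P \<in> U"
  have u: "u P \<in> U" "\<bar>H (u P) - D * H P\<bar> \<le> K * (D - 1)" using assms(1) P by (auto simp: ctrl_def)
  have v: "v (u P) \<in> U" "\<bar>H (v (u P)) - D' * H (u P)\<bar> \<le> K * (D' - 1)" using assms(2) u by (auto simp: ctrl_def)
  show "v (u P) \<in> U" by (rule v)
  have "\<bar>D' * (H (u P) - D * H P)\<bar> \<le> D' * (K * (D - 1))" unfolding abs_mult using u(2) D by (intro mult_mono) auto
  then have "\<bar>D' * H (u P) - D' * D * H P\<bar> \<le> D' * (K * (D - 1))" by (simp add: algebra_simps)
  then have "\<bar>H (v (u P)) - D' * D * H P\<bar> \<le> K * (D' - 1) + D' * (K * (D - 1))" using v(2) by linarith
  then show "\<bar>H (v (u P)) - D' * D * H P\<bar> \<le> K * (D' * D - 1)" by (simp add: algebra_simps)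
qed

lemma ctrl_id: "ctrl (\<lambda>P. P) 1"
  by (simp add: ctrl_def)

lemma ctrl_gen: "ctrl f (real d1)" "ctrl g (real d2)"
proof -
  have "K * 1 \<le> K * (real d1 - 1)" "K * 1 \<le> K * (real d2 - 1)" using K_nonneg d1 d2 by (intro mult_left_mono; simp)+
  then show "ctrl f (real d1)" "ctrl g (real d2)" using f g d1 d2 unfolding ctrl_def by (force intro: order.trans)+
qed

lemma ctrl_funpow: "ctrl u D \<Longrightarrow> ctrl (u ^^ j) (D ^ j)"
proof (induction j)
  case 0 then show ?case using ctrl_id by (simp add: id_def)
next
  case (Suc j) then show ?case using ctrl_comp[OF Suc.IH[OF Suc.prems] Suc.prems] by (simp add: o_def)
qed

definition wdeg :: "nat \<Rightarrow> bool list \<Rightarrow> real" where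
  "wdeg j w = prod_list (map (\<lambda>l. if l then real d1 ^ j else real d2 ^ j) w)"

lemma ctrl_word: "ctrl (word_map (f ^^ j) (g ^^ j) w) (wdeg j w)"
proof (induction w)
  case Nil then show ?case using ctrl_id by (simp add: word_map_Nil[abs_def] wdeg_def word_map_def id_def)
next
  case (Cons l w)
  have l: "ctrl (if l then f ^^ j else g ^^ j) (if l then real d1 ^ j else real d2 ^ j)"
    using ctrl_funpow ctrl_gen by simp
  have "word_map (f ^^ j) (g ^^ j) (l # w) = (\<lambda>P. (if l then f ^^ j else g ^^ j) (word_map (f ^^ j) (g ^^ j) w P))"
    by (rule ext) (simp add: word_map_Cons)
  then show ?case using ctrl_comp[OF Cons.IH l] by (simp add: wdeg_def)
qed

lemma ctrl_upper: "ctrl u D \<Longrightarrow> P \<in> U \<Longrightarrow> H (u P) \<le> D * (H P + K)"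
proof -
  assume "ctrl u D" "P \<in> U"
  then have "H (u P) - D * H P \<le> K * (D - 1)" by (auto simp: ctrl_def)
  then show ?thesis using K_nonneg by (simp add: algebra_simps)
qed

lemma ctrl_lower: "ctrl u D \<Longrightarrow> P \<in> U \<Longrightarrow> D * (H P - K) \<le> H (u P)"
proof -
  assume "ctrl u D" "P \<in> U"
  then have "D * H P - H (u P) \<le> K * (D - 1)" by (auto simp: ctrl_def)
  then show ?thesis using K_nonneg by (simp add: algebra_simps)
qed

lemma high_point: "\<exists>P\<in>U. H P > b"
proof -
  obtain k where "H ((g ^^ k) P0) > b" using unbounded by blast
  moreover have "(g ^^ k) P0 \<in> U" using ctrl_funpow[OF ctrl_gen(2), of k] P0 by (auto simp: ctrl_def)
  ultimately show ?thesis by blast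
qed

text \<open>At points of large height the bounded errors are negligible, so the factor
  \<open>D\<close> is determined by the map.\<close>

lemma ctrl_degree_le:
  assumes "ctrl u D" "ctrl v D'" "\<And>P. P \<in> U \<Longrightarrow> u P = v P" shows "D \<le> D'"
proof (rule ccontr)
  assume "\<not> D \<le> D'"
  then have pos: "D - D' > 0" by simp
  obtain P where P: "P \<in> U" "H P > (D + D') * K / (D - D')" using high_point by blast
  have "D * (H P - K) \<le> D' * (H P + K)" using ctrl_lower[OF assms(1) P(1)] ctrl_upper[OF assms(2) P(1)] assms(3)[OF P(1)] by simp
  then have "H P * (D - D') \<le> (D + D') * K" by (simp add: algebra_simps)
  moreover have "(D + D') * K < H P * (D - D')" using P(2) pos by (simp add: pos_divide_less_eq)
  ultimately show False by simp
qed

text \<open>The degrees of the words drop out: \<open>wdeg j u * d1 ^ j = wdeg j v * d2 ^ j\<close>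
  and \<open>wdeg j v * d2 ^ (j - n0) \<le> wdeg j u * (b + K)\<close> give
  \<open>d1 ^ j \<le> (b + K) * d2 ^ n0\<close>. Hence a single \<open>j\<close>, chosen from the
  two orbits of \<open>P0\<close> alone, excludes all identities between words with different last
  letters.\<close>

theorem powers_generate_free: "\<exists>j>0. generate_free_semigroup V (f ^^ j) (g ^^ j)"
proof -
  obtain b where b: "\<And>k. H ((f ^^ k) P0) \<le> b" using bounded by blast
  \<comment> \<open>One \<open>K\<close> is lost on the way from \<open>n0\<close> to
    \<open>j\<close>, another when \<open>v\<close> is applied.\<close>
  obtain n0 where n0: "H ((g ^^ n0) P0) > 2 * K + 1" using unbounded by blast
  obtain i where i: "(b + K) * real d2 ^ n0 < real d1 ^ i" using real_arch_pow[of "real d1" "(b + K) * real d2 ^ n0"] d1 by auto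
  define j where "j = i + n0 + 1"
  have j0: "j > 0" "n0 \<le> j" by (auto simp: j_def)
  have "real d1 ^ i \<le> real d1 ^ j" using d1 by (intro power_increasing) (auto simp: j_def)
  then have big: "(b + K) * real d2 ^ n0 < real d1 ^ j" using i by linarith
  define a1 where "a1 = f ^^ j"
  define a2 where "a2 = g ^^ j"
  define wm where "wm = word_map a1 a2"
  have cw: "ctrl (wm w) (wdeg j w)" for w unfolding wm_def a1_def a2_def by (rule ctrl_word)
  have c1: "ctrl a1 (real d1 ^ j)" and c2: "ctrl a2 (real d2 ^ j)"
    unfolding a1_def a2_def using ctrl_funpow ctrl_gen by auto
  have wd1: "wdeg j w \<ge> 1" for w using cw[of w] by (simp add: ctrl_def)
  have cross: False if eq: "\<And>P. P \<in> V \<Longrightarrow> wm u (a1 P) = wm v (a2 P)" for u v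
  proof -
    have k1: "ctrl (\<lambda>P. wm u (a1 P)) (wdeg j u * real d1 ^ j)" by (rule ctrl_comp[OF c1 cw])
    have k2: "ctrl (\<lambda>P. wm v (a2 P)) (wdeg j v * real d2 ^ j)" by (rule ctrl_comp[OF c2 cw])
    have "wdeg j u * real d1 ^ j = wdeg j v * real d2 ^ j"
      using ctrl_degree_le[OF k1 k2] ctrl_degree_le[OF k2 k1] eq UV by (simp add: subset_iff order_antisym)
    have U1: "a1 P0 \<in> U" "a2 P0 \<in> U" using c1 c2 P0 by (auto simp: ctrl_def)
    have up: "H (wm u (a1 P0)) \<le> wdeg j u * (b + K)"
    proof -
      have "H (wm u (a1 P0)) \<le> wdeg j u * (H (a1 P0) + K)" by (rule ctrl_upper[OF cw U1(1)])
      also have "\<dots> \<le> wdeg j u * (b + K)" using b[of j] wd1[of u] by (intro mult_left_mono) (auto simp: a1_def)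
      finally show ?thesis .
    qed
    have low: "wdeg j v * (H (a2 P0) - K) \<le> H (wm v (a2 P0))" by (rule ctrl_lower[OF cw U1(2)])
    have "a2 P0 = (g ^^ (j - n0)) ((g ^^ n0) P0)" using j0 by (simp add: a2_def flip: funpow_add comp_apply[of "g ^^ (j - n0)"])
    moreover have "(g ^^ n0) P0 \<in> U" using ctrl_funpow[OF ctrl_gen(2), of n0] P0 by (auto simp: ctrl_def)
    ultimately have "real d2 ^ (j - n0) * (H ((g ^^ n0) P0) - K) \<le> H (a2 P0)"
      using ctrl_lower[OF ctrl_funpow[OF ctrl_gen(2), of "j - n0"]] by simp
    moreover have "real d2 ^ (j - n0) * (K + 1) \<le> real d2 ^ (j - n0) * (H ((g ^^ n0) P0) - K)"
      using n0 by (intro mult_left_mono) auto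
    moreover have "1 * K \<le> real d2 ^ (j - n0) * K" using d2 K_nonneg by (intro mult_right_mono one_le_power) auto
    ultimately have "real d2 ^ (j - n0) \<le> H (a2 P0) - K" by (simp add: distrib_left)
    then have "wdeg j v * real d2 ^ (j - n0) \<le> wdeg j v * (H (a2 P0) - K)" using wd1[of v] by (intro mult_left_mono) auto
    then have le: "wdeg j v * real d2 ^ (j - n0) \<le> wdeg j u * (b + K)" using up low eq[of P0] P0 UV by auto
    have "wdeg j u * real d1 ^ j = wdeg j v * real d2 ^ (j - n0) * real d2 ^ n0"
      using \<open>wdeg j u * real d1 ^ j = wdeg j v * real d2 ^ j\<close> j0 by (simp add: mult.assoc flip: power_add)
    also have "\<dots> \<le> wdeg j u * (b + K) * real d2 ^ n0" using le by (intro mult_right_mono) auto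
    also have "\<dots> < wdeg j u * real d1 ^ j" using big wd1[of u] by (simp add: mult.assoc)
    finally show False by simp
  qed
  \<comment> \<open>A nonempty word has degree above 1, but the identity has degree 1.\<close>
  have nontriv: False if ne: "w \<noteq> []" and triv: "\<And>P. P \<in> V \<Longrightarrow> wm w P = P" for w
  proof -
    have "wdeg j w \<le> 1" using ctrl_degree_le[OF cw ctrl_id] triv UV by blast
    moreover obtain l w' where "w = l # w'" using ne by (meson neq_Nil_conv)
    moreover have "real d1 ^ j > 1" "real d2 ^ j > 1" using d1 d2 j0 by (auto intro: one_less_power)
    moreover have "1 * 1 < (if l then real d1 ^ j else real d2 ^ j) * wdeg j w'" for l w'
      using \<open>real d1 ^ j > 1\<close> \<open>real d2 ^ j > 1\<close> wd1[of w'] by (intro mult_less_le_imp_less) auto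
    ultimately show False by (simp add: wdeg_def) (metis linorder_not_less mult_1 wdeg_def)
  qed
  have snoc: "wm (w @ [l]) P = wm w ((if l then a1 else a2) P)" for w l P
    by (simp add: wm_def word_map_append word_map_Cons word_map_Nil)
  \<comment> \<open>Equal last letters are cancelled, different ones contradict
    \<open>cross\<close>, and if only one word is exhausted the other contradicts
    \<open>nontriv\<close>.\<close>
  have "w = w'" if "\<And>P. P \<in> V \<Longrightarrow> wm w P = wm w' P" for w w'
    using that
  proof (induction w arbitrary: w' rule: rev_induct)
    case Nil
    then have "wm w' P = P" if "P \<in> V" for P using that by (simp add: wm_def word_map_Nil)
    then show ?case using nontriv[of w'] by metis
  next
    case (snoc l w)
    show ?case
    proof (cases w' rule: rev_cases)
      case Nil
      then have "wm (w @ [l]) P = P" if "P \<in> V" for P using snoc.prems[OF that] by (simp add: wm_def word_map_Nil)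
      then show ?thesis using nontriv[of "w @ [l]"] by simp
    next
      case (snoc v l')
      show ?thesis
      proof (cases "l = l'")
        case True
        have "wm w P = wm v P" if "P \<in> V" for P
          using cancel[of j w l v P] snoc.prems that True snoc unfolding wm_def a1_def a2_def by blast
        then have "w = v" using snoc.IH by blast
        then show ?thesis using snoc True by simp
      next
        case False
        have "wm w ((if l then a1 else a2) P) = wm v ((if l' then a1 else a2) P)" if "P \<in> V" for P
          using snoc.prems[OF that] unfolding snoc \<open>\<And>w l P. wm (w @ [l]) P = wm w ((if l then a1 else a2) P)\<close> .
        then show ?thesis using cross[of w v] cross[of v w] False by (cases l; cases l') auto
      qed
    qed
  qed
  then have "generate_free_semigroup V a1 a2" unfolding generate_free_semigroup_def wm_def by blast
  then show ?thesis using j0 unfolding a1_def a2_def by blast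
qed

end

section \<open>Lifting polarized morphisms to the cone\<close>

text \<open>Chart independence of the lift as pure algebra: \<open>A\<close> and \<open>B\<close>
  stand for \<open>\<eta>\<close> at \<open>P\<close> and at \<open>f P\<close>, \<open>Z\<close>
  for \<open>\<xi>\<close>, and \<open>T\<close>, \<open>S\<close> for the transition functions of
  \<open>L\<close> at these two points.\<close>

lemma lift_transition:
  fixes x0 :: "'a::field"
  assumes "x0 * (A0 * T ^ m) = x1 * A1" "B0 * S ^ m = (y1 / y0) * B1" "Z0 * S = T ^ d * Z1" "B0 \<noteq> 0" "B1 \<noteq> 0"
  shows "(y1 / y0) * (x0 ^ d * (A0 ^ d * Z0 ^ m / B0)) = x1 ^ d * (A1 ^ d * Z1 ^ m / B1)"
proof -
  have "x1 ^ d * A1 ^ d * Z1 ^ m = (x0 * (A0 * T ^ m)) ^ d * Z1 ^ m" by (simp add: assms(1) power_mult_distrib)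
  also have "\<dots> = x0 ^ d * A0 ^ d * (T ^ d * Z1) ^ m"
    by (simp add: power_mult_distrib mult.commute mult.left_commute flip: power_mult)
  also have "\<dots> = x0 ^ d * A0 ^ d * Z0 ^ m * S ^ m" by (simp add: power_mult_distrib flip: assms(3))
  finally have 1: "x1 ^ d * A1 ^ d * Z1 ^ m = x0 ^ d * A0 ^ d * Z0 ^ m * S ^ m" .
  have 2: "S ^ m / B1 = (y1 / y0) / B0" using assms(2) by (simp only: frac_eq_eq[OF assms(5,4)] mult.commute)
  have "x1 ^ d * (A1 ^ d * Z1 ^ m / B1) = (x1 ^ d * A1 ^ d * Z1 ^ m) / B1" by (simp add: mult_ac)
  also have "\<dots> = x0 ^ d * A0 ^ d * Z0 ^ m * (S ^ m / B1)" unfolding 1 by simp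
  also have "\<dots> = (y1 / y0) * (x0 ^ d * (A0 ^ d * Z0 ^ m / B0))" unfolding 2 by (simp add: mult_ac)
  finally show ?thesis by simp
qed

context embedded_variety
begin

definition coord_chart :: "nat \<Rightarrow> 'k proj_point set" where
  "coord_chart a = {P \<in> V. \<forall>x\<in>e P. x a \<noteq> 0}"

lemma coord_chart_iff: "P \<in> V \<Longrightarrow> x \<in> e P \<Longrightarrow> a < n \<Longrightarrow> P \<in> coord_chart a \<longleftrightarrow> x a \<noteq> 0"
  unfolding coord_chart_def using hpoly_nonzero_class[OF W_proj hpoly.var, of "e P" a x] by blast

lemma coord_chart_open: "a < n \<Longrightarrow> zariski_open N V (coord_chart a)"
proof -
  assume a: "a < n"
  have "{P \<in> V. e P \<in> {Q \<in> W. \<forall>x\<in>Q. x a \<noteq> 0}} = coord_chart a" by (auto simp: coord_chart_def)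
  then show ?thesis using morphismD(2)[OF e coordinate_open[OF a]] by simp
qed

text \<open>
  The lift is \<open>\<Phi> x b = x\<^sub>a\<^sup>d \<eta>\<^sub>a\<^sub>j(P)\<^sup>d \<xi>\<^sub>j\<^sub>i(P)\<^sup>m / \<eta>\<^sub>b\<^sub>i(f P)\<close> in any charts with \<open>P \<in> U\<^sub>j\<close>, \<open>f P \<in> U\<^sub>i\<close>, \<open>x\<^sub>a \<noteq> 0\<close> and
  \<open>\<Phi> x b \<noteq> 0\<close>; the cocycle identities say that it does not depend on the charts.
\<close>

lemma lift_exists:
  fixes L :: "('i, 'k) line_bundle_data"
  assumes lb: "line_bundle N V L" and m: "m > 0" and d: "d > 0" and f: "morphism N V N V f"
    and \<eta>: "\<And>i a. i \<in> index L \<Longrightarrow> a < n \<Longrightarrow> regular_unit_on N V (chart L i \<inter> coord_chart a) (\<eta> a i)"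
    and \<eta>t: "\<And>i i' a a' P. i \<in> index L \<Longrightarrow> i' \<in> index L \<Longrightarrow> a < n \<Longrightarrow> a' < n \<Longrightarrow>
       P \<in> chart L i \<Longrightarrow> P \<in> chart L i' \<Longrightarrow> P \<in> coord_chart a \<Longrightarrow> P \<in> coord_chart a' \<Longrightarrow>
       \<eta> a i P * transition L i i' P ^ m = coord a' a (e P) * \<eta> a' i' P"
    and \<xi>: "\<And>i j. i \<in> index L \<Longrightarrow> j \<in> index L \<Longrightarrow> regular_unit_on N V ({P \<in> V. f P \<in> chart L i} \<inter> chart L j) (\<xi> j i)"
    and \<xi>t: "\<And>i i' j j' P. i \<in> index L \<Longrightarrow> i' \<in> index L \<Longrightarrow> j \<in> index L \<Longrightarrow> j' \<in> index L \<Longrightarrow> P \<in> V \<Longrightarrow>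
       f P \<in> chart L i \<Longrightarrow> f P \<in> chart L i' \<Longrightarrow> P \<in> chart L j \<Longrightarrow> P \<in> chart L j' \<Longrightarrow>
       \<xi> j i P * transition L i i' (f P) = transition L j j' P ^ d * \<xi> j' i' P"
  shows "\<exists>\<Phi>. (\<forall>x\<in>cone. \<Phi> x \<in> e (f (e' (proj_class x)))) \<and>
     (\<forall>Q\<in>W. \<forall>b<n. \<exists>D p q. hpoly n D q \<and> hpoly n (D + d) p \<and> (\<forall>x\<in>Q. q x \<noteq> 0) \<and> (\<forall>x\<in>cone. q x * \<Phi> x b = p x))"
proof -
  define I where "I = index L"
  define u where "u = (\<lambda>a b i j P. \<eta> a j P ^ d * \<xi> j i P ^ m / \<eta> b i (f P))"
  have cover: "\<exists>i\<in>I. P \<in> chart L i" if "P \<in> V" for P using lb that unfolding line_bundle_def I_def by blast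
  have fV: "f P \<in> V" if "P \<in> V" for P by (rule morphismD(1)[OF f that])
  have \<eta>0: "\<eta> a i P \<noteq> 0" if "i \<in> I" "a < n" "P \<in> chart L i" "P \<in> coord_chart a" for i a P
    using \<eta>[of i a] that by (auto simp: regular_unit_on_def I_def)
  have \<xi>0: "\<xi> j i P \<noteq> 0" if "i \<in> I" "j \<in> I" "P \<in> V" "f P \<in> chart L i" "P \<in> chart L j" for i j P
    using \<xi>[of i j] that by (auto simp: regular_unit_on_def I_def)
  \<comment> \<open>The formula is demanded in all admissible charts at once, so that the chosen
    lift can later be computed in charts adapted to a nearby point.\<close>
  define good where "good = (\<lambda>x y. y \<in> e (f (e' (proj_class x))) \<and>
      (\<forall>a<n. \<forall>b<n. \<forall>i\<in>I. \<forall>j\<in>I. x a \<noteq> 0 \<longrightarrow> y b \<noteq> 0 \<longrightarrow> e' (proj_class x) \<in> chart L j \<longrightarrow> f (e' (proj_class x)) \<in> chart L i \<longrightarrow>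
         y b = x a ^ d * u a b i j (e' (proj_class x))))"
  have "\<exists>y. good x y" if x: "x \<in> cone" for x
  proof -
    define P where "P = e' (proj_class x)"
    have cl: "proj_class x \<in> W" "x \<in> proj_class x" using cone_class[OF x] by auto
    have P: "P \<in> V" "e P = proj_class x" using ee'[OF cl(1)] by (auto simp: P_def)
    have eR: "e (f P) \<in> W" "f P \<in> V" using fV[OF P(1)] by auto
    obtain y0 where y0: "y0 \<in> e (f P)" using proj_space_ex[OF W_proj[OF eR(1)]] by blast
    obtain b0 where b0: "b0 < n" "y0 b0 \<noteq> 0" using proj_space_point(3)[OF W_proj[OF eR(1)] y0] by blast
    obtain a0 where a0: "a0 < n" "x a0 \<noteq> 0" using proj_space_point(3)[OF W_proj[OF cl(1)] cl(2)] by blast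
    obtain i0 where i0: "i0 \<in> I" "f P \<in> chart L i0" using cover[OF eR(2)] by blast
    obtain j0 where j0: "j0 \<in> I" "P \<in> chart L j0" using cover[OF P(1)] by blast
    have xP: "x \<in> e P" using cl P by simp
    have c_iff: "P \<in> coord_chart a \<longleftrightarrow> x a \<noteq> 0" "f P \<in> coord_chart a \<longleftrightarrow> y0 a \<noteq> 0" if "a < n" for a
      using coord_chart_iff[OF P(1) xP that] coord_chart_iff[OF eR(2) y0 that] by auto
    \<comment> \<open>Scales \<open>y0\<close> so that the formula holds in one system of charts;
      the cocycle identities carry it to the others.\<close>
    define c where "c = x a0 ^ d * u a0 b0 i0 j0 P / y0 b0"
    have u0: "u a0 b0 i0 j0 P \<noteq> 0"
      unfolding u_def using \<eta>0[OF j0(1) a0(1) j0(2)] \<xi>0[OF i0(1) j0(1) P(1) i0(2) j0(2)] \<eta>0[OF i0(1) b0(1) i0(2)] c_iff a0 b0 by simp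
    have c0: "c \<noteq> 0" using u0 a0 b0 by (simp add: c_def)
    define y where "y = (\<lambda>k. c * y0 k)"
    have "y \<in> e (f P)" unfolding y_def by (rule proj_space_point(5)[OF W_proj[OF eR(1)] y0 c0])
    moreover have "y b = x a ^ d * u a b i j P"
      if h: "a < n" "b < n" "i \<in> I" "j \<in> I" "x a \<noteq> 0" "y b \<noteq> 0" "P \<in> chart L j" "f P \<in> chart L i" for a b i j
    proof -
      have yb: "y0 b \<noteq> 0" using h(6) by (auto simp: y_def)
      have 1: "\<eta> a0 j0 P * transition L j0 j P ^ m = (x a / x a0) * \<eta> a j P"
        using \<eta>t[of j0 j a0 a P] j0 h a0 c_iff coord_eq[OF W_proj xP] P cl by (simp add: I_def)
      have 2: "\<eta> b0 i0 (f P) * transition L i0 i (f P) ^ m = (y0 b / y0 b0) * \<eta> b i (f P)"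
        using \<eta>t[of i0 i b0 b "f P"] i0 h b0 yb c_iff coord_eq[OF W_proj[OF eR(1)] y0] by (simp add: I_def)
      have 3: "\<xi> j0 i0 P * transition L i0 i (f P) = transition L j0 j P ^ d * \<xi> j i P"
        using \<xi>t[of i0 i j0 j P] i0 j0 h P by (simp add: I_def)
      have 4: "\<eta> b0 i0 (f P) \<noteq> 0" "\<eta> b i (f P) \<noteq> 0"
        using \<eta>0[OF i0(1) b0(1) i0(2)] \<eta>0[OF h(3,2,8)] c_iff b0 yb h by auto
      have "x a0 * (\<eta> a0 j0 P * transition L j0 j P ^ m) = x a * \<eta> a j P" unfolding 1 using a0 by simp
      from lift_transition[OF this 2 3 4]
      have "(y0 b / y0 b0) * (x a0 ^ d * u a0 b0 i0 j0 P) = x a ^ d * u a b i j P" by (simp add: u_def)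
      moreover have "y b = (y0 b / y0 b0) * (x a0 ^ d * u a0 b0 i0 j0 P)" by (simp add: y_def c_def)
      ultimately show ?thesis by simp
    qed
    ultimately have "good x y" unfolding good_def P_def[symmetric] by blast
    then show ?thesis by blast
  qed
  then obtain \<Phi> where \<Phi>: "\<And>x. x \<in> cone \<Longrightarrow> good x (\<Phi> x)" by metis
  have \<Phi>e: "\<Phi> x \<in> e (f (e' (proj_class x)))" if "x \<in> cone" for x using \<Phi>[OF that] by (simp add: good_def)
  have "\<exists>D p q. hpoly n D q \<and> hpoly n (D + d) p \<and> (\<forall>x\<in>Q. q x \<noteq> 0) \<and> (\<forall>x\<in>cone. q x * \<Phi> x k = p x)"
    if Q: "Q \<in> W" and k: "k < n" for Q k
  proof -
    define P where "P = e' Q"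
    have P: "P \<in> V" "e P = Q" using ee'[OF Q] by (auto simp: P_def)
    have eR: "e (f P) \<in> W" "f P \<in> V" using fV[OF P(1)] by auto
    obtain x where x: "x \<in> Q" using proj_space_ex[OF W_proj[OF Q]] by blast
    obtain y where y: "y \<in> e (f P)" using proj_space_ex[OF W_proj[OF eR(1)]] by blast
    obtain b where b: "b < n" "y b \<noteq> 0" using proj_space_point(3)[OF W_proj[OF eR(1)] y] by blast
    obtain a where a: "a < n" "x a \<noteq> 0" using proj_space_point(3)[OF W_proj[OF Q] x] by blast
    obtain i where i: "i \<in> I" "f P \<in> chart L i" using cover[OF eR(2)] by blast
    obtain j where j: "j \<in> I" "P \<in> chart L j" using cover[OF P(1)] by blast
    have Pa: "P \<in> coord_chart a" using coord_chart_iff[OF P(1) _ a(1)] x a P by simp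
    have Rb: "f P \<in> coord_chart b" using coord_chart_iff[OF eR(2) y b(1)] b by simp
    have chart_open: "zariski_open N V (chart L i)" if "i \<in> I" for i using lb that by (auto simp: line_bundle_def I_def)
    have r1: "rat {Q \<in> W. e' Q \<in> chart L j \<inter> coord_chart a} Q (\<lambda>Q. \<eta> a j (e' Q))"
      using rat_pull[OF morphism_id zariski_open_Int[OF chart_open[OF j(1)] coord_chart_open[OF a(1)]], of "\<eta> a j" Q] \<eta>[of j a] j Pa Q a
      by (simp add: regular_unit_on_def I_def P_def)
    have r2: "rat {Q \<in> W. e' Q \<in> {P \<in> V. f P \<in> chart L i} \<inter> chart L j} Q (\<lambda>Q. \<xi> j i (e' Q))"
      using rat_pull[OF morphism_id zariski_open_Int[OF morphismD(2)[OF f chart_open[OF i(1)]] chart_open[OF j(1)]], of "\<xi> j i" Q] \<xi>[of i j] i j Q P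
      by (simp add: regular_unit_on_def I_def P_def)
    have r3: "rat {Q \<in> W. f (e' Q) \<in> chart L i \<inter> coord_chart b} Q (\<lambda>Q. \<eta> b i (f (e' Q)))"
      using rat_pull[OF f zariski_open_Int[OF chart_open[OF i(1)] coord_chart_open[OF b(1)]], of "\<eta> b i" Q] \<eta>[of i b] i b Rb Q
      by (simp add: regular_unit_on_def I_def P_def)
    have "\<eta> b i (f (e' Q)) \<noteq> 0" using \<eta>0[OF i(1) b(1) i(2) Rb] by (simp add: P_def)
    note r3' = rat_inverse[OF r3 Q this]
    have "\<forall>y\<in>e (f (e' Q)). y b \<noteq> 0" using Rb by (simp add: coord_chart_def P_def)
    note r4 = coord_rat[OF f k b(1) Q this]
    obtain d' m' where dm: "d = Suc d'" "m = Suc m'" using m d by (metis gr0_implies_Suc)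
    define \<rho> where "\<rho> = (\<lambda>Q. coord k b (e (f (e' Q))) * (\<eta> a j (e' Q) ^ d * (\<xi> j i (e' Q) ^ m * inverse (\<eta> b i (f (e' Q))))))"
    define U where "U = {Q \<in> W. \<forall>y\<in>e (f (e' Q)). y b \<noteq> 0} \<inter> ({Q \<in> W. e' Q \<in> chart L j \<inter> coord_chart a} \<inter>
       ({Q \<in> W. e' Q \<in> {P \<in> V. f P \<in> chart L i} \<inter> chart L j} \<inter> {Q \<in> W. f (e' Q) \<in> chart L i \<inter> coord_chart b}))"
    have "rat U Q \<rho>" unfolding U_def \<rho>_def dm by (rule rat_mult[OF r4 rat_mult[OF rat_power[OF r1] rat_mult[OF rat_power[OF r2] r3']]])
    then obtain D p q where p: "hpoly n D p" "hpoly n D q" "\<forall>x\<in>Q. q x \<noteq> 0"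
      "\<forall>Q'\<in>W. \<forall>x\<in>Q'. q x \<noteq> 0 \<longrightarrow> Q' \<in> U \<and> \<rho> Q' = p x / q x" unfolding rat_def by blast
    have c1: "q z * q z * \<Phi> z k = q z * (z a ^ d * p z)" if z: "z \<in> cone" for z
    proof (cases "q z = 0")
      case False
      define Q' where "Q' = proj_class z"
      have Q': "Q' \<in> W" "z \<in> Q'" using cone_class[OF z] by (auto simp: Q'_def)
      have U: "Q' \<in> U" "\<rho> Q' = p z / q z" using p(4) Q' False by auto
      define P' where "P' = e' Q'"
      have P': "P' \<in> V" "e P' = Q'" using ee'[OF Q'(1)] by (auto simp: P'_def)
      have \<Phi>z: "\<Phi> z \<in> e (f P')" using \<Phi>e[OF z] by (simp add: P'_def Q'_def)
      have eR': "e (f P') \<in> W" using fV[OF P'(1)] by auto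
      have za: "z a \<noteq> 0" using U(1) Q' P' by (auto simp: U_def coord_chart_def P'_def)
      have zb: "\<Phi> z b \<noteq> 0" using U(1) \<Phi>z by (auto simp: U_def P'_def)
      have "\<Phi> z b = z a ^ d * u a b i j P'"
        using \<Phi>[OF z] a(1) b(1) i(1) j(1) za zb U(1) unfolding good_def U_def P'_def Q'_def by auto
      moreover have "coord k b (e (f P')) = \<Phi> z k / \<Phi> z b" by (rule coord_eq[OF W_proj[OF eR'] \<Phi>z])
      ultimately have "\<Phi> z k = coord k b (e (f P')) * (z a ^ d * u a b i j P')" using zb by simp
      also have "\<dots> = z a ^ d * \<rho> Q'" by (simp add: \<rho>_def u_def P'_def divide_inverse mult_ac)
      finally have "\<Phi> z k = z a ^ d * (p z / q z)" using U(2) by simp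
      then show ?thesis using False by (simp add: field_simps)
    qed simp
    have c2: "hpoly n (D + D) (\<lambda>x. q x * q x)" by (rule hpoly.mult[OF p(2,2)])
    have c3: "hpoly n (D + D + d) (\<lambda>x. q x * (x a ^ d * p x))"
      using hpoly.mult[OF p(2) hpoly.mult[OF hpoly_var_power[OF a(1), of d] p(1)]] by (simp add: algebra_simps)
    have c4: "\<forall>x\<in>Q. q x * q x \<noteq> 0" using p(3) by simp
    show ?thesis
      by (rule exI[of _ "D + D"], rule exI[of _ "\<lambda>x. q x * (x a ^ d * p x)"], rule exI[of _ "\<lambda>x. q x * q x"])
        (intro conjI ballI c1 c2 c3 c4)
  qed
  then show ?thesis using \<Phi>e by blast
qed

text \<open>Sorts the common zeros offered by the Nullstellensatz into points off and on the
  embedded variety. In the second case \<open>a'\<close> is \<open>a\<close> cut off at index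
  \<open>n\<close>: forms do not see later coordinates, but points of the cone vanish there.\<close>

lemma no_common_zero:
  assumes a: "\<exists>i<n. a i \<noteq> 0"
  obtains (outside) D p where "hpoly n D p" "p a \<noteq> 0" "\<forall>x\<in>cone. p x = 0"
  | (inside) a' where "a' \<in> cone" "\<And>D p. hpoly n D p \<Longrightarrow> p a' = p a" "\<And>i. i < n \<Longrightarrow> a' i = a i"
proof -
  define a' where "a' = (\<lambda>i. if i < n then a i else 0)"
  have cong: "p a' = p a" if "hpoly n D p" for D p using hpoly_cong[OF that, of a' a] by (simp add: a'_def)
  have Q: "proj_class a' \<in> proj_space M" unfolding proj_space_def
    using a by (intro CollectI exI[of _ a']) (auto simp: a'_def)
  have self: "a' \<in> proj_class a'" unfolding proj_class_def by (intro CollectI exI[of _ 1]) auto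
  show thesis
  proof (cases "proj_class a' \<in> W")
    case True
    then have "a' \<in> cone" using class_eq self by blast
    then show thesis using inside[of a'] cong by (auto simp: a'_def)
  next
    case False
    obtain S where S: "\<forall>p\<in>S. \<exists>D. hpoly n D p" "W = {P \<in> proj_space M. \<forall>p\<in>S. \<forall>x\<in>P. p x = 0}"
      using closed unfolding proj_closed_hpoly by blast
    obtain p y where p: "p \<in> S" "y \<in> proj_class a'" "p y \<noteq> 0" using False Q unfolding S(2) by blast
    obtain D where D: "hpoly n D p" using S(1) p by blast
    have "p a' \<noteq> 0" by (rule hpoly_nonzero_class[OF Q D p(2) self p(3)])
    then have "p a \<noteq> 0" using cong[OF D] by simp
    moreover have "\<forall>x\<in>cone. p x = 0" unfolding cone_def using p(1) S(2) by auto
    ultimately show thesis using outside[OF D] by blast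
  qed
qed

text \<open>The Nullstellensatz is used twice. The forms whose product with
  \<open>\<Phi>\<^sub>b\<close> is a form on the cone have no common zero, because
  \<open>\<Phi>\<^sub>b\<close> is locally a quotient; the forms that are combinations of the
  \<open>\<Phi>\<^sub>b\<close> have none, because \<open>\<Phi> x\<close> is never the zero vector.
  Both ideals contain the equations of the cone.\<close>

lemma polynomial_lift:
  assumes \<Phi>: "\<And>x. x \<in> cone \<Longrightarrow> \<Phi> x \<in> e (f (e' (proj_class x)))" and f: "morphism N V N V f" and d: "d > 0"
    and loc: "\<And>Q b. Q \<in> W \<Longrightarrow> b < n \<Longrightarrow>
      \<exists>D p q. hpoly n D q \<and> hpoly n (D + d) p \<and> (\<forall>x\<in>Q. q x \<noteq> 0) \<and> (\<forall>x\<in>cone. q x * \<Phi> x b = p x)"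
  shows "\<exists>D H M0. (\<forall>a<n. \<forall>b<n. hpoly n (D + d) (H a b) \<and> (\<forall>x\<in>cone. x a ^ D * \<Phi> x b = H a b x)) \<and> cone_map n d M0 cone \<Phi>"
proof -
  have "\<exists>D. \<forall>a<n. \<exists>h. hpoly n (D + d) h \<and> (\<forall>x\<in>cone. x a ^ D * \<Phi> x b = h x)" if b: "b < n" for b
  proof -
    define I where "I = (\<lambda>k p. hpoly n k p \<and> (\<exists>h. hpoly n (k + d) h \<and> (\<forall>x\<in>cone. p x * \<Phi> x b = h x)))"
    have gi: "graded_ideal n I"
      unfolding graded_ideal_def
    proof (intro conjI allI impI)
      fix k p assume "I k p" then show "hpoly n k p" by (simp add: I_def)
    next
      fix k show "I k (\<lambda>x. 0)" unfolding I_def by (intro conjI hpoly.zero exI[of _ "\<lambda>x. 0"]) auto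
    next
      fix k p q assume "I k p" "I k q"
      then obtain h h' where h: "hpoly n k p" "hpoly n k q" "hpoly n (k + d) h" "\<forall>x\<in>cone. p x * \<Phi> x b = h x"
        "hpoly n (k + d) h'" "\<forall>x\<in>cone. q x * \<Phi> x b = h' x" unfolding I_def by blast
      have "\<forall>x\<in>cone. (p x + q x) * \<Phi> x b = h x + h' x" using h(4,6) by (simp add: distrib_right)
      then show "I k (\<lambda>x. p x + q x)" unfolding I_def using hpoly.add[OF h(1,2)] hpoly.add[OF h(3,5)] by blast
    next
      fix k l and p q :: "(nat \<Rightarrow> 'k alg_closure) \<Rightarrow> 'k alg_closure" assume q: "hpoly n l q" and "I k p"
      then obtain h where h: "hpoly n k p" "hpoly n (k + d) h" "\<forall>x\<in>cone. p x * \<Phi> x b = h x" unfolding I_def by blast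
      have "\<forall>x\<in>cone. (q x * p x) * \<Phi> x b = q x * h x" using h(3) by (simp add: mult.assoc)
      moreover have "hpoly n (l + k + d) (\<lambda>x. q x * h x)" using hpoly.mult[OF q h(2)] by (simp add: add.assoc)
      ultimately show "I (l + k) (\<lambda>x. q x * p x)" unfolding I_def using hpoly.mult[OF q h(1)] by blast
    qed
    have "\<not> (\<exists>a. (\<exists>i<n. a i \<noteq> 0) \<and> (\<forall>k p. I k p \<longrightarrow> p a = 0))"
    proof
      assume "\<exists>a. (\<exists>i<n. a i \<noteq> 0) \<and> (\<forall>k p. I k p \<longrightarrow> p a = 0)"
      then obtain a where a: "\<exists>i<n. a i \<noteq> 0" "\<And>k p. I k p \<Longrightarrow> p a = 0" by blast
      from a(1) show False
      proof (cases rule: no_common_zero)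
        case (outside D p)
        have "\<forall>x\<in>cone. p x * \<Phi> x b = 0" using outside(3) by simp
        then have "I D p" unfolding I_def using outside(1) hpoly.zero by blast
        then show False using a(2) outside(2) by blast
      next
        case (inside a')
        have cl: "proj_class a' \<in> W" "a' \<in> proj_class a'" using cone_class[OF inside(1)] by auto
        obtain D p q where q: "hpoly n D q" "hpoly n (D + d) p" "\<forall>x\<in>proj_class a'. q x \<noteq> 0" "\<forall>x\<in>cone. q x * \<Phi> x b = p x"
          using loc[OF cl(1) b] by blast
        have "I D q" unfolding I_def using q by blast
        then have "q a = 0" by (rule a(2))
        then show False using q(3) cl(2) inside(2)[OF q(1)] by auto
      qed
    qed
    then obtain D where D: "\<forall>i<n. I D (\<lambda>x. x i ^ D)" using projective_nullstellensatz[OF gi] by blast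
    then show ?thesis unfolding I_def by blast
  qed
  then obtain Db where Db: "\<And>b. b < n \<Longrightarrow> \<forall>a<n. \<exists>h. hpoly n (Db b + d) h \<and> (\<forall>x\<in>cone. x a ^ Db b * \<Phi> x b = h x)" by metis
  \<comment> \<open>A common upper bound for the exponents of the single coordinates.\<close>
  define D where "D = (\<Sum>b<n. Db b)"
  have "\<exists>h. hpoly n (D + d) h \<and> (\<forall>x\<in>cone. x a ^ D * \<Phi> x b = h x)" if a: "a < n" and b: "b < n" for a b
  proof -
    obtain h where h: "hpoly n (Db b + d) h" "\<forall>x\<in>cone. x a ^ Db b * \<Phi> x b = h x" using Db[OF b] a by blast
    have le: "Db b \<le> D" unfolding D_def using b by (intro member_le_sum) auto
    have "hpoly n (D - Db b + (Db b + d)) (\<lambda>x. x a ^ (D - Db b) * h x)" by (rule hpoly.mult[OF hpoly_var_power[OF a] h(1)])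
    moreover have "D - Db b + (Db b + d) = D + d" using le by simp
    moreover have "x a ^ D * \<Phi> x b = x a ^ (D - Db b) * h x" if "x \<in> cone" for x
    proof -
      have "x a ^ D = x a ^ (D - Db b) * x a ^ Db b" using le by (simp flip: power_add)
      then show ?thesis using h(2) that by (simp add: mult.assoc)
    qed
    ultimately show ?thesis by (intro exI[of _ "\<lambda>x. x a ^ (D - Db b) * h x"]) auto
  qed
  then obtain H where H: "\<And>a b. a < n \<Longrightarrow> b < n \<Longrightarrow> hpoly n (D + d) (H a b)"
    "\<And>a b x. a < n \<Longrightarrow> b < n \<Longrightarrow> x \<in> cone \<Longrightarrow> x a ^ D * \<Phi> x b = H a b x" by metis
  define I where "I = (\<lambda>k p. hpoly n k p \<and> (\<exists>G. (\<forall>b<n. hdiv n k d (G b)) \<and> (\<forall>x\<in>cone. p x = (\<Sum>b<n. G b x * \<Phi> x b))))"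
  have gi: "graded_ideal n I"
    unfolding graded_ideal_def
  proof (intro conjI allI impI)
    fix k p assume "I k p" then show "hpoly n k p" by (simp add: I_def)
  next
    fix k show "I k (\<lambda>x. 0)" unfolding I_def by (intro conjI hpoly.zero exI[of _ "\<lambda>b x. 0"]) (auto simp: hdiv_zero)
  next
    fix k p q assume "I k p" "I k q"
    then obtain h h' where h: "hpoly n k p" "hpoly n k q" "\<forall>b<n. hdiv n k d (h b)" "\<forall>x\<in>cone. p x = (\<Sum>b<n. h b x * \<Phi> x b)"
      "\<forall>b<n. hdiv n k d (h' b)" "\<forall>x\<in>cone. q x = (\<Sum>b<n. h' b x * \<Phi> x b)" unfolding I_def by blast
    have "\<forall>x\<in>cone. p x + q x = (\<Sum>b<n. (h b x + h' b x) * \<Phi> x b)" using h(4,6) by (simp add: distrib_right sum.distrib)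
    moreover have "\<forall>b<n. hdiv n k d (\<lambda>x. h b x + h' b x)" using h(3,5) hdiv_add by blast
    ultimately show "I k (\<lambda>x. p x + q x)" unfolding I_def using hpoly.add[OF h(1,2)]
      by (intro conjI exI[of _ "\<lambda>b x. h b x + h' b x"])
  next
    fix k l and p q :: "(nat \<Rightarrow> 'k alg_closure) \<Rightarrow> 'k alg_closure" assume q: "hpoly n l q" and "I k p"
    then obtain h where h: "hpoly n k p" "\<forall>b<n. hdiv n k d (h b)" "\<forall>x\<in>cone. p x = (\<Sum>b<n. h b x * \<Phi> x b)" unfolding I_def by blast
    have "\<forall>x\<in>cone. q x * p x = (\<Sum>b<n. (q x * h b x) * \<Phi> x b)" using h(3) by (simp add: sum_distrib_left distrib_left mult.assoc)
    moreover have "\<forall>b<n. hdiv n (l + k) d (\<lambda>x. q x * h b x)" using h(2) hdiv_mult[OF q _ refl] by blast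
    ultimately show "I (l + k) (\<lambda>x. q x * p x)" unfolding I_def using hpoly.mult[OF q h(1)]
      by (intro conjI exI[of _ "\<lambda>b x. q x * h b x"])
  qed
  have \<Phi>W: "e (f (e' (proj_class x))) \<in> W" if "x \<in> cone" for x
    using morphismD(1)[OF f] ee'[of "proj_class x"] cone_class[OF that] by blast
  have "\<not> (\<exists>a. (\<exists>i<n. a i \<noteq> 0) \<and> (\<forall>k p. I k p \<longrightarrow> p a = 0))"
  proof
    assume "\<exists>a. (\<exists>i<n. a i \<noteq> 0) \<and> (\<forall>k p. I k p \<longrightarrow> p a = 0)"
    then obtain a where a: "\<exists>i<n. a i \<noteq> 0" "\<And>k p. I k p \<Longrightarrow> p a = 0" by blast
    from a(1) show False
    proof (cases rule: no_common_zero)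
      case (outside E p)
      have "I E p" unfolding I_def using outside by (intro conjI exI[of _ "\<lambda>b x. 0"]) (auto simp: hdiv_zero)
      then show False using a(2) outside(2) by blast
    next
      case (inside a')
      obtain i where i: "i < n" "a i \<noteq> 0" using a(1) by blast
      obtain b where b: "b < n" "\<Phi> a' b \<noteq> 0"
        using proj_space_point(3)[OF W_proj[OF \<Phi>W[OF inside(1)]] \<Phi>[OF inside(1)]] by blast
      \<comment> \<open>Witness that \<open>x\<^sub>i\<^sup>D \<Phi>\<^sub>b\<close>, already known
        to be a form on the cone, lies in the ideal; it does not vanish at
        \<open>a'\<close>.\<close>
      define G where "G = (\<lambda>c x. if c = b then x i ^ D else 0 :: 'k alg_closure)"
      have "\<forall>x\<in>cone. H i b x = (\<Sum>c<n. G c x * \<Phi> x c)"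
      proof
        fix x assume x: "x \<in> cone"
        have "(\<Sum>c<n. G c x * \<Phi> x c) = (\<Sum>c<n. if c = b then x i ^ D * \<Phi> x c else 0)" by (rule sum.cong) (auto simp: G_def)
        then show "H i b x = (\<Sum>c<n. G c x * \<Phi> x c)" using b(1) H(2)[OF i(1) b(1) x] by simp
      qed
      moreover have "\<forall>c<n. hdiv n (D + d) d (G c)"
      proof (intro allI impI)
        fix c
        show "hdiv n (D + d) d (G c)" unfolding G_def using hpoly_var_power[OF i(1), of D] by (cases "c = b") (auto simp: hdiv_def)
      qed
      ultimately have "I (D + d) (H i b)" unfolding I_def using H(1)[OF i(1) b(1)] by blast
      then have "H i b a' = 0" using a(2) inside(2)[OF H(1)[OF i(1) b(1)]] by simp
      then show False using H(2)[OF i(1) b(1) inside(1)] b(2) i inside(3)[OF i(1)] by simp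
    qed
  qed
  then obtain D' where D': "\<And>i. i < n \<Longrightarrow> I D' (\<lambda>x. x i ^ D')" using projective_nullstellensatz[OF gi] by blast
  note powers = graded_ideal_var_powers[OF gi, of n D']
  \<comment> \<open>\<open>n * D'\<close> is the threshold of
    \<open>graded_ideal_var_powers\<close>; the summand \<open>d\<close> ensures
    \<open>d \<le> M0\<close>.\<close>
  define M0 where "M0 = n * D' + d"
  have "cone_map n d M0 cone \<Phi>"
  proof
    show "d > 0" "d \<le> M0" using d by (auto simp: M0_def)
    show "cone \<noteq> {}"
    proof -
      obtain P where "P \<in> V" using var by (auto simp: projective_variety_def)
      then show ?thesis using proj_space_ex[OF W_proj, of "e P"] by (auto simp: cone_def)
    qed
    show "\<exists>i<n. x i \<noteq> 0" if "x \<in> cone" for x using proj_space_point(3)[OF W_proj] cone_class[OF that] by blast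
    show "(\<forall>x\<in>cone. p x = 0) \<or> (\<forall>x\<in>cone. q x = 0)" if "hpoly n E p" "hpoly n E' q" "\<And>x. x \<in> cone \<Longrightarrow> p x * q x = 0" for E E' p q
      using cone_prime[OF that(1,2)] that(3) by blast
    show "\<Phi> x \<in> cone" if "x \<in> cone" for x using class_eq[OF \<Phi>W[OF that] \<Phi>[OF that]] by blast
    show "\<exists>Q. (\<forall>b<n. hpoly n (k - d) (Q b)) \<and> (\<forall>x\<in>cone. p x = (\<Sum>b<n. Q b x * \<Phi> x b))" if "hpoly n k p" "M0 < k" for k p
    proof -
      have "I k p" using powers[of k p] D' that by (auto simp: M0_def)
      then obtain G where G: "\<forall>b<n. hdiv n k d (G b)" "\<forall>x\<in>cone. p x = (\<Sum>b<n. G b x * \<Phi> x b)" unfolding I_def by blast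
      have "hpoly n (k - d) (G b)" if "b < n" for b
      proof -
        have "G b = (\<lambda>x. 0) \<or> hpoly n (k - d) (G b)" using G(1) that unfolding hdiv_def by blast
        then show ?thesis using hpoly.zero[of n "k - d"] by (elim disjE) (simp_all only:)
      qed
      then show ?thesis using G(2) by blast
    qed
  qed
  then show ?thesis using H by blast
qed

end

section \<open>From the lift to the height inequalities\<close>

lemma combo_sum:
  "(\<And>t. t \<in> T \<Longrightarrow> combo A nm G (E t) (u t)) \<Longrightarrow> combo A nm G (\<Sum>t\<in>T. E t) (\<Sum>t\<in>T. u t)"
proof (induction T rule: infinite_finite_induct)
  case (insert t T)
  from combo_plus[OF insert.prems[OF insertI1] insert.IH[OF insert.prems[OF insertI2]]]
  show ?case using insert.hyps by simp
qed (simp_all add: combo.zero)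

text \<open>\<open>S\<close> is the set of coefficients. It is fixed before the ring, which is
  chosen later so that its fraction field contains such sets; \<open>E\<close> is uniform in the
  points.\<close>

lemma hpoly_combo:
  assumes "hpoly n m p"
  shows "\<exists>S. finite S \<and> (\<forall>A nm \<delta>. normed_subring A nm \<longrightarrow> \<delta> \<in> A \<longrightarrow> (\<forall>s\<in>S. \<delta> * s \<in> A) \<longrightarrow>
     (\<exists>E. \<forall>x y. combo A nm (bimon n x y m 0) E (\<delta> * p x)))"
proof -
  obtain c where c: "\<And>x. p x = (\<Sum>\<alpha>\<in>expo n m. to_ac (c \<alpha>) * monom_at n \<alpha> x)" using hpoly_monomials[OF assms] by blast
  have "\<exists>E. \<forall>x y. combo A nm (bimon n x y m 0) E (\<delta> * p x)"
    if "normed_subring A nm" "\<delta> \<in> A" "\<forall>s\<in>(\<lambda>\<alpha>. to_ac (c \<alpha>)) ` expo n m. \<delta> * s \<in> A" for A nm \<delta>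
  proof (intro exI allI)
    fix x y
    have "combo A nm (bimon n x y m 0) (nm (\<delta> * to_ac (c \<alpha>))) (\<delta> * to_ac (c \<alpha>) * monom_at n \<alpha> x)" if a: "\<alpha> \<in> expo n m" for \<alpha>
    proof -
      have "(\<lambda>i. 0) \<in> expo n 0" "monom_at n (\<lambda>i. 0) y = 1" by (auto simp: expo_def monom_at_def)
      then have "monom_at n \<alpha> x \<in> bimon n x y m 0" using bimonI[OF a, of "\<lambda>i. 0" 0 x y] by simp
      moreover have "\<delta> * to_ac (c \<alpha>) \<in> A" using \<open>\<forall>s\<in>(\<lambda>\<alpha>. to_ac (c \<alpha>)) ` expo n m. \<delta> * s \<in> A\<close> a by blast
      ultimately have "combo A nm (bimon n x y m 0) (0 + nm (\<delta> * to_ac (c \<alpha>))) (0 + \<delta> * to_ac (c \<alpha>) * monom_at n \<alpha> x)"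
        by (intro combo.add combo.zero)
      then show ?thesis by simp
    qed
    then have "combo A nm (bimon n x y m 0) (\<Sum>\<alpha>\<in>expo n m. nm (\<delta> * to_ac (c \<alpha>))) (\<Sum>\<alpha>\<in>expo n m. \<delta> * to_ac (c \<alpha>) * monom_at n \<alpha> x)"
      by (rule combo_sum)
    then show "combo A nm (bimon n x y m 0) (\<Sum>\<alpha>\<in>expo n m. nm (\<delta> * to_ac (c \<alpha>))) (\<delta> * p x)"
      by (simp add: c sum_distrib_left mult.assoc)
  qed
  then show ?thesis using finite_expo by (intro exI[of _ "(\<lambda>\<alpha>. to_ac (c \<alpha>)) ` expo n m"]) auto
qed

lemma (in normed_subring) combo_fracs:
  assumes "combo A nm G E u" "G \<subseteq> fracs A" shows "u \<in> fracs A"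
  using assms(1)
proof (induction rule: combo.induct)
  case (add E u c g)
  have "c \<in> fracs A" "g \<in> fracs A" using add.hyps assms(2) subset_fracs by auto
  then show ?case by (rule fracs_closed(1)[OF add.IH fracs_closed(2)])
qed (simp_all add: fracs_closed)

lemma (in normed_subring) monom_at_fracs:
  assumes "\<And>i. i < n \<Longrightarrow> x i \<in> fracs A" shows "monom_at n \<alpha> x \<in> fracs A"
proof -
  have "x i ^ k \<in> fracs A" if "i < n" for i k using assms[OF that] by (induction k) (auto intro: fracs_closed)
  then have "(\<Prod>i\<in>T. x i ^ \<alpha> i) \<in> fracs A" if "T \<subseteq> {..<n}" for T
    using that by (induction T rule: infinite_finite_induct) (auto intro!: fracs_closed)
  then show ?thesis by (simp add: monom_at_def)
qed

text \<open>The hypothesis of \<open>height_upper\<close> comes from \<open>H\<close>, that of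
  \<open>height_lower\<close> from writing \<open>x\<^sub>c\<^sup>m\<close> as a combination of the
  \<open>\<Phi>\<^sub>b\<close>.\<close>

lemma (in cone_map) height_lift:
  assumes HH: "\<forall>a<n. \<forall>b<n. hpoly n (D + d) (H a b) \<and> (\<forall>x\<in>C. x a ^ D * \<Phi> x b = H a b x)"
    and sc: "\<forall>x\<in>C. \<forall>c. c \<noteq> 0 \<longrightarrow> (\<lambda>i. c * x i) \<in> C \<and> (\<exists>c'. c' \<noteq> 0 \<and> \<Phi> (\<lambda>i. c * x i) = (\<lambda>i. c' * \<Phi> x i))"
  shows "\<exists>S. finite S \<and> (\<forall>A nm. normed_subring A nm \<longrightarrow> S \<subseteq> fracs A \<longrightarrow>
     (\<exists>K. \<forall>x\<in>C. (\<forall>i<n. x i \<in> fracs A) \<longrightarrow>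
        (\<forall>i<n. \<Phi> x i \<in> fracs A) \<and> \<bar>height A nm n (\<Phi> x) - real d * height A nm n x\<bar> \<le> K))"
proof -
  have H: "\<And>a b. a < n \<Longrightarrow> b < n \<Longrightarrow> hpoly n (D + d) (H a b)"
    "\<And>a b x. a < n \<Longrightarrow> b < n \<Longrightarrow> x \<in> C \<Longrightarrow> x a ^ D * \<Phi> x b = H a b x" using HH by blast+
  \<comment> \<open>The least degree covered by \<open>\<Phi>_finite\<close>; it plays the role of
    \<open>D\<close> in \<open>height_lower\<close>.\<close>
  define m where "m = M0 + 1"
  have "\<forall>c. \<exists>Q. c < n \<longrightarrow> (\<forall>b<n. hpoly n (m - d) (Q b)) \<and> (\<forall>x\<in>C. x c ^ m = (\<Sum>b<n. Q b x * \<Phi> x b))"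
  proof
    fix c
    show "\<exists>Q. c < n \<longrightarrow> (\<forall>b<n. hpoly n (m - d) (Q b)) \<and> (\<forall>x\<in>C. x c ^ m = (\<Sum>b<n. Q b x * \<Phi> x b))"
    proof (cases "c < n")
      case True
      have "M0 < m" by (simp add: m_def)
      from \<Phi>_finite[OF hpoly_var_power[OF True] this] show ?thesis by blast
    qed simp
  qed
  from choice[OF this] obtain G where G: "\<And>c b. c < n \<Longrightarrow> b < n \<Longrightarrow> hpoly n (m - d) (G c b)"
    "\<And>c x. c < n \<Longrightarrow> x \<in> C \<Longrightarrow> x c ^ m = (\<Sum>b<n. G c b x * \<Phi> x b)" by blast
  define R where "R = (\<lambda>k (p :: (nat \<Rightarrow> 'k alg_closure) \<Rightarrow> 'k alg_closure) S. finite S \<and> (\<forall>A nm \<delta>. normed_subring A nm \<longrightarrow> \<delta> \<in> A \<longrightarrow> (\<forall>s\<in>S. \<delta> * s \<in> A) \<longrightarrow>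
     (\<exists>E. \<forall>x y. combo A nm (bimon n x y k 0) E (\<delta> * p x))))"
  have Rex: "\<exists>S. R k p S" if "hpoly n k p" for k p unfolding R_def by (rule hpoly_combo[OF that])
  have "\<forall>a b. \<exists>S. a < n \<longrightarrow> b < n \<longrightarrow> R (D + d) (H a b) S" using Rex H(1) by blast
  then obtain SH where SH: "\<And>a b. a < n \<Longrightarrow> b < n \<Longrightarrow> R (D + d) (H a b) (SH a b)" by metis
  have "\<forall>a b. \<exists>S. a < n \<longrightarrow> b < n \<longrightarrow> R (m - d) (G a b) S" using Rex G(1) by blast
  then obtain SG where SG: "\<And>a b. a < n \<Longrightarrow> b < n \<Longrightarrow> R (m - d) (G a b) (SG a b)" by metis
  define S where "S = (\<Union>a<n. \<Union>b<n. SH a b \<union> SG a b)"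
  have fS: "finite S" unfolding S_def using SH SG by (auto simp: R_def)
  have "\<exists>K. \<forall>x\<in>C. (\<forall>i<n. x i \<in> fracs A) \<longrightarrow>
        (\<forall>i<n. \<Phi> x i \<in> fracs A) \<and> \<bar>height A nm n (\<Phi> x) - real d * height A nm n x\<bar> \<le> K"
    if A: "normed_subring A nm" and SA: "S \<subseteq> fracs A" for A nm
  proof -
    interpret A: normed_subring A nm by (rule A)
    obtain \<delta> where \<delta>: "\<delta> \<in> A" "\<delta> \<noteq> 0" "\<forall>s\<in>S. \<delta> * s \<in> A" using A.common_denominator[OF fS SA] by blast
    have "\<forall>a b. \<exists>E. a < n \<longrightarrow> b < n \<longrightarrow> (\<forall>x y. combo A nm (bimon n x y (D + d) 0) E (\<delta> * H a b x))"
    proof (intro allI)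
      fix a b
      have "\<forall>s\<in>SH a b. \<delta> * s \<in> A" if "a < n" "b < n" using \<delta>(3) that unfolding S_def by blast
      then show "\<exists>E. a < n \<longrightarrow> b < n \<longrightarrow> (\<forall>x y. combo A nm (bimon n x y (D + d) 0) E (\<delta> * H a b x))"
        using SH[of a b] A \<delta>(1) unfolding R_def by blast
    qed
    then obtain EH where EH: "\<And>a b x y. a < n \<Longrightarrow> b < n \<Longrightarrow> combo A nm (bimon n x y (D + d) 0) (EH a b) (\<delta> * H a b x)" by metis
    have "\<forall>a b. \<exists>E. a < n \<longrightarrow> b < n \<longrightarrow> (\<forall>x y. combo A nm (bimon n x y (m - d) 0) E (\<delta> * G a b x))"
    proof (intro allI)
      fix a b
      have "\<forall>s\<in>SG a b. \<delta> * s \<in> A" if "a < n" "b < n" using \<delta>(3) that unfolding S_def by blast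
      then show "\<exists>E. a < n \<longrightarrow> b < n \<longrightarrow> (\<forall>x y. combo A nm (bimon n x y (m - d) 0) E (\<delta> * G a b x))"
        using SG[of a b] A \<delta>(1) unfolding R_def by blast
    qed
    then obtain EG where EG: "\<And>a b x y. a < n \<Longrightarrow> b < n \<Longrightarrow> combo A nm (bimon n x y (m - d) 0) (EG a b) (\<delta> * G a b x)" by metis
    have EH0: "0 \<le> EH a b" if "a < n" "b < n" for a b using A.combo_nonneg[OF EH[OF that]] by blast
    have EG0: "0 \<le> EG a b" if "a < n" "b < n" for a b using A.combo_nonneg[OF EG[OF that]] by blast
    define E where "E = 1 + (\<Sum>a<n. \<Sum>b<n. EH a b) + (\<Sum>a<n. \<Sum>b<n. EG a b)"
    have s0: "0 \<le> (\<Sum>a<n. \<Sum>b<n. EH a b)" "0 \<le> (\<Sum>a<n. \<Sum>b<n. EG a b)" using EH0 EG0 by (auto intro!: sum_nonneg)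
    have E1: "1 \<le> E" using s0 by (simp add: E_def)
    have EHE: "EH a b \<le> E" if "a < n" "b < n" for a b
    proof -
      have "EH a b \<le> (\<Sum>b<n. EH a b)" using that EH0 by (intro member_le_sum) auto
      also have "\<dots> \<le> (\<Sum>a<n. \<Sum>b<n. EH a b)"
        by (rule member_le_sum[of a "{..<n}" "\<lambda>a. \<Sum>b<n. EH a b"]) (use that EH0 in \<open>auto intro: sum_nonneg\<close>)
      finally show ?thesis using s0 by (simp add: E_def)
    qed
    have EGE: "(\<Sum>b<n. EG a b) \<le> E" if "a < n" for a
    proof -
      have "(\<Sum>b<n. EG a b) \<le> (\<Sum>a<n. \<Sum>b<n. EG a b)"
        by (rule member_le_sum[of a "{..<n}" "\<lambda>a. \<Sum>b<n. EG a b"]) (use that EG0 in \<open>auto intro: sum_nonneg\<close>)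
      then show ?thesis using s0 by (simp add: E_def)
    qed
    have rational: "\<Phi> x b \<in> fracs A" if x: "x \<in> C" "\<And>i. i < n \<Longrightarrow> x i \<in> fracs A" and b: "b < n" for x b
    proof -
      obtain a where a: "a < n" "x a \<noteq> 0" using C_nonzero[OF x(1)] by blast
      have "bimon n x x (D + d) 0 \<subseteq> fracs A"
        unfolding bimon_def using A.monom_at_fracs[of n x] x(2) A.fracs_closed(2) by auto
      then have "\<delta> * H a b x \<in> fracs A" using A.combo_fracs[OF EH[OF a(1) b, of x x]] by blast
      then have "inverse (\<delta> * x a ^ D) * (\<delta> * H a b x) \<in> fracs A"
      proof -
        have "x a ^ k \<in> fracs A" for k using x(2)[OF a(1)] by (induction k) (auto intro: A.fracs_closed)
        then have "inverse (\<delta> * x a ^ D) \<in> fracs A" using \<delta>(1) A.subset_fracs by (intro A.fracs_closed) auto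
        then show ?thesis using \<open>\<delta> * H a b x \<in> fracs A\<close> by (rule A.fracs_closed(2))
      qed
      moreover have "inverse (\<delta> * x a ^ D) * (\<delta> * H a b x) = \<Phi> x b"
        unfolding H(2)[OF a(1) b x(1), symmetric] using \<delta>(2) a(2) by (simp add: field_simps)
      ultimately show ?thesis by simp
    qed
    have "\<bar>height A nm n (\<Phi> x) - real d * height A nm n x\<bar> \<le> ln E" if x: "x \<in> C" "\<And>i. i < n \<Longrightarrow> x i \<in> fracs A" for x
    proof -
      obtain c where c: "c \<noteq> 0" "\<And>i. i < n \<Longrightarrow> c * x i \<in> A" using A.integral_multiple[of n x] x(2) by blast
      \<comment> \<open>The height inequalities ask for coordinates in \<open>A\<close>. Scaling
        changes neither height, since \<open>\<Phi> z\<close> is proportional to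
        \<open>\<Phi> x\<close>.\<close>
      define z where "z = (\<lambda>i. c * x i)"
      obtain c' where zC: "z \<in> C" and c': "c' \<noteq> 0" "\<Phi> z = (\<lambda>i. c' * \<Phi> x i)" using sc x(1) c(1) unfolding z_def by blast
      have zA: "z i \<in> A" if "i < n" for i using c(2)[OF that] by (simp add: z_def)
      have zf: "z i \<in> fracs A" if "i < n" for i using zA[OF that] A.subset_fracs by blast
      define y where "y = \<Phi> z"
      have U: "combo A nm (bimon n z y (D + d) 0) E (\<delta> * (z a ^ D * y b))" if "a < n" "b < n" for a b
        using combo.le[OF EH[OF that, of z y] EHE[OF that]] H(2)[OF that zC] by (simp add: y_def)
      have Lo: "combo A nm (bimon n z y (m - d) 1) E (\<delta> * z a ^ m)" if a: "a < n" for a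
      proof -
        have "combo A nm (bimon n z y (m - d) 1) (EG a b) (\<delta> * G a b z * y b)" if b: "b < n" for b
        proof (rule combo_mult[OF EG[OF a b, of z y]])
          fix g assume g: "g \<in> bimon n z y (m - d) 0"
          have "(\<lambda>i. 0) \<in> expo n 0" "monom_at n (\<lambda>i. 0) z = 1" by (auto simp: expo_def monom_at_def)
          then have "y b \<in> bimon n z y 0 1"
            using bimonI[of "\<lambda>i. 0" n 0 _ 1 z y, OF _ expo_single[OF b, of 1]] monom_at_single[OF b, of 1 y] by simp
          from bimon_mult[OF g this] show "g * y b \<in> bimon n z y (m - d) 1" by simp
        qed
        then have "combo A nm (bimon n z y (m - d) 1) (\<Sum>b<n. EG a b) (\<Sum>b<n. \<delta> * G a b z * y b)" by (intro combo_sum) auto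
        moreover have "(\<Sum>b<n. \<delta> * G a b z * y b) = \<delta> * z a ^ m"
          by (simp add: G(2)[OF a zC] y_def sum_distrib_left mult.assoc)
        ultimately show ?thesis using combo.le EGE[OF a] by metis
      qed
      obtain a0 where a0: "a0 < n" "z a0 \<noteq> 0" using C_nonzero[OF zC] by blast
      have "height A nm n y \<le> d * height A nm n z + ln E"
        by (rule A.height_upper[OF U E1 \<delta>(2) d zA a0])
      moreover have "d * height A nm n z \<le> height A nm n y + ln E"
      proof (rule A.height_lower[OF Lo _ E1 \<delta>(2) d zA])
        show "d \<le> m" using M0 by (simp add: m_def)
        show "y i \<in> fracs A" if "i < n" for i unfolding y_def by (rule rational[OF zC zf that])
      qed
      moreover have "height A nm n y = height A nm n (\<Phi> x)" unfolding y_def c'(2) by (rule height_scale[OF c'(1)])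
      moreover have "height A nm n z = height A nm n x" unfolding z_def by (rule height_scale[OF c(1)])
      ultimately show ?thesis by simp
    qed
    then show ?thesis using rational by blast
  qed
  then show ?thesis using fS by blast
qed

context embedded_variety
begin

text \<open>The functions \<open>\<eta>\<close> are read off from the isomorphism with the pullback
  of O(1), the functions \<open>\<xi>\<close> from the polarization.\<close>

lemma polarized_lift:
  fixes L :: "('i, 'k) line_bundle_data"
  assumes lb: "line_bundle N V L" and m: "m > 0" and f: "morphism N V N V f" and pol: "polarized_by N V f L"
    and iso: "line_bundle_iso N V (tensor_power L m) (pullback V e (twisting_bundle M))"
  shows "\<exists>d>1. \<exists>\<Phi> D H M0. (\<forall>x\<in>cone. \<Phi> x \<in> e (f (e' (proj_class x)))) \<and>
     (\<forall>a<n. \<forall>b<n. hpoly n (D + d) (H a b) \<and> (\<forall>x\<in>cone. x a ^ D * \<Phi> x b = H a b x)) \<and> cone_map n d M0 cone \<Phi>"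
proof -
  obtain d where d: "d > 1" "line_bundle_iso N V (pullback V f L) (tensor_power L d)" using pol by (auto simp: polarized_by_def)
  have cc: "{P \<in> V. e P \<in> {Q \<in> proj_space M. \<forall>x\<in>Q. x a \<noteq> 0}} = coord_chart a" for a
    unfolding coord_chart_def using W_proj by blast
  obtain \<eta> where \<eta>: "\<forall>i\<in>index L. \<forall>a\<in>{..M}. regular_unit_on N V (chart L i \<inter> coord_chart a) (\<eta> a i)"
    "\<forall>i\<in>index L. \<forall>i'\<in>index L. \<forall>a\<in>{..M}. \<forall>a'\<in>{..M}. \<forall>P \<in> chart L i \<inter> chart L i' \<inter> coord_chart a \<inter> coord_chart a'.
       \<eta> a i P * transition L i i' P ^ m = coord a' a (e P) * \<eta> a' i' P"
    using iso unfolding line_bundle_iso_def tensor_power_def pullback_def twisting_bundle_def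
    by (simp only: line_bundle_data.simps cc coord_def) blast
  obtain \<xi> where \<xi>: "\<forall>i\<in>index L. \<forall>j\<in>index L. regular_unit_on N V ({P \<in> V. f P \<in> chart L i} \<inter> chart L j) (\<xi> j i)"
    "\<forall>i\<in>index L. \<forall>i'\<in>index L. \<forall>j\<in>index L. \<forall>j'\<in>index L.
       \<forall>P \<in> {P \<in> V. f P \<in> chart L i} \<inter> {P \<in> V. f P \<in> chart L i'} \<inter> chart L j \<inter> chart L j'.
       \<xi> j i P * transition L i i' (f P) = transition L j j' P ^ d * \<xi> j' i' P"
    using d(2) unfolding line_bundle_iso_def tensor_power_def pullback_def
    by (simp only: line_bundle_data.simps) blast
  have d0: "d > 0" using d by simp
  have "\<exists>\<Phi>. (\<forall>x\<in>cone. \<Phi> x \<in> e (f (e' (proj_class x)))) \<and>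
     (\<forall>Q\<in>W. \<forall>b<n. \<exists>D p q. hpoly n D q \<and> hpoly n (D + d) p \<and> (\<forall>x\<in>Q. q x \<noteq> 0) \<and> (\<forall>x\<in>cone. q x * \<Phi> x b = p x))"
  proof (rule lift_exists[OF lb m d0 f, of \<eta> \<xi>])
    show "regular_unit_on N V (chart L i \<inter> coord_chart a) (\<eta> a i)" if "i \<in> index L" "a < n" for i a
      using \<eta>(1) that less_Suc_eq_le by blast
    show "\<eta> a i P * transition L i i' P ^ m = coord a' a (e P) * \<eta> a' i' P"
      if "i \<in> index L" "i' \<in> index L" "a < n" "a' < n" "P \<in> chart L i" "P \<in> chart L i'" "P \<in> coord_chart a" "P \<in> coord_chart a'" for i i' a a' P
    proof -
      have "a \<in> {..M}" "a' \<in> {..M}" "P \<in> chart L i \<inter> chart L i' \<inter> coord_chart a \<inter> coord_chart a'" using that by auto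
      then show ?thesis using \<eta>(2) that(1,2) by blast
    qed
    show "regular_unit_on N V ({P \<in> V. f P \<in> chart L i} \<inter> chart L j) (\<xi> j i)" if "i \<in> index L" "j \<in> index L" for i j
      using \<xi>(1) that by blast
    show "\<xi> j i P * transition L i i' (f P) = transition L j j' P ^ d * \<xi> j' i' P"
      if "i \<in> index L" "i' \<in> index L" "j \<in> index L" "j' \<in> index L" "P \<in> V" "f P \<in> chart L i" "f P \<in> chart L i'" "P \<in> chart L j" "P \<in> chart L j'" for i i' j j' P
    proof -
      have "P \<in> {P \<in> V. f P \<in> chart L i} \<inter> {P \<in> V. f P \<in> chart L i'} \<inter> chart L j \<inter> chart L j'" using that by auto
      then show ?thesis using \<xi>(2) that(1-4) by blast
    qed
  qed
  then obtain \<Phi> where \<Phi>: "\<forall>x\<in>cone. \<Phi> x \<in> e (f (e' (proj_class x)))"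
    "\<forall>Q\<in>W. \<forall>b<n. \<exists>D p q. hpoly n D q \<and> hpoly n (D + d) p \<and> (\<forall>x\<in>Q. q x \<noteq> 0) \<and> (\<forall>x\<in>cone. q x * \<Phi> x b = p x)"
    by (elim exE conjE) (rule that)
  have "\<exists>D H M0. (\<forall>a<n. \<forall>b<n. hpoly n (D + d) (H a b) \<and> (\<forall>x\<in>cone. x a ^ D * \<Phi> x b = H a b x)) \<and> cone_map n d M0 cone \<Phi>"
    by (rule polynomial_lift[OF _ f d0]) (erule bspec[OF \<Phi>(1)], rule \<Phi>(2)[rule_format])
  then obtain D H M0 where X: "\<forall>a<n. \<forall>b<n. hpoly n (D + d) (H a b) \<and> (\<forall>x\<in>cone. x a ^ D * \<Phi> x b = H a b x)" "cone_map n d M0 cone \<Phi>"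
    by (elim exE conjE) (rule that)
  show ?thesis
    by (rule exI[of _ d], rule conjI[OF d(1)], rule exI[of _ \<Phi>], rule exI[of _ D], rule exI[of _ H], rule exI[of _ M0])
      (intro conjI \<Phi>(1) X)
qed

text \<open>Both vectors represent the image of the same point, so they are proportional; the factor
  is left unspecified because heights ignore it.\<close>

lemma cone_scale:
  assumes \<Phi>: "\<forall>x\<in>cone. \<Phi> x \<in> e (f (e' (proj_class x)))" and f: "morphism N V N V f"
  shows "\<forall>x\<in>cone. \<forall>c. c \<noteq> 0 \<longrightarrow> (\<lambda>i. c * x i) \<in> cone \<and> (\<exists>c'. c' \<noteq> 0 \<and> \<Phi> (\<lambda>i. c * x i) = (\<lambda>i. c' * \<Phi> x i))"
proof (intro ballI allI impI)
  fix x c assume x: "x \<in> cone" and c: "c \<noteq> (0 :: 'k alg_closure)"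
  have cl: "proj_class x \<in> W" "x \<in> proj_class x" using cone_class[OF x] by auto
  have "(\<lambda>i. c * x i) \<in> proj_class x" by (rule proj_space_point(5)[OF W_proj[OF cl(1)] cl(2) c])
  from class_eq[OF cl(1) this] have k: "proj_class (\<lambda>i. c * x i) = proj_class x" "(\<lambda>i. c * x i) \<in> cone" by auto
  have eW: "e (f (e' (proj_class x))) \<in> W" using morphismD(1)[OF f] ee'[OF cl(1)] by blast
  have "\<Phi> (\<lambda>i. c * x i) \<in> e (f (e' (proj_class x)))" using bspec[OF \<Phi> k(2)] k(1) by simp
  from proj_space_point(4)[OF W_proj[OF eW] bspec[OF \<Phi> x] this]
  show "(\<lambda>i. c * x i) \<in> cone \<and> (\<exists>c'. c' \<noteq> 0 \<and> \<Phi> (\<lambda>i. c * x i) = (\<lambda>i. c' * \<Phi> x i))" using k(2) by blast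
qed

end

text \<open>The asymmetric case; the case of a point preperiodic only for \<open>g\<close> follows
  by exchanging the generators.\<close>

theorem free_of_prep_diff:
  fixes N :: nat and V :: "'k::field proj_point set" and f g :: "'k proj_point \<Rightarrow> 'k proj_point"
    and L :: "('i, 'k) line_bundle_data"
  assumes V: "projective_variety N V" and f: "morphism N V N V f" and g: "morphism N V N V g"
    and lb: "line_bundle N V L" and am: "ample N V L" and pf: "polarized_by N V f L" and pg: "polarized_by N V g L"
    and P0: "P0 \<in> Prep V f" "P0 \<notin> Prep V g"
  shows "\<exists>j>0. generate_free_semigroup V (f ^^ j) (g ^^ j)"
proof -
  obtain m M e where m: "m > 0" "closed_embedding N V M e" "line_bundle_iso N V (tensor_power L m) (pullback V e (twisting_bundle M))"
    using am by (auto simp: ample_def very_ample_def)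
  obtain e' where e': "morphism M (e ` V) N V e'" "\<And>P. P \<in> V \<Longrightarrow> e' (e P) = P" using m(2) by (auto simp: closed_embedding_def)
  interpret embedded_variety N M V e e'
    using V m(2) e' by unfold_locales (auto simp: closed_embedding_def)
  obtain d1 \<Phi>1 D1 H1 M1 where f1: "d1 > 1" "\<forall>x\<in>cone. \<Phi>1 x \<in> e (f (e' (proj_class x)))"
     "\<forall>a<n. \<forall>b<n. hpoly n (D1 + d1) (H1 a b) \<and> (\<forall>x\<in>cone. x a ^ D1 * \<Phi>1 x b = H1 a b x)" "cone_map n d1 M1 cone \<Phi>1"
    using polarized_lift[OF lb m(1) f pf m(3)] by (elim exE conjE) (rule that)
  obtain d2 \<Phi>2 D2 H2 M2 where g1: "d2 > 1" "\<forall>x\<in>cone. \<Phi>2 x \<in> e (g (e' (proj_class x)))"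
     "\<forall>a<n. \<forall>b<n. hpoly n (D2 + d2) (H2 a b) \<and> (\<forall>x\<in>cone. x a ^ D2 * \<Phi>2 x b = H2 a b x)" "cone_map n d2 M2 cone \<Phi>2"
    using polarized_lift[OF lb m(1) g pg m(3)] by (elim exE conjE) (rule that)
  interpret F: cone_map n d1 M1 cone \<Phi>1 by (rule f1(4))
  interpret G: cone_map n d2 M2 cone \<Phi>2 by (rule g1(4))
  have P0V: "P0 \<in> V" using P0(1) by (simp add: Prep_def)
  obtain S1 where S1: "finite S1" "\<forall>A nm. normed_subring A nm \<longrightarrow> S1 \<subseteq> fracs A \<longrightarrow>
     (\<exists>K. \<forall>x\<in>cone. (\<forall>i<n. x i \<in> fracs A) \<longrightarrow> (\<forall>i<n. \<Phi>1 x i \<in> fracs A) \<and> \<bar>height A nm n (\<Phi>1 x) - real d1 * height A nm n x\<bar> \<le> K)"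
    using F.height_lift[OF f1(3) cone_scale[OF f1(2) f]] by (elim exE conjE) (rule that)
  obtain S2 where S2: "finite S2" "\<forall>A nm. normed_subring A nm \<longrightarrow> S2 \<subseteq> fracs A \<longrightarrow>
     (\<exists>K. \<forall>x\<in>cone. (\<forall>i<n. x i \<in> fracs A) \<longrightarrow> (\<forall>i<n. \<Phi>2 x i \<in> fracs A) \<and> \<bar>height A nm n (\<Phi>2 x) - real d2 * height A nm n x\<bar> \<le> K)"
    using G.height_lift[OF g1(3) cone_scale[OF g1(2) g]] by (elim exE conjE) (rule that)
  have eP0: "e P0 \<in> W" using P0V by simp
  obtain x0 where x0: "x0 \<in> e P0" using proj_space_ex[OF W_proj[OF eP0]] by blast
  \<comment> \<open>The coefficients for both lifts and the coordinates of \<open>P0\<close>. With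
    these in the fraction field, both orbits of \<open>P0\<close> have coordinates there
    too.\<close>
  have "finite (S1 \<union> S2 \<union> x0 ` {..<n})" using S1(1) S2(1) by simp
  from exists_northcott_ring[OF this]
  obtain A nm where A: "normed_subring A nm" "northcott A nm" "S1 \<union> S2 \<union> x0 ` {..<n} \<subseteq> fracs A"
    by (elim exE conjE) (rule that)
  interpret A: normed_subring A nm by (rule A(1))
  have "S1 \<subseteq> fracs A" using A(3) by blast
  from S1(2)[rule_format, OF A(1) this]
  obtain K1 where K1': "\<forall>x\<in>cone. (\<forall>i<n. x i \<in> fracs A) \<longrightarrow>
      (\<forall>i<n. \<Phi>1 x i \<in> fracs A) \<and> \<bar>height A nm n (\<Phi>1 x) - real d1 * height A nm n x\<bar> \<le> K1" by (elim exE) (rule that)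
  have "S2 \<subseteq> fracs A" using A(3) by blast
  from S2(2)[rule_format, OF A(1) this]
  obtain K2 where K2': "\<forall>x\<in>cone. (\<forall>i<n. x i \<in> fracs A) \<longrightarrow>
      (\<forall>i<n. \<Phi>2 x i \<in> fracs A) \<and> \<bar>height A nm n (\<Phi>2 x) - real d2 * height A nm n x\<bar> \<le> K2" by (elim exE) (rule that)
  define K where "K = max K1 K2"
  define R where "R = (\<lambda>P x. x \<in> e P \<and> (\<forall>i<n. x i \<in> fracs A))"
  define U where "U = {P \<in> V. \<exists>x. R P x}"
  define h where "h = (\<lambda>P. height A nm n (SOME x. R P x))"
  have h: "h P = height A nm n x" if P: "P \<in> V" and x: "R P x" for P x
  proof -
    have s: "R P (SOME x. R P x)" by (rule someI[of "R P" x, OF x])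
    have eP: "e P \<in> W" using P by simp
    obtain c where "c \<noteq> 0" "(SOME x. R P x) = (\<lambda>i. c * x i)"
      using proj_space_point(4)[OF W_proj[OF eP]] s x unfolding R_def by blast
    then show ?thesis using height_scale[of c A nm n x] by (simp add: h_def)
  qed
  have xc: "x \<in> cone" "e' (proj_class x) = P" if "P \<in> V" "R P x" for P x
  proof -
    have "e P \<in> W" "x \<in> e P" using that by (auto simp: R_def)
    from class_eq[OF this] show "x \<in> cone" "e' (proj_class x) = P" using e'e[OF that(1)] by auto
  qed
  have fU: "f P \<in> U \<and> \<bar>h (f P) - real d1 * h P\<bar> \<le> K" if P: "P \<in> U" for P
  proof -
    obtain x where x: "P \<in> V" "R P x" using P by (auto simp: U_def)
    note c = xc[OF x]
    have k: "\<forall>i<n. \<Phi>1 x i \<in> fracs A" "\<bar>height A nm n (\<Phi>1 x) - real d1 * height A nm n x\<bar> \<le> K1" using bspec[OF K1' c(1)] x(2) by (auto simp: R_def)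
    have R: "R (f P) (\<Phi>1 x)" using f1(2) c k(1) by (auto simp: R_def)
    have fV: "f P \<in> V" by (rule morphismD(1)[OF f x(1)])
    show ?thesis using h[OF fV R] h[OF x] k(2) R fV by (auto simp: U_def K_def)
  qed
  have gU: "g P \<in> U \<and> \<bar>h (g P) - real d2 * h P\<bar> \<le> K" if P: "P \<in> U" for P
  proof -
    obtain x where x: "P \<in> V" "R P x" using P by (auto simp: U_def)
    note c = xc[OF x]
    have k: "\<forall>i<n. \<Phi>2 x i \<in> fracs A" "\<bar>height A nm n (\<Phi>2 x) - real d2 * height A nm n x\<bar> \<le> K2" using bspec[OF K2' c(1)] x(2) by (auto simp: R_def)
    have R: "R (g P) (\<Phi>2 x)" using g1(2) c k(1) by (auto simp: R_def)
    have gV: "g P \<in> V" by (rule morphismD(1)[OF g x(1)])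
    show ?thesis using h[OF gV R] h[OF x] k(2) R gV by (auto simp: U_def K_def)
  qed
  have "x0 i \<in> fracs A" if "i < n" for i using A(3) that by blast
  then have P0U: "P0 \<in> U" using P0V x0 unfolding U_def R_def by blast
  have orb: "(g ^^ k) P0 \<in> U" for k by (induction k) (use P0U gU in auto)
  \<comment> \<open>Bounded heights on the orbit would leave finitely many normalised coordinate
    vectors, hence a finite orbit.\<close>
  have unb: "\<exists>k. h ((g ^^ k) P0) > b" for b
  proof (rule ccontr)
    assume "\<not> ?thesis"
    then have le: "h ((g ^^ k) P0) \<le> b" for k by (meson not_less)
    \<comment> \<open>Strictly above the heights on the orbit and nonnegative, as
      \<open>height_northcott\<close> asks.\<close>
    define b' where "b' = max b 0 + 1"
    obtain Z where Z: "finite Z" "\<And>x a. (\<forall>i<n. x i \<in> fracs A) \<Longrightarrow> a < n \<Longrightarrow> x a \<noteq> 0 \<Longrightarrow> height A nm n x < b' \<Longrightarrow> (\<forall>i<n. x i / x a \<in> Z)"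
      using A.height_northcott[OF A(2), of b' n] by (auto simp: b'_def)
    define T where "T = {v. (\<forall>i<n. v i \<in> Z) \<and> (\<forall>i\<ge>n. v i = 0)}"
    have "finite T"
    proof -
      have "inj_on (\<lambda>v. restrict v {..<n}) T"
      proof (rule inj_onI, rule ext)
        fix v w i assume vw: "v \<in> T" "w \<in> T" "restrict v {..<n} = restrict w {..<n}"
        show "v i = w i" using vw(1,2) fun_cong[OF vw(3), of i] by (cases "i < n") (auto simp: T_def)
      qed
      moreover have "(\<lambda>v. restrict v {..<n}) ` T \<subseteq> {..<n} \<rightarrow>\<^sub>E Z" by (intro image_subsetI) (simp only: restrict_PiE_iff, simp add: T_def)
      moreover have "finite ({..<n} \<rightarrow>\<^sub>E Z)" using Z(1) by (intro finite_PiE) auto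
      ultimately show ?thesis using finite_imageD finite_subset by blast
    qed
    have mem: "(g ^^ k) P0 \<in> (\<lambda>v. e' (proj_class v)) ` T" for k
    proof -
      define P where "P = (g ^^ k) P0"
      obtain x where x: "P \<in> V" "R P x" using orb[of k] by (auto simp: U_def P_def)
      have eP: "e P \<in> W" "x \<in> e P" using x by (auto simp: R_def)
      obtain a where a: "a < n" "x a \<noteq> 0" using proj_space_point(3)[OF W_proj[OF eP(1)] eP(2)] by blast
      have "height A nm n x < b'" using h[OF x] le[of k] by (simp add: P_def b'_def)
      then have xa: "\<forall>i<n. x i / x a \<in> Z" using Z(2)[of x a] x(2) a by (auto simp: R_def)
      define v where "v = (\<lambda>i. inverse (x a) * x i)"
      have vP: "v \<in> e P" unfolding v_def using a(2) by (intro proj_space_point(5)[OF W_proj[OF eP(1)] eP(2)]) simp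
      have "v \<in> T" unfolding T_def v_def using xa proj_space_point(2)[OF W_proj[OF eP(1)] eP(2)] by (auto simp: field_simps)
      moreover have "e' (proj_class v) = P" using class_eq[OF eP(1) vP] e'e[OF x(1)] by simp
      ultimately show ?thesis unfolding P_def[symmetric] by blast
    qed
    have "finite {(g ^^ k) P0 | k. True}"
      by (rule finite_subset[of _ "(\<lambda>v. e' (proj_class v)) ` T"]) (use mem \<open>finite T\<close> in auto)
    then show False using P0(2) P0V by (simp add: Prep_def)
  qed
  have bdd: "\<exists>b. \<forall>k. h ((f ^^ k) P0) \<le> b"
  proof -
    have "finite {(f ^^ k) P0 | k. True}" using P0(1) by (simp add: Prep_def)
    then have fin: "finite (h ` {(f ^^ k) P0 | k. True})" by simp
    have "h ((f ^^ k) P0) \<le> Max (h ` {(f ^^ k) P0 | k. True})" for k by (rule Max_ge[OF fin]) auto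
    then show ?thesis by blast
  qed
  have domf: "\<forall>D s. hpoly n D s \<longrightarrow> (\<forall>P\<in>V. \<forall>x\<in>e (f P). s x = 0) \<longrightarrow> (\<forall>x\<in>cone. s x = 0)"
    using F.dominant f1(2) ee' cone_class by metis
  have domg: "\<forall>D s. hpoly n D s \<longrightarrow> (\<forall>P\<in>V. \<forall>x\<in>e (g P). s x = 0) \<longrightarrow> (\<forall>x\<in>cone. s x = 0)"
    using G.dominant g1(2) ee' cone_class by metis
  \<comment> \<open>One factor \<open>u\<close> is cancelled at a time, so that dominance is used
    for \<open>f\<close> and \<open>g\<close> themselves rather than for their powers.\<close>
  have cancel_pow: "a P = b P"
    if a: "morphism N V N V a" and b: "morphism N V N V b" and u: "morphism N V N V u"
      and dom: "\<forall>D s. hpoly n D s \<longrightarrow> (\<forall>P\<in>V. \<forall>x\<in>e (u P). s x = 0) \<longrightarrow> (\<forall>x\<in>cone. s x = 0)"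
      and eq: "\<And>P. P \<in> V \<Longrightarrow> a ((u ^^ j) P) = b ((u ^^ j) P)" and P: "P \<in> V" for a b u j P
    using a b eq P
  proof (induction j arbitrary: a b P)
    case (Suc j)
    have 1: "morphism N V N V (\<lambda>P. a ((u ^^ j) P))" "morphism N V N V (\<lambda>P. b ((u ^^ j) P))"
      using morphism_comp[OF morphism_funpow[OF u]] Suc.prems by blast+
    have "a ((u ^^ j) P) = b ((u ^^ j) P)" if "P \<in> V" for P
    proof (rule right_cancel[OF 1 u _ _ that])
      show "\<forall>x\<in>cone. s x = 0" if "hpoly n D s" "\<And>P x. P \<in> V \<Longrightarrow> x \<in> e (u P) \<Longrightarrow> s x = 0" for D s
        using dom that by blast
    qed (use Suc.prems(3) in \<open>simp add: funpow_swap1\<close>)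
    then show ?case using Suc.IH[OF Suc.prems(1,2)] Suc.prems(4) by blast
  qed simp
  interpret height_dynamics U V f g h d1 d2 K P0
  proof
    show "1 < d1" "1 < d2" by (fact f1(1) g1(1))+
    show "U \<subseteq> V" by (auto simp: U_def)
    show "f P \<in> U" "\<bar>h (f P) - real d1 * h P\<bar> \<le> K" "g P \<in> U" "\<bar>h (g P) - real d2 * h P\<bar> \<le> K" if "P \<in> U" for P
      using fU[OF that] gU[OF that] by auto
    show "P0 \<in> U" by (rule P0U)
    show "\<exists>b. \<forall>k. h ((f ^^ k) P0) \<le> b" by (rule bdd)
    show "\<exists>k. h ((g ^^ k) P0) > b" for b by (rule unb)
    show "word_map (f ^^ j) (g ^^ j) w P = word_map (f ^^ j) (g ^^ j) w' P"
      if eq: "\<And>P. P \<in> V \<Longrightarrow> word_map (f ^^ j) (g ^^ j) (w @ [l]) P = word_map (f ^^ j) (g ^^ j) (w' @ [l]) P" and P: "P \<in> V" for j w l w' P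
    proof -
      note mw = morphism_word_map[OF morphism_funpow[OF f, of j] morphism_funpow[OF g, of j]]
      show ?thesis
      proof (cases l)
        case True
        have "word_map (f ^^ j) (g ^^ j) w ((f ^^ j) P) = word_map (f ^^ j) (g ^^ j) w' ((f ^^ j) P)" if "P \<in> V" for P
          using eq[OF that] True by (simp add: word_map_append word_map_Cons word_map_Nil)
        then show ?thesis by (rule cancel_pow[OF mw mw f domf _ P])
      next
        case False
        have "word_map (f ^^ j) (g ^^ j) w ((g ^^ j) P) = word_map (f ^^ j) (g ^^ j) w' ((g ^^ j) P)" if "P \<in> V" for P
          using eq[OF that] False by (simp add: word_map_append word_map_Cons word_map_Nil)
        then show ?thesis by (rule cancel_pow[OF mw mw g domg _ P])
      qed
    qed
  qed
  show ?thesis by (rule powers_generate_free)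
qed

theorem theorem1p3:
  fixes N :: nat
    and V :: "'k::field proj_point set"
    and f g :: "'k proj_point \<Rightarrow> 'k proj_point"
    and L :: "('i, 'k) line_bundle_data"
  assumes "projective_variety N V"
    and "morphism N V N V f" and "morphism N V N V g"
    and "line_bundle N V L" and "ample N V L"
    and "polarized_by N V f L" and "polarized_by N V g L"
    and "Prep V f \<noteq> Prep V g"
  shows "\<exists>j>0. generate_free_semigroup V (f ^^ j) (g ^^ j)"
proof -
  consider P where "P \<in> Prep V f" "P \<notin> Prep V g" | P where "P \<in> Prep V g" "P \<notin> Prep V f" using assms(8) by blast
  then show ?thesis
  proof cases
    case 1
    then show ?thesis using free_of_prep_diff[OF assms(1-7)] by blast
  next
    case 2
    then obtain j where "j > 0" "generate_free_semigroup V (g ^^ j) (f ^^ j)"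
      using free_of_prep_diff[OF assms(1,3,2,4,5,7,6)] by blast
    then show ?thesis using generate_free_semigroup_swap by blast
  qed
qed

end
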